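(* Let $d\ge2$, $0<p,q\le\infty$ and $t\in\mathbb{R}$. Then the continuous embedding $$B^{td}_{p,q}(\mathbb{R}^d)\hookrightarrow S^t_{p,q}B(\mathbb{R}^d)$$ holds if and only if one of the following conditions is satisfied: (a) $t>\max(0,\frac1p-1)$; (b) $t=0$, $1<p\le\infty$ and $\max(2,p)\le q\le\infty$; (c) $0<p\le1$, $t=\frac1p-1$ and $q=\infty$.
   Context: Isotropic Besov spaces: let $\psi_0\in C_0^\infty(\mathbb{R}^d)$ with $\psi_0(x)=1$ if $\max_i|x_i|\le1$ and $\psi_0(x)=0$ if $\max_i|x_i|\ge 3/2$, and $\psi_j(x)=\psi_0(2^{-j}x)-\psi_0(2^{-j+1}x)$, $j\in\mathbb{N}$. For $s\in\mathbb{R}$, $0<p,q\le\infty$, $B^s_{p,q}(\mathbb{R}^d)$ is the set of tempered distributions $f$ with $\big(\sum_{j\ge0}2^{jsq}\|\mathcal{F}^{-1}[\psi_j\mathcal{F}f]\|_{L_p}^q\big)^{1/q}<\infty$ (modification if $q=\infty$), $\mathcal{F}$ the Fourier transform. Dominating mixed spaces: let $\varphi_0\in C_0^\infty(\mathbb{R})$ with $\varphi_0=1$ on $[-1,1]$, $\operatorname{supp}\varphi_0\subset[-3/2,3/2]$, $\varphi_j(s)=\varphi_0(2^{-j}s)-\varphi_0(2^{-j+1}s)$, and $\varphi_{\bar k}(x)=\prod_{i=1}^d\varphi_{k_i}(x_i)$, $|\bar k|=k_1+\dots+k_d$. $S^t_{p,q}B(\mathbb{R}^d)$ is the set of tempered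 distributions $f$ with $\big(\sum_{\bar k\in\mathbb{N}_0^d}2^{|\bar k|tq}\|\mathcal{F}^{-1}[\varphi_{\bar k}\mathcal{F}f]\|_{L_p}^q\big)^{1/q}<\infty$. $\hookrightarrow$ is a continuous embedding. *)

theory Defs
  imports "HOL-Analysis.Analysis" "HOL-Probability.Essential_Supremum"
begin

definition dpart :: "'n::finite \<Rightarrow> (real^'n \<Rightarrow> complex) \<Rightarrow> real^'n \<Rightarrow> complex" where
  "dpart i f = (\<lambda>x. vector_derivative (\<lambda>t. f (x + t *\<^sub>R axis i 1)) (at 0))"

definition iter_pd :: "'n::finite list \<Rightarrow> (real^'n \<Rightarrow> complex) \<Rightarrow> real^'n \<Rightarrow> complex" where
  "iter_pd is f = foldr dpart is f"

definition smooth_fun :: "(real^'n::finite \<Rightarrow> complex) \<Rightarrow> bool" where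
  "smooth_fun f \<longleftrightarrow> (\<forall>is. continuous_on UNIV (iter_pd is f) \<and>
     (\<forall>i x. ((\<lambda>t. iter_pd is f (x + t *\<^sub>R axis i 1)) has_vector_derivative
                 iter_pd (i # is) f x) (at 0)))"

definition schwartz :: "(real^'n::finite \<Rightarrow> complex) set" where
  "schwartz = {f. smooth_fun f \<and>
     (\<forall>is (m::nat). \<exists>C. \<forall>x. (1 + norm x) ^ m * norm (iter_pd is f x) \<le> C)}"

definition schwartz_seminorm :: "nat \<Rightarrow> 'n::finite list \<Rightarrow> (real^'n \<Rightarrow> complex) \<Rightarrow> real" where
  "schwartz_seminorm m is f = (SUP x. (1 + norm x) ^ m * norm (iter_pd is f x))"

definition tempered :: "((real^'n::finite \<Rightarrow> complex) \<Rightarrow> complex) \<Rightarrow> bool" where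
  "tempered T \<longleftrightarrow>
     (\<forall>f\<in>schwartz. \<forall>g\<in>schwartz. \<forall>a b. T (\<lambda>x. a * f x + b * g x) = a * T f + b * T g) \<and>
     (\<exists>C N. \<forall>f\<in>schwartz. norm (T f) \<le>
        C * (\<Sum>m\<le>N. \<Sum>is\<in>{is. length is \<le> N}. schwartz_seminorm m is f))"

definition FT :: "(real^'n::finite \<Rightarrow> complex) \<Rightarrow> real^'n \<Rightarrow> complex" where
  "FT g = (\<lambda>y. integral UNIV (\<lambda>x. g x * exp (- \<i> * complex_of_real (x \<bullet> y))))"

text \<open>For a compactly supported smooth multiplier m and a tempered distribution T,
  F^{-1}[m F T] is the smooth function
  x \<mapsto> (2 pi)^{-d} (F T)(m e^{i x.}) = (2 pi)^{-d} T(F(m e^{i x.})).\<close>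
definition fmult :: "(real^'n::finite \<Rightarrow> real) \<Rightarrow> ((real^'n \<Rightarrow> complex) \<Rightarrow> complex)
                      \<Rightarrow> real^'n \<Rightarrow> complex" where
  "fmult m T = (\<lambda>x. complex_of_real (1 / (2 * pi) ^ CARD('n)) *
      T (FT (\<lambda>\<xi>. complex_of_real (m \<xi>) * exp (\<i> * complex_of_real (x \<bullet> \<xi>)))))"

definition epowr :: "ennreal \<Rightarrow> real \<Rightarrow> ennreal" where
  "epowr x r = (if x = \<infinity> then \<infinity> else ennreal (enn2real x powr r))"

definition Lp_qnorm :: "ennreal \<Rightarrow> (real^'n::finite \<Rightarrow> complex) \<Rightarrow> ennreal" where
  "Lp_qnorm p g = (if p = \<infinity> then esssup lborel (\<lambda>x. ennreal (norm (g x)))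
     else epowr (\<integral>\<^sup>+ x. ennreal (norm (g x) powr enn2real p) \<partial>lborel) (1 / enn2real p))"

definition lq_qnorm :: "ennreal \<Rightarrow> ('i \<Rightarrow> ennreal) \<Rightarrow> ennreal" where
  "lq_qnorm q a = (if q = \<infinity> then (SUP k. a k)
     else epowr (\<integral>\<^sup>+ k. epowr (a k) (enn2real q) \<partial>count_space UNIV) (1 / enn2real q))"

definition admissible_psi0 :: "(real^'n::finite \<Rightarrow> real) \<Rightarrow> bool" where
  "admissible_psi0 \<psi>0 \<longleftrightarrow> smooth_fun (\<lambda>x. complex_of_real (\<psi>0 x)) \<and>
     (\<forall>x. (\<forall>i. \<bar>x $ i\<bar> \<le> 1) \<longrightarrow> \<psi>0 x = 1) \<and>
     (\<forall>x. (\<exists>i. \<bar>x $ i\<bar> \<ge> 3/2) \<longrightarrow> \<psi>0 x = 0)"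

definition psi :: "(real^'n::finite \<Rightarrow> real) \<Rightarrow> nat \<Rightarrow> real^'n \<Rightarrow> real" where
  "psi \<psi>0 j = (if j = 0 then \<psi>0 else
     (\<lambda>x. \<psi>0 ((2 powr (- real j)) *\<^sub>R x) - \<psi>0 ((2 powr (1 - real j)) *\<^sub>R x)))"

definition besov_qnorm :: "(real^'n::finite \<Rightarrow> real) \<Rightarrow> real \<Rightarrow> ennreal \<Rightarrow> ennreal
                           \<Rightarrow> ((real^'n \<Rightarrow> complex) \<Rightarrow> complex) \<Rightarrow> ennreal" where
  "besov_qnorm \<psi>0 s p q T =
     lq_qnorm q (\<lambda>j::nat. ennreal (2 powr (real j * s)) * Lp_qnorm p (fmult (psi \<psi>0 j) T))"

definition besov :: "(real^'n::finite \<Rightarrow> real) \<Rightarrow> real \<Rightarrow> ennreal \<Rightarrow> ennreal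
                     \<Rightarrow> ((real^'n \<Rightarrow> complex) \<Rightarrow> complex) set" where
  "besov \<psi>0 s p q = {T. tempered T \<and> besov_qnorm \<psi>0 s p q T < \<infinity>}"

definition smooth1 :: "(real \<Rightarrow> real) \<Rightarrow> bool" where
  "smooth1 f \<longleftrightarrow> (\<forall>k x. ((deriv ^^ k) f) differentiable (at x))"

definition admissible_phi0 :: "(real \<Rightarrow> real) \<Rightarrow> bool" where
  "admissible_phi0 \<phi>0 \<longleftrightarrow> smooth1 \<phi>0 \<and>
     (\<forall>s. \<bar>s\<bar> \<le> 1 \<longrightarrow> \<phi>0 s = 1) \<and> (\<forall>s. \<bar>s\<bar> > 3/2 \<longrightarrow> \<phi>0 s = 0)"

definition phi :: "(real \<Rightarrow> real) \<Rightarrow> nat \<Rightarrow> real \<Rightarrow> real" where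
  "phi \<phi>0 j = (if j = 0 then \<phi>0 else
     (\<lambda>s. \<phi>0 (2 powr (- real j) * s) - \<phi>0 (2 powr (1 - real j) * s)))"

definition phi_multi :: "(real \<Rightarrow> real) \<Rightarrow> ('n::finite \<Rightarrow> nat) \<Rightarrow> real^'n \<Rightarrow> real" where
  "phi_multi \<phi>0 k = (\<lambda>x. \<Prod>i\<in>UNIV. phi \<phi>0 (k i) (x $ i))"

definition mixed_qnorm :: "(real \<Rightarrow> real) \<Rightarrow> real \<Rightarrow> ennreal \<Rightarrow> ennreal
                           \<Rightarrow> ((real^'n::finite \<Rightarrow> complex) \<Rightarrow> complex) \<Rightarrow> ennreal" where
  "mixed_qnorm \<phi>0 t p q T =
     lq_qnorm q (\<lambda>k::'n \<Rightarrow> nat. ennreal (2 powr (real (sum k UNIV) * t)) *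
                               Lp_qnorm p (fmult (phi_multi \<phi>0 k) T))"

definition mixed_besov :: "(real \<Rightarrow> real) \<Rightarrow> real \<Rightarrow> ennreal \<Rightarrow> ennreal
                           \<Rightarrow> ((real^'n::finite \<Rightarrow> complex) \<Rightarrow> complex) set" where
  "mixed_besov \<phi>0 t p q = {T. tempered T \<and> mixed_qnorm \<phi>0 t p q T < \<infinity>}"

definition cont_embedding :: "'a set \<Rightarrow> ('a \<Rightarrow> ennreal) \<Rightarrow> 'a set \<Rightarrow> ('a \<Rightarrow> ennreal) \<Rightarrow> bool" where
  "cont_embedding X nX Y nY \<longleftrightarrow> X \<subseteq> Y \<and> (\<exists>C::real. \<forall>f\<in>X. nY f \<le> ennreal C * nX f)"

definition inv_p :: "ennreal \<Rightarrow> real" where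
  "inv_p p = (if p = \<infinity> then 0 else 1 / enn2real p)"

end

theory Submission
  imports Defs "HOL-Probability.Probability"
begin

text \<open>Everything is done one coordinate axis at a time. A multiplier that depends on a single
  frequency variable acts as a convolution along one axis, so only one-dimensional kernels occur.

  Sufficiency: a mixed block with index k is the sum of at most three pieces obtained from the
  isotropic blocks j close to the largest entry of k by convolving successively along all axes.
  Each axis costs a factor 2^((j-k_i) max(0, 1/p-1)): Young's inequality for p at least 1, and for
  p below 1 a Nikolskii-type estimate for products with Fourier support in an interval of length
  about 2^j. For t above the critical value the resulting geometric sums converge. For t = 0 and p
  strictly between 1 and infinity one needs the one-axis square-function type bound
  sum_k ||P_k f||_p^max(2,p) <= C ||f||_p^max(2,p); it is obtained by duality from
  ||sum_k P_k g_k||_u^min(u,2) <= C sum_k ||g_k||_u^min(u,2), which follows by expanding the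
  u-th power of the partial sums one summand at a time, the cross terms being exponentially small
  because the kernels have mean zero.

  Necessity: test functions whose Fourier transforms are finite sums of products of one-dimensional
  bumps. A single modulated bump excludes t < 0; a product that is a narrow bump on one axis and a
  full low-pass kernel on the others excludes t < 1/p - 1, and t = 1/p - 1 with finite q; at t = 0,
  packets sitting in one isotropic block but in n different mixed blocks exclude q < p (translated
  packets, which almost do not interact) and q < 2 (packets with suitably chosen signs).\<close>


section \<open>Smooth functions and Fourier transforms of bumps\<close>

text \<open>A block of an arbitrary tempered distribution is only known to be a continuous function
  of polynomial growth, and a functional cannot simply be moved inside an integral. The hinge
  between distributions and estimates is therefore \<open>fm_axis_convolution\<close>: a multiplier
  in one frequency variable acts as convolution with \<open>ker m\<close> along that axis. It is
  proved by differentiating the functional applied to the multiplier of the truncated kernel and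
  then using the fundamental theorem of calculus on the line. The critical exponent is a count of
  axes. Put \<sigma> = max(0, 1/p - 1), let d be the dimension and |k| the sum of the entries of k.
  The d axis factors multiply to 2^((j d - |k|) \<sigma>), so a weighted block costs 2^(|k| (t -
  \<sigma>) + j d \<sigma>), to be compared with 2^(j d t); as |k| is at most d (j + 1), the
  threshold is t = \<sigma>. At the threshold all k weigh the same, no geometric gain is left, and a
  finite q can be reached only through cancellation between the kernels, which is what p > 1
  provides.\<close>

type_synonym 'n cfun = "real^'n \<Rightarrow> complex"

abbreviation cor :: "real \<Rightarrow> complex" where
  "cor \<equiv> of_real"

section \<open>Partial derivatives and closure properties of smooth functions\<close>

lemma iter_pd_simps [simp]:
  "iter_pd [] f = f"
  "iter_pd (i # is) f = dpart i (iter_pd is f)"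
  "iter_pd (is @ [i]) f = iter_pd is (dpart i f)"
  by (simp_all add: iter_pd_def)

text \<open>\<open>dpart\<close> is total and so says nothing about existence; this relation records
  existence together with the value, and \<open>dpart_eqI\<close> returns to the operator.\<close>

definition has_pd :: "('n::finite cfun) => 'n => ('n cfun) => bool" where
  "has_pd f i g \<longleftrightarrow>
     (\<forall>x. ((%t. f (x + t *\<^sub>R axis i 1)) has_vector_derivative g x) (at 0))"

lemma dpart_eqI: "has_pd f i g ==> dpart i f = g"
  by (auto simp: has_pd_def dpart_def intro!: ext vector_derivative_at)

text \<open>A set of continuous functions that is closed under partial differentiation contains all
  iterated derivatives of its members. Exhibiting such a set replaces inductions over index
  lists.\<close>

lemma smooth_fun_coinduct:
  assumes "f \<in> X"
    and cont: "!!f. f \<in> X ==> continuous_on UNIV f"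
    and step: "!!f i. f \<in> X ==> \<exists>g\<in>X. has_pd f i g"
  shows "smooth_fun f"
proof -
  have X: "iter_pd is f \<in> X" for "is"
  proof (induction "is")
    case (Cons i "is")
    then show ?case using step[of "iter_pd is f" i] dpart_eqI by auto
  qed (use assms(1) in simp)
  have "has_pd (iter_pd is f) i (iter_pd (i # is) f)" for "is" i
    using step[OF X[of "is"], of i] by (auto dest: dpart_eqI)
  then show ?thesis
    using cont[OF X] by (auto simp: smooth_fun_def has_pd_def)
qed

lemma smooth_fun_continuous: "smooth_fun f ==> continuous_on UNIV f"
  by (auto simp: smooth_fun_def dest: spec[of _ "[]"])

lemma smooth_fun_has_pd: "smooth_fun f ==> has_pd f i (dpart i f)"
  by (auto simp: smooth_fun_def has_pd_def dest: spec[of _ "[]"])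

lemma smooth_fun_dpart: "smooth_fun f ==> smooth_fun (dpart i f)"
proof -
  assume f: "smooth_fun f"
  show ?thesis
    unfolding smooth_fun_def
  proof safe
    fix "is"
    show "continuous_on UNIV (iter_pd is (dpart i f))"
      using f unfolding smooth_fun_def by (metis iter_pd_simps(3))
    fix j x
    show "((%t. iter_pd is (dpart i f) (x + t *\<^sub>R axis j 1)) has_vector_derivative
       iter_pd (j # is) (dpart i f) x) (at 0)"
      using f[unfolded smooth_fun_def, rule_format, of "is @ [i]"] by simp
  qed
qed

lemma smooth_fun_iter_pd: "smooth_fun f ==> smooth_fun (iter_pd is f)"
  by (induction "is") (auto intro: smooth_fun_dpart)

lemma has_pd_add: "has_pd f i f' ==> has_pd g i g' ==> has_pd (%x. f x + g x) i (%x. f' x + g' x)"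
  by (auto simp: has_pd_def intro!: has_vector_derivative_add)

lemma has_pd_mult:
  "has_pd f i f' ==> has_pd g i g' ==> has_pd (%x. f x * g x) i (%x. f x * g' x + f' x * g x)"
  unfolding has_pd_def
proof safe
  fix x assume *: "\<forall>x. ((%t. f (x + t *\<^sub>R axis i 1)) has_vector_derivative f' x) (at 0)"
    "\<forall>x. ((%t. g (x + t *\<^sub>R axis i 1)) has_vector_derivative g' x) (at 0)"
  show "((%t. f (x + t *\<^sub>R axis i 1) * g (x + t *\<^sub>R axis i 1)) has_vector_derivative f x * g' x + f' x * g x) (at 0)"
    using has_vector_derivative_mult[OF *(1)[rule_format, of x] *(2)[rule_format, of x]] by simp
qed

text \<open>Products alone are not closed under differentiation, since the Leibniz rule produces
  sums; the algebra generated by the smooth functions is, and so it qualifies for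
  \<open>smooth_fun_coinduct\<close>.\<close>

inductive_set smooth_alg :: "('n::finite cfun) set" where
  base: "smooth_fun f ==> f \<in> smooth_alg"
| add: "f \<in> smooth_alg ==> g \<in> smooth_alg ==> (%x. f x + g x) \<in> smooth_alg"
| mult: "f \<in> smooth_alg ==> g \<in> smooth_alg ==> (%x. f x * g x) \<in> smooth_alg"

lemma smooth_alg_step:
  "f \<in> smooth_alg ==> continuous_on UNIV f \<and> (\<forall>i. \<exists>g\<in>smooth_alg. has_pd f i g)"
proof (induction rule: smooth_alg.induct)
  case (base f)
  then show ?case
    by (blast intro: smooth_alg.base smooth_fun_continuous smooth_fun_dpart smooth_fun_has_pd)
next
  case (add f g)
  show ?case
  proof (intro conjI allI)
    show "continuous_on UNIV (%x. f x + g x)" using add.IH by (intro continuous_intros) auto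
    fix i
    obtain f' g' where "f' \<in> smooth_alg" "has_pd f i f'" "g' \<in> smooth_alg" "has_pd g i g'"
      using add.IH by blast
    then show "\<exists>h\<in>smooth_alg. has_pd (%x. f x + g x) i h"
      by (intro bexI[of _ "%x. f' x + g' x"] has_pd_add smooth_alg.add)
  qed
next
  case (mult f g)
  show ?case
  proof (intro conjI allI)
    show "continuous_on UNIV (%x. f x * g x)" using mult.IH by (intro continuous_intros) auto
    fix i
    obtain f' g' where "f' \<in> smooth_alg" "has_pd f i f'" "g' \<in> smooth_alg" "has_pd g i g'"
      using mult.IH by blast
    then show "\<exists>h\<in>smooth_alg. has_pd (%x. f x * g x) i h"
      using mult.hyps
      by (intro bexI[of _ "%x. f x * g' x + f' x * g x"] has_pd_mult smooth_alg.add smooth_alg.mult)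
  qed
qed

lemma smooth_alg_smooth: "f \<in> smooth_alg ==> smooth_fun f"
  by (rule smooth_fun_coinduct[of f smooth_alg]) (use smooth_alg_step in blast)+

lemma smooth_fun_add: "smooth_fun f ==> smooth_fun g ==> smooth_fun (%x. f x + g x)"
  by (rule smooth_alg_smooth, rule smooth_alg.add; rule smooth_alg.base)

lemma smooth_fun_mult: "smooth_fun f ==> smooth_fun g ==> smooth_fun (%x. f x * g x)"
  by (rule smooth_alg_smooth, rule smooth_alg.mult; rule smooth_alg.base)

lemma has_pd_const: "has_pd (%_. c) i (%_. 0)"
  by (simp add: has_pd_def)

lemma smooth_fun_const: "smooth_fun (%_::real^'n::finite. c)"
  by (rule smooth_fun_coinduct[of _ "range (%c _. c)"]) (auto intro: has_pd_const)

lemma dpart_lincomb: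
  assumes "smooth_fun f" "smooth_fun g"
  shows "dpart i (%x. a * f x + b * g x) = (%x. a * dpart i f x + b * dpart i g x)"
proof -
  have "has_pd (%x. a * f x + b * g x) i (%x. (a * dpart i f x + 0 * f x) + (b * dpart i g x + 0 * g x))"
    by (intro has_pd_add has_pd_mult has_pd_const smooth_fun_has_pd assms)
  from dpart_eqI[OF this] show ?thesis by simp
qed

lemma smooth_fun_lincomb:
  "smooth_fun f ==> smooth_fun g ==> smooth_fun (%x. a * f x + b * g x)"
  by (intro smooth_fun_add smooth_fun_mult smooth_fun_const)

lemma iter_pd_lincomb:
  assumes "smooth_fun f" "smooth_fun g"
  shows "iter_pd is (%x. a * f x + b * g x) = (%x. a * iter_pd is f x + b * iter_pd is g x)"
  by (induction "is") (auto simp: dpart_lincomb smooth_fun_iter_pd assms)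

lemma dpart_mult:
  assumes "smooth_fun f" "smooth_fun g"
  shows "dpart i (%x. f x * g x) = (%x. f x * dpart i g x + dpart i f x * g x)"
  by (intro dpart_eqI has_pd_mult smooth_fun_has_pd assms)

text \<open>Each application of the Leibniz rule doubles the number of terms, whence the power of 2.
  The induction peels off the innermost derivative, the one that meets the product itself, and
  appends its index to the lists in the hypotheses on the differentiated factor.\<close>

lemma iter_pd_mult_bound:
  assumes "smooth_fun f" "smooth_fun g"
    and "!!js. length js \<le> length is ==> norm (iter_pd js f x) \<le> a"
    and "!!js. length js \<le> length is ==> norm (iter_pd js g x) \<le> b"
  shows "norm (iter_pd is (%x. f x * g x) x) \<le> 2 ^ length is * a * b"
  using assms
proof (induction "is" arbitrary: f g rule: rev_induct)
  case Nil
  have "norm (f x) * norm (g x) \<le> a * b"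
    by (intro mult_mono) (use Nil.prems(3,4)[of "[]"] in \<open>auto intro: order_trans[OF norm_ge_zero]\<close>)
  then show ?case by (simp add: norm_mult)
next
  case (snoc i "is")
  note sm = snoc.prems(1,2)
  have 1: "norm (iter_pd is (%x. f x * dpart i g x) x) \<le> 2 ^ length is * a * b"
    by (rule snoc.IH) (use sm snoc.prems(3) snoc.prems(4)[of "_ @ [i]"] in \<open>auto intro: smooth_fun_dpart\<close>)
  have 2: "norm (iter_pd is (%x. dpart i f x * g x) x) \<le> 2 ^ length is * a * b"
    by (rule snoc.IH) (use sm snoc.prems(4) snoc.prems(3)[of "_ @ [i]"] in \<open>auto intro: smooth_fun_dpart\<close>)
  have "iter_pd is (%x. 1 * (f x * dpart i g x) + 1 * (dpart i f x * g x)) x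
      = 1 * iter_pd is (%x. f x * dpart i g x) x + 1 * iter_pd is (%x. dpart i f x * g x) x"
    by (subst iter_pd_lincomb) (auto intro!: smooth_fun_mult smooth_fun_dpart sm)
  then have "norm (iter_pd (is @ [i]) (%x. f x * g x) x)
      \<le> 2 ^ length is * a * b + 2 ^ length is * a * b"
    using norm_triangle_mono[OF 1 2] by (simp add: dpart_mult sm)
  then show ?case by (simp add: mult_ac)
qed

section \<open>Functions of one coordinate, and characters\<close>

definition chain :: "(nat => real => complex) => bool" where
  "chain D \<longleftrightarrow> (\<forall>r x. (D r has_vector_derivative D (Suc r) x) (at x))"

lemma chain_continuous: "chain D ==> continuous_on S (D r)"
  by (metis chain_def continuous_at_imp_continuous_on has_vector_derivative_continuous)

lemma has_pd_coord:
  fixes h :: "real => complex"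
  assumes "!!x. (h has_vector_derivative h' x) (at x)"
  shows "has_pd (%\<xi>::real^'n::finite. h (\<xi> $ i)) j (%\<xi>. if j = i then h' (\<xi> $ i) else 0)"
  unfolding has_pd_def
proof
  fix x :: "real^'n"
  show "((%t. h ((x + t *\<^sub>R axis j 1) $ i)) has_vector_derivative (if j = i then h' (x $ i) else 0)) (at 0)"
  proof (cases "j = i")
    case True
    have "((%t. x $ i + t) has_vector_derivative 1) (at 0)"
      by (auto intro!: derivative_eq_intros)
    then have "(h \<circ> (%t. x $ i + t) has_vector_derivative (1 *\<^sub>R h' (x $ i))) (at 0)"
      by (rule vector_diff_chain_at) (use assms in simp)
    then show ?thesis using True by (simp add: o_def)
  next
    case False
    then show ?thesis by (simp add: axis_def)
  qed
qed

lemma smooth_fun_coord: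
  assumes "chain D"
  shows "smooth_fun (%\<xi>::real^'n::finite. D r (\<xi> $ i))"
proof (rule smooth_fun_coinduct[of _ "insert (%_. 0) {%\<xi>::real^'n. D r (\<xi> $ i) |r. True}"])
  fix f :: "'n cfun" and j
  assume f: "f \<in> insert (%_. 0) {%\<xi>. D r (\<xi> $ i) |r. True}"
  have "continuous_on UNIV (%\<xi>::real^'n. D r (\<xi> $ i))" for r
    by (rule continuous_on_compose2[OF chain_continuous[OF assms, of UNIV]]) (auto intro!: continuous_intros)
  then show "continuous_on UNIV f" using f by auto
  have *: "has_pd (%\<xi>::real^'n. D r (\<xi> $ i)) j (%\<xi>. if j = i then D (Suc r) (\<xi> $ i) else 0)" for r
    by (rule has_pd_coord) (use assms in \<open>auto simp: chain_def\<close>)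
  show "\<exists>g\<in>insert (%_. 0) {%\<xi>. D r (\<xi> $ i) |r. True}. has_pd f j g"
    using f *[of _] by (cases "j = i") (auto intro: has_pd_const)
qed auto

lemma dpart_coord:
  assumes "chain D"
  shows "dpart j (%\<xi>::real^'n::finite. D r (\<xi> $ i)) = (%\<xi>. if j = i then D (Suc r) (\<xi> $ i) else 0)"
  by (rule dpart_eqI, rule has_pd_coord) (use assms in \<open>auto simp: chain_def\<close>)

lemma iter_pd_coord:
  assumes "chain D"
  shows "iter_pd is (%\<xi>::real^'n::finite. D r (\<xi> $ i)) =
    (%\<xi>. if set is \<subseteq> {i} then D (r + length is) (\<xi> $ i) else 0)"
proof (induction "is")
  case (Cons j "is")
  have 0: "dpart j (%_::real^'n. 0) = (%_. 0)" by (intro dpart_eqI has_pd_const)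
  show ?case
    by (cases "set is \<subseteq> {i}") (auto simp: Cons dpart_coord[OF assms] 0)
qed simp

lemma chain_linear: "chain (%r x. if r = 0 then c * cor x else if r = 1 then c else 0)"
  unfolding chain_def
proof safe
  fix r x
  have "(cor has_vector_derivative 1) (at x)"
    using has_vector_derivative_of_real[OF DERIV_ident, of "at x"] by simp
  then have "((%x. c * cor x) has_vector_derivative c) (at x)"
    using has_vector_derivative_mult_right[of cor 1 "at x" c] by simp
  then show "((%x. if r = 0 then c * cor x else if r = 1 then c else 0)
     has_vector_derivative (if Suc r = 0 then c * cor x else if Suc r = 1 then c else 0)) (at x)"
    by (cases r) auto
qed

definition ee :: "real^'n::finite => 'n cfun" where
  "ee x \<xi> = exp (\<i> * cor (x \<bullet> \<xi>))"

lemma norm_ee [simp]: "norm (ee x \<xi>) = 1"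
  by (simp add: ee_def)

lemma ee_add: "ee (x + y) \<xi> = ee x \<xi> * ee y \<xi>"
  by (simp add: ee_def inner_add_left exp_add algebra_simps)

lemma ee_continuous [continuous_intros]:
  "continuous_on S f ==> continuous_on S g ==> continuous_on S (%x. ee (f x) (g x))"
  unfolding ee_def by (intro continuous_intros)

lemma has_pd_ee: "has_pd (ee (x::real^'n::finite)) i (%\<xi>. \<i> * cor (x $ i) * ee x \<xi>)"
  unfolding has_pd_def
proof
  fix \<xi> :: "real^'n"
  have "((%t. x \<bullet> (\<xi> + t *\<^sub>R axis i 1)) has_real_derivative x $ i) (at 0)"
    by (auto simp: inner_add_right inner_axis intro!: derivative_eq_intros)
  then have "((%t. cor (x \<bullet> (\<xi> + t *\<^sub>R axis i 1))) has_vector_derivative cor (x $ i)) (at 0)"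
    by (rule has_vector_derivative_of_real)
  then have "((%t. \<i> * cor (x \<bullet> (\<xi> + t *\<^sub>R axis i 1))) has_vector_derivative \<i> * cor (x $ i)) (at 0)"
    by (rule has_vector_derivative_mult_right)
  moreover have "(exp has_field_derivative ee x \<xi>) (at (\<i> * cor (x \<bullet> (\<xi> + 0 *\<^sub>R axis i 1))))"
    by (auto simp: ee_def intro!: derivative_eq_intros)
  ultimately have "(exp \<circ> (%t. \<i> * cor (x \<bullet> (\<xi> + t *\<^sub>R axis i 1))) has_vector_derivative
       \<i> * cor (x $ i) * ee x \<xi>) (at 0)"
    by (rule field_vector_diff_chain_at)
  then show "((%t. ee x (\<xi> + t *\<^sub>R axis i 1)) has_vector_derivative \<i> * cor (x $ i) * ee x \<xi>) (at 0)"
    by (simp add: o_def ee_def)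
qed

lemma has_pd_cmult_ee: "has_pd (%\<xi>. c * ee x \<xi>) i (%\<xi>. (c * (\<i> * cor (x $ i))) * ee x \<xi>)"
  using has_pd_mult[OF has_pd_const[of c i] has_pd_ee[of x i]] by (simp add: mult_ac)

lemma smooth_fun_ee: "smooth_fun (ee (x::real^'n::finite))"
proof (rule smooth_fun_coinduct[of _ "range (%c \<xi>. c * ee x \<xi>)"])
  show "ee x \<in> range (%c \<xi>. c * ee x \<xi>)" by (auto intro!: image_eqI[of _ _ 1])
  fix f :: "'n cfun" and i
  assume "f \<in> range (%c \<xi>. c * ee x \<xi>)"
  then obtain c where f: "f = (%\<xi>. c * ee x \<xi>)" by auto
  show "continuous_on UNIV f" unfolding f by (intro continuous_intros)
  show "\<exists>g\<in>range (%c \<xi>. c * ee x \<xi>). has_pd f i g"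
    unfolding f using has_pd_cmult_ee[of c x i] by auto
qed

lemma iter_pd_ee:
  "iter_pd is (ee x) = (%\<xi>. (\<Prod>l\<leftarrow>is. \<i> * cor (x $ l)) * ee x \<xi>)"
proof (induction "is")
  case (Cons j "is")
  show ?case
    unfolding iter_pd_simps Cons by (subst dpart_eqI[OF has_pd_cmult_ee]) (simp add: mult_ac)
qed simp

lemma norm_iter_pd_ee:
  assumes "length is \<le> M"
  shows "norm (iter_pd is (ee x) \<xi>) \<le> (1 + norm x) ^ M"
proof -
  have "norm (\<Prod>l\<leftarrow>is. \<i> * cor (x $ l)) \<le> (1 + norm x) ^ length is" for "is"
  proof (induction "is")
    case (Cons j "is")
    have "\<bar>x $ j\<bar> \<le> 1 + norm x" using component_le_norm_cart[of x j] by simp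
    then show ?case using Cons by (auto simp: norm_mult intro!: mult_mono)
  qed simp
  also have "(1 + norm x) ^ length is \<le> (1 + norm x) ^ M"
    by (rule power_increasing) (use assms in auto)
  finally show ?thesis by (simp add: iter_pd_ee norm_mult)
qed

text \<open>Difference quotients are the form in which derivatives enter the dominated convergence
  arguments.\<close>

lemma has_vector_derivative_iff_quotient:
  fixes f :: "real => 'a::real_normed_vector"
  shows "(f has_vector_derivative f') (at x) \<longleftrightarrow>
    ((%h. (1 / h) *\<^sub>R (f (x + h) - f x)) \<longlongrightarrow> f') (at 0)"
proof -
  have eq: "norm ((1 / h) *\<^sub>R (f (x + h) - f x) - f') = norm (f (x + h) - f x - h *\<^sub>R f') / norm h"
    if "h \<noteq> 0" for h
  proof -
    have "(1 / h) *\<^sub>R (f (x + h) - f x) - f' = (1 / h) *\<^sub>R (f (x + h) - f x - h *\<^sub>R f')"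
      using that by (simp add: scaleR_diff_right)
    then show ?thesis by (simp add: divide_inverse)
  qed
  have "(f has_vector_derivative f') (at x) \<longleftrightarrow>
     ((%h. norm (f (x + h) - f x - h *\<^sub>R f') / norm h) \<longlongrightarrow> 0) (at 0)"
    by (simp add: has_vector_derivative_def has_derivative_at bounded_linear_scaleR_left)
  also have "... \<longleftrightarrow> ((%h. norm ((1 / h) *\<^sub>R (f (x + h) - f x) - f')) \<longlongrightarrow> 0) (at 0)"
    by (rule tendsto_cong) (auto simp: eventually_at_filter eq)
  finally show ?thesis
    by (simp add: tendsto_norm_zero_iff LIM_zero_iff)
qed

section \<open>Smooth functions supported in a box: integration and differentiation\<close>

definition qbox :: "real => (real^'n::finite) set" where
  "qbox R = {x. \<forall>i. \<bar>x $ i\<bar> \<le> R}"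

lemma qbox_eq: "qbox R = cbox (\<chi> i. - R) (\<chi> i. R)"
  by (auto simp: qbox_def mem_box_cart abs_le_iff minus_le_iff)

lemma compact_qbox: "compact (qbox R)"
  by (simp add: qbox_eq)

definition bump :: "real => ('n::finite cfun) => bool" where
  "bump R n \<longleftrightarrow> smooth_fun n \<and> (\<forall>\<xi>. \<xi> \<notin> qbox R --> n \<xi> = 0)"

lemma bump_smooth: "bump R n ==> smooth_fun n"
  and bump_zero: "bump R n ==> \<xi> \<notin> qbox R ==> n \<xi> = 0"
  by (auto simp: bump_def)

text \<open>The complement of the box is open, so near any of its points the function is constantly
  0.\<close>

lemma bump_dpart:
  assumes "bump R n"
  shows "bump R (dpart i n)"
  unfolding bump_def
proof safe
  show "smooth_fun (dpart i n)" using assms by (auto simp: bump_def smooth_fun_dpart)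
  fix \<xi> :: "real^'a" assume "\<xi> \<notin> qbox R"
  have "open ((%t. \<xi> + t *\<^sub>R axis i 1) -` (- qbox R))"
    by (rule open_vimage) (auto intro!: continuous_intros compact_imp_closed compact_qbox)
  then have "\<forall>\<^sub>F t in at 0. t \<in> (%t. \<xi> + t *\<^sub>R axis i 1) -` (- qbox R)"
    using \<open>\<xi> \<notin> qbox R\<close> by (intro eventually_at_in_open') auto
  then have ev: "\<forall>\<^sub>F t in at 0. 0 = n (\<xi> + t *\<^sub>R axis i 1)"
    by eventually_elim (use assms in \<open>auto simp: bump_def\<close>)
  have "((%t. n (\<xi> + t *\<^sub>R axis i 1)) has_vector_derivative dpart i n \<xi>) (at 0)"
    using smooth_fun_has_pd[OF bump_smooth[OF assms]] by (auto simp: has_pd_def)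
  moreover have "((%t. n (\<xi> + t *\<^sub>R axis i 1)) has_vector_derivative 0) (at 0)"
    unfolding has_vector_derivative_iff_quotient
  proof (rule Lim_transform_eventually[of "%_. 0"])
    show "\<forall>\<^sub>F h in at 0. 0 = (1 / h) *\<^sub>R (n (\<xi> + (0 + h) *\<^sub>R axis i 1) - n (\<xi> + 0 *\<^sub>R axis i 1))"
      using ev by eventually_elim (use \<open>\<xi> \<notin> qbox R\<close> assms in \<open>simp add: bump_def\<close>)
  qed simp
  ultimately show "dpart i n \<xi> = 0"
    using vector_derivative_unique_at by blast
qed

lemma bump_mult: "bump R n ==> smooth_fun g ==> bump R (%x. g x * n x)"
  by (auto simp: bump_def smooth_fun_mult)

lemma bump_iter_pd: "bump R n ==> bump R (iter_pd is n)"
  by (induction "is") (auto intro: bump_dpart)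

lemma bump_lincomb: "bump R f ==> bump R g ==> bump R (%x. a * f x + b * g x)"
  by (auto simp: bump_def smooth_fun_lincomb)

lemma integrable_compact_supported:
  fixes f :: "'a::euclidean_space => complex"
  assumes "continuous_on UNIV f" "compact S" "!!x. x \<notin> S ==> f x = 0"
  shows "integrable lborel f"
proof -
  have "integrable lborel (%x. indicator S x *\<^sub>R f x)"
    by (rule borel_integrable_compact) (use assms in \<open>auto intro: continuous_on_subset\<close>)
  moreover have "(%x. indicator S x *\<^sub>R f x) = f"
    using assms(3) by (auto simp: fun_eq_iff indicator_def)
  ultimately show ?thesis by simp
qed

lemma bump_integrable: "bump R n ==> integrable lborel n"
  by (rule integrable_compact_supported[OF _ compact_qbox[of R]])
     (auto simp: bump_def smooth_fun_continuous)

lemma bump_integrable_ee: "bump R n ==> integrable lborel (%\<xi>. n \<xi> * ee y \<xi>)"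
  by (rule integrable_compact_supported[OF _ compact_qbox[of R]])
     (auto simp: bump_def intro!: continuous_intros dest: smooth_fun_continuous)

lemma FT_eq_lborel:
  assumes "integrable lborel (%\<xi>. n \<xi> * ee (- y) \<xi>)"
  shows "FT n y = (LINT \<xi>|lborel. n \<xi> * ee (- y) \<xi>)"
proof -
  have "FT n y = integral UNIV (%\<xi>. n \<xi> * ee (- y) \<xi>)"
    by (simp add: FT_def ee_def inner_commute)
  also have "... = (LINT \<xi>|lborel. n \<xi> * ee (- y) \<xi>)"
    using has_integral_integral_lborel[OF assms] by (rule integral_unique)
  finally show ?thesis .
qed

lemma FT_bump: "bump R n ==> FT n y = (LINT \<xi>|lborel. n \<xi> * ee (- y) \<xi>)"
  by (intro FT_eq_lborel bump_integrable_ee)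

text \<open>Differentiation under the integral sign by dominated convergence of the difference
  quotients; the local Lipschitz hypothesis makes \<open>w\<close> their majorant.\<close>

lemma has_vector_derivative_integral:
  fixes f :: "real => 'b => complex"
  assumes int: "!!t. integrable M (f t)"
    and f': "f' \<in> borel_measurable M"
    and deriv: "!!x. x \<in> space M ==> ((%t. f t x) has_vector_derivative f' x) (at t0)"
    and lip: "!!t x. x \<in> space M ==> \<bar>t - t0\<bar> < 1 ==> norm (f t x - f t0 x) \<le> w x * \<bar>t - t0\<bar>"
    and w: "integrable M w"
  shows "((%t. LINT x|M. f t x) has_vector_derivative (LINT x|M. f' x)) (at t0)"
proof -
  define q where "q h x = (1 / h) *\<^sub>R (f (t0 + h) x - f t0 x)" for h x
  have "((%h. LINT x|M. q h x) \<longlongrightarrow> (LINT x|M. f' x)) (at 0)"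
    unfolding tendsto_at_iff_sequentially
  proof (intro allI impI, unfold comp_def)
    fix X :: "nat => real"
    assume X: "\<forall>i. X i \<in> UNIV - {0}" "X \<longlonglongrightarrow> 0"
    then have "\<forall>\<^sub>F i in sequentially. \<bar>X i\<bar> < 1"
      by (metis (no_types) abs_zero order_tendstoD(2) tendsto_rabs zero_less_one)
    then obtain N where N: "!!i. i \<ge> N ==> \<bar>X i\<bar> < 1"
      by (auto simp: eventually_sequentially)
    \<comment> \<open>The Lipschitz bound covers increments below 1 only, so the sequence is entered
      at \<open>N\<close>.\<close>
    have "(%i. LINT x|M. q (X (i + N)) x) \<longlonglongrightarrow> (LINT x|M. f' x)"
    proof (rule integral_dominated_convergence[where w = w])
      show "f' \<in> borel_measurable M" "integrable M w" by fact+
      show "q (X (i + N)) \<in> borel_measurable M" for i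
        unfolding q_def using int by measurable
      show "AE x in M. (%i. q (X (i + N)) x) \<longlonglongrightarrow> f' x"
      proof (rule AE_I2)
        fix x assume x: "x \<in> space M"
        have "((%h. q h x) \<longlongrightarrow> f' x) (at 0)"
          using deriv[OF x] unfolding q_def has_vector_derivative_iff_quotient .
        then show "(%i. q (X (i + N)) x) \<longlonglongrightarrow> f' x"
          using X LIMSEQ_ignore_initial_segment[OF X(2), of N] unfolding tendsto_at_iff_sequentially comp_def
          by (auto dest!: spec[of _ "%i. X (i + N)"])
      qed
      show "AE x in M. norm (q (X (i + N)) x) \<le> w x" for i
      proof (rule AE_I2)
        fix x assume x: "x \<in> space M"
        show "norm (q (X (i + N)) x) \<le> w x"
          using lip[OF x, of "t0 + X (i + N)"] N[of "i + N"] X(1)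
          by (simp add: q_def pos_divide_le_eq)
      qed
    qed
    then show "(%i. LINT x|M. q (X i) x) \<longlonglongrightarrow> (LINT x|M. f' x)"
      by (rule LIMSEQ_offset)
  qed
  moreover have "(LINT x|M. q h x) = (1 / h) *\<^sub>R ((LINT x|M. f (t0 + h) x) - (LINT x|M. f t0 x))" for h
    unfolding q_def using int by (simp del: scaleR_conv_of_real)
  ultimately show ?thesis
    by (simp add: has_vector_derivative_iff_quotient)
qed

lemma vector_derivative_bound:
  fixes g :: "real => 'a::real_normed_vector"
  assumes "!!t. (g has_vector_derivative g' t) (at t)" "!!t. norm (g' t) \<le> C"
  shows "norm (g a - g b) \<le> C * \<bar>a - b\<bar>"
proof -
  have "norm (g a - g b) \<le> C * norm (a - b)"
  proof (rule differentiable_bound[of UNIV])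
    show "(g has_derivative (%h. h *\<^sub>R g' t)) (at t within UNIV)" for t
      using assms(1)[of t] by (simp add: has_vector_derivative_def)
    show "onorm (%h. h *\<^sub>R g' t) \<le> C" for t
      by (rule onorm_le) (use assms(2)[of t] in \<open>auto simp: mult.commute[of C] intro!: mult_left_mono\<close>)
  qed auto
  then show ?thesis by simp
qed

lemma nn_integral_translate:
  fixes c :: "'a::euclidean_space"
  assumes "f \<in> borel_measurable borel"
  shows "(\<integral>\<^sup>+x. f (x + c) \<partial>lborel) = (\<integral>\<^sup>+x. f x \<partial>lborel)"
  using nn_integral_distr[of "(+) c" lborel borel f] assms by (simp add: lborel_distr_plus add.commute)

lemma lborel_integral_translate:
  fixes c :: "'a::euclidean_space" and f :: "'a => 'b::{banach, second_countable_topology}"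
  assumes "f \<in> borel_measurable borel"
  shows "(LINT x|lborel. f (x + c)) = (LINT x|lborel. f x)"
  using integral_distr[of "(+) c" lborel borel f] assms by (simp add: lborel_distr_plus add.commute)

lemma lborel_integrable_translate:
  fixes c :: "'a::euclidean_space" and f :: "'a => 'b::{banach, second_countable_topology}"
  assumes "integrable lborel f"
  shows "integrable lborel (%x. f (x + c))"
  using integrable_distr_eq[of "(+) c" lborel borel f] assms
  by (simp add: lborel_distr_plus add.commute)

text \<open>The integral of the translate F(x + t v) does not depend on t. Differentiating at t = 0
  under the integral sign gives the integral of \<open>F'\<close>, which is therefore 0: integration
  by parts without iterated integrals.\<close>

lemma integral_directional_derivative_zero:
  fixes F :: "'a::euclidean_space => complex"
  assumes d: "!!x. ((%t. F (x + t *\<^sub>R v)) has_vector_derivative F' x) (at 0)"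
    and c: "continuous_on UNIV F" "continuous_on UNIV F'"
    and S: "compact S" "!!x. x \<notin> S ==> F x = 0" "!!x. x \<notin> S ==> F' x = 0"
  shows "(LINT x|lborel. F' x) = 0"
proof -
  have dt: "((%t. F (x + t *\<^sub>R v)) has_vector_derivative F' (x + t *\<^sub>R v)) (at t)" for x t
    using d[of "x + t *\<^sub>R v"] unfolding has_vector_derivative_iff_quotient
    by (simp add: algebra_simps)
  have "compact (F' ` S)" using c(2) S(1) by (meson compact_continuous_image continuous_on_subset subset_UNIV)
  then obtain C where "!!x. x \<in> S ==> norm (F' x) \<le> C"
    by (metis bounded_iff compact_imp_bounded imageI)
  then have C: "norm (F' x) \<le> \<bar>C\<bar>" for x using S(3)[of x] by (cases "x \<in> S") (auto intro: order_trans[OF _ abs_ge_self])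
  have lip: "norm (F (x + t *\<^sub>R v) - F x) \<le> \<bar>C\<bar> * \<bar>t\<bar>" for x t
    using vector_derivative_bound[of "%t. F (x + t *\<^sub>R v)" "%t. F' (x + t *\<^sub>R v)" "\<bar>C\<bar>" t 0] dt C by simp
  \<comment> \<open>All points that a shift by t v with |t| \<le> 1 can carry into \<open>S\<close>.
    Outside this compact set the difference quotients vanish, so a multiple of its indicator
    dominates them.\<close>
  define S' where "S' = (%(x, t). x - t *\<^sub>R v) ` (S \<times> {-1..1::real})"
  have S': "compact S'" unfolding S'_def
    by (rule compact_continuous_image)
       (auto intro!: continuous_intros compact_Times S(1) simp: case_prod_unfold)
  have inS': "x \<in> S'" if "x + t *\<^sub>R v \<in> S" "\<bar>t\<bar> \<le> 1" for x t
    unfolding S'_def by (rule image_eqI[of _ _ "(x + t *\<^sub>R v, t)"]) (use that in \<open>auto simp: abs_le_iff\<close>)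
  have [measurable]: "F \<in> borel_measurable borel" "F' \<in> borel_measurable borel"
    using c by (auto intro: borel_measurable_continuous_onI)
  have iF: "integrable lborel F" by (rule integrable_compact_supported[OF c(1) S(1,2)])
  have "((%t. LINT x|lborel. F (x + t *\<^sub>R v)) has_vector_derivative (LINT x|lborel. F' x)) (at 0)"
  proof (rule has_vector_derivative_integral[where w = "%x. \<bar>C\<bar> * indicator S' x"])
    show "integrable lborel (%x. \<bar>C\<bar> * indicator S' x)"
      by (intro integrable_mult_right integrable_real_indicator emeasure_compact_finite[OF S'])
         (simp add: borel_closed compact_imp_closed S')
    fix t x assume t: "\<bar>t - 0::real\<bar> < 1"
    show "norm (F (x + t *\<^sub>R v) - F (x + 0 *\<^sub>R v)) \<le> \<bar>C\<bar> * indicator S' x * \<bar>t - 0\<bar>"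
    proof (cases "x \<in> S'")
      case True then show ?thesis using lip[of x t] by simp
    next
      case False
      then have "x \<notin> S" "x + t *\<^sub>R v \<notin> S" using inS'[of x 0] inS'[of x t] t by auto
      then show ?thesis using S(2) by simp
    qed
  qed (use d iF in \<open>auto intro: lborel_integrable_translate\<close>)
  then have "((%t::real. LINT x|lborel. F x) has_vector_derivative (LINT x|lborel. F' x)) (at 0)"
    by (subst (asm) lborel_integral_translate) simp_all
  then show ?thesis
    using vector_derivative_unique_at has_vector_derivative_const by blast
qed

lemma has_pd_at:
  assumes "has_pd f i g"
  shows "((%t. f (x + t *\<^sub>R axis i 1)) has_vector_derivative g (x + t *\<^sub>R axis i 1)) (at t)"
  using assms[unfolded has_pd_def, rule_format, of "x + t *\<^sub>R axis i 1"]
  unfolding has_vector_derivative_iff_quotient by (simp add: algebra_simps)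

section \<open>Fourier transforms of bumps and their uniform decay\<close>

lemma FT_dpart:
  assumes n: "bump R n"
  shows "FT (dpart i n) y = \<i> * cor (y $ i) * FT n y"
proof -
  let ?F = "%\<xi>. n \<xi> * ee (- y) \<xi>"
  let ?F' = "%\<xi>. n \<xi> * (\<i> * cor ((- y) $ i) * ee (- y) \<xi>) + dpart i n \<xi> * ee (- y) \<xi>"
  note c = smooth_fun_continuous[OF bump_smooth[OF n]] smooth_fun_continuous[OF bump_smooth[OF bump_dpart[OF n]]]
  have "(LINT \<xi>|lborel. ?F' \<xi>) = 0"
  proof (rule integral_directional_derivative_zero[of ?F "axis i 1" _ "qbox R"])
    have "has_pd ?F i ?F'" by (intro has_pd_mult smooth_fun_has_pd has_pd_ee bump_smooth[OF n])
    then show "((%t. ?F (x + t *\<^sub>R axis i 1)) has_vector_derivative ?F' x) (at 0)" for x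
      by (simp add: has_pd_def)
  qed (use c bump_zero[OF n] bump_zero[OF bump_dpart[OF n]] compact_qbox in \<open>auto intro!: continuous_intros\<close>)
  moreover have "?F' = (%\<xi>. (- \<i> * cor (y $ i)) * (n \<xi> * ee (- y) \<xi>) + dpart i n \<xi> * ee (- y) \<xi>)"
    by (auto simp: algebra_simps)
  ultimately have "(LINT \<xi>|lborel. (- \<i> * cor (y $ i)) * (n \<xi> * ee (- y) \<xi>) + dpart i n \<xi> * ee (- y) \<xi>) = 0"
    by (simp only:)
  then have "(- \<i> * cor (y $ i)) * (LINT \<xi>|lborel. n \<xi> * ee (- y) \<xi>) +
      (LINT \<xi>|lborel. dpart i n \<xi> * ee (- y) \<xi>) = 0"
    using bump_integrable_ee[OF n, of "- y"] bump_integrable_ee[OF bump_dpart[OF n], of i "- y"]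
    by (subst (asm) Bochner_Integration.integral_add) (simp_all del: mult_minus_left)
  then show ?thesis
    by (simp add: FT_bump[OF n] FT_bump[OF bump_dpart[OF n]])
qed

lemma ee_swap: "ee (- y) \<xi> = ee (- \<xi>) y"
  by (simp add: ee_def inner_commute)

lemma smooth_fun_linear_coord: "smooth_fun (%\<xi>::real^'n::finite. c * cor (\<xi> $ l))"
  using smooth_fun_coord[OF chain_linear[of c], of 0 l] by simp

lemma has_pd_FT:
  fixes n :: "'n::finite cfun"
  assumes n: "bump R n"
  shows "has_pd (FT n) l (FT (%\<xi>. (- \<i> * cor (\<xi> $ l)) * n \<xi>))"
proof -
  have n': "bump R (%\<xi>. (- \<i> * cor (\<xi> $ l)) * n \<xi>)"
    by (intro bump_mult n smooth_fun_linear_coord)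
  note c = smooth_fun_continuous[OF bump_smooth[OF n]]
  show ?thesis
    unfolding has_pd_def FT_bump[OF n] FT_bump[OF n']
  proof
    fix y :: "real^'n"
    have pd: "has_pd (ee (- \<xi>)) l (%y. \<i> * cor ((- \<xi>) $ l) * ee (- \<xi>) y)" for \<xi> :: "real^'n"
      by (rule has_pd_ee)
    show "((%t. LINT \<xi>|lborel. n \<xi> * ee (- (y + t *\<^sub>R axis l 1)) \<xi>) has_vector_derivative
          (LINT \<xi>|lborel. (- \<i> * cor (\<xi> $ l)) * n \<xi> * ee (- y) \<xi>)) (at 0)"
    proof (rule has_vector_derivative_integral[where w = "%\<xi>. norm (cor (\<xi> $ l) * n \<xi>)"])
      show "integrable lborel (%\<xi>. norm (cor (\<xi> $ l) * n \<xi>))"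
        by (rule integrable_norm, rule integrable_compact_supported[OF _ compact_qbox[of R]])
           (use c bump_zero[OF n] in \<open>auto intro!: continuous_intros\<close>)
      show "integrable lborel (%\<xi>. n \<xi> * ee (- (y + t *\<^sub>R axis l 1)) \<xi>)" for t
        by (rule bump_integrable_ee[OF n])
      show "(%\<xi>. (- \<i> * cor (\<xi> $ l)) * n \<xi> * ee (- y) \<xi>) \<in> borel_measurable lborel"
        using borel_measurable_integrable[OF bump_integrable_ee[OF n']] by simp
      show "((%t. n \<xi> * ee (- (y + t *\<^sub>R axis l 1)) \<xi>) has_vector_derivative
          (- \<i> * cor (\<xi> $ l)) * n \<xi> * ee (- y) \<xi>) (at 0)" for \<xi>
        using has_vector_derivative_mult_right[OF pd[unfolded has_pd_def, rule_format, of \<xi> y], of "n \<xi>"]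
        unfolding ee_swap[of _ \<xi>] by (simp add: mult_ac)
      show "norm (n \<xi> * ee (- (y + t *\<^sub>R axis l 1)) \<xi> - n \<xi> * ee (- (y + 0 *\<^sub>R axis l 1)) \<xi>)
           \<le> norm (cor (\<xi> $ l) * n \<xi>) * \<bar>t - 0\<bar>" for \<xi> t
        unfolding ee_swap[of _ \<xi>]
        by (rule vector_derivative_bound[OF has_vector_derivative_mult_right[OF has_pd_at[OF pd]]])
           (auto simp: norm_mult)
    qed
  qed
qed

text \<open>A derivative of \<open>FT n\<close> is the transform of a coordinate times
  \<open>n\<close>, again a bump in the same box; the transforms of bumps thus form a class closed
  under differentiation.\<close>

lemma smooth_fun_FT:
  assumes "bump R n"
  shows "smooth_fun (FT n)"
proof (rule smooth_fun_coinduct[of _ "FT ` {n. bump R n}"])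
  fix f :: "real^'a => complex" and l assume "f \<in> FT ` {n. bump R n}"
  then obtain n where n: "bump R n" and f: "f = FT n" by auto
  have n': "bump R (%\<xi>. (- \<i> * cor (\<xi> $ l)) * n \<xi>)" for l
    by (intro bump_mult n smooth_fun_linear_coord)
  show "\<exists>g\<in>FT ` {n. bump R n}. has_pd f l g"
    unfolding f using has_pd_FT[OF n, of l] n' by blast
  have cn: "continuous_on UNIV n" using n by (simp add: bump_def smooth_fun_continuous)
  then have [measurable]: "n \<in> borel_measurable borel" by (rule borel_measurable_continuous_onI)
  have "continuous_on UNIV (%y. LINT \<xi>|lborel. n \<xi> * ee (- y) \<xi>)"
    unfolding continuous_on_sequentially
  proof (safe, unfold comp_def)
    fix X :: "nat => real^'a" and y assume X: "X \<longlonglongrightarrow> y"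
    show "(%i. LINT \<xi>|lborel. n \<xi> * ee (- X i) \<xi>) \<longlonglongrightarrow> (LINT \<xi>|lborel. n \<xi> * ee (- y) \<xi>)"
    proof (rule integral_dominated_convergence[where w = "%\<xi>. norm (n \<xi>)"])
      show "integrable lborel (%\<xi>. norm (n \<xi>))" using bump_integrable[OF n] by simp
      show "AE \<xi> in lborel. (%i. n \<xi> * ee (- X i) \<xi>) \<longlonglongrightarrow> n \<xi> * ee (- y) \<xi>"
        unfolding ee_def by (auto intro!: tendsto_intros X)
    qed (use bump_integrable_ee[OF n] in \<open>auto simp: norm_mult\<close>)
  qed
  then show "continuous_on UNIV f" by (simp add: f FT_bump[OF n])
qed (use assms in auto)

lemma iter_pd_FT:
  assumes n: "bump R n"
  shows "bump R (%\<xi>. (\<Prod>l\<leftarrow>is. - \<i> * cor (\<xi> $ l)) * n \<xi>) \<and>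
    iter_pd is (FT n) = FT (%\<xi>. (\<Prod>l\<leftarrow>is. - \<i> * cor (\<xi> $ l)) * n \<xi>)"
proof (induction "is")
  case (Cons l "is")
  let ?n = "%\<xi>. (\<Prod>l\<leftarrow>is. - \<i> * cor (\<xi> $ l)) * n \<xi>"
  have "bump R (%\<xi>. (- \<i> * cor (\<xi> $ l)) * ?n \<xi>)"
    by (rule bump_mult[OF _ smooth_fun_linear_coord]) (use Cons in simp)
  moreover have "dpart l (FT ?n) = FT (%\<xi>. (- \<i> * cor (\<xi> $ l)) * ?n \<xi>)"
    by (rule dpart_eqI[OF has_pd_FT[of R]]) (use Cons in simp)
  ultimately show ?case using Cons by (simp add: mult.assoc)
qed (use n in simp)

text \<open>A bound for the C^M norm. Estimates for \<open>FT n\<close> are expressed through it,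
  with constants that depend on the box but not on \<open>n\<close>.\<close>

definition pd_bound :: "nat => ('n::finite cfun) => real => bool" where
  "pd_bound M n b \<longleftrightarrow> (\<forall>is \<xi>. length is \<le> M --> norm (iter_pd is n \<xi>) \<le> b)"

lemma pd_bound_nonneg: "pd_bound M n b ==> 0 \<le> b"
  unfolding pd_bound_def by (metis list.size(3) norm_ge_zero order_trans zero_le)

lemma pd_bound_mono: "pd_bound M n b ==> M' \<le> M ==> b \<le> b' ==> pd_bound M' n b'"
  unfolding pd_bound_def by (meson order_trans)

lemma bump_pd_bound_ex:
  assumes n: "bump R n"
  shows "\<exists>b. pd_bound M n b"
proof -
  have "\<exists>b. \<forall>\<xi>. norm (iter_pd is n \<xi>) \<le> b" for "is"
  proof -
    note b = bump_iter_pd[OF n, of "is"]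
    have "compact (iter_pd is n ` qbox R)"
      using smooth_fun_continuous[OF bump_smooth[OF b]] compact_qbox
      by (meson compact_continuous_image continuous_on_subset subset_UNIV)
    then obtain C where "!!x. x \<in> qbox R ==> norm (iter_pd is n x) \<le> C"
      by (metis bounded_iff compact_imp_bounded imageI)
    then have "norm (iter_pd is n x) \<le> \<bar>C\<bar>" for x
      using bump_zero[OF b, of x] by (cases "x \<in> qbox R") (auto intro: order_trans[OF _ abs_ge_self])
    then show ?thesis by blast
  qed
  then obtain B where B: "!!is \<xi>. norm (iter_pd is n \<xi>) \<le> B is" by metis
  have fin: "finite {is::'a list. length is \<le> M}"
    using finite_lists_length_le[of "UNIV::'a set" M] by simp
  have "norm (iter_pd is n \<xi>) \<le> (\<Sum>is\<in>{is. length is \<le> M}. \<bar>B is\<bar>)" if "length is \<le> M" for "is" \<xi>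
    using B[of "is" \<xi>] member_le_sum[of "is" "{is. length is \<le> M}" "%is. \<bar>B is\<bar>"] that fin
    by fastforce
  then show ?thesis unfolding pd_bound_def by blast
qed

text \<open>A factor y_i on the transform is a derivative on \<open>n\<close>, so each power of 1 +
  |y| costs one derivative; |y| is at most the sum of the |y_i|, which contributes the factor 1 + d.
  The constant has to be uniform in \<open>n\<close>, because the multipliers tested later carry the
  parameter x of a character.\<close>

lemma FT_decay:
  "\<exists>C\<ge>0. \<forall>n::'n::finite cfun. \<forall>b. bump R n --> pd_bound m n b -->
     (\<forall>y. (1 + norm y) ^ m * norm (FT n y) \<le> C * b)"
proof (induction m)
  case 0
  show ?case
  proof (intro exI conjI allI impI)
    let ?C = "measure lborel (qbox R :: (real^'n) set)"
    show "?C \<ge> 0" by simp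
    fix n :: "'n cfun" and b y assume n: "bump R n" and b: "pd_bound 0 n b"
    have "norm (n \<xi>) \<le> b" for \<xi> using b by (auto simp: pd_bound_def dest: spec[of _ "[]"])
    then have *: "norm (n \<xi>) \<le> b * indicator (qbox R) \<xi>" for \<xi>
      using bump_zero[OF n, of \<xi>] by (cases "\<xi> \<in> qbox R") auto
    have fin: "emeasure lborel (qbox R :: (real^'n) set) < \<infinity>"
      using emeasure_lborel_cbox_finite by (simp only: qbox_eq infinity_ennreal_def)
    have "norm (FT n y) \<le> (LINT \<xi>|lborel. norm (n \<xi> * ee (- y) \<xi>))"
      unfolding FT_bump[OF n] by (rule integral_norm_bound)
    also have "... \<le> (LINT \<xi>|lborel. b * indicator (qbox R :: (real^'n) set) \<xi>)"
      by (rule Bochner_Integration.integral_mono) (use * fin bump_integrable_ee[OF n] bump_integrable[OF n] in \<open>auto simp: norm_mult compact_imp_closed compact_qbox\<close>)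
    also have "... = ?C * b" by simp
    finally show "(1 + norm y) ^ 0 * norm (FT n y) \<le> ?C * b" by simp
  qed
next
  case (Suc m)
  then obtain C where C: "C \<ge> 0" "!!n b y. bump R n ==> pd_bound m n b ==>
     (1 + norm y) ^ m * norm (FT (n::'n cfun) y) \<le> C * b" by blast
  show ?case
  proof (intro exI[of _ "C * (1 + real CARD('n))"] conjI allI impI)
    fix n :: "'n cfun" and b and y :: "real^'n" assume n: "bump R n" and b: "pd_bound (Suc m) n b"
    have bi: "pd_bound m (dpart i n) b" for i
      unfolding pd_bound_def using b[unfolded pd_bound_def, rule_format, of "_ @ [i]"] by auto
    have 0: "(1 + norm y) ^ m * norm (FT n y) \<le> C * b"
      by (rule C(2)[OF n]) (use b pd_bound_mono in force)
    have 1: "(1 + norm y) ^ m * (\<bar>y $ i\<bar> * norm (FT n y)) \<le> C * b" for i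
      using C(2)[OF bump_dpart[OF n] bi, of y i] by (simp add: FT_dpart[OF n] norm_mult)
    have "(1 + norm y) ^ Suc m * norm (FT n y) = (1 + norm y) ^ m * norm (FT n y) + norm y * ((1 + norm y) ^ m * norm (FT n y))"
      by (simp add: algebra_simps)
    also have "... \<le> C * b + (\<Sum>i\<in>UNIV. \<bar>y $ i\<bar>) * ((1 + norm y) ^ m * norm (FT n y))"
      by (intro add_mono 0 mult_right_mono norm_le_l1_cart) auto
    also have "... = C * b + (\<Sum>i\<in>UNIV. (1 + norm y) ^ m * (\<bar>y $ i\<bar> * norm (FT n y)))"
      by (subst sum_distrib_right) (simp add: mult_ac)
    also have "... \<le> C * b + (\<Sum>i\<in>(UNIV::'n set). C * b)"
      by (intro add_mono sum_mono 1) auto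
    finally show "(1 + norm y) ^ Suc m * norm (FT n y) \<le> C * (1 + real CARD('n)) * b"
      by (simp add: algebra_simps)
  qed (use C in simp)
qed

lemma pd_bound_mult:
  fixes n :: "'n::finite cfun"
  assumes n: "bump R n" and g: "smooth_fun g" and b: "pd_bound M n b"
    and a: "!!js \<xi>. length js \<le> M ==> \<xi> \<in> qbox R ==> norm (iter_pd js g \<xi>) \<le> a" and "0 \<le> a"
  shows "pd_bound M (%\<xi>. g \<xi> * n \<xi>) (2 ^ M * a * b)"
  unfolding pd_bound_def
proof safe
  fix js :: "'n list" and \<xi> :: "real^'n" assume js: "length js \<le> M"
  have b0: "0 \<le> b" by (rule pd_bound_nonneg[OF b])
  show "norm (iter_pd js (%\<xi>. g \<xi> * n \<xi>) \<xi>) \<le> 2 ^ M * a * b"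
  proof (cases "\<xi> \<in> qbox R")
    case True
    have "norm (iter_pd js (%\<xi>. g \<xi> * n \<xi>) \<xi>) \<le> 2 ^ length js * a * b"
      by (rule iter_pd_mult_bound[OF g bump_smooth[OF n]])
         (use a b js True in \<open>auto simp: pd_bound_def\<close>)
    also have "... \<le> 2 ^ M * a * b"
      by (intro mult_right_mono power_increasing) (use js b0 \<open>0 \<le> a\<close> in auto)
    finally show ?thesis .
  next
    case False
    then show ?thesis
      using bump_zero[OF bump_iter_pd[OF bump_mult[OF n g]] False, of js] b0 \<open>0 \<le> a\<close> by simp
  qed
qed

lemma pd_bound_monomial:
  fixes n :: "'n::finite cfun"
  assumes n: "bump R n" and b: "pd_bound M n b"
  shows "pd_bound M (%\<xi>. (\<Prod>l\<leftarrow>is. - \<i> * cor (\<xi> $ l)) * n \<xi>) ((2 ^ M * (1 + \<bar>R\<bar>)) ^ length is * b)"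
proof (induction "is")
  case (Cons l "is")
  let ?n = "%\<xi>. (\<Prod>l\<leftarrow>is. - \<i> * cor (\<xi> $ l)) * n \<xi>"
  have *: "iter_pd js (%\<xi>::real^'n. - \<i> * cor (\<xi> $ l)) = (%\<xi>. if set js \<subseteq> {l} then
      (if length js = 0 then - \<i> * cor (\<xi> $ l) else if length js = 1 then - \<i> else 0) else 0)" for js
    using iter_pd_coord[OF chain_linear[of "- \<i>"], of js 0 l] by (simp only: add_0 if_True refl)
  have "pd_bound M (%\<xi>. (- \<i> * cor (\<xi> $ l)) * ?n \<xi>) (2 ^ M * (1 + \<bar>R\<bar>) * ((2 ^ M * (1 + \<bar>R\<bar>)) ^ length is * b))"
  proof (rule pd_bound_mult[OF _ _ Cons])
    show "bump R ?n" using iter_pd_FT[OF n, of "is"] by simp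
    show "norm (iter_pd js (%\<xi>. - \<i> * cor (\<xi> $ l)) \<xi>) \<le> 1 + \<bar>R\<bar>" if "\<xi> \<in> qbox R" for js and \<xi> :: "real^'n"
    proof -
      have "\<bar>\<xi> $ l\<bar> \<le> R" using that by (auto simp: qbox_def)
      then show ?thesis unfolding * by (auto simp: norm_mult)
    qed
  qed (rule smooth_fun_linear_coord, simp)
  then show ?case by (simp add: mult_ac)
qed (use b in simp)

lemma FT_seminorm_bound:
  "\<exists>C\<ge>0. \<forall>n::'n::finite cfun. \<forall>b. bump R n --> pd_bound m n b -->
     (\<forall>y. (1 + norm y) ^ m * norm (iter_pd is (FT n) y) \<le> C * b)"
proof -
  obtain C where C: "C \<ge> 0" "!!n b y. bump R n ==> pd_bound m n b ==>
     (1 + norm y) ^ m * norm (FT (n::'n cfun) y) \<le> C * b" using FT_decay[of R m] by blast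
  show ?thesis
  proof (intro exI[of _ "C * (2 ^ m * (1 + \<bar>R\<bar>)) ^ length is"] conjI allI impI)
    fix n :: "'n cfun" and b y assume n: "bump R n" and b: "pd_bound m n b"
    show "(1 + norm y) ^ m * norm (iter_pd is (FT n) y) \<le> C * (2 ^ m * (1 + \<bar>R\<bar>)) ^ length is * b"
      using C(2)[OF _ pd_bound_monomial[OF n b, of "is"], of y] iter_pd_FT[OF n, of "is"] by (simp add: mult_ac)
  qed (use C(1) in simp)
qed

lemma FT_schwartz:
  assumes n: "bump R n"
  shows "FT n \<in> schwartz"
  unfolding schwartz_def
proof (safe intro!: smooth_fun_FT[OF n])
  fix "is" and m :: nat
  obtain b where "pd_bound m n b" using bump_pd_bound_ex[OF n] by blast
  then show "\<exists>C. \<forall>x. (1 + norm x) ^ m * norm (iter_pd is (FT n) x) \<le> C"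
    using FT_seminorm_bound[of R m "is"] n by blast
qed

text \<open>Continuity of \<open>T\<close> read on the frequency side: on bumps in a fixed box its
  Fourier transform is a distribution of finite order \<open>M\<close>. The later limits use
  continuity in this form.\<close>

lemma tempered_FT_bound:
  fixes T :: "('n::finite cfun) => complex"
  assumes "tempered T"
  shows "\<exists>C M. C \<ge> 0 \<and> (\<forall>n b. bump R n --> pd_bound M n b --> norm (T (FT n)) \<le> C * b)"
proof -
  obtain C0 N where T: "!!f. f \<in> schwartz ==> norm (T f) \<le>
        C0 * (\<Sum>m\<le>N. \<Sum>is\<in>{is. length is \<le> N}. schwartz_seminorm m is f)"
    using assms unfolding tempered_def by blast
  have "\<forall>m is. \<exists>C\<ge>0. \<forall>n::'n cfun. \<forall>b. bump R n --> pd_bound m n b -->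
     (\<forall>y. (1 + norm y) ^ m * norm (iter_pd is (FT n) y) \<le> C * b)" using FT_seminorm_bound by blast
  then obtain D where D: "!!m is. D m is \<ge> 0" "!!m is n b y. bump R n ==> pd_bound m n b ==>
      (1 + norm y) ^ m * norm (iter_pd is (FT (n::'n cfun)) y) \<le> D m is * b"
    by metis
  let ?C = "\<bar>C0\<bar> * (\<Sum>m\<le>N. \<Sum>is\<in>{is. length is \<le> N}. D m is)"
  show ?thesis
  proof (intro exI[of _ ?C] exI[of _ N] conjI allI impI)
    fix n :: "'n cfun" and b assume n: "bump R n" and b: "pd_bound N n b"
    have s: "schwartz_seminorm m is (FT n) \<le> D m is * b" if "m \<le> N" for m "is"
      unfolding schwartz_seminorm_def
      by (rule cSUP_least) (auto intro!: D(2) n pd_bound_mono[OF b] that)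
    have s0: "0 \<le> schwartz_seminorm m is (FT n)" if "m \<le> N" for m "is"
      unfolding schwartz_seminorm_def
    proof (rule cSUP_upper2)
      show "bdd_above (range (%x. (1 + norm x) ^ m * norm (iter_pd is (FT n) x)))"
        using D(2)[OF n pd_bound_mono[OF b that order_refl], of _ "is"] by (auto simp: bdd_above_def)
      show "0 \<le> (1 + norm (0::real^'n)) ^ m * norm (iter_pd is (FT n) 0)" by simp
    qed simp
    have "norm (T (FT n)) \<le> C0 * (\<Sum>m\<le>N. \<Sum>is\<in>{is. length is \<le> N}. schwartz_seminorm m is (FT n))"
      by (rule T[OF FT_schwartz[OF n]])
    also have "... \<le> \<bar>C0\<bar> * (\<Sum>m\<le>N. \<Sum>is\<in>{is. length is \<le> N}. schwartz_seminorm m is (FT n))"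
      by (intro mult_right_mono sum_nonneg s0) auto
    also have "... \<le> \<bar>C0\<bar> * (\<Sum>m\<le>N. \<Sum>is\<in>{is. length is \<le> N}. D m is * b)"
      by (intro mult_left_mono sum_mono s) auto
    finally show "norm (T (FT n)) \<le> ?C * b" by (simp add: sum_distrib_right mult.assoc)
  qed (auto intro!: sum_nonneg D mult_nonneg_nonneg)
qed

lemma FT_lincomb:
  assumes "bump R f" "bump R g"
  shows "FT (%\<xi>. a * f \<xi> + b * g \<xi>) = (%y. a * FT f y + b * FT g y)"
  using bump_integrable_ee[OF assms(1)] bump_integrable_ee[OF assms(2)]
  by (auto simp: FT_bump[OF assms(1)] FT_bump[OF assms(2)] FT_bump[OF bump_lincomb[OF assms]]
      distrib_right mult.assoc)

lemma tempered_FT_lincomb: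
  assumes "tempered T" "bump R f" "bump R g"
  shows "T (FT (%\<xi>. a * f \<xi> + b * g \<xi>)) = a * T (FT f) + b * T (FT g)"
  unfolding FT_lincomb[OF assms(2,3)]
  using assms(1) FT_schwartz[OF assms(2)] FT_schwartz[OF assms(3)] by (auto simp: tempered_def)

section \<open>One-dimensional kernels\<close>

definition sm1 :: "(real => complex) => bool" where
  "sm1 m \<longleftrightarrow> (\<exists>D. chain D \<and> D 0 = m)"

lemma sm1_coinduct:
  assumes "m \<in> X" and step: "!!f. f \<in> X ==> \<exists>g\<in>X. \<forall>x. (f has_vector_derivative g x) (at x)"
  shows "sm1 m"
proof -
  obtain nx where nx: "!!f. f \<in> X ==> nx f \<in> X" "!!f x. f \<in> X ==> (f has_vector_derivative nx f x) (at x)"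
    using step by metis
  have X: "(nx ^^ r) m \<in> X" for r by (induction r) (auto intro: nx assms(1))
  show ?thesis unfolding sm1_def chain_def
    by (rule exI[of _ "%r. (nx ^^ r) m"]) (use nx(2)[OF X] in auto)
qed

lemma sm1_deriv: "sm1 m ==> \<exists>m'. sm1 m' \<and> (\<forall>x. (m has_vector_derivative m' x) (at x))"
proof -
  assume "sm1 m"
  then obtain D where D: "chain D" "D 0 = m" by (auto simp: sm1_def)
  have "chain (%r. D (Suc r))" using D(1) by (auto simp: chain_def)
  then have "sm1 (D (Suc 0))" unfolding sm1_def by blast
  moreover have "\<forall>x. (m has_vector_derivative D (Suc 0) x) (at x)"
    using D by (auto simp: chain_def)
  ultimately show ?thesis by blast
qed

lemma sm1_continuous: "sm1 m ==> continuous_on S m"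
  unfolding sm1_def using chain_continuous by blast

inductive_set sm1_alg :: "(real => complex) set" where
  base: "sm1 f ==> f \<in> sm1_alg"
| add: "f \<in> sm1_alg ==> g \<in> sm1_alg ==> (%x. f x + g x) \<in> sm1_alg"
| mult: "f \<in> sm1_alg ==> g \<in> sm1_alg ==> (%x. f x * g x) \<in> sm1_alg"

lemma sm1_alg_step: "f \<in> sm1_alg ==> \<exists>g\<in>sm1_alg. \<forall>x. (f has_vector_derivative g x) (at x)"
proof (induction rule: sm1_alg.induct)
  case (base f)
  then show ?case using sm1_deriv sm1_alg.base by blast
next
  case (add f g)
  then obtain f' g' where *: "f' \<in> sm1_alg" "\<forall>x. (f has_vector_derivative f' x) (at x)"
    "g' \<in> sm1_alg" "\<forall>x. (g has_vector_derivative g' x) (at x)" by blast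
  then show ?case
    by (intro bexI[of _ "%x. f' x + g' x"]) (auto intro!: has_vector_derivative_add sm1_alg.add)
next
  case (mult f g)
  then obtain f' g' where *: "f' \<in> sm1_alg" "\<forall>x. (f has_vector_derivative f' x) (at x)"
    "g' \<in> sm1_alg" "\<forall>x. (g has_vector_derivative g' x) (at x)" by blast
  then show ?case
    by (intro bexI[of _ "%x. f x * g' x + f' x * g x"])
       (auto intro!: has_vector_derivative_mult sm1_alg.add sm1_alg.mult mult.hyps)
qed

lemma sm1_alg_sm1: "f \<in> sm1_alg ==> sm1 f"
  by (rule sm1_coinduct[of f sm1_alg]) (use sm1_alg_step in blast)+

lemma sm1_add: "sm1 f ==> sm1 g ==> sm1 (%x. f x + g x)"
  by (rule sm1_alg_sm1, rule sm1_alg.add; rule sm1_alg.base)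

lemma sm1_mult: "sm1 f ==> sm1 g ==> sm1 (%x. f x * g x)"
  by (rule sm1_alg_sm1, rule sm1_alg.mult; rule sm1_alg.base)

lemma sm1_const: "sm1 (%_. c)"
  by (rule sm1_coinduct[of _ "range (%c _. c)"]) (auto intro!: exI[of _ 0])

lemma sm1_linear: "sm1 (%x. c * cor x)"
  unfolding sm1_def using chain_linear[of c] by (intro exI conjI) (assumption, simp)

lemma has_vector_derivative_compose_affine:
  fixes f :: "real => complex"
  assumes "(f has_vector_derivative f') (at (a * x + b))"
  shows "((%x. f (a * x + b)) has_vector_derivative cor a * f') (at x)"
proof -
  have "((%x. a * x + b) has_vector_derivative a) (at x)"
    by (auto intro!: derivative_eq_intros simp flip: has_real_derivative_iff_has_vector_derivative)
  from vector_diff_chain_at[OF this, of f f'] assms show ?thesis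
    by (simp add: o_def scaleR_conv_of_real)
qed

lemma sm1_affine:
  assumes "sm1 f"
  shows "sm1 (%x. f (a * x + b))"
proof (rule sm1_coinduct[of _ "{%x. c * f (a * x + b) |c f. sm1 f}"])
  show "(%x. f (a * x + b)) \<in> {%x. c * f (a * x + b) |c f. sm1 f}"
    using assms by (intro CollectI exI[of _ 1] exI[of _ f]) auto
  fix g assume "g \<in> {%x. c * f (a * x + b) |c f. sm1 f}"
  then obtain c f where g: "g = (%x. c * f (a * x + b))" and "sm1 f" by blast
  then obtain f' where f': "sm1 f'" "!!x. (f has_vector_derivative f' x) (at x)"
    using sm1_deriv by blast
  have "(g has_vector_derivative (c * cor a) * f' (a * x + b)) (at x)" for x
    unfolding g using has_vector_derivative_mult_right[OF has_vector_derivative_compose_affine[OF f'(2)], of c a b x]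
    by (simp add: mult.assoc)
  then show "\<exists>h\<in>{%x. c * f (a * x + b) |c f. sm1 f}. \<forall>x. (g has_vector_derivative h x) (at x)"
    using f'(1) by (intro bexI[of _ "%x. (c * cor a) * f' (a * x + b)"]) auto
qed

lemma cis_has_vector_derivative:
  "((%x. cis (a * x)) has_vector_derivative \<i> * cor a * cis (a * x)) (at x)"
proof -
  have "(cis has_vector_derivative \<i> * cis y) (at y)" for y
  proof -
    have "((%t. \<i> * cor t) has_vector_derivative \<i>) (at y)"
      using has_vector_derivative_mult_right[OF has_vector_derivative_of_real[OF DERIV_ident], of \<i> "at y"] by simp
    then have "(exp \<circ> (%t. \<i> * cor t) has_vector_derivative \<i> * exp (\<i> * cor y)) (at y)"
      by (rule field_vector_diff_chain_at) (auto intro!: derivative_eq_intros)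
    then show ?thesis by (simp add: o_def cis_conv_exp[abs_def])
  qed
  from has_vector_derivative_compose_affine[of cis _ a x 0, OF this] show ?thesis
    by (simp add: mult_ac)
qed

lemma sm1_cis: "sm1 (%x. cis (a * x))"
proof (rule sm1_coinduct[of _ "range (%c x. c * cis (a * x))"])
  show "(%x. cis (a * x)) \<in> range (%c x. c * cis (a * x))" by (rule image_eqI[of _ _ 1]) auto
  fix f assume "f \<in> range (%c x. c * cis (a * x))"
  then obtain c where f: "f = (%x. c * cis (a * x))" by auto
  have "(f has_vector_derivative (c * (\<i> * cor a)) * cis (a * x)) (at x)" for x
    unfolding f using has_vector_derivative_mult_right[OF cis_has_vector_derivative[of a x], of c]
    by (simp add: mult.assoc)
  then show "\<exists>g\<in>range (%c x. c * cis (a * x)). \<forall>x. (f has_vector_derivative g x) (at x)"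
    by (intro bexI[of _ "%x. (c * (\<i> * cor a)) * cis (a * x)"]) auto
qed

section \<open>Compactly supported functions of one variable and their kernels\<close>

definition test1 :: "real => (real => complex) => bool" where
  "test1 R m \<longleftrightarrow> sm1 m \<and> (\<forall>x. \<bar>x\<bar> > R --> m x = 0)"

lemma test1_deriv:
  assumes "test1 R m"
  shows "\<exists>m'. test1 R m' \<and> (\<forall>x. (m has_vector_derivative m' x) (at x))"
proof -
  obtain m' where m': "sm1 m'" "!!x. (m has_vector_derivative m' x) (at x)"
    using assms sm1_deriv[of m] by (auto simp: test1_def)
  have "m' x = 0" if x: "\<bar>x\<bar> > R" for x
  proof -
    have "open {x. \<bar>x\<bar> > R}" by (intro open_Collect_less continuous_intros)
    then have "(m has_vector_derivative 0) (at x)"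
      by (rule has_vector_derivative_transform_within_open[OF has_vector_derivative_const[of 0]])
         (use x assms in \<open>auto simp: test1_def\<close>)
    then show ?thesis using m'(2) vector_derivative_unique_at by blast
  qed
  then show ?thesis using m' by (auto simp: test1_def)
qed

lemma test1_mult: "test1 R m ==> sm1 g ==> test1 R (%x. g x * m x)"
  by (auto simp: test1_def sm1_mult)

lemma test1_continuous: "test1 R m ==> continuous_on S m"
  by (auto simp: test1_def sm1_continuous)

lemma test1_integrable:
  assumes "test1 R m"
  shows "integrable lborel m"
  by (rule integrable_compact_supported[of _ "{-R..R}"])
     (use assms test1_continuous[OF assms] in \<open>auto simp: test1_def not_le\<close>)

lemma test1_measurable [measurable_dest]: "test1 R m ==> m \<in> borel_measurable borel"
  by (intro borel_measurable_continuous_onI test1_continuous)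

lemma continuous_on_cis [continuous_intros]:
  "continuous_on S f ==> continuous_on S (%x. cis (f x))"
  unfolding cis_conv_exp by (intro continuous_intros)

lemma borel_measurable_cis [measurable]: "cis \<in> borel_measurable borel"
  by (intro borel_measurable_continuous_onI continuous_intros)

lemma test1_integrable_cis: "test1 R m ==> integrable lborel (%x. m x * cis (a * x))"
  by (rule test1_integrable[of R], subst mult.commute, rule test1_mult[OF _ sm1_cis])

text \<open>The inverse Fourier transform. With this normalisation the multiplier \<open>m\<close>
  acts as convolution with \<open>ker m\<close> without further constants.\<close>

definition ker :: "(real => complex) => real => complex" where
  "ker m s = cor (1 / (2 * pi)) * (LINT \<eta>|lborel. m \<eta> * cis (s * \<eta>))"

lemma ker_deriv:
  assumes m: "test1 R m" and m': "test1 R m'" "!!x. (m has_vector_derivative m' x) (at x)"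
  shows "ker m' s = - \<i> * cor s * ker m s"
proof -
  let ?F' = "%x. m x * (\<i> * cor s * cis (s * x)) + m' x * cis (s * x)"
  have "(LINT x|lborel. ?F' x) = 0"
  proof (rule integral_directional_derivative_zero[of "%x. m x * cis (s * x)" 1 _ "{-R..R}"])
    fix x :: real
    have "((%x. m x * cis (s * x)) has_vector_derivative ?F' x) (at x)"
      by (intro has_vector_derivative_mult cis_has_vector_derivative m')
    then show "((%t. m (x + t *\<^sub>R 1) * cis (s * (x + t *\<^sub>R 1))) has_vector_derivative ?F' x) (at 0)"
      by (simp add: has_vector_derivative_iff_quotient)
    assume "x \<notin> {-R..R}"
    then have "\<bar>x\<bar> > R" by auto
    then show "m x * cis (s * x) = 0" "?F' x = 0" using m m' by (auto simp: test1_def)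
  qed (use test1_continuous[OF m, of UNIV] test1_continuous[OF m'(1), of UNIV] in \<open>auto intro!: continuous_intros\<close>)
  moreover have "?F' = (%x. (\<i> * cor s) * (m x * cis (s * x)) + m' x * cis (s * x))"
    by (auto simp: algebra_simps)
  ultimately have "(LINT x|lborel. (\<i> * cor s) * (m x * cis (s * x)) + m' x * cis (s * x)) = 0"
    by (simp only:)
  then have "(\<i> * cor s) * (LINT x|lborel. m x * cis (s * x)) + (LINT x|lborel. m' x * cis (s * x)) = 0"
    using test1_integrable_cis[OF m, of s] test1_integrable_cis[OF m'(1), of s]
    by (subst (asm) Bochner_Integration.integral_add) simp_all
  then have "(LINT x|lborel. m' x * cis (s * x)) = - ((\<i> * cor s) * (LINT x|lborel. m x * cis (s * x)))"
    by (metis add_eq_0_iff)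
  then show ?thesis by (simp add: ker_def)
qed

text \<open>By \<open>ker_deriv\<close>, |s| |ker m s| equals |ker m' s|, so one more power of 1 +
  |s| is paid for with one derivative of \<open>m\<close>; this is why \<open>m\<close> varies in
  the induction.\<close>

lemma ker_decay:
  "test1 R m ==> \<exists>C. \<forall>s. (1 + \<bar>s\<bar>) ^ N * norm (ker m s) \<le> C"
proof (induction N arbitrary: m)
  case 0
  have "norm (ker m s) \<le> 1 / (2 * pi) * (LINT \<eta>|lborel. norm (m \<eta> * cis (s * \<eta>)))" for s
    unfolding ker_def norm_mult[of "cor _"]
    by (intro mult_mono integral_norm_bound) (auto simp: norm_divide)
  then show ?case by (auto simp: norm_mult intro!: exI[of _ "1 / (2 * pi) * (LINT \<eta>|lborel. norm (m \<eta>))"])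
next
  case (Suc N)
  obtain m' where m': "test1 R m'" "!!x. (m has_vector_derivative m' x) (at x)"
    using test1_deriv[OF Suc.prems] by blast
  obtain C C' where C: "!!s. (1 + \<bar>s\<bar>) ^ N * norm (ker m s) \<le> C" "!!s. (1 + \<bar>s\<bar>) ^ N * norm (ker m' s) \<le> C'"
    using Suc.IH[OF Suc.prems] Suc.IH[OF m'(1)] by blast
  have "(1 + \<bar>s\<bar>) ^ Suc N * norm (ker m s) \<le> C + C'" for s
    using C(1)[of s] C(2)[of s] by (simp add: ker_deriv[OF Suc.prems m'] norm_mult algebra_simps)
  then show ?case by blast
qed

lemma ker_has_derivative:
  assumes m: "test1 R m"
  shows "(ker m has_vector_derivative ker (%\<eta>. (\<i> * cor \<eta>) * m \<eta>) s) (at s)"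
proof -
  have m': "test1 R (%\<eta>. (\<i> * cor \<eta>) * m \<eta>)" by (rule test1_mult[OF m sm1_linear])
  note [measurable] = test1_measurable[OF m]
  have cis': "((%s. cis (s * \<eta>)) has_vector_derivative \<i> * cor \<eta> * cis (s * \<eta>)) (at s)" for s \<eta>
    using cis_has_vector_derivative[of \<eta> s] by (simp add: mult.commute)
  have "((%s. LINT \<eta>|lborel. m \<eta> * cis (s * \<eta>)) has_vector_derivative
        (LINT \<eta>|lborel. (\<i> * cor \<eta>) * m \<eta> * cis (s * \<eta>))) (at s)"
  proof (rule has_vector_derivative_integral[where w = "%\<eta>. norm ((\<i> * cor \<eta>) * m \<eta>)"])
    show "((%s. m \<eta> * cis (s * \<eta>)) has_vector_derivative (\<i> * cor \<eta>) * m \<eta> * cis (s * \<eta>)) (at s)" for \<eta>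
      using has_vector_derivative_mult_right[OF cis'[of \<eta> s], of "m \<eta>"] by (simp add: mult_ac)
    show "norm (m \<eta> * cis (t * \<eta>) - m \<eta> * cis (s * \<eta>)) \<le> norm (\<i> * cor \<eta> * m \<eta>) * \<bar>t - s\<bar>" for t \<eta>
      by (rule vector_derivative_bound[OF has_vector_derivative_mult_right[OF cis']]) (auto simp: norm_mult)
  qed (use test1_integrable_cis[OF m] test1_integrable[OF m'] in auto)
  from has_vector_derivative_mult_right[OF this, of "cor (1 / (2 * pi))"]
  show ?thesis by (simp add: ker_def[abs_def])
qed

section \<open>Rapidly decreasing kernels and Fourier inversion\<close>

definition rapid :: "(real => complex) => bool" where
  "rapid K \<longleftrightarrow> continuous_on UNIV K \<and> (\<forall>N. \<exists>C. \<forall>s. (1 + \<bar>s\<bar>) ^ N * norm (K s) \<le> C)"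

lemma rapid_ker: "test1 R m ==> rapid (ker m)"
  unfolding rapid_def
  by (auto intro!: ker_decay continuous_at_imp_continuous_on dest: ker_has_derivative has_vector_derivative_continuous)

lemma integrable_inverse_square: "integrable lborel (%s::real. inverse (1 + s\<^sup>2))"
  using integrable_inverse_1_plus_square by (simp add: set_integrable_def)

lemma rapid_measurable [measurable_dest]: "rapid K ==> K \<in> borel_measurable borel"
  by (auto simp: rapid_def intro: borel_measurable_continuous_onI)

lemma rapid_integrable:
  assumes "rapid K"
  shows "integrable lborel (%s. (1 + \<bar>s\<bar>) ^ N * norm (K s))"
proof -
  note [measurable] = rapid_measurable[OF assms]
  \<comment> \<open>The two extra powers are traded for the integrable factor 1 / (1 + s^2).\<close>
  obtain C where C: "!!s. (1 + \<bar>s\<bar>) ^ (N + 2) * norm (K s) \<le> C" using assms unfolding rapid_def by blast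
  show ?thesis
  proof (rule Bochner_Integration.integrable_bound[where f = "%s. C * inverse (1 + s\<^sup>2)"])
    show "integrable lborel (%s. C * inverse (1 + s\<^sup>2))" using integrable_inverse_square by auto
    show "AE s in lborel. norm ((1 + \<bar>s\<bar>) ^ N * norm (K s)) \<le> norm (C * inverse (1 + s\<^sup>2))"
    proof (rule AE_I2)
      fix s :: real
      have p: "1 + s\<^sup>2 > 0" by (simp add: add_pos_nonneg)
      have "(1 + s\<^sup>2) * ((1 + \<bar>s\<bar>) ^ N * norm (K s)) \<le> (1 + \<bar>s\<bar>)\<^sup>2 * ((1 + \<bar>s\<bar>) ^ N * norm (K s))"
        by (intro mult_right_mono) (auto simp: power2_eq_square algebra_simps)
      also have "... \<le> C" using C[of s] by (simp only: power_add mult_ac)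
      finally have "(1 + \<bar>s\<bar>) ^ N * norm (K s) \<le> C * inverse (1 + s\<^sup>2)"
        using p by (simp add: field_simps)
      then show "norm ((1 + \<bar>s\<bar>) ^ N * norm (K s)) \<le> norm (C * inverse (1 + s\<^sup>2))"
        by (metis abs_ge_self abs_of_nonneg order_trans real_norm_def mult_nonneg_nonneg norm_ge_zero zero_le_power abs_ge_zero add_nonneg_nonneg zero_le_one)
    qed
  qed measurable
qed

lemma rapid_integrable_poly:
  assumes K: "rapid K" and [measurable]: "f \<in> borel_measurable borel"
    and "!!s. norm (f s) \<le> C * (1 + \<bar>s\<bar>) ^ N"
  shows "integrable lborel (%s. K s * (f s :: complex))"
proof (rule Bochner_Integration.integrable_bound[where f = "%s. C * ((1 + \<bar>s\<bar>) ^ N * norm (K s))"])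
  show "integrable lborel (%s. C * ((1 + \<bar>s\<bar>) ^ N * norm (K s)))"
    using rapid_integrable[OF K] by auto
  note [measurable] = rapid_measurable[OF K]
  show "(%s. K s * f s) \<in> borel_measurable lborel" by measurable
  have "norm (K s * f s) \<le> C * ((1 + \<bar>s\<bar>) ^ N * norm (K s))" for s
    using mult_left_mono[OF assms(3)[of s] norm_ge_zero[of "K s"]] by (simp add: norm_mult mult_ac)
  then show "AE s in lborel. norm (K s * f s) \<le> norm (C * ((1 + \<bar>s\<bar>) ^ N * norm (K s)))"
    by (intro AE_I2) (metis abs_ge_self order_trans real_norm_def)
qed

lemma integrable_prod_mult:
  fixes f :: "'a::euclidean_space => complex" and g :: "'b::euclidean_space => complex"
  assumes f: "integrable lborel f" and g: "integrable lborel g"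
  shows "integrable (lborel \<Otimes>\<^sub>M lborel) (%(x, y). f x * g y)"
proof (rule lborel_pair.Fubini_integrable)
  note [measurable] = borel_measurable_integrable[OF f] borel_measurable_integrable[OF g]
  show "(%(x, y). f x * g y) \<in> borel_measurable (lborel \<Otimes>\<^sub>M lborel)" by measurable
qed (use f g in \<open>auto simp: norm_mult\<close>)

text \<open>The characteristic function of the standard normal law at a / \<epsilon>, followed by
  the substitution x = \<epsilon> s.\<close>

lemma gaussian_fourier:
  assumes "0 < \<epsilon>"
  shows "(LINT s|lborel. cis (s * a) * cor (exp (- (\<epsilon> * s)\<^sup>2 / 2))) =
    cor (sqrt (2 * pi) / \<epsilon> * exp (- (a / \<epsilon>)\<^sup>2 / 2))"
proof -
  have "(LINT x|lborel. cor (std_normal_density x) * cis (t * x)) = cor (exp (- t\<^sup>2 / 2))" for t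
  proof -
    have "char std_normal_distribution t = (LINT x|lborel. std_normal_density x *\<^sub>R iexp (t * x))"
      unfolding char_def by (rule integral_density) auto
    then show ?thesis
      by (simp add: char_std_normal_distribution scaleR_conv_of_real cis_conv_exp)
  qed
  from this[of "a / \<epsilon>"]
  have 1: "(LINT x|lborel. cis (a / \<epsilon> * x) * cor (exp (- x\<^sup>2 / 2))) = cor (sqrt (2 * pi) * exp (- (a / \<epsilon>)\<^sup>2 / 2))"
    (is "?I = _")
  proof -
    have "(%x. cor (std_normal_density x) * cis (a / \<epsilon> * x)) =
       (%x. cor (1 / sqrt (2 * pi)) * (cis (a / \<epsilon> * x) * cor (exp (- x\<^sup>2 / 2))))"
      by (auto simp: std_normal_density_def mult_ac)
    then have "cor (1 / sqrt (2 * pi)) * ?I = cor (exp (- (a / \<epsilon>)\<^sup>2 / 2))"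
      using \<open>(LINT x|lborel. cor (std_normal_density x) * cis (a / \<epsilon> * x)) = _\<close>
      by (simp only: integral_mult_right_zero)
    then have "cor (sqrt (2 * pi)) * (cor (1 / sqrt (2 * pi)) * ?I) =
        cor (sqrt (2 * pi)) * cor (exp (- (a / \<epsilon>)\<^sup>2 / 2))" by simp
    then show ?thesis
      by (simp add: mult.assoc[symmetric] flip: of_real_mult)
  qed
  have "?I = \<bar>\<epsilon>\<bar> *\<^sub>R (LINT s|lborel. cis (a / \<epsilon> * (0 + \<epsilon> * s)) * cor (exp (- (0 + \<epsilon> * s)\<^sup>2 / 2)))"
    by (rule lborel_integral_real_affine) (use assms in simp)
  then have "cor \<epsilon> * (LINT s|lborel. cis (s * a) * cor (exp (- (\<epsilon> * s)\<^sup>2 / 2))) = ?I"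
    using assms by (simp add: scaleR_conv_of_real mult_ac)
  with 1 have "(LINT s|lborel. cis (s * a) * cor (exp (- (\<epsilon> * s)\<^sup>2 / 2))) =
     cor (sqrt (2 * pi) * exp (- (a / \<epsilon>)\<^sup>2 / 2)) / cor \<epsilon>"
    using assms by (simp add: field_simps)
  then show ?thesis by simp
qed

text \<open>Gauss regularisation. The factor exp(-(\<epsilon> s)^2 / 2) makes the double integral
  absolutely convergent; after the integrals are exchanged, the regularised expression is the mean
  of \<open>m\<close> under a normal law centred at \<xi> with deviation \<epsilon>. Both
  descriptions are followed to \<epsilon> = 0 by dominated convergence.\<close>

theorem ker_inversion:
  assumes m: "test1 R m"
  shows "(LINT s|lborel. ker m s * cis (- (s * \<xi>))) = m \<xi>"
proof -
  define \<epsilon> where "\<epsilon> n = 1 / real (Suc n)" for n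
  have \<epsilon>: "\<epsilon> n > 0" for n by (simp add: \<epsilon>_def)
  have \<epsilon>0: "\<epsilon> \<longlonglongrightarrow> 0" unfolding \<epsilon>_def by (rule lim_1_over_n[THEN LIMSEQ_Suc])
  define I where "I n = (LINT s|lborel. ker m s * cis (- (s * \<xi>)) * cor (exp (- (\<epsilon> n * s)\<^sup>2 / 2)))" for n
  note [measurable] = rapid_measurable[OF rapid_ker[OF m]] test1_measurable[OF m]
  have lim1: "I \<longlonglongrightarrow> (LINT s|lborel. ker m s * cis (- (s * \<xi>)))"
    unfolding I_def
  proof (rule integral_dominated_convergence[where w = "%s. norm (ker m s)"])
    show "integrable lborel (%s. norm (ker m s))"
      using rapid_integrable[OF rapid_ker[OF m], of 0] by simp
    show "AE s in lborel. (%n. ker m s * cis (- (s * \<xi>)) * cor (exp (- (\<epsilon> n * s)\<^sup>2 / 2)))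
        \<longlonglongrightarrow> ker m s * cis (- (s * \<xi>))"
    proof (rule AE_I2)
      fix s
      have "(%n. ker m s * cis (- (s * \<xi>)) * cor (exp (- (\<epsilon> n * s)\<^sup>2 / 2)))
        \<longlonglongrightarrow> ker m s * cis (- (s * \<xi>)) * cor (exp (- (0 * s)\<^sup>2 / 2))"
        by (intro tendsto_intros \<epsilon>0) auto
      then show "(%n. ker m s * cis (- (s * \<xi>)) * cor (exp (- (\<epsilon> n * s)\<^sup>2 / 2)))
        \<longlonglongrightarrow> ker m s * cis (- (s * \<xi>))" by simp
    qed
    show "AE s in lborel. norm (ker m s * cis (- (s * \<xi>)) * cor (exp (- (\<epsilon> n * s)\<^sup>2 / 2))) \<le> norm (ker m s)" for n
      by (intro AE_I2) (auto simp: norm_mult intro!: mult_left_le)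
  qed measurable
  have Ieq: "I n = (LINT v|lborel. cor (std_normal_density v) * m (\<xi> + \<epsilon> n * v))" for n
  proof -
    let ?g = "%s. cor (exp (- (\<epsilon> n * s)\<^sup>2 / 2))"
    let ?c = "cor (1 / (2 * pi))"
    let ?F = "%(s, \<eta>). m \<eta> * cis (s * (\<eta> - \<xi>)) * ?g s"
    have g: "integrable lborel ?g"
    proof -
      have "integrable lborel (%s. exp (- (0 + \<epsilon> n * s)\<^sup>2 / 2))"
      proof (rule lborel_integrable_real_affine)
        have "integrable lborel (%s. sqrt (2 * pi) * std_normal_density s)"
          by (intro integrable_mult_right integrable_normal_density[OF zero_less_one])
        then show "integrable lborel (%s::real. exp (- s\<^sup>2 / 2))" by (simp add: std_normal_density_def)
      qed (use \<epsilon>[of n] in simp)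
      then show ?thesis by simp
    qed
    have intF: "integrable (lborel \<Otimes>\<^sub>M lborel) ?F"
    proof (rule Bochner_Integration.integrable_bound[OF integrable_prod_mult[OF g test1_integrable[OF m]]])
      show "?F \<in> borel_measurable (lborel \<Otimes>\<^sub>M lborel)" by measurable
      show "AE x in lborel \<Otimes>\<^sub>M lborel. norm (?F x) \<le> norm (case x of (s, \<eta>) => ?g s * m \<eta>)"
        by (auto simp: norm_mult)
    qed
    have "I n = (LINT s|lborel. ?c * (LINT \<eta>|lborel. m \<eta> * cis (s * (\<eta> - \<xi>)) * ?g s))"
      unfolding I_def
    proof (rule Bochner_Integration.integral_cong[OF refl])
      fix s
      have "cis (s * (\<eta> - \<xi>)) = cis (s * \<eta>) * cis (- (s * \<xi>))" for \<eta>
        by (simp add: cis_mult algebra_simps)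
      then have "(LINT \<eta>|lborel. m \<eta> * cis (s * (\<eta> - \<xi>)) * ?g s) = (LINT \<eta>|lborel. (m \<eta> * cis (s * \<eta>)) * (cis (- (s * \<xi>)) * ?g s))"
        by (simp add: mult.assoc)
      also have "... = (LINT \<eta>|lborel. m \<eta> * cis (s * \<eta>)) * (cis (- (s * \<xi>)) * ?g s)"
        by (simp only: integral_mult_left_zero)
      finally show "ker m s * cis (- (s * \<xi>)) * ?g s = ?c * (LINT \<eta>|lborel. m \<eta> * cis (s * (\<eta> - \<xi>)) * ?g s)"
        unfolding ker_def by (simp only: mult.assoc)
    qed
    also have "... = ?c * (LINT s|lborel. LINT \<eta>|lborel. m \<eta> * cis (s * (\<eta> - \<xi>)) * ?g s)"
      by (simp only: integral_mult_right_zero)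
    also have "... = ?c * (LINT \<eta>|lborel. LINT s|lborel. m \<eta> * cis (s * (\<eta> - \<xi>)) * ?g s)"
      using lborel_pair.Fubini_integral[of "%s \<eta>. m \<eta> * cis (s * (\<eta> - \<xi>)) * ?g s"] intF by simp
    also have "(%\<eta>. LINT s|lborel. m \<eta> * cis (s * (\<eta> - \<xi>)) * ?g s) =
        (%\<eta>. m \<eta> * cor (sqrt (2 * pi) / \<epsilon> n * exp (- ((\<eta> - \<xi>) / \<epsilon> n)\<^sup>2 / 2)))"
      using gaussian_fourier[OF \<epsilon>[of n]] by (simp add: mult.assoc)
    also have "(LINT \<eta>|lborel. m \<eta> * cor (sqrt (2 * pi) / \<epsilon> n * exp (- ((\<eta> - \<xi>) / \<epsilon> n)\<^sup>2 / 2))) =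
        \<bar>\<epsilon> n\<bar> *\<^sub>R (LINT v|lborel. m (\<xi> + \<epsilon> n * v) * cor (sqrt (2 * pi) / \<epsilon> n * exp (- ((\<xi> + \<epsilon> n * v - \<xi>) / \<epsilon> n)\<^sup>2 / 2)))"
      by (rule lborel_integral_real_affine) (use \<epsilon>[of n] in simp)
    also have "... = (LINT v|lborel. cor (\<epsilon> n) * (m (\<xi> + \<epsilon> n * v) * cor (sqrt (2 * pi) / \<epsilon> n * exp (- v\<^sup>2 / 2))))"
      using \<epsilon>[of n] by (simp add: scaleR_conv_of_real)
    also have "?c * ... = (LINT v|lborel. ?c * (cor (\<epsilon> n) * (m (\<xi> + \<epsilon> n * v) * cor (sqrt (2 * pi) / \<epsilon> n * exp (- v\<^sup>2 / 2)))))"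
      by (simp only: integral_mult_right_zero)
    also have "... = (LINT v|lborel. cor (std_normal_density v) * m (\<xi> + \<epsilon> n * v))"
    proof (rule Bochner_Integration.integral_cong[OF refl])
      fix v
      have "1 / (2 * pi) * \<epsilon> n * (sqrt (2 * pi) / \<epsilon> n * exp (- v\<^sup>2 / 2)) = std_normal_density v"
        using \<epsilon>[of n] by (simp add: std_normal_density_def field_simps)
      moreover have "?c * (cor (\<epsilon> n) * (m (\<xi> + \<epsilon> n * v) * cor (sqrt (2 * pi) / \<epsilon> n * exp (- v\<^sup>2 / 2)))) =
          cor (1 / (2 * pi) * \<epsilon> n * (sqrt (2 * pi) / \<epsilon> n * exp (- v\<^sup>2 / 2))) * m (\<xi> + \<epsilon> n * v)"
        unfolding of_real_mult by (simp only: mult_ac)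
      ultimately show "?c * (cor (\<epsilon> n) * (m (\<xi> + \<epsilon> n * v) * cor (sqrt (2 * pi) / \<epsilon> n * exp (- v\<^sup>2 / 2)))) =
          cor (std_normal_density v) * m (\<xi> + \<epsilon> n * v)"
        by (simp only:)
    qed
    finally show ?thesis .
  qed
  have lim2: "(%n. LINT v|lborel. cor (std_normal_density v) * m (\<xi> + \<epsilon> n * v)) \<longlonglongrightarrow> m \<xi>"
  proof -
    have "bounded (m ` {-R..R})"
      by (intro compact_imp_bounded compact_continuous_image test1_continuous[OF m]) auto
    then obtain B where "!!x. x \<in> {-R..R} ==> norm (m x) \<le> B" by (auto simp only: bounded_iff ball_simps)
    then have B: "norm (m x) \<le> \<bar>B\<bar>" for x
      using m by (cases "\<bar>x\<bar> > R") (auto simp: test1_def not_less abs_le_iff minus_le_iff intro: order_trans[OF _ abs_ge_self])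
    have "(%n. LINT v|lborel. cor (std_normal_density v) * m (\<xi> + \<epsilon> n * v)) \<longlonglongrightarrow>
       (LINT v|lborel. cor (std_normal_density v) * m \<xi>)"
    proof (rule integral_dominated_convergence[where w = "%v. std_normal_density v * \<bar>B\<bar>"])
      show "integrable lborel (%v. std_normal_density v * \<bar>B\<bar>)"
        by (intro integrable_mult_left integrable_normal_density[OF zero_less_one])
      have "isCont m \<xi>" using test1_continuous[OF m, of UNIV] by (simp add: continuous_on_eq_continuous_at)
      moreover have "(%n. \<xi> + \<epsilon> n * v) \<longlonglongrightarrow> \<xi>" for v
        using tendsto_add[OF tendsto_const[of \<xi>] tendsto_mult[OF \<epsilon>0 tendsto_const[of v]]] by simp
      ultimately show "AE v in lborel. (%n. cor (std_normal_density v) * m (\<xi> + \<epsilon> n * v))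
          \<longlonglongrightarrow> cor (std_normal_density v) * m \<xi>"
        by (intro AE_I2 tendsto_mult tendsto_const) (rule isCont_tendsto_compose)
    qed (auto simp: norm_mult intro!: mult_left_mono B)
    moreover have "(LINT v|lborel. cor (std_normal_density v) * m \<xi>) = m \<xi>"
      using integral_std_normal_moment_even[of 0] by simp
    ultimately show ?thesis by simp
  qed
  have "I \<longlonglongrightarrow> m \<xi>" using lim2 unfolding Ieq[symmetric] .
  with lim1 show ?thesis by (rule LIMSEQ_unique)
qed

lemma ker_scale:
  assumes "0 < a"
  shows "ker (%\<eta>. m (\<eta> / a)) s = cor a * ker m (a * s)"
proof -
  have "(LINT \<eta>|lborel. m (\<eta> / a) * cis (s * \<eta>)) = \<bar>a\<bar> *\<^sub>R (LINT \<eta>|lborel. m ((0 + a * \<eta>) / a) * cis (s * (0 + a * \<eta>)))"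
    by (rule lborel_integral_real_affine) (use assms in simp)
  then show ?thesis
    using assms by (simp add: ker_def scaleR_conv_of_real mult_ac)
qed

lemma ker_modulate:
  assumes [measurable]: "m \<in> borel_measurable borel"
  shows "ker (%\<eta>. m (\<eta> - c)) s = cis (s * c) * ker m s"
proof -
  have "(LINT \<eta>|lborel. m (\<eta> - c) * cis (s * \<eta>)) = (LINT \<eta>|lborel. m (\<eta> + c - c) * cis (s * (\<eta> + c)))"
    by (rule lborel_integral_translate[symmetric]) measurable
  also have "... = (LINT \<eta>|lborel. cis (s * c) * (m \<eta> * cis (s * \<eta>)))"
    by (simp add: distrib_left cis_mult[symmetric] mult_ac)
  also have "... = cis (s * c) * (LINT \<eta>|lborel. m \<eta> * cis (s * \<eta>))"
    by (rule integral_mult_right_zero)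
  finally show ?thesis by (simp add: ker_def mult_ac)
qed

text \<open>The increment is the integral of \<open>K'\<close> along the segment from u to u + s;
  Tonelli and translation invariance remove the dependence on the position in the segment.\<close>

lemma kernel_L1_modulus:
  assumes K: "!!s. (K has_vector_derivative K' s) (at s)" and K': "continuous_on UNIV K'"
  shows "(\<integral>\<^sup>+u. norm (K (u + s) - K u :: complex) \<partial>lborel) \<le> ennreal \<bar>s\<bar> * (\<integral>\<^sup>+u. norm (K' u) \<partial>lborel)"
proof -
  have cK: "continuous_on UNIV K"
    using K by (meson continuous_at_imp_continuous_on has_vector_derivative_continuous)
  have [measurable]: "K \<in> borel_measurable borel" "K' \<in> borel_measurable borel"
    using K' cK by (auto intro: borel_measurable_continuous_onI)
  have *: "ennreal (norm (K (u + s) - K u)) \<le> (\<integral>\<^sup>+\<tau>. indicator {0..1} \<tau> * (ennreal \<bar>s\<bar> * norm (K' (u + \<tau> * s))) \<partial>lborel)" for u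
  proof -
    have "(LINT \<tau>|lborel. indicator {0..1} \<tau> *\<^sub>R (cor s * K' (u + \<tau> * s))) = K (u + 1 * s) - K (u + 0 * s)"
    proof (rule integral_FTC_atLeastAtMost[where F = "%\<tau>. K (u + \<tau> * s)"])
      show "((%\<tau>. K (u + \<tau> * s)) has_vector_derivative cor s * K' (u + \<tau> * s)) (at \<tau> within {0..1})" for \<tau>
        using has_vector_derivative_compose_affine[of K "K' (u + \<tau> * s)" s \<tau> u] K[of "s * \<tau> + u"]
        by (simp add: mult.commute add.commute has_vector_derivative_at_within)
      show "continuous_on {0..1} (%\<tau>. cor s * K' (u + \<tau> * s))"
        by (intro continuous_intros continuous_on_compose2[OF K']) auto
    qed auto
    then have "ennreal (norm (K (u + s) - K u)) = norm (LINT \<tau>|lborel. indicator {0..1} \<tau> *\<^sub>R (cor s * K' (u + \<tau> * s)))"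
      by simp
    also have "... \<le> (\<integral>\<^sup>+\<tau>. norm (indicator {0..1} \<tau> *\<^sub>R (cor s * K' (u + \<tau> * s))) \<partial>lborel)"
    proof (rule integral_norm_bound_ennreal)
      have "continuous_on {0..1} (%\<tau>. cor s * K' (u + \<tau> * s))"
        by (intro continuous_intros continuous_on_compose2[OF K']) auto
      then show "integrable lborel (%\<tau>. indicator {0..1} \<tau> *\<^sub>R (cor s * K' (u + \<tau> * s)))"
        by (intro borel_integrable_compact) auto
    qed
    also have "... = (\<integral>\<^sup>+\<tau>. indicator {0..1} \<tau> * (ennreal \<bar>s\<bar> * norm (K' (u + \<tau> * s))) \<partial>lborel)"
      by (rule nn_integral_cong) (auto simp: norm_mult ennreal_mult split: split_indicator)
    finally show ?thesis .
  qed
  have "(\<integral>\<^sup>+u. norm (K (u + s) - K u) \<partial>lborel) \<le>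
      (\<integral>\<^sup>+u. \<integral>\<^sup>+\<tau>. indicator {0..1} \<tau> * (ennreal \<bar>s\<bar> * norm (K' (u + \<tau> * s))) \<partial>lborel \<partial>lborel)"
    by (intro nn_integral_mono *)
  also have "... = (\<integral>\<^sup>+\<tau>. \<integral>\<^sup>+u. indicator {0..1} \<tau> * (ennreal \<bar>s\<bar> * norm (K' (u + \<tau> * s))) \<partial>lborel \<partial>lborel)"
    by (rule lborel_pair.Fubini') measurable
  also have "... = (\<integral>\<^sup>+\<tau>. indicator {0..1::real} \<tau> * (ennreal \<bar>s\<bar> * (\<integral>\<^sup>+u. norm (K' u) \<partial>lborel)) \<partial>lborel)"
  proof (rule nn_integral_cong)
    fix \<tau> :: real
    show "(\<integral>\<^sup>+u. indicator {0..1} \<tau> * (ennreal \<bar>s\<bar> * norm (K' (u + \<tau> * s))) \<partial>lborel) =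
       indicator {0..1} \<tau> * (ennreal \<bar>s\<bar> * (\<integral>\<^sup>+u. norm (K' u) \<partial>lborel))"
      using nn_integral_translate[of "%u. ennreal (norm (K' u))" "\<tau> * s"]
      by (simp add: nn_integral_cmult)
  qed
  also have "... = ennreal \<bar>s\<bar> * (\<integral>\<^sup>+u. norm (K' u) \<partial>lborel)"
    by (simp add: nn_integral_multc)
  finally show ?thesis .
qed

section \<open>Multipliers in one frequency variable\<close>

definition fm :: "('n::finite cfun) => (('n cfun) => complex) => 'n cfun" where
  "fm n T x = cor (1 / (2 * pi) ^ CARD('n)) * T (FT (%\<xi>. ee x \<xi> * n \<xi>))"

lemma fmult_eq_fm: "fmult m T = fm (%\<xi>. cor (m \<xi>)) T"
  by (auto simp: fmult_def fm_def ee_def mult.commute)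

lemma bump_ee: "bump R n ==> bump R (%\<xi>. ee x \<xi> * n \<xi>)"
  by (intro bump_mult smooth_fun_ee)

text \<open>Multiplication by the character with parameter x costs at most a multiple of (1 + |x|)^M
  in the C^M norm, where \<open>M\<close> is the order of the transformed distribution.\<close>

lemma fm_growth:
  assumes T: "tempered T" and n: "bump R n"
  shows "\<exists>C N. \<forall>x. norm (fm n T x) \<le> C * (1 + norm x) ^ N"
proof -
  obtain C M where C: "C \<ge> 0" "!!n b. bump R n ==> pd_bound M n b ==> norm (T (FT n)) \<le> C * b"
    using tempered_FT_bound[OF T, of R] by blast
  obtain b where b: "pd_bound M n b" using bump_pd_bound_ex[OF n] by blast
  have "norm (fm n T x) \<le> 1 / (2 * pi) ^ CARD('a) * (C * 2 ^ M * b) * (1 + norm x) ^ M" for x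
  proof -
    have "pd_bound M (%\<xi>. ee x \<xi> * n \<xi>) (2 ^ M * (1 + norm x) ^ M * b)"
      by (rule pd_bound_mult[OF n smooth_fun_ee b]) (auto intro: norm_iter_pd_ee)
    from C(2)[OF bump_ee[OF n] this]
    have "norm (T (FT (%\<xi>. ee x \<xi> * n \<xi>))) \<le> C * 2 ^ M * b * (1 + norm x) ^ M" by (simp add: mult_ac)
    then show ?thesis
      unfolding fm_def by (simp add: norm_mult norm_divide norm_power divide_right_mono)
  qed
  then show ?thesis by blast
qed

lemma norm_exp_i_minus_1: "norm (exp (\<i> * cor a) - 1) \<le> \<bar>a\<bar>"
  using vector_derivative_bound[of "%x. cis (1 * x)" _ 1 a 0, OF cis_has_vector_derivative]
  by (simp add: cis_conv_exp norm_mult)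

text \<open>The difference of two characters is \<open>ee x\<close> times
  \<open>ee (y - x) - 1\<close>, and the second factor has C^M norm O(|y - x|) on the box.\<close>

lemma fm_continuous:
  fixes T :: "('n::finite cfun) => complex"
  assumes T: "tempered T" and n: "bump R n"
  shows "continuous_on UNIV (fm n T)"
proof -
  obtain C M where C: "C \<ge> 0" "!!n b. bump R n ==> pd_bound M n b ==> norm (T (FT n)) \<le> C * b"
    using tempered_FT_bound[OF T, of R] by blast
  have "((%y. T (FT (%\<xi>. ee y \<xi> * n \<xi>))) \<longlongrightarrow> T (FT (%\<xi>. ee x \<xi> * n \<xi>))) (at x)" for x
  proof -
    obtain b where b: "pd_bound M (%\<xi>. ee x \<xi> * n \<xi>) b" using bump_pd_bound_ex[OF bump_ee[OF n]] by blast
    \<comment> \<open>Bounds |\<xi>| on the box, which serves the function itself, and is at least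
      1, which serves the derivatives, where |v| \<le> 1 leaves a single factor |v|.\<close>
    define A where "A = 1 + real CARD('n) * \<bar>R\<bar>"
    have bd: "norm (T (FT (%\<xi>. ee y \<xi> * n \<xi>)) - T (FT (%\<xi>. ee x \<xi> * n \<xi>))) \<le> C * (2 ^ M * (norm (y - x) * A) * b)"
      if y: "norm (y - x) \<le> 1" for y
    proof -
      define v where "v = y - x"
      have sv: "smooth_fun (%\<xi>. 1 * ee v \<xi> + (-1) * 1)"
        by (intro smooth_fun_lincomb smooth_fun_ee smooth_fun_const)
      have "pd_bound M (%\<xi>. (1 * ee v \<xi> + (-1) * 1) * (ee x \<xi> * n \<xi>)) (2 ^ M * (norm v * A) * b)"
      proof (rule pd_bound_mult[OF bump_ee[OF n] sv b])
        fix js and \<xi> :: "real^'n" assume \<xi>: "\<xi> \<in> qbox R"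
        have "norm \<xi> \<le> (\<Sum>i\<in>UNIV. \<bar>\<xi> $ i\<bar>)" by (rule norm_le_l1_cart)
        also have "... \<le> (\<Sum>i\<in>(UNIV::'n set). \<bar>R\<bar>)"
          by (rule sum_mono) (use \<xi> in \<open>auto simp: qbox_def intro: order_trans[OF _ abs_ge_self]\<close>)
        finally have n\<xi>: "norm \<xi> \<le> A" by (simp add: A_def)
        have A1: "1 \<le> A" by (simp add: A_def)
        have e: "iter_pd js (%\<xi>. 1 * ee v \<xi> + (-1) * 1) \<xi> = 1 * iter_pd js (ee v) \<xi> + (-1) * iter_pd js (%_::real^'n. 1) \<xi>"
          by (subst iter_pd_lincomb[OF smooth_fun_ee smooth_fun_const]) simp
        show "norm (iter_pd js (%\<xi>. 1 * ee v \<xi> + (-1) * 1) \<xi>) \<le> norm v * A"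
        proof (cases js)
          case Nil
          have "norm (ee v \<xi> - 1) \<le> norm v * norm \<xi>"
            unfolding ee_def using norm_exp_i_minus_1[of "v \<bullet> \<xi>"] Cauchy_Schwarz_ineq2[of v \<xi>] by linarith
          also have "... \<le> norm v * A" using n\<xi> by (intro mult_left_mono) auto
          finally show ?thesis using Nil by simp
        next
          case (Cons l ls)
          have 0: "iter_pd js (%_::real^'n. 1) \<xi> = 0"
          proof -
            have "\<exists>c. iter_pd ls (%_::real^'n. 1) = (%_. c)"
              by (induction ls) (auto simp: dpart_eqI[OF has_pd_const])
            then obtain c where "iter_pd ls (%_::real^'n. 1) = (%_. c)" ..
            then show ?thesis by (simp add: Cons dpart_eqI[OF has_pd_const])
          qed
          have "norm (\<Prod>l\<leftarrow>ls. \<i> * cor (v $ l)) \<le> 1" for ls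
          proof (induction ls)
            case (Cons a ls)
            have "\<bar>v $ a\<bar> \<le> 1" using component_le_norm_cart[of v a] y by (simp add: v_def)
            then show ?case using Cons by (auto simp: norm_mult intro: mult_le_one)
          qed simp
          then have "\<bar>v $ l\<bar> * norm (\<Prod>l\<leftarrow>ls. \<i> * cor (v $ l)) \<le> norm v * 1"
            by (intro mult_mono component_le_norm_cart) auto
          then have "norm (iter_pd js (ee v) \<xi>) \<le> norm v * 1"
            unfolding iter_pd_ee Cons by (simp add: norm_mult)
          also have "... \<le> norm v * A" using A1 by (intro mult_left_mono) auto
          finally show ?thesis unfolding e 0 by simp
        qed
      qed (auto simp: A_def)
      from C(2)[OF bump_mult[OF bump_ee[OF n] sv] this]
      have "norm (T (FT (%\<xi>. (1 * ee v \<xi> + (-1) * 1) * (ee x \<xi> * n \<xi>)))) \<le> C * (2 ^ M * (norm v * A) * b)" .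
      also have "(%\<xi>. (1 * ee v \<xi> + (-1) * 1) * (ee x \<xi> * n \<xi>)) = (%\<xi>. 1 * (ee y \<xi> * n \<xi>) + (-1) * (ee x \<xi> * n \<xi>))"
        using ee_add[of v x] by (auto simp: v_def algebra_simps)
      also have "T (FT ...) = 1 * T (FT (%\<xi>. ee y \<xi> * n \<xi>)) + (-1) * T (FT (%\<xi>. ee x \<xi> * n \<xi>))"
        by (rule tempered_FT_lincomb[OF T bump_ee[OF n] bump_ee[OF n]])
      finally show ?thesis by (simp add: v_def)
    qed
    have "((%y. T (FT (%\<xi>. ee y \<xi> * n \<xi>)) - T (FT (%\<xi>. ee x \<xi> * n \<xi>))) \<longlongrightarrow> 0) (at x)"
    proof (rule Lim_null_comparison)
      have "\<forall>\<^sub>F y in at x. dist y x < 1" by (auto simp: eventually_at intro!: exI[of _ 1])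
      then show "\<forall>\<^sub>F y in at x. norm (T (FT (%\<xi>. ee y \<xi> * n \<xi>)) - T (FT (%\<xi>. ee x \<xi> * n \<xi>)))
          \<le> C * (2 ^ M * (norm (y - x) * A) * b)"
        by eventually_elim (rule bd, simp add: dist_norm)
      have "((%y. C * (2 ^ M * (norm (y - x) * A) * b)) \<longlongrightarrow> C * (2 ^ M * (norm (x - x) * A) * b)) (at x)"
        by (intro tendsto_intros)
      then show "((%y. C * (2 ^ M * (norm (y - x) * A) * b)) \<longlongrightarrow> 0) (at x)" by simp
    qed
    then show ?thesis by (simp add: LIM_zero_iff)
  qed
  then have "continuous_on UNIV (%y. T (FT (%\<xi>. ee y \<xi> * n \<xi>)))"
    by (simp add: continuous_on_eq_continuous_at isCont_def)
  then show ?thesis unfolding fm_def[abs_def] by (intro continuous_intros)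
qed

text \<open>The derivative of order \<open>r\<close> of the Fourier transform of \<open>k\<close>,
  written as an integral so that moments of \<open>k\<close> bound all orders at once.\<close>

definition mt :: "(real => complex) => nat => real => complex" where
  "mt k r \<xi> = (LINT s|lborel. k s * (- \<i> * cor s) ^ r * cis (- (s * \<xi>)))"

definition wint :: "(real => complex) => bool" where
  "wint k \<longleftrightarrow> k \<in> borel_measurable borel \<and> (\<forall>N. integrable lborel (%s. (1 + \<bar>s\<bar>) ^ N * norm (k s)))"

lemma rapid_wint: "rapid K ==> wint K"
  by (auto simp: wint_def rapid_measurable rapid_integrable)

lemma wint_indicator:
  assumes "wint k" "A \<in> sets borel"
  shows "wint (%s. indicator A s * k s)"
  unfolding wint_def
proof safe
  note [measurable] = assms(2) conjunct1[OF assms(1)[unfolded wint_def]]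
  show "(%s. indicator A s * k s) \<in> borel_measurable borel" by measurable
  fix N
  show "integrable lborel (%s. (1 + \<bar>s\<bar>) ^ N * norm (indicator A s * k s))"
    by (rule Bochner_Integration.integrable_bound[where f = "%s. (1 + \<bar>s\<bar>) ^ N * norm (k s)"])
       (use assms(1) in \<open>auto simp: wint_def norm_mult split: split_indicator\<close>)
qed

lemma mt_integrand_bound:
  "norm (k s * (- \<i> * cor s) ^ r * cis (- (s * \<xi>))) \<le> (1 + \<bar>s\<bar>) ^ r * norm (k s)"
proof -
  have "\<bar>s\<bar> ^ r \<le> (1 + \<bar>s\<bar>) ^ r" by (intro power_mono) auto
  then show ?thesis by (simp add: norm_mult norm_power mult_left_mono mult.commute)
qed

lemma mt_integrable:
  assumes "wint k"
  shows "integrable lborel (%s. k s * (- \<i> * cor s) ^ r * cis (- (s * \<xi>)))"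
proof (rule Bochner_Integration.integrable_bound[where f = "%s. (1 + \<bar>s\<bar>) ^ r * norm (k s)"])
  show "integrable lborel (%s. (1 + \<bar>s\<bar>) ^ r * norm (k s))" using assms by (auto simp: wint_def)
  note [measurable] = conjunct1[OF assms[unfolded wint_def]]
  show "(%s. k s * (- \<i> * cor s) ^ r * cis (- (s * \<xi>))) \<in> borel_measurable lborel" by measurable
  show "AE s in lborel. norm (k s * (- \<i> * cor s) ^ r * cis (- (s * \<xi>))) \<le> norm ((1 + \<bar>s\<bar>) ^ r * norm (k s))"
    by (intro AE_I2 order_trans[OF mt_integrand_bound]) simp
qed

lemma mt_bound:
  assumes "wint k"
  shows "norm (mt k r \<xi>) \<le> (LINT s|lborel. (1 + \<bar>s\<bar>) ^ r * norm (k s))"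
proof -
  have "norm (mt k r \<xi>) \<le> (LINT s|lborel. norm (k s * (- \<i> * cor s) ^ r * cis (- (s * \<xi>))))"
    unfolding mt_def by (rule integral_norm_bound)
  also have "... \<le> (LINT s|lborel. (1 + \<bar>s\<bar>) ^ r * norm (k s))"
    by (rule Bochner_Integration.integral_mono)
       (use assms mt_integrable[OF assms] mt_integrand_bound in \<open>auto simp: wint_def\<close>)
  finally show ?thesis .
qed

lemma chain_mt:
  assumes k: "wint k"
  shows "chain (mt k)"
  unfolding chain_def
proof safe
  fix r \<xi>
  note [measurable] = conjunct1[OF k[unfolded wint_def]]
  have cis': "((%\<xi>. cis (- (s * \<xi>))) has_vector_derivative (- \<i> * cor s) * cis (- (s * \<xi>))) (at \<xi>)" for s \<xi>
    using cis_has_vector_derivative[of "- s" \<xi>] by simp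
  show "(mt k r has_vector_derivative mt k (Suc r) \<xi>) (at \<xi>)"
    unfolding mt_def[abs_def]
  proof (rule has_vector_derivative_integral[where w = "%s. (1 + \<bar>s\<bar>) ^ Suc r * norm (k s)"])
    show "((%\<xi>. k s * (- \<i> * cor s) ^ r * cis (- (s * \<xi>))) has_vector_derivative
       k s * (- \<i> * cor s) ^ Suc r * cis (- (s * \<xi>))) (at \<xi>)" for s
      using has_vector_derivative_mult_right[OF cis'[of s \<xi>], of "k s * (- \<i> * cor s) ^ r"]
      by (simp only: power_Suc mult_ac)
    show "norm (k s * (- \<i> * cor s) ^ r * cis (- (s * t)) - k s * (- \<i> * cor s) ^ r * cis (- (s * \<xi>)))
       \<le> (1 + \<bar>s\<bar>) ^ Suc r * norm (k s) * \<bar>t - \<xi>\<bar>" for s t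
    proof (rule vector_derivative_bound[OF has_vector_derivative_mult_right[OF cis']])
      fix \<xi>
      show "norm (k s * (- \<i> * cor s) ^ r * ((- \<i> * cor s) * cis (- (s * \<xi>)))) \<le> (1 + \<bar>s\<bar>) ^ Suc r * norm (k s)"
        using mt_integrand_bound[of k s "Suc r" \<xi>] by (simp only: power_Suc mult_ac)
    qed
    show "integrable lborel (%s. (1 + \<bar>s\<bar>) ^ Suc r * norm (k s))" using k unfolding wint_def by blast
  qed (use mt_integrable[OF k, of r] borel_measurable_integrable[OF mt_integrable[OF k, of "Suc r"]] in auto)
qed

lemma chain_lincomb: "chain D ==> chain E ==> chain (%r x. a * D r x + b * E r x)"
  by (auto simp: chain_def intro!: has_vector_derivative_add has_vector_derivative_mult_right)

lemma chain_cis: "chain (%r \<xi>. (- \<i> * cor c) ^ r * cis (- (c * \<xi>)))"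
  unfolding chain_def
proof safe
  fix r x
  have "((%\<xi>. cis (- (c * \<xi>))) has_vector_derivative (- \<i> * cor c) * cis (- (c * x))) (at x)"
    using cis_has_vector_derivative[of "- c" x] by simp
  from has_vector_derivative_mult_right[OF this, of "(- \<i> * cor c) ^ r"]
  show "((%\<xi>. (- \<i> * cor c) ^ r * cis (- (c * \<xi>))) has_vector_derivative
      (- \<i> * cor c) ^ Suc r * cis (- (c * x))) (at x)"
    by (simp only: power_Suc mult_ac)
qed

text \<open>With \<open>n\<close> fixed, \<open>D \<mapsto> T (FT (D(\<xi>\<^sub>i) n))\<close> is a one-dimensional distribution of finite order.\<close>

lemma coord_functional_bound:
  fixes n :: "'n::finite cfun"
  assumes T: "tempered T" and n: "bump R n"
  shows "\<exists>C M. C \<ge> 0 \<and> (\<forall>D a. chain D --> 0 \<le> a --> (\<forall>r\<le>M. \<forall>u. \<bar>u\<bar> \<le> R --> norm (D r u) \<le> a) -->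
     norm (T (FT (%\<xi>. D 0 (\<xi> $ i) * n \<xi>))) \<le> C * a)"
proof -
  obtain C M where C: "C \<ge> 0" "!!n b. bump R n ==> pd_bound M n b ==> norm (T (FT n)) \<le> C * b"
    using tempered_FT_bound[OF T, of R] by blast
  obtain b where b: "pd_bound M n b" using bump_pd_bound_ex[OF n] by blast
  show ?thesis
  proof (intro exI[of _ "C * 2 ^ M * b"] exI[of _ M] conjI allI impI)
    show "0 \<le> C * 2 ^ M * b" using C(1) pd_bound_nonneg[OF b] by simp
    fix D a assume D: "chain D" and a: "0 \<le> a" "\<forall>r\<le>M. \<forall>u. \<bar>u\<bar> \<le> R --> norm (D r u) \<le> a"
    have "pd_bound M (%\<xi>. D 0 (\<xi> $ i) * n \<xi>) (2 ^ M * a * b)"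
      by (rule pd_bound_mult[OF n smooth_fun_coord[OF D] b])
         (use a in \<open>auto simp: iter_pd_coord[OF D] qbox_def\<close>)
    from C(2)[OF bump_mult[OF n smooth_fun_coord[OF D]] this]
    show "norm (T (FT (%\<xi>. D 0 (\<xi> $ i) * n \<xi>))) \<le> C * 2 ^ M * b * a" by (simp add: mult_ac)
  qed
qed

lemma coord_functional_lincomb:
  assumes T: "tempered T" and n: "bump R n" and D: "chain D" and E: "chain E"
  shows "T (FT (%\<xi>. (a * D 0 (\<xi> $ i) + b * E 0 (\<xi> $ i)) * n \<xi>)) =
     a * T (FT (%\<xi>. D 0 (\<xi> $ i) * n \<xi>)) + b * T (FT (%\<xi>. E 0 (\<xi> $ i) * n \<xi>))"
  using tempered_FT_lincomb[OF T bump_mult[OF n smooth_fun_coord[OF D]] bump_mult[OF n smooth_fun_coord[OF E]], of a 0 i b 0 i]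
  by (simp add: distrib_right mult.assoc)

text \<open>\<open>W u\<close> tests the multiplier of the kernel truncated at \<open>u\<close>.
  Over a short interval [a, b] containing c this multiplier changes by (b - a) K(c) times the
  character \<open>cis (- (c * \<xi>))\<close>, up to an error that is small in C^M on the box;
  finite order turns this into an estimate for \<open>W\<close>.\<close>

lemma coord_functional_deriv:
  fixes n :: "'n::finite cfun" and i :: 'n
  assumes T: "tempered T" and n: "bump R n" and K: "rapid K"
  defines "W \<equiv> %u. T (FT (%\<xi>. mt (%s. indicator {..u} s * K s) 0 (\<xi> $ i) * n \<xi>))"
  shows "(W has_vector_derivative K u * T (FT (%\<xi>. cis (- (u * (\<xi> $ i))) * n \<xi>))) (at u)"
proof -
  define F where "F c = T (FT (%\<xi>. cis (- (c * (\<xi> $ i))) * n \<xi>))" for c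
  obtain C M where CM: "C \<ge> 0 \<and> (\<forall>D a. chain D --> 0 \<le> a --> (\<forall>r\<le>M. \<forall>u. \<bar>u\<bar> \<le> R --> norm (D r u) \<le> a) -->
     norm (T (FT (%\<xi>. D 0 (\<xi> $ i) * n \<xi>))) \<le> C * a)"
    using coord_functional_bound[OF T n, of i] by (elim exE)
  note C = conjunct1[OF CM] conjunct2[OF CM, rule_format]
  have wK: "wint (%s. indicator A s * K s)" if "A \<in> sets borel" for A
    by (rule wint_indicator[OF rapid_wint[OF K] that])
  \<comment> \<open>The integrand of the r-th derivative of the multiplier; its uniform continuity
    on a compact rectangle is what makes the error small.\<close>
  define G where "G r = (%(s, \<xi>). K s * (- \<i> * cor s) ^ r * cis (- (s * \<xi>)))" for r
  have ucG: "uniformly_continuous_on ({u-1..u+1} \<times> {-R..R}) (G r)" for r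
  proof (rule compact_uniformly_continuous)
    have "continuous_on ({u-1..u+1} \<times> {-R..R}) (%x. K (fst x))"
      by (rule continuous_on_compose2[of UNIV K]) (use K in \<open>auto simp: rapid_def intro!: continuous_intros\<close>)
    then show "continuous_on ({u-1..u+1} \<times> {-R..R}) (G r)"
      unfolding G_def case_prod_unfold by (intro continuous_intros)
  qed (auto intro: compact_Times)
  have uc: "\<exists>\<delta>>0. \<forall>s\<in>{u-1..u+1}. \<forall>s'\<in>{u-1..u+1}. \<forall>\<xi>\<in>{-R..R}. \<bar>s - s'\<bar> < \<delta> --> norm (G r (s, \<xi>) - G r (s', \<xi>)) < e"
    if ep: "e > 0" for r e
  proof -
    define S where "S = {u-1..u+1} \<times> {-R..R}"
    have u: "\<forall>e>0. \<exists>\<delta>>0. \<forall>x\<in>S. \<forall>x'\<in>S. dist x' x < \<delta> --> dist (G r x') (G r x) < e"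
      using ucG[of r] unfolding S_def uniformly_continuous_on_def .
    obtain \<delta> where d: "\<delta> > 0 \<and> (\<forall>x\<in>S. \<forall>x'\<in>S. dist x' x < \<delta> --> dist (G r x') (G r x) < e)"
      using u[rule_format, OF ep] by (rule exE)
    note \<delta> = conjunct1[OF d] conjunct2[OF d, rule_format]
    have "norm (G r (s, \<xi>) - G r (s', \<xi>)) < e"
      if "s \<in> {u-1..u+1}" "s' \<in> {u-1..u+1}" "\<xi> \<in> {-R..R}" "\<bar>s - s'\<bar> < \<delta>" for s s' \<xi>
      using \<delta>(2)[of "(s', \<xi>)" "(s, \<xi>)"] that by (simp add: S_def dist_Pair_Pair dist_norm)
    then show ?thesis using \<delta>(1) by blast
  qed
  have est: "norm (W b - W a - cor (b - a) * (K c * F c)) \<le> C * (e * (b - a))"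
    if ab: "a \<le> b" and c: "c \<in> {a..b}" and e: "e \<ge> 0"
      and osc: "!!r s \<xi>. r \<le> M ==> s \<in> {a..b} ==> \<bar>\<xi>\<bar> \<le> R ==> norm (G r (s, \<xi>) - G r (c, \<xi>)) \<le> e" for a b c e
  proof -
    define D0 where "D0 = mt (%s. indicator {..b} s * K s)"
    define D1 where "D1 = mt (%s. indicator {..a} s * K s)"
    define D2 where "D2 r \<xi> = (- \<i> * cor c) ^ r * cis (- (c * \<xi>))" for r \<xi>
    have ch: "chain D0" "chain D1" "chain D2"
      unfolding D0_def D1_def D2_def[abs_def] by (intro chain_mt wK chain_cis; simp)+
    define D where "D r \<xi> = 1 * (1 * D0 r \<xi> + (-1) * D1 r \<xi>) + (- cor (b - a) * K c) * D2 r \<xi>" for r \<xi>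
    have chD: "chain D" unfolding D_def[abs_def] by (intro chain_lincomb ch)
    have "T (FT (%\<xi>. D 0 (\<xi> $ i) * n \<xi>)) = 1 * (1 * W b + (-1) * W a) + (- cor (b - a) * K c) * F c"
      unfolding D_def
      by (subst coord_functional_lincomb[OF T n chain_lincomb[OF ch(1,2)] ch(3)], subst coord_functional_lincomb[OF T n ch(1,2)])
         (simp add: W_def F_def D0_def D1_def D2_def)
    then have "W b - W a - cor (b - a) * (K c * F c) = T (FT (%\<xi>. D 0 (\<xi> $ i) * n \<xi>))"
      by (simp add: algebra_simps)
    moreover have "norm (D r \<xi>) \<le> e * (b - a)" if r: "r \<le> M" and \<xi>: "\<bar>\<xi>\<bar> \<le> R" for r \<xi>
    proof -
      have i1: "integrable lborel (%s. indicator {a<..b} s *\<^sub>R G r (s, \<xi>))"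
      proof -
        have "(%s. indicator {a<..b} s *\<^sub>R G r (s, \<xi>)) =
            (%s. indicator {a<..b} s * K s * (- \<i> * cor s) ^ r * cis (- (s * \<xi>)))"
          by (auto simp: G_def fun_eq_iff split: split_indicator)
        then show ?thesis using mt_integrable[OF wK[of "{a<..b}"], of r \<xi>] by simp
      qed
      have i2: "integrable lborel (%s. indicator {a<..b} s *\<^sub>R G r (c, \<xi>))"
        using ab by (intro integrable_scaleR_left integrable_real_indicator) auto
      have "1 * D0 r \<xi> + (-1) * D1 r \<xi> = (LINT s|lborel. indicator {..b} s * K s * (- \<i> * cor s) ^ r * cis (- (s * \<xi>)) - indicator {..a} s * K s * (- \<i> * cor s) ^ r * cis (- (s * \<xi>)))"
        unfolding D0_def D1_def mt_def
        using mt_integrable[OF wK[of "{..b}"], of r \<xi>] mt_integrable[OF wK[of "{..a}"], of r \<xi>] by simp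
      also have "... = (LINT s|lborel. indicator {a<..b} s *\<^sub>R G r (s, \<xi>))"
        by (rule Bochner_Integration.integral_cong) (use ab in \<open>auto simp: G_def split: split_indicator\<close>)
      finally have e1: "1 * D0 r \<xi> + (-1) * D1 r \<xi> = (LINT s|lborel. indicator {a<..b} s *\<^sub>R G r (s, \<xi>))" .
      have e2: "cor (b - a) * K c * D2 r \<xi> = (LINT s|lborel. indicator {a<..b} s *\<^sub>R G r (c, \<xi>))"
        using ab by (simp add: G_def D2_def scaleR_conv_of_real mult.assoc)
      have "D r \<xi> = (LINT s|lborel. indicator {a<..b} s *\<^sub>R G r (s, \<xi>)) - (LINT s|lborel. indicator {a<..b} s *\<^sub>R G r (c, \<xi>))"
        unfolding D_def e1 e2[symmetric] by (simp add: algebra_simps)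
      also have "... = (LINT s|lborel. indicator {a<..b} s *\<^sub>R G r (s, \<xi>) - indicator {a<..b} s *\<^sub>R G r (c, \<xi>))"
        using i1 i2 by simp
      also have "norm ... \<le> (LINT s|lborel. indicator {a<..b} s * e)"
      proof (rule Bochner_Integration.integral_norm_bound_integral)
        show "integrable lborel (%s. indicator {a<..b} s * e)"
          using ab by (intro integrable_mult_left integrable_real_indicator) auto
        show "norm (indicator {a<..b} s *\<^sub>R G r (s, \<xi>) - indicator {a<..b} s *\<^sub>R G r (c, \<xi>)) \<le> indicator {a<..b} s * e" for s
          using osc[OF r _ \<xi>, of s] by (auto split: split_indicator)
      qed (use i1 i2 in auto)
      also have "... = e * (b - a)" using ab by simp
      finally show ?thesis .
    qed
    ultimately show ?thesis using C(2)[OF chD] ab e by simp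
  qed
  show ?thesis
    unfolding has_vector_derivative_iff_quotient
  proof (rule LIM_I)
    fix e :: real assume e: "e > 0"
    \<comment> \<open>The denominator makes C e' < e strict, also when \<open>C\<close> is
      0.\<close>
    define e' where "e' = e / (2 * (C + 1))"
    have e': "e' > 0" "C * e' < e"
      using e C(1) mult_nonneg_nonneg[OF C(1) less_imp_le[OF e]] by (auto simp: e'_def field_simps intro!: add_nonneg_pos)
    have "\<forall>r. \<exists>\<delta>>0. \<forall>s\<in>{u-1..u+1}. \<forall>s'\<in>{u-1..u+1}. \<forall>\<xi>\<in>{-R..R}. \<bar>s - s'\<bar> < \<delta> --> norm (G r (s, \<xi>) - G r (s', \<xi>)) < e'"
      using uc[OF e'(1)] by blast
    then obtain \<delta> where \<delta>: "!!r. \<delta> r > 0" "!!r s s' \<xi>. s \<in> {u-1..u+1} ==> s' \<in> {u-1..u+1} ==> \<xi> \<in> {-R..R} ==>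
        \<bar>s - s'\<bar> < \<delta> r ==> norm (G r (s, \<xi>) - G r (s', \<xi>)) < e'" by metis
    \<comment> \<open>One radius for the finitely many orders up to \<open>M\<close>; the 1 keeps
      the points inside the window [u - 1, u + 1].\<close>
    define d where "d = Min (insert 1 (\<delta> ` {..M}))"
    have d: "d > 0" "d \<le> 1" using \<delta>(1) by (auto simp: d_def)
    have dr: "d \<le> \<delta> r" if "r \<le> M" for r unfolding d_def by (rule Min_le) (use that in auto)
    show "\<exists>d>0. \<forall>h. h \<noteq> 0 \<and> norm (h - 0) < d --> norm ((1 / h) *\<^sub>R (W (u + h) - W u) - K u * T (FT (%\<xi>. cis (- (u * (\<xi> $ i))) * n \<xi>))) < e"
    proof (intro exI conjI allI impI, rule d(1))
      fix h :: real assume h: "h \<noteq> 0 \<and> norm (h - 0) < d"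
      have osc: "norm (G r (s, \<xi>) - G r (u, \<xi>)) \<le> e'" if "r \<le> M" "\<bar>s - u\<bar> \<le> \<bar>h\<bar>" "\<bar>\<xi>\<bar> \<le> R" for r s \<xi>
        using \<delta>(2)[of s u \<xi> r] d(2) dr[OF that(1)] that(2,3) h by (force simp: abs_le_iff)
      have *: "norm (W (u + h) - W u - cor h * (K u * F u)) \<le> C * (e' * \<bar>h\<bar>)"
      proof (cases "h > 0")
        case True
        have "norm (W (u + h) - W u - cor (u + h - u) * (K u * F u)) \<le> C * (e' * (u + h - u))"
          by (rule est) (use True e' osc in auto)
        then show ?thesis using True by simp
      next
        case False
        have "norm (W u - W (u + h) - cor (u - (u + h)) * (K u * F u)) \<le> C * (e' * (u - (u + h)))"
          by (rule est) (use False e' osc in auto)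
        moreover have "W u - W (u + h) - cor (u - (u + h)) * (K u * F u) = - (W (u + h) - W u - cor h * (K u * F u))"
          by (simp add: algebra_simps)
        ultimately show ?thesis using False by (simp only: norm_minus_cancel) simp
      qed
      have "(1 / h) *\<^sub>R (W (u + h) - W u) - K u * F u = (1 / h) *\<^sub>R (W (u + h) - W u - cor h * (K u * F u))"
        using h by (simp add: scaleR_conv_of_real field_simps)
      then have "norm ((1 / h) *\<^sub>R (W (u + h) - W u) - K u * F u) = norm (W (u + h) - W u - cor h * (K u * F u)) / \<bar>h\<bar>"
        by simp
      also have "... \<le> C * (e' * \<bar>h\<bar>) / \<bar>h\<bar>" using * h by (intro divide_right_mono) auto
      also have "... = C * e'" using h by simp
      finally show "norm ((1 / h) *\<^sub>R (W (u + h) - W u) - K u * T (FT (%\<xi>. cis (- (u * (\<xi> $ i))) * n \<xi>))) < e"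
        using e'(2) by (simp add: F_def)
    qed
  qed
qed

lemma ee_axis: "ee (x - s *\<^sub>R axis i 1) \<xi> = cis (- (s * (\<xi> $ i))) * ee x \<xi>"
  by (simp add: ee_def cis_conv_exp inner_diff_left inner_axis' exp_diff exp_minus field_simps right_diff_distrib)

text \<open>Up to a constant, \<open>W\<close> is an antiderivative of the integrand. As u tends to
  minus infinity the truncated kernel disappears and with it the multiplier; as u tends to infinity
  the multiplier becomes the transform of \<open>ker m\<close>, which is \<open>m\<close> by
  inversion. The fundamental theorem of calculus on the whole line gives the formula.\<close>

theorem fm_axis_convolution:
  fixes n :: "'n::finite cfun"
  assumes T: "tempered T" and n: "bump R n" and m: "test1 R' m"
  shows "fm (%\<xi>. m (\<xi> $ i) * n \<xi>) T x = (LINT s|lborel. ker m s * fm n T (x - s *\<^sub>R axis i 1))"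
proof -
  let ?K = "ker m"
  define N where "N \<xi> = ee x \<xi> * n \<xi>" for \<xi>
  have N: "bump R N" unfolding N_def[abs_def] by (rule bump_ee[OF n])
  have K: "rapid ?K" by (rule rapid_ker[OF m])
  note [measurable] = rapid_measurable[OF K]
  define W where "W u = T (FT (%\<xi>. mt (%s. indicator {..u} s * ?K s) 0 (\<xi> $ i) * N \<xi>))" for u
  define F where "F c = T (FT (%\<xi>. cis (- (c * (\<xi> $ i))) * N \<xi>))" for c
  have F: "cor (1 / (2 * pi) ^ CARD('n)) * F c = fm n T (x - c *\<^sub>R axis i 1)" for c
    by (simp add: F_def fm_def N_def ee_axis mult.assoc)
  have F': "F c = cor ((2 * pi) ^ CARD('n)) * fm n T (x - c *\<^sub>R axis i 1)" for c
    unfolding F[symmetric] by simp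
  have contF: "continuous_on UNIV F"
    unfolding F'[abs_def] by (intro continuous_intros continuous_on_compose2[OF fm_continuous[OF T n]]) auto
  have contK: "continuous_on UNIV ?K" using K by (simp add: rapid_def)
  obtain C0 N0 where g: "!!x. norm (fm n T x) \<le> C0 * (1 + norm x) ^ N0" using fm_growth[OF T n] by blast
  have C0: "C0 \<ge> 0" using g[of 0] by (auto intro: order_trans[OF norm_ge_zero])
  have intKF: "integrable lborel (%s. ?K s * F s)"
  proof (rule rapid_integrable_poly[OF K])
    show "F \<in> borel_measurable borel" by (rule borel_measurable_continuous_onI[OF contF])
    fix s
    have "norm (fm n T (x - s *\<^sub>R axis i 1)) \<le> C0 * ((1 + norm x) * (1 + \<bar>s\<bar>)) ^ N0"
    proof (rule order_trans[OF g], intro mult_left_mono power_mono C0)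
      have "norm (x - s *\<^sub>R axis i 1) \<le> norm x + \<bar>s\<bar>"
        using norm_triangle_ineq4[of x "s *\<^sub>R axis i 1"] by (simp add: norm_axis_1)
      also have "1 + (norm x + \<bar>s\<bar>) \<le> (1 + norm x) * (1 + \<bar>s\<bar>)" by (simp add: algebra_simps)
      finally show "1 + norm (x - s *\<^sub>R axis i 1) \<le> (1 + norm x) * (1 + \<bar>s\<bar>)" by simp
    qed auto
    then show "norm (F s) \<le> ((2 * pi) ^ CARD('n) * C0 * (1 + norm x) ^ N0) * (1 + \<bar>s\<bar>) ^ N0"
      unfolding F' by (simp add: norm_mult norm_power power_mult_distrib mult.assoc)
  qed
  obtain C M where CM: "C \<ge> 0 \<and> (\<forall>D a. chain D --> 0 \<le> a --> (\<forall>r\<le>M. \<forall>u. \<bar>u\<bar> \<le> R --> norm (D r u) \<le> a) -->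
     norm (T (FT (%\<xi>. D 0 (\<xi> $ i) * N \<xi>))) \<le> C * a)"
    using coord_functional_bound[OF T N, of i] by (elim exE)
  note C = conjunct1[OF CM] conjunct2[OF CM, rule_format]
  have wK: "wint (%s. indicator A s * ?K s)" if "A \<in> sets borel" for A
    by (rule wint_indicator[OF rapid_wint[OF K] that])
  \<comment> \<open>Bounds all derivatives up to order \<open>M\<close> of the multiplier of the
    kernel restricted to \<open>A\<close>; it tends to 0 along both tails.\<close>
  define tl where "tl A = (LINT s|lborel. (1 + \<bar>s\<bar>) ^ M * norm (indicator A s * ?K s))" for A
  have small: "norm (T (FT (%\<xi>. mt (%s. indicator A s * ?K s) 0 (\<xi> $ i) * N \<xi>))) \<le> C * tl A" if A: "A \<in> sets borel" for A
  proof (rule C(2)[OF chain_mt[OF wK[OF A]]])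
    show "0 \<le> tl A" unfolding tl_def by (rule Bochner_Integration.integral_nonneg) auto
    fix r u assume r: "r \<le> M"
    show "norm (mt (%s. indicator A s * ?K s) r u) \<le> tl A"
      unfolding tl_def
    proof (rule order_trans[OF mt_bound[OF wK[OF A]]], rule Bochner_Integration.integral_mono)
      show "integrable lborel (%s. (1 + \<bar>s\<bar>) ^ r * norm (indicator A s * ?K s))" for r
        using wK[OF A] by (auto simp: wint_def)
      show "(1 + \<bar>s\<bar>) ^ r * norm (indicator A s * ?K s) \<le> (1 + \<bar>s\<bar>) ^ M * norm (indicator A s * ?K s)" for s
        by (intro mult_right_mono power_increasing r) auto
    qed (use wK[OF A] in \<open>auto simp: wint_def\<close>)
  qed
  have iK: "integrable lborel (%s. (1 + \<bar>s\<bar>) ^ M * norm (?K s))" by (rule rapid_integrable[OF K])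
  have tl_top: "((%u. tl {u<..}) \<longlongrightarrow> 0) at_top"
  proof -
    have "((%u. tl {u<..}) \<longlongrightarrow> (LINT s|(lborel :: real measure). 0::real)) at_top"
      unfolding tl_def
    proof (rule integral_dominated_convergence_at_top[where w = "%s. (1 + \<bar>s\<bar>) ^ M * norm (?K s)"])
      show "AE s in lborel. ((%u. (1 + \<bar>s\<bar>) ^ M * norm (indicator {u<..} s * ?K s)) \<longlongrightarrow> 0) at_top"
      proof (rule AE_I2)
        fix s :: real
        have "\<forall>\<^sub>F u in at_top. (1 + \<bar>s\<bar>) ^ M * norm (indicator {u<..} s * ?K s) = 0"
          using eventually_ge_at_top[of s] by eventually_elim simp
        then show "((%u. (1 + \<bar>s\<bar>) ^ M * norm (indicator {u<..} s * ?K s)) \<longlongrightarrow> 0) at_top"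
          by (rule tendsto_eventually)
      qed
      show "\<forall>\<^sub>F u in at_top. AE s in lborel. norm ((1 + \<bar>s\<bar>) ^ M * norm (indicator {u<..} s * ?K s)) \<le> (1 + \<bar>s\<bar>) ^ M * norm (?K s)"
        by (intro always_eventually allI AE_I2) (auto simp: norm_mult split: split_indicator)
    qed (use iK in auto)
    then show ?thesis by simp
  qed
  have tl_bot: "((%u. tl {..-u}) \<longlongrightarrow> 0) at_top"
  proof -
    have "((%u. tl {..-u}) \<longlongrightarrow> (LINT s|(lborel :: real measure). 0::real)) at_top"
      unfolding tl_def
    proof (rule integral_dominated_convergence_at_top[where w = "%s. (1 + \<bar>s\<bar>) ^ M * norm (?K s)"])
      show "AE s in lborel. ((%u. (1 + \<bar>s\<bar>) ^ M * norm (indicator {..-u} s * ?K s)) \<longlongrightarrow> 0) at_top"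
      proof (rule AE_I2)
        fix s :: real
        have "\<forall>\<^sub>F u in at_top. (1 + \<bar>s\<bar>) ^ M * norm (indicator {..-u} s * ?K s) = 0"
          using eventually_gt_at_top[of "- s"] by eventually_elim simp
        then show "((%u. (1 + \<bar>s\<bar>) ^ M * norm (indicator {..-u} s * ?K s)) \<longlongrightarrow> 0) at_top"
          by (rule tendsto_eventually)
      qed
      show "\<forall>\<^sub>F u in at_top. AE s in lborel. norm ((1 + \<bar>s\<bar>) ^ M * norm (indicator {..-u} s * ?K s)) \<le> (1 + \<bar>s\<bar>) ^ M * norm (?K s)"
        by (intro always_eventually allI AE_I2) (auto simp: norm_mult split: split_indicator)
    qed (use iK in auto)
    then show ?thesis by simp
  qed
  have W_bot: "(W \<longlongrightarrow> 0) at_bot"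
    unfolding filterlim_at_bot_mirror
  proof (rule Lim_null_comparison)
    show "\<forall>\<^sub>F u in at_top. norm (W (- u)) \<le> C * tl {..-u}"
      unfolding W_def by (intro always_eventually allI small) auto
    show "((%u. C * tl {..-u}) \<longlongrightarrow> 0) at_top" using tendsto_mult_right_zero[OF tl_bot] .
  qed
  let ?L = "T (FT (%\<xi>. mt ?K 0 (\<xi> $ i) * N \<xi>))"
  have W_top: "(W \<longlongrightarrow> ?L) at_top"
  proof -
    have eq: "W u - ?L = - T (FT (%\<xi>. mt (%s. indicator {u<..} s * ?K s) 0 (\<xi> $ i) * N \<xi>))" for u
    proof -
      have "mt ?K 0 \<xi> = 1 * mt (%s. indicator {..u} s * ?K s) 0 \<xi> + 1 * mt (%s. indicator {u<..} s * ?K s) 0 \<xi>" for \<xi>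
      proof -
        have "mt (%s. indicator {..u} s * ?K s) 0 \<xi> + mt (%s. indicator {u<..} s * ?K s) 0 \<xi> =
          (LINT s|lborel. indicator {..u} s * ?K s * (- \<i> * cor s) ^ 0 * cis (- (s * \<xi>)) +
            indicator {u<..} s * ?K s * (- \<i> * cor s) ^ 0 * cis (- (s * \<xi>)))"
          unfolding mt_def
          by (rule Bochner_Integration.integral_add[symmetric]; rule mt_integrable[OF wK]; simp)
        also have "... = mt ?K 0 \<xi>"
          unfolding mt_def by (rule Bochner_Integration.integral_cong) (auto split: split_indicator)
        finally show ?thesis by simp
      qed
      then have "?L = 1 * W u + 1 * T (FT (%\<xi>. mt (%s. indicator {u<..} s * ?K s) 0 (\<xi> $ i) * N \<xi>))"
        unfolding W_def by (subst coord_functional_lincomb[OF T N chain_mt[OF wK] chain_mt[OF wK], symmetric]) auto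
      then show ?thesis by simp
    qed
    have "((%u. W u - ?L) \<longlongrightarrow> 0) at_top"
    proof (rule Lim_null_comparison)
      show "\<forall>\<^sub>F u in at_top. norm (W u - ?L) \<le> C * tl {u<..}"
        unfolding eq norm_minus_cancel by (intro always_eventually allI small) auto
      show "((%u. C * tl {u<..}) \<longlongrightarrow> 0) at_top" using tendsto_mult_right_zero[OF tl_top] .
    qed
    then show ?thesis by (simp add: LIM_zero_iff)
  qed
  have "(LBINT s=-\<infinity>..\<infinity>. ?K s * F s) = ?L - 0"
  proof (rule interval_integral_FTC_integrable)
    show "(W has_vector_derivative ?K u * F u) (at u)" for u
      using coord_functional_deriv[OF T N K, of i u] unfolding W_def[abs_def] F_def .
    show "isCont (%s. ?K s * F s) u" for u
      using contF contK by (intro continuous_intros) (auto simp: continuous_on_eq_continuous_at)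
    show "set_integrable lborel (einterval (- \<infinity>) \<infinity>) (%s. ?K s * F s)"
      using intKF by (simp add: set_integrable_def)
    show "((W \<circ> real_of_ereal) \<longlongrightarrow> 0) (at_right (- \<infinity>))" using W_bot by (simp add: ereal_tendsto_simps)
    show "((W \<circ> real_of_ereal) \<longlongrightarrow> ?L) (at_left \<infinity>)" using W_top by (simp add: ereal_tendsto_simps)
  qed simp
  then have L: "?L = (LINT s|lborel. ?K s * F s)"
    by (simp add: interval_lebesgue_integral_def set_lebesgue_integral_def)
  have mtm: "mt ?K 0 \<xi> = m \<xi>" for \<xi>
    using ker_inversion[OF m, of \<xi>] by (simp add: mt_def)
  have "fm (%\<xi>. m (\<xi> $ i) * n \<xi>) T x = cor (1 / (2 * pi) ^ CARD('n)) * ?L"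
    by (simp add: fm_def mtm N_def mult_ac)
  also have "... = (LINT s|lborel. cor (1 / (2 * pi) ^ CARD('n)) * (?K s * F s))"
    unfolding L by (rule integral_mult_right_zero[symmetric])
  also have "... = (LINT s|lborel. ?K s * fm n T (x - s *\<^sub>R axis i 1))"
    by (rule Bochner_Integration.integral_cong[OF refl]) (simp only: F[symmetric] mult_ac)
  finally show ?thesis .
qed

section \<open>Convolution along an axis\<close>

text \<open>The class in which blocks of an arbitrary tempered distribution live. They need not be
  integrable, but convolution with a rapidly decreasing kernel is defined on them and stays in the
  class.\<close>

definition pg :: "('n::finite cfun) => bool" where
  "pg f \<longleftrightarrow> f \<in> borel_measurable borel \<and> (\<exists>C N. \<forall>x. norm (f x) \<le> C * (1 + norm x) ^ N)"

lemma pg_measurable [measurable_dest]: "pg f ==> f \<in> borel_measurable borel"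
  by (simp add: pg_def)

lemma pg_boundE:
  assumes "pg f"
  obtains C N where "C \<ge> 0" "!!x. norm (f x) \<le> C * (1 + norm x) ^ N"
proof -
  obtain C N where b: "!!x. norm (f x) \<le> C * (1 + norm x) ^ N" using assms by (auto simp: pg_def)
  have "0 \<le> C" using order_trans[OF norm_ge_zero b[of 0]] by simp
  with b that show ?thesis by blast
qed

lemma pg_fm: "tempered T ==> bump R n ==> pg (fm n T)"
  unfolding pg_def by (intro conjI borel_measurable_continuous_onI fm_continuous fm_growth)

lemma pg_le:
  assumes g: "pg g" and [measurable]: "f \<in> borel_measurable borel"
    and le: "!!x. norm (f x) \<le> C * (1 + norm (g x)) ^ N" and C: "C \<ge> 0"
  shows "pg f"
proof -
  obtain D M where D: "D \<ge> 0" "!!x. norm (g x) \<le> D * (1 + norm x) ^ M" using pg_boundE[OF g] by metis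
  have "norm (f x) \<le> C * (1 + D) ^ N * (1 + norm x) ^ (M * N)" for x
  proof -
    have "1 + norm (g x) \<le> (1 + D) * (1 + norm x) ^ M"
    proof -
      have "1 \<le> (1 + norm x) ^ M" by simp
      with D(2)[of x] show ?thesis unfolding distrib_right by linarith
    qed
    then have "(1 + norm (g x)) ^ N \<le> ((1 + D) * (1 + norm x) ^ M) ^ N" by (intro power_mono) auto
    also have "... = (1 + D) ^ N * (1 + norm x) ^ (M * N)" by (simp add: power_mult_distrib power_mult)
    finally show ?thesis using mult_left_mono[OF _ C] le[of x] by (metis (no_types, lifting) mult.assoc order_trans)
  qed
  then show ?thesis by (auto simp: pg_def)
qed

lemma pg_add:
  assumes "pg f" "pg g"
  shows "pg (%x. f x + g x)"
proof -
  obtain C N where C: "C \<ge> 0" "!!x. norm (f x) \<le> C * (1 + norm x) ^ N" using pg_boundE[OF assms(1)] by metis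
  obtain D M where D: "D \<ge> 0" "!!x. norm (g x) \<le> D * (1 + norm x) ^ M" using pg_boundE[OF assms(2)] by metis
  note [measurable] = pg_measurable[OF assms(1)] pg_measurable[OF assms(2)]
  have "norm (f x + g x) \<le> (C + D) * (1 + norm x) ^ (N + M)" for x
  proof -
    have "norm (f x + g x) \<le> C * (1 + norm x) ^ N + D * (1 + norm x) ^ M"
      using C(2)[of x] D(2)[of x] by (meson add_mono norm_triangle_ineq order_trans)
    also have "... \<le> C * (1 + norm x) ^ (N + M) + D * (1 + norm x) ^ (N + M)"
      by (intro add_mono mult_left_mono power_increasing C D) auto
    finally show ?thesis by (simp add: algebra_simps)
  qed
  then show ?thesis unfolding pg_def by (intro conjI exI allI) measurable
qed

lemma pg_0: "pg (%x. 0)"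
  by (auto simp: pg_def intro!: exI[of _ 0])

lemma norm_translate_le: "1 + norm (x + y :: 'a::real_normed_vector) \<le> (1 + norm x) * (1 + norm y)"
proof -
  have "(1 + norm x) * (1 + norm y) = 1 + norm x + norm y + norm x * norm y" by (simp add: algebra_simps)
  moreover have "0 \<le> norm x * norm y" by simp
  ultimately show ?thesis using norm_triangle_ineq[of x y] by linarith
qed

lemma pg_translate:
  assumes "pg f"
  shows "pg (%x. f (x + c))"
proof -
  obtain C N where C: "C \<ge> 0" "!!x. norm (f x) \<le> C * (1 + norm x) ^ N" using pg_boundE[OF assms] by metis
  note [measurable] = pg_measurable[OF assms]
  have "norm (f (x + c)) \<le> (C * (1 + norm c) ^ N) * (1 + norm x) ^ N" for x
  proof -
    have "C * (1 + norm (x + c)) ^ N \<le> C * ((1 + norm x) * (1 + norm c)) ^ N"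
      by (intro mult_left_mono power_mono norm_translate_le C) auto
    then show ?thesis using C(2)[of "x + c"] by (simp add: power_mult_distrib mult_ac)
  qed
  then show ?thesis unfolding pg_def by (intro conjI exI allI) measurable
qed

definition axc :: "'n::finite => (real => complex) => ('n cfun) => 'n cfun" where
  "axc i K f x = (LINT s|lborel. K s * f (x - s *\<^sub>R axis i 1))"

lemma axis_measurable [measurable]:
  "(%s. x - s *\<^sub>R axis i (1::real)) \<in> borel_measurable borel"
  "(%(x, s). x - s *\<^sub>R axis i (1::real)) \<in> borel_measurable (borel \<Otimes>\<^sub>M borel)"
  by measurable

lemma axis_slice_bound:
  fixes f :: "'n::finite cfun"
  assumes "C \<ge> 0" "!!x. norm (f x) \<le> C * (1 + norm x) ^ N"
  shows "norm (f (x - s *\<^sub>R axis i 1)) \<le> C * (1 + norm x) ^ N * (1 + \<bar>s\<bar>) ^ N"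
proof -
  have "C * (1 + norm (x - s *\<^sub>R axis i 1)) ^ N \<le> C * ((1 + norm x) * (1 + \<bar>s\<bar>)) ^ N"
    using norm_translate_le[of x "- (s *\<^sub>R axis i 1)"]
    by (intro mult_left_mono power_mono assms(1)) (auto simp: norm_axis_1)
  then show ?thesis using assms(2)[of "x - s *\<^sub>R axis i 1"] by (simp add: power_mult_distrib mult_ac)
qed

lemma axc_integrable:
  assumes K: "rapid K" and f: "pg f"
  shows "integrable lborel (%s. K s * f (x - s *\<^sub>R axis i 1))"
proof -
  obtain C N where C: "C \<ge> 0" "!!x. norm (f x) \<le> C * (1 + norm x) ^ N" using pg_boundE[OF f] by metis
  note [measurable] = pg_measurable[OF f]
  show ?thesis
    by (rule rapid_integrable_poly[OF K _ axis_slice_bound[OF C]]) measurable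
qed

lemma pg_axc:
  fixes f :: "'n::finite cfun"
  assumes K: "rapid K" and f: "pg f"
  shows "pg (axc i K f)"
proof -
  obtain C N where C: "C \<ge> 0" "!!x. norm (f x) \<le> C * (1 + norm x) ^ N" using pg_boundE[OF f] by metis
  note [measurable] = pg_measurable[OF f] rapid_measurable[OF K]
  have "norm (axc i K f x) \<le> C * (LINT s|lborel. (1 + \<bar>s\<bar>) ^ N * norm (K s)) * (1 + norm x) ^ N" for x
  proof -
    have "norm (axc i K f x) \<le> (LINT s|lborel. norm (K s * f (x - s *\<^sub>R axis i 1)))"
      unfolding axc_def by (rule integral_norm_bound)
    also have "... \<le> (LINT s|lborel. (C * (1 + norm x) ^ N) * ((1 + \<bar>s\<bar>) ^ N * norm (K s)))"
    proof (rule Bochner_Integration.integral_mono)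
      show "integrable lborel (%s. (C * (1 + norm x) ^ N) * ((1 + \<bar>s\<bar>) ^ N * norm (K s)))"
        using rapid_integrable[OF K, of N] by (rule integrable_mult_right)
      show "norm (K s * f (x - s *\<^sub>R axis i 1)) \<le> (C * (1 + norm x) ^ N) * ((1 + \<bar>s\<bar>) ^ N * norm (K s))" for s
        using mult_left_mono[OF axis_slice_bound[OF C, of x s i] norm_ge_zero[of "K s"]] by (simp add: norm_mult mult_ac)
    qed (use axc_integrable[OF K f] in auto)
    also have "... = (C * (1 + norm x) ^ N) * (LINT s|lborel. (1 + \<bar>s\<bar>) ^ N * norm (K s))"
      by (rule integral_mult_right_zero)
    finally show ?thesis by (simp add: mult_ac)
  qed
  moreover have "axc i K f \<in> borel_measurable borel"
  proof -
    have "(%(x, s). K s * f (x - s *\<^sub>R axis i 1)) \<in> borel_measurable (borel \<Otimes>\<^sub>M lborel)" by measurable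
    from lborel.borel_measurable_lebesgue_integral[OF this] show ?thesis by (simp add: axc_def[abs_def])
  qed
  ultimately show ?thesis unfolding pg_def by blast
qed

theorem fm_axc:
  assumes "tempered T" "bump R n" "test1 R' m"
  shows "fm (%\<xi>. m (\<xi> $ i) * n \<xi>) T = axc i (ker m) (fm n T)"
  using fm_axis_convolution[OF assms] by (auto simp: axc_def)

text \<open>Convexity of the power function, obtained from Young's inequality with the exponents p
  and p / (p - 1); the endpoint p = 1 has no finite conjugate and is treated separately.\<close>

lemma powr_tangent:
  fixes x y p :: real
  assumes "0 \<le> x" "0 \<le> y" "1 \<le> p"
  shows "y powr p + p * y powr (p - 1) * (x - y) \<le> x powr p"
proof (cases "p = 1")
  case True
  then show ?thesis using assms by (cases "y = 0") auto
next
  case False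
  define q where "q = p / (p - 1)"
  have p: "p > 1" using False assms by simp
  have q: "q > 1" using p by (simp add: q_def)
  have "1 / p + 1 / q = 1" using p by (simp add: q_def field_simps)
  then have "x * y powr (p - 1) \<le> x powr p / p + (y powr (p - 1)) powr q / q"
    using Youngs_inequality[OF p q _ assms(1), of "y powr (p - 1)"] by simp
  also have "(y powr (p - 1)) powr q = y powr p" using p by (simp add: powr_powr q_def)
  also have "x powr p / p + y powr p / q = (x powr p + (p - 1) * y powr p) / p"
    using p by (simp add: q_def field_simps)
  finally have "p * (x * y powr (p - 1)) \<le> x powr p + (p - 1) * y powr p"
    using p by (simp add: field_simps)
  moreover have "y powr (p - 1) * y = y powr p"
    using assms p by (cases "y = 0") (auto simp: powr_diff)
  ultimately show ?thesis by (simp add: algebra_simps)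
qed

section \<open>Estimates for convolution along an axis\<close>

definition Ip :: "real => ('n::finite cfun) => ennreal" where
  "Ip p f = (\<integral>\<^sup>+x. ennreal (norm (f x) powr p) \<partial>lborel)"

text \<open>The common end of both convolution estimates: a pointwise bound by a weighted integral
  over the line through x in direction i is integrated in x, and every translate contributes the
  same amount.\<close>

lemma slice_powr_bound:
  fixes f :: "'n::finite cfun" and w :: "real => real"
  assumes f: "pg f" and w: "w \<in> borel_measurable borel" "!!s. 0 \<le> w s"
    and le: "!!x. norm (h x) powr p \<le> c * enn2real (\<integral>\<^sup>+s. ennreal (w s * norm (f (x - s *\<^sub>R axis i 1)) powr p) \<partial>lborel)"
    and c: "c \<ge> 0"
  shows "Ip p h \<le> ennreal c * (\<integral>\<^sup>+s. ennreal (w s) \<partial>lborel) * Ip p f"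
proof -
  note [measurable] = pg_measurable[OF f] w(1)
  have "Ip p h \<le> (\<integral>\<^sup>+x. ennreal c * (\<integral>\<^sup>+s. ennreal (w s * norm (f (x - s *\<^sub>R axis i 1)) powr p) \<partial>lborel) \<partial>lborel)"
    unfolding Ip_def
  proof (rule nn_integral_mono)
    fix x
    let ?I = "\<integral>\<^sup>+s. ennreal (w s * norm (f (x - s *\<^sub>R axis i 1)) powr p) \<partial>lborel"
    have "ennreal (norm (h x) powr p) \<le> ennreal (c * enn2real ?I)" by (intro ennreal_leI le)
    also have "... = ennreal c * ennreal (enn2real ?I)" by (rule ennreal_mult) (use c in auto)
    \<comment> \<open>\<open>enn2real\<close> sends infinity to 0, so it never exceeds its
      argument.\<close>
    also have "... \<le> ennreal c * ?I" by (intro mult_left_mono) (auto simp: ennreal_enn2real_if)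
    finally show "ennreal (norm (h x) powr p) \<le> ennreal c * ?I" .
  qed
  also have "... = ennreal c * (\<integral>\<^sup>+x. \<integral>\<^sup>+s. ennreal (w s * norm (f (x - s *\<^sub>R axis i 1)) powr p) \<partial>lborel \<partial>lborel)"
    by (rule nn_integral_cmult) measurable
  also have "(\<integral>\<^sup>+x. \<integral>\<^sup>+s. ennreal (w s * norm (f (x - s *\<^sub>R axis i 1)) powr p) \<partial>lborel \<partial>lborel) =
     (\<integral>\<^sup>+s. \<integral>\<^sup>+x. ennreal (w s * norm (f (x - s *\<^sub>R axis i 1)) powr p) \<partial>lborel \<partial>lborel)"
    by (rule lborel_pair.Fubini') measurable
  also have "... = (\<integral>\<^sup>+s. ennreal (w s) * Ip p f \<partial>lborel)"
  proof (rule nn_integral_cong)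
    fix s
    have "(\<integral>\<^sup>+x. ennreal (w s * norm (f (x - s *\<^sub>R axis i 1)) powr p) \<partial>lborel) =
       ennreal (w s) * (\<integral>\<^sup>+x. ennreal (norm (f (x + - (s *\<^sub>R axis i 1))) powr p) \<partial>lborel)"
      using w(2)[of s] by (simp add: ennreal_mult nn_integral_cmult)
    also have "(\<integral>\<^sup>+x. ennreal (norm (f (x + - (s *\<^sub>R axis i 1))) powr p) \<partial>lborel) = Ip p f"
      unfolding Ip_def by (rule nn_integral_translate) measurable
    finally show "(\<integral>\<^sup>+x. ennreal (w s * norm (f (x - s *\<^sub>R axis i 1)) powr p) \<partial>lborel) = ennreal (w s) * Ip p f" .
  qed
  also have "... = (\<integral>\<^sup>+s. ennreal (w s) \<partial>lborel) * Ip p f" by (rule nn_integral_multc) measurable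
  finally show ?thesis by (simp add: mult_ac)
qed

lemma pg_powr:
  assumes f: "pg f" and p: "p \<ge> 0"
  shows "pg (%x. cor (norm (f x) powr p))"
proof (rule pg_le[OF f, of _ 1 "nat \<lceil>p\<rceil>"])
  note [measurable] = pg_measurable[OF f]
  show "(%x. cor (norm (f x) powr p)) \<in> borel_measurable borel" by measurable
  fix x
  have "norm (f x) powr p \<le> (1 + norm (f x)) powr p" by (intro powr_mono2) (use p in auto)
  also have "... \<le> (1 + norm (f x)) powr real (nat \<lceil>p\<rceil>)" by (intro powr_mono) (use p in auto)
  also have "... = (1 + norm (f x)) ^ nat \<lceil>p\<rceil>" by (rule powr_realpow) (simp add: add_pos_nonneg)
  finally show "norm (cor (norm (f x) powr p)) \<le> 1 * (1 + norm (f x)) ^ nat \<lceil>p\<rceil>" by simp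
qed simp

lemma slice_powr_integrable:
  assumes K: "rapid K" and f: "pg f" and p: "p \<ge> 0"
  shows "integrable lborel (%s. norm (K s) * norm (f (x - s *\<^sub>R axis i 1)) powr p)"
  using integrable_norm[OF axc_integrable[OF K pg_powr[OF f p], of x i]] by (simp add: norm_mult)

text \<open>Jensen's inequality on each line for the measure |K(s)| ds, obtained by integrating a
  tangent line of the power function.\<close>

theorem young_axis:
  fixes f :: "'n::finite cfun"
  assumes K: "rapid K" and f: "pg f" and p: "1 \<le> p" and A: "(LINT s|lborel. norm (K s)) \<le> A" "A > 0"
  shows "Ip p (axc i K f) \<le> ennreal (A powr p) * Ip p f"
proof -
  note [measurable] = rapid_measurable[OF K] pg_measurable[OF f]
  have iK: "integrable lborel (%s. norm (K s))" using rapid_integrable[OF K, of 0] by simp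
  have "Ip p (axc i K f) \<le> ennreal (A powr (p - 1)) * (\<integral>\<^sup>+s. ennreal (norm (K s)) \<partial>lborel) * Ip p f"
  proof (rule slice_powr_bound[OF f, where i = i])
    fix x
    let ?y = "%s. norm (f (x - s *\<^sub>R axis i 1))"
    define \<mu> where "\<mu> = (LINT s|lborel. norm (K s) * ?y s)"
    define Q where "Q = (LINT s|lborel. norm (K s) * ?y s powr p)"
    have iy: "integrable lborel (%s. norm (K s) * ?y s)"
      using integrable_norm[OF axc_integrable[OF K f, of x i]] by (simp add: norm_mult)
    have iyp: "integrable lborel (%s. norm (K s) * ?y s powr p)" by (rule slice_powr_integrable[OF K f]) (use p in simp)
    have \<mu>0: "\<mu> \<ge> 0" unfolding \<mu>_def by (rule Bochner_Integration.integral_nonneg) auto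
    \<comment> \<open>The mean value on the line if the total mass were exactly \<open>A\<close>;
      the tangent is taken at this point.\<close>
    define a where "a = \<mu> / A"
    have a0: "a \<ge> 0" using \<mu>0 A by (simp add: a_def)
    have \<mu>a: "\<mu> = a * A" using A by (simp add: a_def)
    have "(LINT s|lborel. norm (K s) * (a powr p + p * a powr (p - 1) * (?y s - a))) \<le> Q"
      unfolding Q_def
    proof (rule Bochner_Integration.integral_mono)
      show "integrable lborel (%s. norm (K s) * (a powr p + p * a powr (p - 1) * (?y s - a)))"
        using Bochner_Integration.integrable_add[OF integrable_mult_right[OF iK, of "a powr p - p * a powr (p - 1) * a"] integrable_mult_right[OF iy, of "p * a powr (p - 1)"]]
        by (simp add: algebra_simps)
      show "norm (K s) * (a powr p + p * a powr (p - 1) * (?y s - a)) \<le> norm (K s) * ?y s powr p" for s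
        by (intro mult_left_mono powr_tangent) (use a0 p in auto)
    qed (rule iyp)
    also have "(LINT s|lborel. norm (K s) * (a powr p + p * a powr (p - 1) * (?y s - a))) =
        (LINT s|lborel. (a powr p - p * a powr (p - 1) * a) * norm (K s) + (p * a powr (p - 1)) * (norm (K s) * ?y s))"
      by (rule Bochner_Integration.integral_cong) (auto simp: algebra_simps)
    also have "... = (a powr p - p * a powr (p - 1) * a) * (LINT s|lborel. norm (K s)) + (p * a powr (p - 1)) * \<mu>"
      unfolding \<mu>_def using iK iy by simp
    also have aa: "a powr (p - 1) * a = a powr p" using a0 by (cases "a = 0") (auto simp: powr_diff)
    \<comment> \<open>The constant term of the tangent is nonpositive because p \<ge> 1, so
      replacing the total mass by its upper bound \<open>A\<close> goes in the right
      direction.\<close>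
    have "(a powr p - p * a powr (p - 1) * a) * A \<le> (a powr p - p * a powr (p - 1) * a) * (LINT s|lborel. norm (K s))"
    proof (rule mult_left_mono_neg[OF A(1)])
      have "p * (a powr (p - 1) * a) \<ge> 1 * a powr p" unfolding aa by (intro mult_right_mono) (use p in auto)
      then show "a powr p - p * a powr (p - 1) * a \<le> 0" by (simp add: mult.assoc)
    qed
    ultimately have "(a powr p - p * a powr (p - 1) * a) * A + (p * a powr (p - 1)) * \<mu> \<le> Q" by linarith
    then have "a powr p * A \<le> Q" unfolding \<mu>a using aa by (simp add: algebra_simps)
    then have *: "A powr (p - 1) * (a powr p * A) \<le> A powr (p - 1) * Q" by (intro mult_left_mono) auto
    have "A powr (p - 1) * (a powr p * A) = \<mu> powr p"
      unfolding \<mu>a using a0 A by (simp add: powr_mult powr_diff)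
    with * have "\<mu> powr p \<le> A powr (p - 1) * Q" by simp
    moreover have "norm (axc i K f x) \<le> \<mu>"
      unfolding axc_def \<mu>_def using integral_norm_bound[of lborel "%s. K s * f (x - s *\<^sub>R axis i 1)"] by (simp add: norm_mult)
    then have "norm (axc i K f x) powr p \<le> \<mu> powr p" by (intro powr_mono2) (use p in auto)
    moreover have "Q = enn2real (\<integral>\<^sup>+s. ennreal (norm (K s) * ?y s powr p) \<partial>lborel)"
      unfolding Q_def by (rule integral_eq_nn_integral) auto
    ultimately show "norm (axc i K f x) powr p \<le> A powr (p - 1) * enn2real (\<integral>\<^sup>+s. ennreal (norm (K s) * ?y s powr p) \<partial>lborel)"
      by (metis order_trans)
  qed auto
  also have "(\<integral>\<^sup>+s. ennreal (norm (K s)) \<partial>lborel) = ennreal (LINT s|lborel. norm (K s))"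
    by (rule nn_integral_eq_integral[OF iK]) auto
  also have "ennreal (A powr (p - 1)) * ennreal (LINT s|lborel. norm (K s)) * Ip p f \<le> ennreal (A powr (p - 1)) * ennreal A * Ip p f"
    by (intro mult_right_mono mult_left_mono ennreal_leI A(1)) auto
  also have "ennreal (A powr (p - 1)) * ennreal A = ennreal (A powr p)"
    using A(2) by (simp add: powr_diff flip: ennreal_mult)
  finally show ?thesis .
qed

lemma young_axis_sup:
  assumes K: "rapid K" and pf: "pg f" and f: "!!x. norm (f x) \<le> c" and A: "(LINT s|lborel. norm (K s)) \<le> A"
  shows "norm (axc i K f x) \<le> A * c"
proof -
  have c: "0 \<le> c" using order_trans[OF norm_ge_zero f[of 0]] .
  have iK: "integrable lborel (%s. norm (K s))" using rapid_integrable[OF K, of 0] by simp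
  have "norm (axc i K f x) \<le> (LINT s|lborel. norm (K s) * c)"
    unfolding axc_def
    by (rule Bochner_Integration.integral_norm_bound_integral) (use iK f axc_integrable[OF K pf] in \<open>auto simp: norm_mult intro!: mult_left_mono\<close>)
  also have "... \<le> A * c" using A c by (simp add: mult_right_mono)
  finally show ?thesis .
qed

text \<open>For \<open>p < 1\<close> convolution is controlled by band limitation: the slice
  \<open>g(s) = K(s) f(x - s e\<^sub>i)\<close> is reproduced by a kernel of height \<open>H\<close>, so its integral is
  bounded by its \<open>p\<close>-th moment.\<close>

lemma slice_reproducing:
  fixes n :: "'n::finite cfun" and i :: 'n
  assumes T: "tempered T" and n: "bump R n" and m: "test1 Rm m" and \<Phi>: "test1 R\<Phi> \<Phi>"
    and one: "!!u. \<bar>u\<bar> \<le> R + Rm ==> \<Phi> u = 1"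
  defines "g \<equiv> %x s. ker m s * fm n T (x - s *\<^sub>R axis i 1)"
  shows "g x s = (LINT r|lborel. ker \<Phi> r * g x (s + r))"
proof -
  define f where "f = fm n T"
  have f: "pg f" unfolding f_def by (rule pg_fm[OF T n])
  obtain C N where C: "C \<ge> 0" "!!x. norm (f x) \<le> C * (1 + norm x) ^ N" using pg_boundE[OF f] by metis
  define y where "y = x - s *\<^sub>R axis i 1"
  have y: "x - (s + r) *\<^sub>R axis i 1 = y - r *\<^sub>R axis i 1" for r by (simp add: y_def algebra_simps)
  note [measurable] = pg_measurable[OF f] rapid_measurable[OF rapid_ker[OF \<Phi>]] test1_measurable[OF m] test1_measurable[OF \<Phi>]
  \<comment> \<open>For |\<eta>| \<le> Rm the cutoff shifted by \<eta> is still 1 on the support of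
    \<open>n\<close>, so convolution with its kernel, which is a modulated
    \<open>ker \<Phi>\<close>, reproduces \<open>f\<close>.\<close>
  have rep: "(LINT r|lborel. cis (r * \<eta>) * ker \<Phi> r * f (y - r *\<^sub>R axis i 1)) = f y" if \<eta>: "\<bar>\<eta>\<bar> \<le> Rm" for \<eta>
  proof -
    have t: "test1 (R\<Phi> + \<bar>\<eta>\<bar>) (%u. \<Phi> (u - \<eta>))"
      using sm1_affine[of \<Phi> 1 "- \<eta>"] \<Phi> by (auto simp: test1_def)
    have "(LINT r|lborel. cis (r * \<eta>) * ker \<Phi> r * f (y - r *\<^sub>R axis i 1)) = (LINT r|lborel. ker (%u. \<Phi> (u - \<eta>)) r * f (y - r *\<^sub>R axis i 1))"
      by (subst ker_modulate) auto
    also have "... = fm (%\<xi>. \<Phi> (\<xi> $ i - \<eta>) * n \<xi>) T y"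
      unfolding f_def by (rule fm_axis_convolution[OF T n t, symmetric])
    also have "(%\<xi>. \<Phi> (\<xi> $ i - \<eta>) * n \<xi>) = n"
    proof
      fix \<xi> show "\<Phi> (\<xi> $ i - \<eta>) * n \<xi> = n \<xi>"
      proof (cases "\<xi> \<in> qbox R")
        case True
        then have "\<bar>\<xi> $ i\<bar> \<le> R" by (simp add: qbox_def)
        then show ?thesis using one[of "\<xi> $ i - \<eta>"] \<eta> by simp
      qed (simp add: bump_zero[OF n])
    qed
    finally show ?thesis by (simp add: f_def)
  qed
  let ?F = "%(r, \<eta>). (ker \<Phi> r * f (y - r *\<^sub>R axis i 1)) * (m \<eta> * cis ((s + r) * \<eta>))"
  have intF: "integrable (lborel \<Otimes>\<^sub>M lborel) ?F"
  proof (rule Bochner_Integration.integrable_bound[OF integrable_prod_mult[OF axc_integrable[OF rapid_ker[OF \<Phi>] f, of y i] test1_integrable[OF m]]])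
    show "?F \<in> borel_measurable (lborel \<Otimes>\<^sub>M lborel)" by measurable
  qed (auto simp: norm_mult)
  let ?c = "cor (1 / (2 * pi))"
  have "(LINT r|lborel. ker \<Phi> r * g x (s + r)) = (LINT r|lborel. ?c * (LINT \<eta>|lborel. (ker \<Phi> r * f (y - r *\<^sub>R axis i 1)) * (m \<eta> * cis ((s + r) * \<eta>))))"
    by (rule Bochner_Integration.integral_cong) (auto simp: g_def ker_def[of m] y f_def)
  also have "... = ?c * (LINT r|lborel. LINT \<eta>|lborel. (ker \<Phi> r * f (y - r *\<^sub>R axis i 1)) * (m \<eta> * cis ((s + r) * \<eta>)))"
    by (rule integral_mult_right_zero)
  also have "(LINT r|lborel. LINT \<eta>|lborel. (ker \<Phi> r * f (y - r *\<^sub>R axis i 1)) * (m \<eta> * cis ((s + r) * \<eta>))) =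
     (LINT \<eta>|lborel. LINT r|lborel. (ker \<Phi> r * f (y - r *\<^sub>R axis i 1)) * (m \<eta> * cis ((s + r) * \<eta>)))"
    using lborel_pair.Fubini_integral[of "%r \<eta>. (ker \<Phi> r * f (y - r *\<^sub>R axis i 1)) * (m \<eta> * cis ((s + r) * \<eta>))"] intF by simp
  also have "... = (LINT \<eta>|lborel. m \<eta> * cis (s * \<eta>) * f y)"
  proof (rule Bochner_Integration.integral_cong[OF refl])
    fix \<eta>
    have "(LINT r|lborel. (ker \<Phi> r * f (y - r *\<^sub>R axis i 1)) * (m \<eta> * cis ((s + r) * \<eta>))) =
       (LINT r|lborel. (m \<eta> * cis (s * \<eta>)) * (cis (r * \<eta>) * ker \<Phi> r * f (y - r *\<^sub>R axis i 1)))"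
    proof -
      have "cis ((s + r) * \<eta>) = cis (s * \<eta>) * cis (r * \<eta>)" for r by (simp add: cis_mult distrib_right)
      then show ?thesis by (simp only: mult_ac)
    qed
    also have "... = m \<eta> * cis (s * \<eta>) * (LINT r|lborel. cis (r * \<eta>) * ker \<Phi> r * f (y - r *\<^sub>R axis i 1))"
      by (rule integral_mult_right_zero)
    also have "... = m \<eta> * cis (s * \<eta>) * f y"
      using rep[of \<eta>] m by (cases "\<bar>\<eta>\<bar> \<le> Rm") (auto simp: test1_def)
    finally show "(LINT r|lborel. (ker \<Phi> r * f (y - r *\<^sub>R axis i 1)) * (m \<eta> * cis ((s + r) * \<eta>))) = m \<eta> * cis (s * \<eta>) * f y" .
  qed
  also have "?c * ... = g x s"
    unfolding integral_mult_left_zero by (simp add: g_def ker_def y_def f_def)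
  finally show ?thesis by simp
qed

text \<open>With J the L_1 norm of the slice g, reproduction bounds |g| by H J. Hence J, the
  integral of |g|^(1-p) |g|^p, is at most (H J)^(1-p) times the integral of |g|^p; cancelling
  J^(1-p) leaves J^p \<le> H^(1-p) times that integral.\<close>

theorem small_p_axis:
  fixes n :: "'n::finite cfun"
  assumes T: "tempered T" and n: "bump R n" and m: "test1 Rm m" and \<Phi>: "test1 R\<Phi> \<Phi>"
    and one: "!!u. \<bar>u\<bar> \<le> R + Rm ==> \<Phi> u = 1" and H: "!!r. norm (ker \<Phi> r) \<le> H"
    and p: "0 < p" "p \<le> 1"
  shows "Ip p (axc i (ker m) (fm n T)) \<le>
     ennreal (H powr (1 - p)) * (\<integral>\<^sup>+s. ennreal (norm (ker m s) powr p) \<partial>lborel) * Ip p (fm n T)"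
proof -
  define f where "f = fm n T"
  have f: "pg f" unfolding f_def by (rule pg_fm[OF T n])
  have K: "rapid (ker m)" by (rule rapid_ker[OF m])
  note [measurable] = pg_measurable[OF f] rapid_measurable[OF K] rapid_measurable[OF rapid_ker[OF \<Phi>]]
  have H0: "H \<ge> 0" using order_trans[OF norm_ge_zero H[of 0]] .
  show ?thesis
    unfolding f_def[symmetric]
  proof (rule slice_powr_bound[OF f, where i = i])
    fix x
    define g where "g s = ker m s * f (x - s *\<^sub>R axis i 1)" for s
    have ig: "integrable lborel g" unfolding g_def[abs_def] by (rule axc_integrable[OF K f])
    define J where "J = (LINT s|lborel. norm (g s))"
    have J0: "J \<ge> 0" unfolding J_def by (rule Bochner_Integration.integral_nonneg) auto
    have [measurable]: "g \<in> borel_measurable borel" unfolding g_def[abs_def] by measurable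
    have sup: "norm (g s) \<le> H * J" for s
    proof -
      have "norm (g s) = norm (LINT r|lborel. ker \<Phi> r * g (s + r))"
        using slice_reproducing[OF T n m \<Phi> one, where i = i and x = x and s = s] by (simp add: g_def f_def)
      also have "... \<le> (LINT r|lborel. norm (ker \<Phi> r * g (s + r)))" by (rule integral_norm_bound)
      also have "... \<le> (LINT r|lborel. H * norm (g (r + s)))"
      proof (rule integral_mono')
        show "integrable lborel (%r. H * norm (g (r + s)))"
          using lborel_integrable_translate[OF integrable_norm[OF ig], of s] by (rule integrable_mult_right)
        show "norm (ker \<Phi> r * g (s + r)) \<le> H * norm (g (r + s))" for r
          using H[of r] by (simp add: norm_mult add.commute mult_right_mono)
      qed (use H0 in auto)
      also have "... = H * J"
        using lborel_integral_translate[of "%s. norm (g s)" s] by (simp add: J_def)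
      finally show ?thesis .
    qed
    let ?I = "\<integral>\<^sup>+s. ennreal (norm (ker m s) powr p * norm (f (x - s *\<^sub>R axis i 1)) powr p) \<partial>lborel"
    have gp: "norm (ker m s) powr p * norm (f (x - s *\<^sub>R axis i 1)) powr p = norm (g s) powr p" for s
      by (simp add: g_def norm_mult powr_mult)
    have fin: "?I < \<infinity>"
    proof -
      obtain C N where C: "C \<ge> 0" "!!x. norm (f x) \<le> C * (1 + norm x) ^ N" using pg_boundE[OF f] by metis
      \<comment> \<open>So many powers of 1 + |s| that their p-th power still dominates (1 +
        |s|)^2.\<close>
      define M where "M = nat \<lceil>2 / p\<rceil>"
      have Mp: "real M * p \<ge> 2"       proof -
        have "2 / p \<le> real M" unfolding M_def by (rule real_nat_ceiling_ge)
        then show ?thesis using p by (simp add: field_simps)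
      qed
      obtain D where D: "!!s. (1 + \<bar>s\<bar>) ^ (N + M) * norm (ker m s) \<le> D" using K unfolding rapid_def by blast
      have D0: "D \<ge> 0" using order_trans[OF _ D[of 0]] by simp
      define B where "B = C * (1 + norm x) ^ N * D"
      have B0: "B \<ge> 0" using C D0 by (simp add: B_def)
      have "norm (g s) powr p \<le> B powr p * (inverse (1 + s\<^sup>2))" for s
      proof -
        have "(1 + \<bar>s\<bar>) ^ M * norm (g s) \<le> (1 + \<bar>s\<bar>) ^ M * (norm (ker m s) * (C * (1 + norm x) ^ N * (1 + \<bar>s\<bar>) ^ N))"
          unfolding g_def norm_mult by (intro mult_left_mono axis_slice_bound[OF C]) auto
        also have "... = C * (1 + norm x) ^ N * ((1 + \<bar>s\<bar>) ^ (N + M) * norm (ker m s))" by (simp add: power_add mult_ac)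
        also have "... \<le> B" unfolding B_def using C D[of s] by (intro mult_left_mono) auto
        finally have "((1 + \<bar>s\<bar>) ^ M * norm (g s)) powr p \<le> B powr p" by (intro powr_mono2) (use p in auto)
        moreover have "((1 + \<bar>s\<bar>) ^ M * norm (g s)) powr p = (1 + \<bar>s\<bar>) powr (real M * p) * norm (g s) powr p"
          by (simp add: powr_mult powr_powr flip: powr_realpow)
        moreover have "(1 + s\<^sup>2) * norm (g s) powr p \<le> (1 + \<bar>s\<bar>) powr (real M * p) * norm (g s) powr p"
        proof (rule mult_right_mono)
          have "1 + s\<^sup>2 \<le> (1 + \<bar>s\<bar>)\<^sup>2" by (simp add: power2_eq_square algebra_simps)
          also have "... = (1 + \<bar>s\<bar>) powr 2" by (simp add: powr_realpow[of _ 2, simplified])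
          also have "... \<le> (1 + \<bar>s\<bar>) powr (real M * p)" by (intro powr_mono Mp) auto
          finally show "1 + s\<^sup>2 \<le> (1 + \<bar>s\<bar>) powr (real M * p)" .
        qed simp
        ultimately have "(1 + s\<^sup>2) * norm (g s) powr p \<le> B powr p" by linarith
        moreover have "1 + s\<^sup>2 > 0" by (simp add: add_pos_nonneg)
        ultimately show ?thesis by (simp add: field_simps)
      qed
      then have "?I \<le> (\<integral>\<^sup>+s. ennreal (B powr p * inverse (1 + s\<^sup>2)) \<partial>lborel)"
        unfolding gp by (intro nn_integral_mono ennreal_leI)
      also have "... < \<infinity>"
        by (subst nn_integral_eq_integral[OF integrable_mult_right[OF integrable_inverse_square]])
           (auto simp: add_nonneg_nonneg)
      finally show ?thesis .
    qed
    have J_le: "ennreal J \<le> ennreal ((H * J) powr (1 - p)) * ?I"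
    proof -
      have "ennreal J = (\<integral>\<^sup>+s. ennreal (norm (g s)) \<partial>lborel)"
        unfolding J_def by (rule nn_integral_eq_integral[symmetric]) (use ig in auto)
      also have "... \<le> (\<integral>\<^sup>+s. ennreal ((H * J) powr (1 - p)) * ennreal (norm (g s) powr p) \<partial>lborel)"
      proof (rule nn_integral_mono)
        fix s
        have "norm (g s) = norm (g s) powr (1 - p) * norm (g s) powr p"
          by (cases "g s = 0") (auto simp flip: powr_add)
        also have "... \<le> (H * J) powr (1 - p) * norm (g s) powr p"
          by (intro mult_right_mono powr_mono2 sup) (use p in auto)
        finally show "ennreal (norm (g s)) \<le> ennreal ((H * J) powr (1 - p)) * ennreal (norm (g s) powr p)"
          by (simp add: ennreal_leI flip: ennreal_mult)
      qed
      also have "... = ennreal ((H * J) powr (1 - p)) * ?I"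
        unfolding gp by (rule nn_integral_cmult) measurable
      finally show ?thesis .
    qed
    define Q where "Q = enn2real ?I"
    have IQ: "?I = ennreal Q" unfolding Q_def using fin by simp
    have Q0: "Q \<ge> 0" by (simp add: Q_def)
    have JQ: "J \<le> (H * J) powr (1 - p) * Q"
      using J_le Q0 unfolding IQ by (simp flip: ennreal_mult)
    have "J powr p \<le> H powr (1 - p) * Q"
    proof (cases "J = 0")
      case False
      then have J: "J > 0" using J0 by simp
      have "J = J powr (1 - p) * J powr p" using J by (simp flip: powr_add)
      then have "J powr (1 - p) * J powr p \<le> J powr (1 - p) * (H powr (1 - p) * Q)"
        using JQ H0 J by (simp add: powr_mult mult_ac)
      then show ?thesis using J by simp
    qed (use Q0 in simp)
    moreover have "norm (axc i (ker m) f x) \<le> J"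
      unfolding axc_def J_def g_def by (rule integral_norm_bound)
    then have "norm (axc i (ker m) f x) powr p \<le> J powr p" by (intro powr_mono2) (use p in auto)
    ultimately show "norm (axc i (ker m) f x) powr p \<le> H powr (1 - p) * enn2real ?I"
      unfolding Q_def by linarith
  qed auto
qed

section \<open>Littlewood-Paley sums along an axis\<close>

definition Lpi :: "real => ('n::finite cfun) => bool" where
  "Lpi p f \<longleftrightarrow> pg f \<and> integrable lborel (%x. norm (f x) powr p)"

text \<open>The p-th power of the norm rather than the norm, which is why its bounds take the form
  \<open>b powr p\<close>.\<close>

definition np :: "real => ('n::finite cfun) => real" where
  "np p f = (LINT x|lborel. norm (f x) powr p)"

lemma np_nonneg: "0 \<le> np p f"
  unfolding np_def by (rule Bochner_Integration.integral_nonneg) auto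

lemma Lpi_iff_Ip: "pg f ==> Lpi p f \<longleftrightarrow> Ip p f < \<infinity>"
  using pg_measurable[of f] by (auto simp: Lpi_def Ip_def integrable_iff_bounded)

lemma Ip_eq_np: "Lpi p f ==> Ip p f = ennreal (np p f)"
  unfolding Ip_def np_def Lpi_def by (intro nn_integral_eq_integral) auto

lemma Lpi_pg: "Lpi p f ==> pg f" and Lpi_int: "Lpi p f ==> integrable lborel (%x. norm (f x) powr p)"
  by (auto simp: Lpi_def)

lemma Lpi_measurable [measurable_dest]: "Lpi p f ==> f \<in> borel_measurable borel"
  by (auto simp: Lpi_def pg_def)

lemma Lpi_axc_Ip:
  assumes K: "rapid K" and f: "Lpi p f" and p: "1 \<le> p" and A: "0 \<le> B"
    and le: "Ip p (axc i K f) \<le> ennreal B * Ip p f"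
  shows "Lpi p (axc i K f)" "np p (axc i K f) \<le> B * np p f"
proof -
  have le': "Ip p (axc i K f) \<le> ennreal (B * np p f)"
    using le unfolding Ip_eq_np[OF f] by (simp add: ennreal_mult[OF A np_nonneg])
  then show 1: "Lpi p (axc i K f)"
    unfolding Lpi_iff_Ip[OF pg_axc[OF K Lpi_pg[OF f]]] using order_le_less_trans by fastforce
  then show "np p (axc i K f) \<le> B * np p f"
    using le' mult_nonneg_nonneg[OF A np_nonneg[of p f]] unfolding Ip_eq_np[OF 1] by simp
qed

lemma Lpi_axc:
  assumes "rapid K" "Lpi p f" "1 \<le> p" "(LINT s|lborel. norm (K s)) \<le> A" "A > 0"
  shows "Lpi p (axc i K f)" "np p (axc i K f) \<le> A powr p * np p f"
  using Lpi_axc_Ip[OF assms(1,2,3) _ young_axis[OF assms(1) Lpi_pg[OF assms(2)] assms(3,4,5)]] by auto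

lemma powr_add_le:
  fixes a b p :: real
  assumes "0 \<le> a" "0 \<le> b" "0 < p"
  shows "(a + b) powr p \<le> 2 powr p * (a powr p + b powr p)"
proof -
  have "(a + b) powr p \<le> (2 * max a b) powr p" by (intro powr_mono2) (use assms in auto)
  also have "... = 2 powr p * max a b powr p" using assms by (simp add: powr_mult)
  also have "... \<le> 2 powr p * (a powr p + b powr p)" by (intro mult_left_mono) (auto simp: max_def)
  finally show ?thesis .
qed

lemma Lpi_0: "Lpi p (%_. 0)"
  by (simp add: Lpi_def pg_0)

lemma Lpi_add:
  assumes f: "Lpi p f" and g: "Lpi p g" and p: "0 < p"
  shows "Lpi p (%x. f x + g x)"
  unfolding Lpi_def
proof
  show "pg (%x. f x + g x)" by (intro pg_add Lpi_pg[OF f] Lpi_pg[OF g])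
  note [measurable] = Lpi_measurable[OF f] Lpi_measurable[OF g]
  show "integrable lborel (%x. norm (f x + g x) powr p)"
  proof (rule Bochner_Integration.integrable_bound[where f = "%x. 2 powr p * (norm (f x) powr p + norm (g x) powr p)"])
    show "integrable lborel (%x. 2 powr p * (norm (f x) powr p + norm (g x) powr p))"
      using Lpi_int[OF f] Lpi_int[OF g] by auto
    show "AE x in lborel. norm (norm (f x + g x) powr p) \<le> norm (2 powr p * (norm (f x) powr p + norm (g x) powr p))"
    proof (rule AE_I2)
      fix x
      have "norm (f x + g x) powr p \<le> (norm (f x) + norm (g x)) powr p"
        by (intro powr_mono2 norm_triangle_ineq) (use p in auto)
      also have "... \<le> 2 powr p * (norm (f x) powr p + norm (g x) powr p)" by (rule powr_add_le) (use p in auto)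
      finally show "norm (norm (f x + g x) powr p) \<le> norm (2 powr p * (norm (f x) powr p + norm (g x) powr p))" by simp
    qed
  qed measurable
qed

lemma Lpi_sum:
  "0 < p ==> (!!k. k \<in> I ==> Lpi p (f k)) ==> Lpi p (%x. \<Sum>k\<in>I. f k x)"
  by (induction I rule: infinite_finite_induct) (auto intro: Lpi_0 Lpi_add)

lemma Lpi_translate: "Lpi p f ==> Lpi p (%x. f (x + c))"
  using lborel_integrable_translate[of "%x. norm (f x) powr p" c] by (auto simp: Lpi_def pg_translate)

lemma np_translate: "Lpi p f ==> np p (%x. f (x + c)) = np p f"
proof -
  assume "Lpi p f"
  note [measurable] = Lpi_measurable[OF this]
  show ?thesis
    unfolding np_def by (rule lborel_integral_translate[of "%x. norm (f x) powr p"]) measurable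
qed

lemma rapid_shift:
  assumes K: "rapid K"
  shows "rapid (%v. K (v + s))"
  unfolding rapid_def
proof safe
  show "continuous_on UNIV (%v. K (v + s))"
    by (rule continuous_on_compose2[of UNIV K]) (use K in \<open>auto simp: rapid_def intro!: continuous_intros\<close>)
  fix N
  obtain C where C: "!!v. (1 + \<bar>v\<bar>) ^ N * norm (K v) \<le> C" using K unfolding rapid_def by blast
  have "(1 + \<bar>v\<bar>) ^ N * norm (K (v + s)) \<le> (1 + \<bar>s\<bar>) ^ N * C" for v
  proof -
    have "1 + norm ((v + s) + - s) \<le> (1 + norm (v + s)) * (1 + norm (- s))" by (rule norm_translate_le)
    then have "(1 + \<bar>v\<bar>) ^ N \<le> ((1 + \<bar>v + s\<bar>) * (1 + \<bar>s\<bar>)) ^ N" by (intro power_mono) auto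
    then have "(1 + \<bar>v\<bar>) ^ N * norm (K (v + s)) \<le> (1 + \<bar>s\<bar>) ^ N * ((1 + \<bar>v + s\<bar>) ^ N * norm (K (v + s)))"
      by (drule_tac mult_right_mono[OF _ norm_ge_zero[of "K (v + s)"]]) (simp add: power_mult_distrib mult_ac)
    also have "... \<le> (1 + \<bar>s\<bar>) ^ N * C" by (intro mult_left_mono C) auto
    finally show ?thesis .
  qed
  then show "\<exists>C. \<forall>v. (1 + \<bar>v\<bar>) ^ N * norm (K (v + s)) \<le> C" by blast
qed

lemma rapid_diff:
  assumes "rapid K" "rapid L"
  shows "rapid (%v. K v - L v)"
  unfolding rapid_def
proof safe
  show "continuous_on UNIV (%v. K v - L v)" using assms by (auto simp: rapid_def intro!: continuous_intros)
  fix N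
  obtain C D where C: "!!v. (1 + \<bar>v\<bar>) ^ N * norm (K v) \<le> C" "!!v. (1 + \<bar>v\<bar>) ^ N * norm (L v) \<le> D"
    using assms unfolding rapid_def by metis
  have "(1 + \<bar>v\<bar>) ^ N * norm (K v - L v) \<le> C + D" for v
  proof -
    have "(1 + \<bar>v\<bar>) ^ N * norm (K v - L v) \<le> (1 + \<bar>v\<bar>) ^ N * (norm (K v) + norm (L v))"
      by (intro mult_left_mono norm_triangle_ineq4) auto
    then show ?thesis using C(1)[of v] C(2)[of v] by (simp add: distrib_left)
  qed
  then show "\<exists>C. \<forall>v. (1 + \<bar>v\<bar>) ^ N * norm (K v - L v) \<le> C" by blast
qed

lemma axc_shift_diff:
  assumes K: "rapid K" and f: "pg f"
  shows "axc i K f (x + s *\<^sub>R axis i 1) - axc i K f x = axc i (%v. K (v + s) - K v) f x"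
proof -
  note [measurable] = pg_measurable[OF f] rapid_measurable[OF K]
  have "axc i K f (x + s *\<^sub>R axis i 1) = (LINT v|lborel. K (v + s) * f (x + s *\<^sub>R axis i 1 - (v + s) *\<^sub>R axis i 1))"
    unfolding axc_def
    by (rule lborel_integral_translate[of "%v. K v * f (x + s *\<^sub>R axis i 1 - v *\<^sub>R axis i 1)", symmetric]) measurable
  also have "... = (LINT v|lborel. K (v + s) * f (x - v *\<^sub>R axis i 1))" by (simp add: algebra_simps)
  finally show ?thesis
    using axc_integrable[OF K f, of x i] axc_integrable[OF rapid_shift[OF K] f, of s x i]
    by (simp add: axc_def left_diff_distrib)
qed

text \<open>\<open>K\<close> models the kernels of a dyadic decomposition along one axis.\<close>

definition kfam :: "(nat => real => complex) => real => bool" where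
  "kfam K A \<longleftrightarrow> A > 0 \<and> (\<forall>l. rapid (K l) \<and> (LINT s|lborel. norm (K l s)) \<le> A \<and>
     (\<forall>s. (LINT v|lborel. norm (K l (v + s) - K l v)) \<le> A * 2 ^ l * \<bar>s\<bar>) \<and>
     (l > 0 --> (LINT s|lborel. K l s) = 0 \<and>
       (\<forall>\<alpha>. 0 < \<alpha> --> \<alpha> \<le> 1 --> (LINT s|lborel. norm (K l s) * \<bar>s\<bar> powr \<alpha>) \<le> A * 2 powr (- \<alpha> * real l))))"

lemma kfamD:
  assumes "kfam K A"
  shows "A > 0" "rapid (K l)" "(LINT s|lborel. norm (K l s)) \<le> A"
    "(LINT v|lborel. norm (K l (v + s) - K l v)) \<le> A * 2 ^ l * \<bar>s\<bar>"
    "l > 0 ==> (LINT s|lborel. K l s) = 0"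
    "l > 0 ==> 0 < \<alpha> ==> \<alpha> \<le> 1 ==> (LINT s|lborel. norm (K l s) * \<bar>s\<bar> powr \<alpha>) \<le> A * 2 powr (- \<alpha> * real l)"
  using assms by (auto simp: kfam_def)

text \<open>A Bernstein-type bound: the shift is moved onto the kernel, whose increments have L_1
  norm at most A 2^l |s|, and Young's inequality applies.\<close>

lemma kfam_difference:
  assumes K: "kfam K A" and g: "Lpi u g" and u: "1 \<le> u" and b: "np u g \<le> b powr u" "b > 0" and s: "s \<noteq> 0"
  shows "Lpi u (%x. axc i (K l) g (x + s *\<^sub>R axis i 1) - axc i (K l) g x)"
    "np u (%x. axc i (K l) g (x + s *\<^sub>R axis i 1) - axc i (K l) g x) \<le> (A * 2 ^ l * \<bar>s\<bar> * b) powr u"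
proof -
  note k = kfamD[OF K]
  have B: "A * 2 ^ l * \<bar>s\<bar> > 0" using k(1) s by simp
  have r: "rapid (%v. K l (v + s) - K l v)" by (intro rapid_diff rapid_shift k)
  note Y = Lpi_axc[OF r g u k(4) B, of i]
  show "Lpi u (%x. axc i (K l) g (x + s *\<^sub>R axis i 1) - axc i (K l) g x)"
    unfolding axc_shift_diff[OF k(2) Lpi_pg[OF g]] using Y(1) by simp
  have "np u (axc i (%v. K l (v + s) - K l v) g) \<le> (A * 2 ^ l * \<bar>s\<bar>) powr u * b powr u"
    using Y(2) b(1) by (meson mult_left_mono order_trans powr_ge_zero)
  then show "np u (%x. axc i (K l) g (x + s *\<^sub>R axis i 1) - axc i (K l) g x) \<le> (A * 2 ^ l * \<bar>s\<bar> * b) powr u"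
    unfolding axc_shift_diff[OF k(2) Lpi_pg[OF g]] using B b(2) by (simp add: powr_mult)
qed

lemma kfam_bound:
  assumes K: "kfam K A" and g: "Lpi u g" and u: "1 \<le> u" and b: "np u g \<le> b powr u" "b > 0"
  shows "Lpi u (axc i (K l) g)" "np u (axc i (K l) g) \<le> (A * b) powr u"
proof -
  note k = kfamD[OF K]
  note Y = Lpi_axc[OF k(2) g u k(3) k(1), of i]
  show "Lpi u (axc i (K l) g)" by (rule Y(1))
  show "np u (axc i (K l) g) \<le> (A * b) powr u"
    using order_trans[OF Y(2)[of l] mult_left_mono[OF b(1) powr_ge_zero]] b k(1) by (simp add: powr_mult)
qed

section \<open>Pairings and adjoints of axis convolutions\<close>

lemma pairing_integrable:
  assumes P: "pg P" and Q: "pg Q" and a: "integrable lborel a" "integrable lborel b"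
    and le: "!!x y. norm (P x) * norm (Q y) \<le> a x + b y"
  shows "integrable lborel (%x. P x * Q (x + c))"
proof (rule Bochner_Integration.integrable_bound[where f = "%x. a x + b (x + c)"])
  note [measurable] = pg_measurable[OF P] pg_measurable[OF Q]
  show "integrable lborel (%x. a x + b (x + c))" using a lborel_integrable_translate[of b c] by auto
  show "AE x in lborel. norm (P x * Q (x + c)) \<le> norm (a x + b (x + c))"
    using le by (auto simp: norm_mult intro: order_trans[OF _ abs_ge_self])
  show "(%x. P x * Q (x + c)) \<in> borel_measurable lborel" by measurable
qed

text \<open>The hypothesis \<open>le\<close> stands for Young's inequality with separated variables.
  Its majorant keeps its integral when one argument is translated, which gives the bound uniform in
  \<open>s\<close> that Fubini's theorem asks for.\<close>

lemma pairing_axis: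
  fixes P Q :: "'n::finite cfun"
  assumes K: "rapid K" and P: "pg P" and Q: "pg Q" and a: "integrable lborel a" "integrable lborel b"
    and le: "!!x y. norm (P x) * norm (Q y) \<le> a x + b y"
  shows "(LINT x|lborel. P x * axc i K Q x) = (LINT s|lborel. K s * (LINT x|lborel. P (x + s *\<^sub>R axis i 1) * Q x))"
    and "integrable lborel (%s. K s * (LINT x|lborel. P (x + s *\<^sub>R axis i 1) * Q x))"
proof -
  note [measurable] = pg_measurable[OF P] pg_measurable[OF Q] rapid_measurable[OF K]
  let ?e = "axis i (1::real)"
  let ?F = "%(s, x). K s * (P x * Q (x - s *\<^sub>R ?e))"
  have mF: "?F \<in> borel_measurable (lborel \<Otimes>\<^sub>M lborel)" by measurable
  have ab: "0 \<le> a x + b y" for x y using le[of x y] by (meson mult_nonneg_nonneg norm_ge_zero order_trans)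
  have iab: "integrable lborel (%x. a x + b (x + c))" for c using a lborel_integrable_translate[of b c] by auto
  have ic: "integrable lborel (%x. P x * Q (x - s *\<^sub>R ?e))" for s
    using pairing_integrable[OF P Q a le, of "- (s *\<^sub>R ?e)"] by simp
  have bd: "(LINT x|lborel. norm (P x * Q (x - s *\<^sub>R ?e))) \<le> integral\<^sup>L lborel a + integral\<^sup>L lborel b" for s
  proof -
    have "(LINT x|lborel. norm (P x * Q (x - s *\<^sub>R ?e))) \<le> (LINT x|lborel. a x + b (x + - (s *\<^sub>R ?e)))"
    proof (rule Bochner_Integration.integral_mono[OF integrable_norm[OF ic] iab])
      show "norm (P x * Q (x - s *\<^sub>R ?e)) \<le> a x + b (x + - (s *\<^sub>R ?e))" for x
        using le[of x "x - s *\<^sub>R ?e"] by (simp add: norm_mult)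
    qed
    also have "... = integral\<^sup>L lborel a + (LINT x|lborel. b (x + - (s *\<^sub>R ?e)))"
      using a lborel_integrable_translate[OF a(2), of "- (s *\<^sub>R ?e)"] by (intro Bochner_Integration.integral_add)
    also have "(LINT x|lborel. b (x + - (s *\<^sub>R ?e))) = integral\<^sup>L lborel b"
      by (rule lborel_integral_translate) (use a in auto)
    finally show ?thesis .
  qed
  have intF: "integrable (lborel \<Otimes>\<^sub>M lborel) ?F"
  proof (rule lborel_pair.Fubini_integrable[OF mF])
    show "integrable lborel (%s. LINT x|lborel. norm (?F (s, x)))"
    proof (rule Bochner_Integration.integrable_bound[where f = "%s. norm (K s) * (integral\<^sup>L lborel a + integral\<^sup>L lborel b)"])
      show "integrable lborel (%s. norm (K s) * (integral\<^sup>L lborel a + integral\<^sup>L lborel b))"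
        using rapid_integrable[OF K, of 0] by auto
      show "(%s. LINT x|lborel. norm (?F (s, x))) \<in> borel_measurable lborel"
        using mF by measurable
      have "norm (LINT x|lborel. norm (?F (s, x))) \<le> norm (norm (K s) * (integral\<^sup>L lborel a + integral\<^sup>L lborel b))" for s
      proof -
        have "(LINT x|lborel. norm (?F (s, x))) = norm (K s) * (LINT x|lborel. norm (P x * Q (x - s *\<^sub>R ?e)))"
          by (simp add: norm_mult)
        also have "... \<le> norm (K s) * (integral\<^sup>L lborel a + integral\<^sup>L lborel b)"
          by (intro mult_left_mono bd) auto
        finally show ?thesis
          using Bochner_Integration.integral_nonneg[of lborel "%x. norm (?F (s, x))"] by simp
      qed
      then show "AE s in lborel. norm (LINT x|lborel. norm (?F (s, x))) \<le> norm (norm (K s) * (integral\<^sup>L lborel a + integral\<^sup>L lborel b))"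
        by (intro AE_I2)
    qed
    show "AE s in lborel. integrable lborel (%x. ?F (s, x))" using ic by auto
  qed
  have tr: "(LINT x|lborel. P x * Q (x - s *\<^sub>R ?e)) = (LINT x|lborel. P (x + s *\<^sub>R ?e) * Q x)" for s
    using lborel_integral_translate[of "%x. P x * Q (x - s *\<^sub>R ?e)" "s *\<^sub>R ?e"] by simp
  show "integrable lborel (%s. K s * (LINT x|lborel. P (x + s *\<^sub>R ?e) * Q x))"
    using lborel_pair.integrable_fst'[OF intF] by (simp add: tr)
  have "(LINT x|lborel. P x * axc i K Q x) = (LINT x|lborel. LINT s|lborel. K s * (P x * Q (x - s *\<^sub>R ?e)))"
  proof (rule Bochner_Integration.integral_cong[OF refl])
    fix x
    have "P x * axc i K Q x = (LINT s|lborel. P x * (K s * Q (x - s *\<^sub>R ?e)))"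
      unfolding axc_def by (rule integral_mult_right_zero[symmetric])
    then show "P x * axc i K Q x = (LINT s|lborel. K s * (P x * Q (x - s *\<^sub>R ?e)))" by (simp add: mult_ac)
  qed
  also have "... = (LINT s|lborel. LINT x|lborel. K s * (P x * Q (x - s *\<^sub>R ?e)))"
    using lborel_pair.Fubini_integral[of "%s x. K s * (P x * Q (x - s *\<^sub>R ?e))"] intF by simp
  finally show "(LINT x|lborel. P x * axc i K Q x) = (LINT s|lborel. K s * (LINT x|lborel. P (x + s *\<^sub>R ?e) * Q x))"
    by (simp add: tr)
qed

lemma lborel_integral_reflect:
  fixes f :: "real => 'b::{banach, second_countable_topology}"
  shows "(LINT s|lborel. f (- s)) = (LINT s|lborel. f s)"
  using lborel_integral_real_affine[of "-1" f 0] by simp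

lemma rapid_reflect: "rapid K ==> rapid (%s. K (- s))"
  unfolding rapid_def
proof safe
  assume "continuous_on UNIV K"
  then show "continuous_on UNIV (%s. K (- s))"
    by (rule continuous_on_compose2) (auto intro!: continuous_intros)
  fix N assume "\<forall>N. \<exists>C. \<forall>s. (1 + \<bar>s\<bar>) ^ N * norm (K s) \<le> C"
  then obtain C where "!!s. (1 + \<bar>s\<bar>) ^ N * norm (K s) \<le> C" by blast
  from this[of "- _"] show "\<exists>C. \<forall>s. (1 + \<bar>s\<bar>) ^ N * norm (K (- s)) \<le> C" by auto
qed

text \<open>By \<open>pairing_axis\<close> both sides are the same integral over \<open>s\<close>,
  up to a reflection.\<close>

lemma adjoint_axis:
  fixes P Q :: "'n::finite cfun"
  assumes K: "rapid K" and P: "pg P" and Q: "pg Q" and a: "integrable lborel a" "integrable lborel b"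
    and le: "!!x y. norm (P x) * norm (Q y) \<le> a x + b y"
  shows "(LINT x|lborel. P x * axc i K Q x) = (LINT x|lborel. Q x * axc i (%s. K (- s)) P x)"
proof -
  note [measurable] = pg_measurable[OF P] pg_measurable[OF Q]
  have le': "norm (Q x) * norm (P y) \<le> b x + a y" for x y using le[of y x] by (simp add: mult.commute add.commute)
  have tr: "(LINT x|lborel. Q (x + s *\<^sub>R axis i 1) * P x) = (LINT x|lborel. P (x + (- s) *\<^sub>R axis i 1) * Q x)" for s
    using lborel_integral_translate[of "%x. P (x - s *\<^sub>R axis i 1) * Q x" "s *\<^sub>R axis i 1"] by (simp add: mult.commute)
  have "(LINT x|lborel. Q x * axc i (%s. K (- s)) P x) = (LINT s|lborel. K (- s) * (LINT x|lborel. Q (x + s *\<^sub>R axis i 1) * P x))"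
    by (rule pairing_axis(1)[OF rapid_reflect[OF K] Q P a(2,1) le'])
  also have "... = (LINT s|lborel. K s * (LINT x|lborel. P (x + s *\<^sub>R axis i 1) * Q x))"
    unfolding tr by (rule lborel_integral_reflect[of "%s. K s * (LINT x|lborel. P (x + s *\<^sub>R axis i 1) * Q x)"])
  also have "... = (LINT x|lborel. P x * axc i K Q x)"
    by (rule pairing_axis(1)[OF K P Q a le, symmetric])
  finally show ?thesis by simp
qed

section \<open>The duality map of L_u and the expansion of u-th powers\<close>

definition gf :: "real => complex => complex" where
  "gf u z = cnj z * cor (norm z powr (u - 2))"

lemma powr_minus_one_mult: "0 \<le> x ==> x powr (v - 1) * x = x powr (v::real)"
  by (cases "x = 0") (auto simp: powr_diff)

lemma norm_gf: "norm (gf u z) = norm z powr (u - 1)"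
  using powr_minus_one_mult[of "norm z" "u - 1"] by (simp add: gf_def norm_mult mult.commute)

lemma gf_mult_self: "gf u z * z = cor (norm z powr u)"
proof (cases "z = 0")
  case False
  have "gf u z * z = cor ((norm z)\<^sup>2 * norm z powr (u - 2))"
    unfolding gf_def by (simp only: of_real_mult complex_norm_square) (simp add: mult_ac)
  also have "(norm z)\<^sup>2 * norm z powr (u - 2) = norm z powr u"
    using False by (simp add: powr_diff powr_numeral)
  finally show ?thesis .
qed (simp add: gf_def)

lemma gf_measurable [measurable]: "gf u \<in> borel_measurable borel"
proof -
  have [measurable]: "cnj \<in> borel_measurable borel"
    by (intro borel_measurable_continuous_onI continuous_intros)
  show ?thesis unfolding gf_def[abs_def] by measurable
qed

lemma gf_diff_aux:
  "norm (gf u a - gf u b) \<le> norm a powr (u - 2) * norm (a - b) + \<bar>norm a powr (u - 2) - norm b powr (u - 2)\<bar> * norm b"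
proof -
  have "gf u a - gf u b = cnj (a - b) * cor (norm a powr (u - 2)) + cnj b * cor (norm a powr (u - 2) - norm b powr (u - 2))"
    by (simp add: gf_def algebra_simps)
  then have "norm (gf u a - gf u b) \<le> norm (cnj (a - b) * cor (norm a powr (u - 2))) + norm (cnj b * cor (norm a powr (u - 2) - norm b powr (u - 2)))"
    by (metis norm_triangle_ineq)
  then show ?thesis by (simp add: norm_mult mult.commute del: complex_cnj_diff of_real_diff)
qed

text \<open>For u \<ge> 2 the duality map is locally Lipschitz, with a constant of the size of its
  derivative at the larger argument; the moduli are compared through the tangent of the power
  function.\<close>

lemma gf_diff_ge2_aux:
  assumes u: "2 \<le> u" and ba: "norm b \<le> norm a"
  shows "norm (gf u a - gf u b) \<le> u * norm a powr (u - 2) * norm (a - b)"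
proof -
  let ?x = "norm a" and ?y = "norm b"
  have "?y powr (u - 2) \<le> ?x powr (u - 2)" by (intro powr_mono2) (use u ba in auto)
  then have "\<bar>?x powr (u - 2) - ?y powr (u - 2)\<bar> * ?y = ?x powr (u - 2) * ?y - ?y powr (u - 1)"
    using powr_minus_one_mult[of ?y "u - 1"] by (simp add: left_diff_distrib)
  also have "... \<le> (u - 1) * ?x powr (u - 2) * (?x - ?y)"
  proof -
    have "?x powr (u - 1) + (u - 1) * ?x powr (u - 1 - 1) * (?y - ?x) \<le> ?y powr (u - 1)"
      by (rule powr_tangent) (use u in auto)
    then have "?x powr (u - 1) + (u - 1) * ?x powr (u - 2) * (?y - ?x) \<le> ?y powr (u - 1)" by simp
    moreover have "?x powr (u - 2) * ?y \<le> ?x powr (u - 1)"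
      using mult_left_mono[OF ba, of "?x powr (u - 2)"] powr_minus_one_mult[of ?x "u - 1"] by simp
    ultimately show ?thesis by (simp add: algebra_simps)
  qed
  also have "... \<le> (u - 1) * ?x powr (u - 2) * norm (a - b)"
    by (intro mult_left_mono norm_triangle_ineq2) (use u in auto)
  finally show ?thesis using gf_diff_aux[of u a b] by (simp add: algebra_simps)
qed

lemma gf_diff_ge2:
  assumes u: "2 \<le> u"
  shows "norm (gf u a - gf u b) \<le> u * max (norm a) (norm b) powr (u - 2) * norm (a - b)"
  using gf_diff_ge2_aux[OF u, of b a] gf_diff_ge2_aux[OF u, of a b]
  by (cases "norm b \<le> norm a") (auto simp: norm_minus_commute max_def)

text \<open>For u \<le> 2 the map is only Hoelder continuous of order u - 1. If |a - b| exceeds |a|,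
  the two values are estimated separately; otherwise |a|^(u-2) is at most |a - b|^(u-2), the
  exponent being nonpositive.\<close>

lemma gf_diff_le2_aux:
  assumes u: "1 < u" "u \<le> 2" and ba: "norm b \<le> norm a"
  shows "norm (gf u a - gf u b) \<le> 2 * norm (a - b) powr (u - 1)"
proof (cases "a = 0 \<or> norm a < norm (a - b)")
  case True
  have "norm (gf u a - gf u b) \<le> norm a powr (u - 1) + norm b powr (u - 1)"
    using norm_triangle_ineq4[of "gf u a" "gf u b"] by (simp add: norm_gf)
  moreover have "norm a powr (u - 1) \<le> norm (a - b) powr (u - 1)" "norm b powr (u - 1) \<le> norm (a - b) powr (u - 1)"
    using True ba u by (auto intro!: powr_mono2)
  ultimately show ?thesis by linarith
next
  case False
  let ?x = "norm a" and ?y = "norm b"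
  have x: "?x > 0" using False by simp
  have "\<bar>?x powr (u - 2) - ?y powr (u - 2)\<bar> * ?y \<le> ?x powr (u - 2) * (?x - ?y)"
  proof (cases "b = 0")
    case False
    have "?x powr (u - 2) \<le> ?y powr (u - 2)" by (rule powr_mono2') (use u ba False in auto)
    then have "\<bar>?x powr (u - 2) - ?y powr (u - 2)\<bar> * ?y = ?y powr (u - 1) - ?x powr (u - 2) * ?y"
      using powr_minus_one_mult[of ?y "u - 1"] by (simp add: left_diff_distrib)
    also have "?y powr (u - 1) \<le> ?x powr (u - 1)" by (intro powr_mono2) (use u ba in auto)
    finally show ?thesis using powr_minus_one_mult[of ?x "u - 1"] by (simp add: right_diff_distrib)
  qed simp
  also have "... \<le> ?x powr (u - 2) * norm (a - b)" by (intro mult_left_mono norm_triangle_ineq2) auto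
  finally have "norm (gf u a - gf u b) \<le> 2 * (?x powr (u - 2) * norm (a - b))" using gf_diff_aux[of u a b] by simp
  also have "?x powr (u - 2) * norm (a - b) \<le> norm (a - b) powr (u - 1)"
  proof (cases "a = b")
    case False
    have "?x powr (u - 2) \<le> norm (a - b) powr (u - 2)"
      by (rule powr_mono2') (use u False \<open>\<not> (a = 0 \<or> norm a < norm (a - b))\<close> in auto)
    then have "?x powr (u - 2) * norm (a - b) \<le> norm (a - b) powr (u - 2) * norm (a - b)" by (intro mult_right_mono) auto
    then show ?thesis using powr_minus_one_mult[of "norm (a - b)" "u - 1"] by simp
  qed simp
  finally show ?thesis by simp
qed

lemma gf_diff_le2:
  assumes u: "1 < u" "u \<le> 2"
  shows "norm (gf u a - gf u b) \<le> 2 * norm (a - b) powr (u - 1)"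
  using gf_diff_le2_aux[OF u, of b a] gf_diff_le2_aux[OF u, of a b]
  by (cases "norm b \<le> norm a") (auto simp: norm_minus_commute)

text \<open>An upper bound for |a + h|^u needs the tangent at a + h. Replacing the duality map there
  by its value at a yields the linear term and an error that contains the increment of the
  map.\<close>

lemma powr_norm_expand:
  assumes u: "1 < u"
  shows "norm (a + h) powr u \<le> norm a powr u + u * Re (gf u a * h) + u * (norm (gf u (a + h) - gf u a) * norm h)"
proof -
  define b where "b = a + h"
  have r1: "norm b powr (u - 1) * (norm b - norm a) \<le> Re (gf u b * h)"
  proof -
    have "Re (gf u b * h) = norm b powr (u - 2) * Re (cnj b * (b - a))"
      unfolding gf_def b_def by (simp add: algebra_simps)
    also have "Re (cnj b * (b - a)) = (norm b)\<^sup>2 - Re (cnj b * a)"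
    proof -
      have "cnj b * b = cor ((norm b)\<^sup>2)" by (simp only: complex_norm_square mult.commute)
      then show ?thesis by (simp only: right_diff_distrib minus_complex.sel Re_complex_of_real)
    qed
    finally have 1: "Re (gf u b * h) = norm b powr (u - 2) * ((norm b)\<^sup>2 - Re (cnj b * a))" .
    have "Re (cnj b * a) \<le> norm b * norm a" using complex_Re_le_cmod[of "cnj b * a"] by (simp add: norm_mult)
    then have "norm b powr (u - 2) * ((norm b)\<^sup>2 - norm b * norm a) \<le> Re (gf u b * h)"
      unfolding 1 by (intro mult_left_mono) auto
    moreover have "norm b powr (u - 2) * ((norm b)\<^sup>2 - norm b * norm a) = (norm b powr (u - 1 - 1) * norm b) * (norm b - norm a)"
      by (simp add: power2_eq_square algebra_simps)
    ultimately show ?thesis unfolding powr_minus_one_mult[OF norm_ge_zero] by simp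
  qed
  have r2: "norm b powr u + u * norm b powr (u - 1) * (norm a - norm b) \<le> norm a powr u"
    by (rule powr_tangent) (use u in auto)
  have r3: "Re (gf u b * h) \<le> Re (gf u a * h) + norm (gf u b - gf u a) * norm h"
  proof -
    have "Re (gf u b * h) = Re (gf u a * h) + Re ((gf u b - gf u a) * h)" by (simp add: algebra_simps)
    then show ?thesis using complex_Re_le_cmod[of "(gf u b - gf u a) * h"] unfolding norm_mult by linarith
  qed
  have "norm b powr u \<le> norm a powr u + u * (norm b powr (u - 1) * (norm b - norm a))"
    using r2 by (simp add: algebra_simps)
  also have "u * (norm b powr (u - 1) * (norm b - norm a)) \<le> u * (Re (gf u a * h) + norm (gf u b - gf u a) * norm h)"
    using order_trans[OF r1 r3] u by (intro mult_left_mono) auto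
  finally show ?thesis by (simp only: b_def distrib_left add.assoc)
qed

section \<open>Hoelder-type bounds with crude constants, and the cross terms\<close>

lemma integral_norm_dominated:
  fixes w :: "real^'n::finite => 'b::{banach, second_countable_topology}"
  assumes F: "integrable lborel F" and w: "w \<in> borel_measurable borel" and le: "!!x. norm (w x) \<le> F x"
  shows "integrable lborel w" "(LINT x|lborel. norm (w x)) \<le> (LINT x|lborel. F x)"
proof -
  show i: "integrable lborel w"
    by (rule Bochner_Integration.integrable_bound[OF F]) (use w le in \<open>auto intro: order_trans[OF _ abs_ge_self]\<close>)
  show "(LINT x|lborel. norm (w x)) \<le> (LINT x|lborel. F x)"
    by (rule Bochner_Integration.integral_mono[OF integrable_norm[OF i] F]) (use le in auto)
qed

lemma powr_mult_le_sum:
  fixes x y u :: real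
  assumes "0 \<le> x" "0 \<le> y" "1 \<le> u"
  shows "x powr (u - 1) * y \<le> x powr u + y powr u"
proof (cases "y \<le> x")
  case True
  have "x powr (u - 1) * y \<le> x powr (u - 1) * x" by (intro mult_left_mono True) auto
  also have "... = x powr u" by (rule powr_minus_one_mult[OF assms(1)])
  finally show ?thesis by (simp add: add_increasing2)
next
  case False
  have "x powr (u - 1) * y \<le> y powr (u - 1) * y" by (intro mult_right_mono powr_mono2) (use False assms in auto)
  also have "... = y powr u" by (rule powr_minus_one_mult[OF assms(2)])
  finally show ?thesis by (simp add: add_increasing)
qed

lemma integral_scaled_le:
  assumes "np u f \<le> D powr u" "D > 0" "Lpi u f"
  shows "integrable lborel (%x. (norm (f x) / D) powr u)" "(LINT x|lborel. (norm (f x) / D) powr u) \<le> 1"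
proof -
  have eq: "(norm (f x) / D) powr u = norm (f x) powr u / D powr u" for x using assms(2) by (simp add: powr_divide)
  show "integrable lborel (%x. (norm (f x) / D) powr u)" unfolding eq using Lpi_int[OF assms(3)] by simp
  show "(LINT x|lborel. (norm (f x) / D) powr u) \<le> 1"
    unfolding eq using assms(1,2) by (simp add: np_def divide_le_eq_1)
qed

text \<open>After division by the bounds of the norms, the product is majorised pointwise by a sum
  of u-th powers, each with integral at most 1. The resulting constant 2 is harmless.\<close>

lemma holder2_crude:
  fixes f g :: "'n::finite cfun"
  assumes f: "Lpi u f" "np u f \<le> D powr u" "D > 0" and g: "Lpi u g" "np u g \<le> b powr u" "b > 0" and u: "1 \<le> u"
  shows "integrable lborel (%x. norm (f x) powr (u - 1) * norm (g x))"
    "(LINT x|lborel. norm (f x) powr (u - 1) * norm (g x)) \<le> 2 * (D powr (u - 1) * b)"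
proof -
  note [measurable] = Lpi_measurable[OF f(1)] Lpi_measurable[OF g(1)]
  let ?F = "%x. D powr (u - 1) * b * ((norm (f x) / D) powr u + (norm (g x) / b) powr u)"
  note F = integral_scaled_le[OF f(2,3,1)] and G = integral_scaled_le[OF g(2,3,1)]
  have iF: "integrable lborel ?F" using F(1) G(1) by auto
  have "norm (norm (f x) powr (u - 1) * norm (g x)) \<le> ?F x" for x
  proof -
    have "norm (f x) powr (u - 1) * norm (g x) = D powr (u - 1) * b * ((norm (f x) / D) powr (u - 1) * (norm (g x) / b))"
      using f(3) g(3) by (simp add: powr_divide)
    also have "... \<le> ?F x" by (intro mult_left_mono powr_mult_le_sum) (use f(3) g(3) u in auto)
    finally show ?thesis by simp
  qed
  note D = integral_norm_dominated[OF iF _ this]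
  show "integrable lborel (%x. norm (f x) powr (u - 1) * norm (g x))" by (rule D(1)) measurable
  have "(LINT x|lborel. norm (norm (f x) powr (u - 1) * norm (g x))) \<le> (LINT x|lborel. ?F x)" by (rule D(2)) measurable
  also have "... = D powr (u - 1) * b * ((LINT x|lborel. (norm (f x) / D) powr u) + (LINT x|lborel. (norm (g x) / b) powr u))"
    using F(1) G(1) by simp
  also have "... \<le> D powr (u - 1) * b * (1 + 1)" by (intro mult_left_mono add_mono F G) (use g(3) in auto)
  finally show "(LINT x|lborel. norm (f x) powr (u - 1) * norm (g x)) \<le> 2 * (D powr (u - 1) * b)" by simp
qed

text \<open>The same normalisation with a weight in the middle: pointwise all three factors are at
  most their maximum, whose u-th power is at most the sum of the three u-th powers.\<close>

lemma holder3_crude: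
  fixes f g :: "'n::finite cfun" and w :: "real^'n => real"
  assumes f: "Lpi u f" "np u f \<le> A powr u" "A > 0" and g: "Lpi u g" "np u g \<le> D powr u" "D > 0"
    and w: "w \<in> borel_measurable borel" "!!x. 0 \<le> w x" "integrable lborel (%x. w x powr u)" "(LINT x|lborel. w x powr u) \<le> B powr u" "B > 0"
    and u: "2 \<le> u"
  shows "integrable lborel (%x. norm (f x) * w x powr (u - 2) * norm (g x))"
    "(LINT x|lborel. norm (f x) * w x powr (u - 2) * norm (g x)) \<le> 3 * (A * B powr (u - 2) * D)"
proof -
  note [measurable] = Lpi_measurable[OF f(1)] Lpi_measurable[OF g(1)] w(1)
  let ?c = "A * B powr (u - 2) * D"
  let ?F = "%x. ?c * ((norm (f x) / A) powr u + (w x / B) powr u + (norm (g x) / D) powr u)"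
  note F = integral_scaled_le[OF f(2,3,1)] and G = integral_scaled_le[OF g(2,3,1)]
  have eq: "(w x / B) powr u = w x powr u / B powr u" for x using w(2)[of x] w(5) by (simp add: powr_divide)
  have W: "integrable lborel (%x. (w x / B) powr u)" "(LINT x|lborel. (w x / B) powr u) \<le> 1"
    unfolding eq using w by (auto simp: divide_le_eq_1)
  have iF: "integrable lborel ?F" using F(1) G(1) W(1) by auto
  have pt: "x * y powr (u - 2) * z \<le> x powr u + y powr u + z powr u" if "0 \<le> x" "0 \<le> y" "0 \<le> z" for x y z :: real
  proof -
    define M where "M = max x (max y z)"
    have M: "0 \<le> M" "x \<le> M" "y \<le> M" "z \<le> M" using that by (auto simp: M_def)
    have "x * y powr (u - 2) * z \<le> M * M powr (u - 2) * M"
      by (intro mult_mono powr_mono2) (use that M u in auto)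
    also have "... = M powr u" using powr_minus_one_mult[OF M(1), of "u - 1"] powr_minus_one_mult[OF M(1), of u]
      by (simp add: mult_ac)
    also have "M powr u \<le> x powr u + y powr u + z powr u" unfolding M_def max_def by auto
    finally show ?thesis .
  qed
  have "norm (norm (f x) * w x powr (u - 2) * norm (g x)) \<le> ?F x" for x
  proof -
    have "norm (f x) * w x powr (u - 2) * norm (g x) = ?c * ((norm (f x) / A) * (w x / B) powr (u - 2) * (norm (g x) / D))"
      using f(3) g(3) w(2)[of x] w(5) by (simp add: powr_divide)
    also have "... \<le> ?F x" by (intro mult_left_mono pt) (use f(3) g(3) w u in auto)
    finally show ?thesis using w(2)[of x] by simp
  qed
  note DD = integral_norm_dominated[OF iF _ this]
  show "integrable lborel (%x. norm (f x) * w x powr (u - 2) * norm (g x))" by (rule DD(1)) measurable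
  have "(LINT x|lborel. norm (norm (f x) * w x powr (u - 2) * norm (g x))) \<le> (LINT x|lborel. ?F x)" by (rule DD(2)) measurable
  also have "... = ?c * ((LINT x|lborel. (norm (f x) / A) powr u) + (LINT x|lborel. (w x / B) powr u) + (LINT x|lborel. (norm (g x) / D) powr u))"
    using F(1) G(1) W(1) by simp
  also have "... \<le> ?c * (1 + 1 + 1)" by (intro mult_left_mono add_mono F G W) (use f(3) g(3) in auto)
  finally show "(LINT x|lborel. norm (f x) * w x powr (u - 2) * norm (g x)) \<le> 3 * ?c"
    using w(2) by (simp add: abs_mult)
qed

lemma pg_gf:
  assumes S: "pg S" and u: "1 < u"
  shows "pg (%x. gf u (S x))"
proof (rule pg_le[OF S, of _ 1 "nat \<lceil>u - 1\<rceil>"])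
  note [measurable] = pg_measurable[OF S]
  show "(%x. gf u (S x)) \<in> borel_measurable borel" by measurable
  fix x
  have "norm (S x) powr (u - 1) \<le> (1 + norm (S x)) powr (u - 1)" by (intro powr_mono2) (use u in auto)
  also have "... \<le> (1 + norm (S x)) powr real (nat \<lceil>u - 1\<rceil>)" by (intro powr_mono) (use u in auto)
  also have "... = (1 + norm (S x)) ^ nat \<lceil>u - 1\<rceil>" by (rule powr_realpow) (simp add: add_pos_nonneg)
  finally show "norm (gf u (S x)) \<le> 1 * (1 + norm (S x)) ^ nat \<lceil>u - 1\<rceil>" by (simp add: norm_gf)
qed simp

lemma gf_pair_le: "1 \<le> u ==> norm (gf u z) * norm y \<le> norm z powr u + norm y powr u"
  unfolding norm_gf by (rule powr_mult_le_sum) auto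

text \<open>Moving the convolution to the other factor leaves the integral of K(s) F(s). The mean of
  \<open>K\<close> is 0, so F(s) may be replaced by F(s) - F(0), which sees only the increment of
  the duality map under a shift of \<open>S\<close>.\<close>

lemma cross_bound:
  fixes S g :: "'n::finite cfun"
  assumes K: "rapid K" "(LINT s|lborel. K s) = 0" and S: "Lpi u S" and g: "Lpi u g" and u: "1 < u"
    and E: "!!s. (LINT x|lborel. norm (gf u (S (x + s *\<^sub>R axis i 1)) - gf u (S x)) * norm (g x)) \<le> E s"
    and iE: "integrable lborel (%s. norm (K s) * E s)"
  shows "norm (LINT x|lborel. gf u (S x) * axc i K g x) \<le> (LINT s|lborel. norm (K s) * E s)"
proof -
  define P where "P x = gf u (S x)" for x
  have P: "pg P" unfolding P_def[abs_def] by (rule pg_gf[OF Lpi_pg[OF S] u])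
  have le: "norm (P x) * norm (g y) \<le> norm (S x) powr u + norm (g y) powr u" for x y
    unfolding P_def by (rule gf_pair_le) (use u in simp)
  define F where "F s = (LINT x|lborel. P (x + s *\<^sub>R axis i 1) * g x)" for s
  note pa = pairing_axis[OF K(1) P Lpi_pg[OF g] Lpi_int[OF S] Lpi_int[OF g] le, of i, folded F_def]
  have ip: "integrable lborel (%x. P (x + c) * g x)" for c
  proof -
    have "integrable lborel (%x. g x * P (x + c))"
      by (rule pairing_integrable[OF Lpi_pg[OF g] P Lpi_int[OF g] Lpi_int[OF S]]) (use le in \<open>simp add: mult.commute add.commute\<close>)
    then show ?thesis by (simp add: mult.commute)
  qed
  have iK: "integrable lborel K" using integrable_norm_cancel[OF _ ] rapid_integrable[OF K(1), of 0] rapid_measurable[OF K(1)]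
    by (simp add: integrable_norm_iff)
  have "(LINT x|lborel. P x * axc i K g x) = (LINT s|lborel. K s * F s) - (LINT s|lborel. K s) * F 0"
    using pa(1) K(2) by simp
  also have "... = (LINT s|lborel. K s * F s) - (LINT s|lborel. K s * F 0)" by simp
  also have "... = (LINT s|lborel. K s * (F s - F 0))"
    using pa(2) iK by (simp add: right_diff_distrib)
  finally have "norm (LINT x|lborel. P x * axc i K g x) \<le> (LINT s|lborel. norm (K s * (F s - F 0)))"
    using integral_norm_bound[of lborel "%s. K s * (F s - F 0)"] by simp
  also have "... \<le> (LINT s|lborel. norm (K s) * E s)"
  proof (rule Bochner_Integration.integral_mono)
    show "integrable lborel (%s. norm (K s * (F s - F 0)))"
      using Bochner_Integration.integrable_diff[OF pa(2) integrable_mult_left[OF iK, of "F 0"]]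
      by (intro integrable_norm) (simp add: right_diff_distrib)
    fix s
    have "F s - F 0 = (LINT x|lborel. (P (x + s *\<^sub>R axis i 1) - P x) * g x)"
      unfolding F_def using ip[of "s *\<^sub>R axis i 1"] ip[of 0] by (simp add: left_diff_distrib)
    then have "norm (F s - F 0) \<le> (LINT x|lborel. norm ((P (x + s *\<^sub>R axis i 1) - P x) * g x))"
      using integral_norm_bound[of lborel "%x. (P (x + s *\<^sub>R axis i 1) - P x) * g x"] by simp
    also have "... \<le> E s" using E[of s] by (simp add: P_def norm_mult)
    finally show "norm (K s * (F s - F 0)) \<le> norm (K s) * E s" by (simp add: norm_mult mult_left_mono)
  qed (rule iE)
  finally show ?thesis by (simp add: P_def)
qed

text \<open>\<open>powr_norm_expand\<close> integrated: \<open>X\<close> bounds the cross term of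
  the new summand with the sum so far, \<open>Y\<close> the error.\<close>

lemma telescoping_step:
  fixes S h :: "'n::finite cfun"
  assumes S: "Lpi u S" and h: "Lpi u h" and u: "1 < u"
    and X: "norm (LINT x|lborel. gf u (S x) * h x) \<le> X"
    and Y: "(LINT x|lborel. norm (gf u (S x + h x) - gf u (S x)) * norm (h x)) \<le> Y"
  shows "np u (%x. S x + h x) \<le> np u S + u * X + u * Y"
proof -
  note [measurable] = Lpi_measurable[OF S] Lpi_measurable[OF h]
  have Sh: "Lpi u (%x. S x + h x)" by (rule Lpi_add[OF S h]) (use u in simp)
  have i1: "integrable lborel (%x. gf u (S x) * h x)"
  proof (rule integral_norm_dominated(1))
    show "integrable lborel (%x. norm (S x) powr u + norm (h x) powr u)" using Lpi_int[OF S] Lpi_int[OF h] by auto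
    show "norm (gf u (S x) * h x) \<le> norm (S x) powr u + norm (h x) powr u" for x
      unfolding norm_mult by (rule gf_pair_le) (use u in simp)
  qed measurable
  have i2: "integrable lborel (%x. norm (gf u (S x + h x) - gf u (S x)) * norm (h x))"
  proof (rule integral_norm_dominated(1))
    show "integrable lborel (%x. norm (S x + h x) powr u + norm (h x) powr u + (norm (S x) powr u + norm (h x) powr u))"
      using Lpi_int[OF S] Lpi_int[OF h] Lpi_int[OF Sh] by auto
    fix x
    have "norm (gf u (S x + h x) - gf u (S x)) * norm (h x) \<le> (norm (gf u (S x + h x)) + norm (gf u (S x))) * norm (h x)"
      by (intro mult_right_mono norm_triangle_ineq4) auto
    also have "... \<le> norm (S x + h x) powr u + norm (h x) powr u + (norm (S x) powr u + norm (h x) powr u)"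
      unfolding distrib_right by (intro add_mono gf_pair_le) (use u in auto)
    finally show "norm (norm (gf u (S x + h x) - gf u (S x)) * norm (h x)) \<le> norm (S x + h x) powr u + norm (h x) powr u + (norm (S x) powr u + norm (h x) powr u)"
      by simp
  qed measurable
  have "np u (%x. S x + h x) \<le> (LINT x|lborel. norm (S x) powr u + u * Re (gf u (S x) * h x) + u * (norm (gf u (S x + h x) - gf u (S x)) * norm (h x)))"
    unfolding np_def
    by (rule Bochner_Integration.integral_mono[OF Lpi_int[OF Sh]],
        intro Bochner_Integration.integrable_add integrable_mult_right Lpi_int[OF S] integrable_Re[OF i1] i2,
        rule powr_norm_expand[OF u])
  also have "... = np u S + u * Re (LINT x|lborel. gf u (S x) * h x) + u * (LINT x|lborel. norm (gf u (S x + h x) - gf u (S x)) * norm (h x))"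
    unfolding np_def integral_Re[OF i1, symmetric] using Lpi_int[OF S] integrable_Re[OF i1] i2
    by (simp del: times_complex.sel)
  also have "... \<le> np u S + u * X + u * Y"
  proof -
    have "Re (LINT x|lborel. gf u (S x) * h x) \<le> X" using complex_Re_le_cmod X by (rule order_trans)
    then show ?thesis using Y u by (intro add_mono mult_left_mono) auto
  qed
  finally show ?thesis .
qed

text \<open>Schur's test for the kernel \<rho>^(l-k): its row and column sums are at most 1 / (1 -
  \<rho>), as the recursions for \<open>y\<close> and \<open>z\<close> show.\<close>

lemma geometric_convolution:
  fixes \<rho> :: real and x :: "nat => real"
  assumes \<rho>: "0 < \<rho>" "\<rho> < 1" and x: "!!l. 0 \<le> x l"
  shows "(\<Sum>l<L. \<Sum>k<l. \<rho> ^ (l - k) * (x l + x k)) \<le> 2 / (1 - \<rho>) * (\<Sum>l<L. x l)"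
proof -
  define y where "y l = (\<Sum>k<l. \<rho> ^ (l - k) * x k)" for l
  define z where "z l = (\<Sum>k<l. \<rho> ^ (l - k))" for l
  have ys: "y (Suc l) = \<rho> * (y l + x l)" for l
  proof -
    have "(\<Sum>k<l. \<rho> ^ (Suc l - k) * x k) = (\<Sum>k<l. \<rho> * (\<rho> ^ (l - k) * x k))"
      by (rule sum.cong) (auto simp: Suc_diff_le)
    then show ?thesis by (simp add: y_def sum_distrib_left distrib_left)
  qed
  have zs: "z (Suc l) = \<rho> * (z l + 1)" for l
  proof -
    have "(\<Sum>k<l. \<rho> ^ (Suc l - k)) = (\<Sum>k<l. \<rho> * \<rho> ^ (l - k))"
      by (rule sum.cong) (auto simp: Suc_diff_le)
    then show ?thesis by (simp add: z_def sum_distrib_left distrib_left)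
  qed
  have y0: "y l \<ge> 0" for l unfolding y_def by (intro sum_nonneg mult_nonneg_nonneg x) (use \<rho> in auto)
  have "(1 - \<rho>) * (\<Sum>l<L. y l) + y L = \<rho> * (\<Sum>l<L. x l)" for L
  proof (induction L)
    case 0 then show ?case by (simp add: y_def)
  next
    case (Suc L)
    have "(1 - \<rho>) * (\<Sum>l<Suc L. y l) + y (Suc L) = ((1 - \<rho>) * (\<Sum>l<L. y l) + y L) + \<rho> * x L"
      by (simp add: ys algebra_simps)
    then show ?case unfolding Suc by (simp add: distrib_left)
  qed
  then have "(1 - \<rho>) * (\<Sum>l<L. y l) \<le> \<rho> * (\<Sum>l<L. x l)" using y0[of L] by (metis le_add_same_cancel1)
  also have "... \<le> 1 * (\<Sum>l<L. x l)" by (intro mult_right_mono sum_nonneg x) (use \<rho> in auto)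
  finally have Y: "(\<Sum>l<L. y l) \<le> 1 / (1 - \<rho>) * (\<Sum>l<L. x l)" using \<rho> by (simp add: field_simps)
  have "(1 - \<rho>) * z l \<le> 1" for l
  proof (induction l)
    case 0 then show ?case by (simp add: z_def)
  next
    case (Suc l)
    have "(1 - \<rho>) * z (Suc l) = \<rho> * ((1 - \<rho>) * z l) + \<rho> * (1 - \<rho>)" by (simp add: zs algebra_simps)
    also have "... \<le> \<rho> * 1 + \<rho> * (1 - \<rho>)" using Suc \<rho> by (intro add_mono mult_left_mono) auto
    also have "... = 1 - (1 - \<rho>)\<^sup>2" by (simp add: power2_eq_square algebra_simps)
    finally show ?case using zero_le_power2[of "1 - \<rho>"] by linarith
  qed
  then have z: "z l \<le> 1 / (1 - \<rho>)" for l using \<rho> by (simp add: field_simps)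
  have "(\<Sum>l<L. \<Sum>k<l. \<rho> ^ (l - k) * (x l + x k)) = (\<Sum>l<L. z l * x l + y l)"
    by (simp add: z_def y_def distrib_left sum.distrib sum_distrib_right)
  also have "... = (\<Sum>l<L. z l * x l) + (\<Sum>l<L. y l)" by (rule sum.distrib)
  also have "... \<le> (\<Sum>l<L. 1 / (1 - \<rho>) * x l) + 1 / (1 - \<rho>) * (\<Sum>l<L. x l)"
    by (intro add_mono sum_mono mult_right_mono z x Y)
  also have "... = 2 / (1 - \<rho>) * (\<Sum>l<L. x l)" by (simp add: sum_divide_distrib[symmetric])
  finally show ?thesis .
qed

section \<open>Partial sums of pieces along one axis\<close>

lemma abs_powr_integrable:
  assumes K: "rapid K" and \<alpha>: "0 < \<alpha>" "\<alpha> \<le> 1"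
  shows "integrable lborel (%s. norm (K s) * (c * \<bar>s\<bar> powr \<alpha>))"
proof -
  note [measurable] = rapid_measurable[OF K]
  have "integrable lborel (%s. norm (K s) * \<bar>s\<bar> powr \<alpha>)"
  proof (rule Bochner_Integration.integrable_bound[OF rapid_integrable[OF K, of 1]])
    have "\<bar>s\<bar> powr \<alpha> \<le> 1 + \<bar>s\<bar>" for s :: real
    proof -
      have "\<bar>s\<bar> powr \<alpha> \<le> (1 + \<bar>s\<bar>) powr \<alpha>" by (intro powr_mono2) (use \<alpha> in auto)
      also have "... \<le> (1 + \<bar>s\<bar>) powr 1" by (intro powr_mono) (use \<alpha> in auto)
      finally show ?thesis by simp
    qed
    then show "AE s in lborel. norm (norm (K s) * \<bar>s\<bar> powr \<alpha>) \<le> norm ((1 + \<bar>s\<bar>) ^ 1 * norm (K s))"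
      by (auto simp: abs_mult mult.commute[of _ "norm (K _)"] intro!: mult_left_mono)
  qed measurable
  from integrable_mult_right[OF this, of c] show ?thesis by (simp add: mult_ac)
qed

lemma sum_powr_le:
  fixes a :: "'k => real"
  assumes "finite I" "!!k. k \<in> I ==> 0 \<le> a k" "0 < \<alpha>" "\<alpha> \<le> 1"
  shows "(\<Sum>k\<in>I. a k) powr \<alpha> \<le> (\<Sum>k\<in>I. a k powr \<alpha>)"
  using assms(1,2)
proof (induction I)
  case (insert k I)
  have two: "(x + y) powr \<alpha> \<le> x powr \<alpha> + y powr \<alpha>" if "0 \<le> x" "0 \<le> y" for x y :: real
  proof (cases "x + y = 0")
    case False
    then have s: "x + y > 0" using that by simp
    have "t powr \<alpha> \<ge> t" if "0 \<le> t" "t \<le> 1" for t :: real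
      using powr_mono'[of \<alpha> 1 t] assms(4) that by (cases "t = 0") auto
    from this[of "x / (x + y)"] this[of "y / (x + y)"] that s
    have "1 \<le> (x / (x + y)) powr \<alpha> + (y / (x + y)) powr \<alpha>"
      by (smt (verit, best) add_divide_distrib divide_le_eq_1_pos divide_nonneg_pos divide_self)
    then show ?thesis using that s by (simp add: powr_divide field_simps)
  qed (use that in simp)
  have "(\<Sum>k\<in>insert k I. a k) powr \<alpha> \<le> a k powr \<alpha> + (\<Sum>k\<in>I. a k) powr \<alpha>"
    using insert.hyps insert.prems two[of "a k" "sum a I"] by (auto intro: sum_nonneg)
  also have "... \<le> a k powr \<alpha> + (\<Sum>k\<in>I. a k powr \<alpha>)" using insert by auto
  finally show ?case using insert.hyps by simp
qed simp

text \<open>\<open>b k\<close> majorises the L_u norm of \<open>g k\<close> and is kept strictly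
  positive, because the normalisations in the Hoelder bounds divide by it.\<close>

locale axis_sums =
  fixes K :: "nat => real => complex" and A u :: real and i :: "'n::finite"
    and g :: "nat => 'n cfun" and b :: "nat => real" and h S
  assumes K: "kfam K A" and u: "1 < u" and g: "!!k. Lpi u (g k)"
    and b: "!!k. np u (g k) \<le> b k powr u" "!!k. b k > 0"
  defines "h \<equiv> %k. axc i (K k) (g k)" and "S \<equiv> %l x. \<Sum>k<l. h k x"
begin

lemma u1: "1 \<le> u" using u by simp

lemma h: "Lpi u (h k)" "np u (h k) \<le> (A * b k) powr u"
  unfolding h_def by (rule kfam_bound[OF K g u1 b])+

lemma LS: "Lpi u (S l)"
  unfolding S_def by (rule Lpi_sum) (use u h in auto)

lemma S_Suc: "S (Suc l) = (%x. S l x + h l x)"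
  by (auto simp: S_def)

lemma diff_h:
  assumes "s \<noteq> 0"
  shows "Lpi u (%x. h k (x + s *\<^sub>R axis i 1) - h k x)"
    "np u (%x. h k (x + s *\<^sub>R axis i 1) - h k x) \<le> (A * 2 ^ k * \<bar>s\<bar> * b k) powr u"
    "A * 2 ^ k * \<bar>s\<bar> * b k > 0"
  unfolding h_def using kfam_difference[OF K g u1 b assms] kfamD(1)[OF K] b(2)[of k] assms by auto

lemma S_diff: "S l (x + c) - S l x = (\<Sum>k<l. h k (x + c) - h k x)"
  by (simp add: S_def sum_subtractf)

lemma np_S1: "np u (S 1) \<le> (A * b 0) powr u"
  using h(2)[of 0] by (simp add: S_def)

lemma S_measurable [measurable]: "S l \<in> borel_measurable borel" "g l \<in> borel_measurable borel" "h l \<in> borel_measurable borel"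
  using LS g h(1) Lpi_measurable by blast+

text \<open>By Hoelder continuity of the duality map, a shift of \<open>S l\<close> by s contributes
  (2^k |s| b_k)^(u-1) for each earlier piece k. The moment of order u - 1 of the l-th kernel
  supplies 2^(-l(u-1)), so the pieces k and l interact with weight 2^((1-u)(l-k)).\<close>

lemma step_le2:
  assumes u2: "u \<le> 2" and l: "l > 0"
  shows "np u (S (Suc l)) \<le> np u (S l) + u * (\<Sum>k<l. 4 * A powr u * (2 powr (1 - u)) ^ (l - k) * (b l * b k powr (u - 1))) + u * (2 * (A * b l) powr u)"
proof -
  have A: "A > 0" by (rule kfamD(1)[OF K])
  define c where "c = (\<Sum>k<l. 4 * b l * (A * 2 ^ k * b k) powr (u - 1))"
  have c0: "c \<ge> 0" unfolding c_def by (intro sum_nonneg mult_nonneg_nonneg) (use b(2)[of l] in auto)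
  have X: "norm (LINT x|lborel. gf u (S l x) * h l x) \<le> (LINT s|lborel. norm (K l s) * (c * \<bar>s\<bar> powr (u - 1)))"
    unfolding h_def[of] 
  proof (rule cross_bound[OF kfamD(2)[OF K] kfamD(5)[OF K l] LS g u])
    show "integrable lborel (%s. norm (K l s) * (c * \<bar>s\<bar> powr (u - 1)))"
      by (rule abs_powr_integrable[OF kfamD(2)[OF K]]) (use u u2 in auto)
    fix s :: real
    show "(LINT x|lborel. norm (gf u (S l (x + s *\<^sub>R axis i 1)) - gf u (S l x)) * norm (g l x)) \<le> c * \<bar>s\<bar> powr (u - 1)"
    proof (cases "s = 0")
      case False
      let ?d = "%k x. h k (x + s *\<^sub>R axis i 1) - h k x"
      note H = holder2_crude[OF diff_h(1,2,3)[OF False] g b u1]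
      have pt: "norm (gf u (S l (x + s *\<^sub>R axis i 1)) - gf u (S l x)) * norm (g l x) \<le> (\<Sum>k<l. 2 * (norm (?d k x) powr (u - 1) * norm (g l x)))" for x
      proof -
        have "norm (gf u (S l (x + s *\<^sub>R axis i 1)) - gf u (S l x)) \<le> 2 * norm (\<Sum>k<l. ?d k x) powr (u - 1)"
          using gf_diff_le2[OF u u2] unfolding S_diff[symmetric] by blast
        also have "norm (\<Sum>k<l. ?d k x) powr (u - 1) \<le> (\<Sum>k<l. norm (?d k x)) powr (u - 1)"
          by (intro powr_mono2 norm_sum) (use u in auto)
        also have "... \<le> (\<Sum>k<l. norm (?d k x) powr (u - 1))" by (rule sum_powr_le) (use u u2 in auto)
        finally have "norm (gf u (S l (x + s *\<^sub>R axis i 1)) - gf u (S l x)) \<le> 2 * (\<Sum>k<l. norm (?d k x) powr (u - 1))" by simp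
        then have "norm (gf u (S l (x + s *\<^sub>R axis i 1)) - gf u (S l x)) * norm (g l x) \<le> 2 * (\<Sum>k<l. norm (?d k x) powr (u - 1)) * norm (g l x)"
          by (intro mult_right_mono) auto
        then show ?thesis by (simp add: sum_distrib_left sum_distrib_right mult.assoc)
      qed
      have iF: "integrable lborel (%x. \<Sum>k<l. 2 * (norm (?d k x) powr (u - 1) * norm (g l x)))"
        using H(1) by (intro Bochner_Integration.integrable_sum integrable_mult_right)
      have "(LINT x|lborel. norm (norm (gf u (S l (x + s *\<^sub>R axis i 1)) - gf u (S l x)) * norm (g l x))) \<le> (LINT x|lborel. (\<Sum>k<l. 2 * (norm (?d k x) powr (u - 1) * norm (g l x))))"
        by (rule integral_norm_dominated(2)[OF iF]) (use pt in auto)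
      also have "... = (\<Sum>k<l. 2 * (LINT x|lborel. norm (?d k x) powr (u - 1) * norm (g l x)))"
        using H(1) by (subst Bochner_Integration.integral_sum) auto
      also have "... \<le> (\<Sum>k<l. 2 * (2 * ((A * 2 ^ k * \<bar>s\<bar> * b k) powr (u - 1) * b l)))"
        by (intro sum_mono mult_left_mono H(2)) auto
      also have "... = c * \<bar>s\<bar> powr (u - 1)"
        unfolding c_def sum_distrib_right
      proof (rule sum.cong[OF refl])
        fix k
        have "(A * 2 ^ k * \<bar>s\<bar> * b k) powr (u - 1) = (A * 2 ^ k * b k) powr (u - 1) * \<bar>s\<bar> powr (u - 1)"
          using A b(2)[of k] by (subst powr_mult[symmetric]) (auto simp: mult_ac)
        then show "2 * (2 * ((A * 2 ^ k * \<bar>s\<bar> * b k) powr (u - 1) * b l)) = 4 * b l * (A * 2 ^ k * b k) powr (u - 1) * \<bar>s\<bar> powr (u - 1)"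
          by simp
      qed
      finally show ?thesis by simp
    qed (use c0 in simp)
  qed
  also have "(LINT s|lborel. norm (K l s) * (c * \<bar>s\<bar> powr (u - 1))) = c * (LINT s|lborel. norm (K l s) * \<bar>s\<bar> powr (u - 1))"
    by (subst integral_mult_right_zero[symmetric]) (simp add: mult_ac)
  also have "... \<le> c * (A * 2 powr (- (u - 1) * real l))"
    by (intro mult_left_mono c0 kfamD(6)[OF K l]) (use u u2 in auto)
  also have "... = (\<Sum>k<l. 4 * A powr u * (2 powr (1 - u)) ^ (l - k) * (b l * b k powr (u - 1)))"
    unfolding c_def sum_distrib_right
  proof (rule sum.cong[OF refl])
    fix k assume "k \<in> {..<l}"
    then have kl: "k \<le> l" by simp
    have "(A * 2 ^ k * b k) powr (u - 1) = A powr (u - 1) * 2 powr (real k * (u - 1)) * b k powr (u - 1)"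
      using A b(2)[of k] by (simp add: powr_mult powr_powr flip: powr_realpow)
    moreover have "(2 powr (1 - u)) ^ (l - k) = 2 powr (real k * (u - 1)) * 2 powr (- (u - 1) * real l)"
      using kl by (simp add: powr_powr flip: powr_add powr_realpow) (simp add: algebra_simps of_nat_diff)
    moreover have "A powr u = A powr (u - 1) * A" using powr_minus_one_mult[of A u] A by simp
    ultimately show "4 * b l * (A * 2 ^ k * b k) powr (u - 1) * (A * 2 powr (- (u - 1) * real l)) =
       4 * A powr u * (2 powr (1 - u)) ^ (l - k) * (b l * b k powr (u - 1))" by (simp add: mult_ac)
  qed
  finally have X': "norm (LINT x|lborel. gf u (S l x) * h l x) \<le> (\<Sum>k<l. 4 * A powr u * (2 powr (1 - u)) ^ (l - k) * (b l * b k powr (u - 1)))" .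
  have Y: "(LINT x|lborel. norm (gf u (S l x + h l x) - gf u (S l x)) * norm (h l x)) \<le> 2 * (A * b l) powr u"
  proof -
    have "(LINT x|lborel. norm (norm (gf u (S l x + h l x) - gf u (S l x)) * norm (h l x))) \<le> (LINT x|lborel. 2 * norm (h l x) powr u)"
    proof (rule integral_norm_dominated(2))
      show "integrable lborel (%x. 2 * norm (h l x) powr u)" using Lpi_int[OF h(1)] by auto
      fix x
      have "norm (gf u (S l x + h l x) - gf u (S l x)) * norm (h l x) \<le> 2 * norm (h l x) powr (u - 1) * norm (h l x)"
        using gf_diff_le2[OF u u2, of "S l x + h l x" "S l x"] by (intro mult_right_mono) auto
      also have "... = 2 * norm (h l x) powr u" using powr_minus_one_mult[of "norm (h l x)" u] by simp
      finally show "norm (norm (gf u (S l x + h l x) - gf u (S l x)) * norm (h l x)) \<le> 2 * norm (h l x) powr u" by simp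
    qed measurable
    also have "... \<le> 2 * (A * b l) powr u" using h(2)[of l] by (simp add: np_def)
    finally show ?thesis by simp
  qed
  show ?thesis unfolding S_Suc by (rule telescoping_step[OF LS h(1) u X' Y])
qed

text \<open>For u \<ge> 2 the increment of the duality map carries the (u-2)-th power of the larger
  of the two moduli as a weight, so a bound \<open>M\<close> for the partial sums enters; the first
  moment of the kernel gives the decay 2^(k-l).\<close>

lemma step_ge2:
  assumes u2: "2 \<le> u" and l: "l > 0" and M: "M > 0" "np u (S l) \<le> M powr u" "np u (S (Suc l)) \<le> M powr u"
  shows "np u (S (Suc l)) \<le> np u (S l) + u * (\<Sum>k<l. 3 * u * A\<^sup>2 * (2 * M) powr (u - 2) * (1 / 2) ^ (l - k) * (b l * b k)) +
      u * (3 * u * A\<^sup>2 * (2 * M) powr (u - 2) * (b l)\<^sup>2)"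
proof -
  have A: "A > 0" by (rule kfamD(1)[OF K])
  define c where "c = (\<Sum>k<l. 3 * u * (2 * M) powr (u - 2) * b l * (A * 2 ^ k * b k))"
  have c0: "c \<ge> 0" unfolding c_def by (intro sum_nonneg mult_nonneg_nonneg) (use b(2) A u in \<open>auto intro: less_imp_le\<close>)
  \<comment> \<open>The maximum of two functions of norm at most \<open>M\<close> has norm at most 2
    M, since 2 \<le> 2^u.\<close>
  have maxw: "integrable lborel (%x. max (norm (f x)) (norm (f' x)) powr u)"
    "(LINT x|lborel. max (norm (f x)) (norm (f' x)) powr u) \<le> (2 * M) powr u"
    if f: "Lpi u f" "np u f \<le> M powr u" "Lpi u f'" "np u f' \<le> M powr u" for f f' :: "'n cfun"
  proof -
    note [measurable] = Lpi_measurable[OF f(1)] Lpi_measurable[OF f(3)]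
    have i: "integrable lborel (%x. norm (f x) powr u + norm (f' x) powr u)" using Lpi_int[OF f(1)] Lpi_int[OF f(3)] by auto
    have le: "norm (max (norm (f x)) (norm (f' x)) powr u) \<le> norm (f x) powr u + norm (f' x) powr u" for x
      by (auto simp: max_def)
    note D = integral_norm_dominated[OF i _ le]
    show "integrable lborel (%x. max (norm (f x)) (norm (f' x)) powr u)" by (rule D(1)) measurable
    have "(LINT x|lborel. norm (max (norm (f x)) (norm (f' x)) powr u)) \<le> np u f + np u f'"
      using D(2) Lpi_int[OF f(1)] Lpi_int[OF f(3)] by (simp add: np_def)
    also have "... \<le> 2 powr 1 * M powr u" using f by simp
    also have "... \<le> 2 powr u * M powr u" by (intro mult_right_mono powr_mono) (use u in auto)
    finally show "(LINT x|lborel. max (norm (f x)) (norm (f' x)) powr u) \<le> (2 * M) powr u" using M by (simp add: powr_mult)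
  qed
  have X: "norm (LINT x|lborel. gf u (S l x) * h l x) \<le> (LINT s|lborel. norm (K l s) * (c * \<bar>s\<bar> powr 1))"
    unfolding h_def[of]
  proof (rule cross_bound[OF kfamD(2)[OF K] kfamD(5)[OF K l] LS g u])
    show "integrable lborel (%s. norm (K l s) * (c * \<bar>s\<bar> powr 1))"
      by (rule abs_powr_integrable[OF kfamD(2)[OF K]]) auto
    fix s :: real
    show "(LINT x|lborel. norm (gf u (S l (x + s *\<^sub>R axis i 1)) - gf u (S l x)) * norm (g l x)) \<le> c * \<bar>s\<bar> powr 1"
    proof (cases "s = 0")
      case False
      let ?d = "%k x. h k (x + s *\<^sub>R axis i 1) - h k x"
      let ?w = "%x. max (norm (S l (x + s *\<^sub>R axis i 1))) (norm (S l x))"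
      have w: "integrable lborel (%x. ?w x powr u)" "(LINT x|lborel. ?w x powr u) \<le> (2 * M) powr u"
        using maxw[OF Lpi_translate[OF LS[of l], of "s *\<^sub>R axis i 1"] _ LS M(2)] M(2) by (auto simp: np_translate[OF LS])
      have H: "integrable lborel (%x. norm (g l x) * ?w x powr (u - 2) * norm (?d k x))"
        "(LINT x|lborel. norm (g l x) * ?w x powr (u - 2) * norm (?d k x)) \<le> 3 * (b l * (2 * M) powr (u - 2) * (A * 2 ^ k * \<bar>s\<bar> * b k))" for k
        by (rule holder3_crude[OF g b diff_h[OF False] _ _ w _ u2]; (use M in \<open>auto simp: max_def; measurable\<close>)?; simp add: M le_max_iff_disj)+
      have pt: "norm (gf u (S l (x + s *\<^sub>R axis i 1)) - gf u (S l x)) * norm (g l x) \<le> (\<Sum>k<l. u * (norm (g l x) * ?w x powr (u - 2) * norm (?d k x)))" for x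
      proof -
        have "norm (gf u (S l (x + s *\<^sub>R axis i 1)) - gf u (S l x)) \<le> u * ?w x powr (u - 2) * norm (\<Sum>k<l. ?d k x)"
          using gf_diff_ge2[OF u2] unfolding S_diff[symmetric] by blast
        also have "... \<le> u * ?w x powr (u - 2) * (\<Sum>k<l. norm (?d k x))"
          by (intro mult_left_mono norm_sum) (use u in auto)
        finally have "norm (gf u (S l (x + s *\<^sub>R axis i 1)) - gf u (S l x)) * norm (g l x) \<le> u * ?w x powr (u - 2) * (\<Sum>k<l. norm (?d k x)) * norm (g l x)"
          by (intro mult_right_mono) auto
        then show ?thesis by (simp add: sum_distrib_left sum_distrib_right mult_ac)
      qed
      have iF: "integrable lborel (%x. \<Sum>k<l. u * (norm (g l x) * ?w x powr (u - 2) * norm (?d k x)))"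
        using H(1) by (intro Bochner_Integration.integrable_sum integrable_mult_right)
      have "(LINT x|lborel. norm (norm (gf u (S l (x + s *\<^sub>R axis i 1)) - gf u (S l x)) * norm (g l x))) \<le> (LINT x|lborel. (\<Sum>k<l. u * (norm (g l x) * ?w x powr (u - 2) * norm (?d k x))))"
        by (rule integral_norm_dominated(2)[OF iF]) (use pt in auto)
      also have "... = (\<Sum>k<l. u * (LINT x|lborel. norm (g l x) * ?w x powr (u - 2) * norm (?d k x)))"
        using H(1) by (subst Bochner_Integration.integral_sum) auto
      also have "... \<le> (\<Sum>k<l. u * (3 * (b l * (2 * M) powr (u - 2) * (A * 2 ^ k * \<bar>s\<bar> * b k))))"
        by (intro sum_mono mult_left_mono H(2)) (use u in auto)
      also have "... = c * \<bar>s\<bar> powr 1"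
        unfolding c_def sum_distrib_right by (rule sum.cong[OF refl]) simp
      finally show ?thesis by simp
    qed (use c0 in simp)
  qed
  also have "(LINT s|lborel. norm (K l s) * (c * \<bar>s\<bar> powr 1)) = c * (LINT s|lborel. norm (K l s) * \<bar>s\<bar> powr 1)"
    by (subst integral_mult_right_zero[symmetric]) (simp add: mult_ac)
  also have "... \<le> c * (A * 2 powr (- 1 * real l))"
    by (intro mult_left_mono c0 kfamD(6)[OF K l]) auto
  also have "... = (\<Sum>k<l. 3 * u * A\<^sup>2 * (2 * M) powr (u - 2) * (1 / 2) ^ (l - k) * (b l * b k))"
    unfolding c_def sum_distrib_right
  proof (rule sum.cong[OF refl])
    fix k assume "k \<in> {..<l}"
    then have "(1 / 2) ^ (l - k) = 2 ^ k * 2 powr (- 1 * real l)"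
      by (simp add: powr_minus powr_realpow power_divide field_simps flip: power_add)
    then show "3 * u * (2 * M) powr (u - 2) * b l * (A * 2 ^ k * b k) * (A * 2 powr (- 1 * real l)) =
       3 * u * A\<^sup>2 * (2 * M) powr (u - 2) * (1 / 2) ^ (l - k) * (b l * b k)" by (simp add: power2_eq_square)
  qed
  finally have X': "norm (LINT x|lborel. gf u (S l x) * h l x) \<le> (\<Sum>k<l. 3 * u * A\<^sup>2 * (2 * M) powr (u - 2) * (1 / 2) ^ (l - k) * (b l * b k))" .
  have Y: "(LINT x|lborel. norm (gf u (S l x + h l x) - gf u (S l x)) * norm (h l x)) \<le> 3 * u * A\<^sup>2 * (2 * M) powr (u - 2) * (b l)\<^sup>2"
  proof -
    let ?w = "%x. max (norm (S (Suc l) x)) (norm (S l x))"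
    note w = maxw[OF LS M(3) LS M(2)]
    have Ab: "A * b l > 0" using A b(2)[of l] by simp
    have H: "integrable lborel (%x. norm (h l x) * ?w x powr (u - 2) * norm (h l x))"
        "(LINT x|lborel. norm (h l x) * ?w x powr (u - 2) * norm (h l x)) \<le> 3 * ((A * b l) * (2 * M) powr (u - 2) * (A * b l))"
      by (rule holder3_crude[OF h Ab h Ab _ _ w _ u2]; (use M in \<open>auto simp: max_def; measurable\<close>)?; simp add: M le_max_iff_disj)+
    have "(LINT x|lborel. norm (norm (gf u (S l x + h l x) - gf u (S l x)) * norm (h l x))) \<le> (LINT x|lborel. u * (norm (h l x) * ?w x powr (u - 2) * norm (h l x)))"
    proof (rule integral_norm_dominated(2))
      show "integrable lborel (%x. u * (norm (h l x) * ?w x powr (u - 2) * norm (h l x)))" using H(1) by auto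
      fix x
      have "norm (gf u (S l x + h l x) - gf u (S l x)) * norm (h l x) \<le> u * ?w x powr (u - 2) * norm (h l x) * norm (h l x)"
        using gf_diff_ge2[OF u2, of "S l x + h l x" "S l x"] unfolding S_Suc by (intro mult_right_mono) auto
      then show "norm (norm (gf u (S l x + h l x) - gf u (S l x)) * norm (h l x)) \<le> u * (norm (h l x) * ?w x powr (u - 2) * norm (h l x))"
        by (simp add: mult_ac)
    qed measurable
    also have "... = u * (LINT x|lborel. norm (h l x) * ?w x powr (u - 2) * norm (h l x))" by simp
    also have "... \<le> u * (3 * ((A * b l) * (2 * M) powr (u - 2) * (A * b l)))" by (intro mult_left_mono H) (use u in auto)
    finally show ?thesis by (simp add: power2_eq_square mult_ac)
  qed
  show ?thesis unfolding S_Suc by (rule telescoping_step[OF LS h(1) u X' Y])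
qed

end

context axis_sums
begin

lemma np_S0: "np u (S 0) = 0"
  by (simp add: S_def np_def)

text \<open>The steps are summed: mixed products are split into u-th powers and
  \<open>geometric_convolution\<close> adds up the interactions. The initial piece is estimated
  directly, since the kernel of level 0 has no cancellation.\<close>

lemma sum_le2:
  assumes u2: "u \<le> 2"
  shows "np u (S L) \<le> A powr u * (8 * u / (1 - 2 powr (1 - u)) + 1 + 2 * u) * (\<Sum>l<L. b l powr u)"
proof -
  have A: "A > 0" by (rule kfamD(1)[OF K])
  define \<rho> :: real where "\<rho> = 2 powr (1 - u)"
  have \<rho>: "0 < \<rho>" "\<rho> < 1" using u by (auto simp: \<rho>_def powr_less_one)
  define c where "c l = u * (\<Sum>k<l. 4 * A powr u * \<rho> ^ (l - k) * (b l powr u + b k powr u)) + (1 + 2 * u) * (A * b l) powr u" for l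
  have "np u (S L) \<le> (\<Sum>l<L. c l)"
  proof (induction L)
    case (Suc l)
    have "np u (S (Suc l)) \<le> np u (S l) + c l"
    proof (cases "l = 0")
      case True
      have "np u (S 1) \<le> (A * b 0) powr u" by (rule np_S1)
      also have "... \<le> (1 + 2 * u) * (A * b 0) powr u" using u by (simp add: distrib_right)
      finally show ?thesis using True by (simp add: np_S0 c_def)
    next
      case False
      have "np u (S (Suc l)) \<le> np u (S l) + u * (\<Sum>k<l. 4 * A powr u * \<rho> ^ (l - k) * (b l * b k powr (u - 1))) + u * (2 * (A * b l) powr u)"
        unfolding \<rho>_def by (rule step_le2[OF u2]) (use False in simp)
      also have "u * (\<Sum>k<l. 4 * A powr u * \<rho> ^ (l - k) * (b l * b k powr (u - 1))) \<le> u * (\<Sum>k<l. 4 * A powr u * \<rho> ^ (l - k) * (b l powr u + b k powr u))"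
      proof (intro mult_left_mono sum_mono)
        fix k
        show "b l * b k powr (u - 1) \<le> b l powr u + b k powr u"
          using powr_mult_le_sum[of "b k" "b l" u] b(2)[of k] b(2)[of l] u by (simp add: mult.commute add.commute)
      qed (use u \<rho> in auto)
      also have "u * (2 * (A * b l) powr u) \<le> (1 + 2 * u) * (A * b l) powr u" by (simp add: distrib_right)
      finally show ?thesis by (simp add: c_def add.assoc)
    qed
    then show ?case using Suc by simp
  qed (simp add: np_S0)
  also have "(\<Sum>l<L. c l) = 4 * u * A powr u * (\<Sum>l<L. \<Sum>k<l. \<rho> ^ (l - k) * (b l powr u + b k powr u)) + (1 + 2 * u) * A powr u * (\<Sum>l<L. b l powr u)"
  proof -
    have "c l = 4 * u * A powr u * (\<Sum>k<l. \<rho> ^ (l - k) * (b l powr u + b k powr u)) + (1 + 2 * u) * A powr u * b l powr u" for l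
    proof -
      have "(A * b l) powr u = A powr u * b l powr u" using A b(2)[of l] by (simp add: powr_mult)
      moreover have "u * (\<Sum>k<l. 4 * A powr u * \<rho> ^ (l - k) * (b l powr u + b k powr u)) = 4 * u * A powr u * (\<Sum>k<l. \<rho> ^ (l - k) * (b l powr u + b k powr u))"
        unfolding sum_distrib_left by (rule sum.cong) (auto simp: mult_ac)
      ultimately show ?thesis unfolding c_def by simp
    qed
    then show ?thesis by (simp add: sum.distrib sum_distrib_left)
  qed
  also have "... \<le> 4 * u * A powr u * (2 / (1 - \<rho>) * (\<Sum>l<L. b l powr u)) + (1 + 2 * u) * A powr u * (\<Sum>l<L. b l powr u)"
    by (intro add_mono mult_left_mono geometric_convolution \<rho> order_refl) (use u in auto)
  also have "... = A powr u * (8 * u / (1 - \<rho>) + 1 + 2 * u) * (\<Sum>l<L. b l powr u)"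
    using \<rho> by (simp add: field_simps)
  finally show ?thesis by (simp add: \<rho>_def)
qed

text \<open>A self-bounding argument. The steps bound every partial sum by M^(u-2) times a quadratic
  expression in \<open>b\<close>, where M^u is itself the largest of these quantities; from M^u
  \<le> (1 + D) M^(u-2) B the power M^(u-2) cancels, as \<open>M\<close> is finite and
  positive.\<close>

lemma sum_ge2:
  assumes u2: "2 \<le> u" and L: "L > 0"
  shows "np u (S L) \<le> ((1 + (15 * 2 powr (u - 2) * u\<^sup>2 * A\<^sup>2 + A powr u)) * (\<Sum>l<L. (b l)\<^sup>2)) powr (u / 2)"
proof -
  have A: "A > 0" by (rule kfamD(1)[OF K])
  define B where "B = (\<Sum>l<L. (b l)\<^sup>2)"
  have B0: "B > 0" unfolding B_def using L b(2) by (intro sum_pos zero_less_power) auto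
  \<comment> \<open>Here 15 is 3 times 5: the factor 3 comes from the Hoelder bound with three
    factors, and 5 is 4 from the geometric sum with ratio 1/2 plus 1 from the diagonal term. The
    last summand pays for the initial piece.\<close>
  define D where "D = 15 * 2 powr (u - 2) * u\<^sup>2 * A\<^sup>2 + A powr u"
  have D0: "D > 0" unfolding D_def using A by (intro add_nonneg_pos) auto
  \<comment> \<open>Including \<open>B powr (u / 2)\<close> makes \<open>M\<close> positive and at
    least \<open>b 0\<close>, as the initial piece requires.\<close>
  define V where "V = Max (insert (B powr (u / 2)) ((%l. np u (S l)) ` {..L}))"
  have V1: "B powr (u / 2) \<le> V" unfolding V_def by (rule Max_ge) auto
  have V2: "np u (S l) \<le> V" if "l \<le> L" for l unfolding V_def by (rule Max_ge) (use that in auto)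
  have V3: "V = B powr (u / 2) \<or> (\<exists>l\<le>L. V = np u (S l))"
    using Max_in[of "insert (B powr (u / 2)) ((%l. np u (S l)) ` {..L})"] unfolding V_def by auto
  have V0: "V > 0" using less_le_trans[OF _ V1, of 0] B0 by simp
  define M where "M = V powr (1 / u)"
  have M0: "M > 0" using V0 by (simp add: M_def)
  have MV: "M powr u = V" using V0 u by (simp add: M_def powr_powr)
  have BM: "sqrt B \<le> M"
  proof -
    have "sqrt B = (B powr (u / 2)) powr (1 / u)" using u B0 by (simp add: powr_powr powr_half_sqrt)
    also have "... \<le> M" unfolding M_def by (intro powr_mono2 V1) (use u in auto)
    finally show ?thesis .
  qed
  have bM: "b 0 \<le> M"
  proof -
    have "(b 0)\<^sup>2 \<le> B" unfolding B_def by (rule member_le_sum) (use L in auto)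
    then have "b 0 \<le> sqrt B" by (rule real_le_rsqrt)
    then show ?thesis using BM by simp
  qed
  define q where "q = 3 * u\<^sup>2 * A\<^sup>2 * (2 * M) powr (u - 2)"
  have q0: "q \<ge> 0" unfolding q_def by simp
  define c where "c l = q * (\<Sum>k<l. (1 / 2) ^ (l - k) * ((b l)\<^sup>2 + (b k)\<^sup>2)) + (q + A powr u * M powr (u - 2)) * (b l)\<^sup>2" for l
  have c0: "c l \<ge> 0" for l unfolding c_def using q0
    by (intro add_nonneg_nonneg mult_nonneg_nonneg sum_nonneg) auto
  have le: "np u (S l) \<le> (\<Sum>l<l. c l)" if "l \<le> L" for l
    using that
  proof (induction l)
    case (Suc l)
    have "np u (S (Suc l)) \<le> np u (S l) + c l"
    proof (cases "l = 0")
      case True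
      have "np u (S 1) \<le> (A * b 0) powr u" by (rule np_S1)
      also have "... = A powr u * (b 0 powr (u - 2) * (b 0)\<^sup>2)"
        using A b(2)[of 0] by (simp add: powr_mult powr_diff powr_numeral)
      also have "... \<le> A powr u * (M powr (u - 2) * (b 0)\<^sup>2)"
        by (intro mult_left_mono mult_right_mono powr_mono2 bM) (use u2 b(2)[of 0] in auto)
      also have "... \<le> c 0" unfolding c_def using q0 by (simp add: distrib_right)
      finally show ?thesis using True by (simp add: np_S0)
    next
      case False
      have "np u (S (Suc l)) \<le> np u (S l) + u * (\<Sum>k<l. 3 * u * A\<^sup>2 * (2 * M) powr (u - 2) * (1 / 2) ^ (l - k) * (b l * b k)) +
         u * (3 * u * A\<^sup>2 * (2 * M) powr (u - 2) * (b l)\<^sup>2)"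
        by (rule step_ge2[OF u2 _ M0]) (use False V2 Suc.prems MV in auto)
      also have "u * (\<Sum>k<l. 3 * u * A\<^sup>2 * (2 * M) powr (u - 2) * (1 / 2) ^ (l - k) * (b l * b k)) = q * (\<Sum>k<l. (1 / 2) ^ (l - k) * (b l * b k))"
        unfolding q_def sum_distrib_left by (rule sum.cong) (auto simp: power2_eq_square mult_ac)
      also have "u * (3 * u * A\<^sup>2 * (2 * M) powr (u - 2) * (b l)\<^sup>2) = q * (b l)\<^sup>2"
        by (simp add: q_def power2_eq_square)
      also have "q * (\<Sum>k<l. (1 / 2) ^ (l - k) * (b l * b k)) \<le> q * (\<Sum>k<l. (1 / 2) ^ (l - k) * ((b l)\<^sup>2 + (b k)\<^sup>2))"
      proof (intro mult_left_mono sum_mono q0)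
        fix k
        have "0 \<le> (b l - b k)\<^sup>2" "0 \<le> b l * b k" using b(2)[of l] b(2)[of k] by auto
        then show "b l * b k \<le> (b l)\<^sup>2 + (b k)\<^sup>2" by (simp add: power2_eq_square algebra_simps)
      qed auto
      also have "q * (b l)\<^sup>2 \<le> (q + A powr u * M powr (u - 2)) * (b l)\<^sup>2" by (simp add: distrib_right)
      finally show ?thesis unfolding c_def by (simp add: add.assoc)
    qed
    then show ?case using Suc by simp
  qed (simp add: np_S0)
  have bound: "np u (S l) \<le> D * M powr (u - 2) * B" if "l \<le> L" for l
  proof -
    have "np u (S l) \<le> (\<Sum>l<L. c l)"
      using le[OF that] sum_mono2[of "{..<L}" "{..<l}" c] that c0 by (auto intro: order_trans)
    also have "... = q * (\<Sum>l<L. \<Sum>k<l. (1 / 2) ^ (l - k) * ((b l)\<^sup>2 + (b k)\<^sup>2)) + (q + A powr u * M powr (u - 2)) * B"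
      unfolding c_def B_def by (simp add: sum.distrib sum_distrib_left)
    also have "... \<le> q * (2 / (1 - 1 / 2) * B) + (q + A powr u * M powr (u - 2)) * B"
      unfolding B_def by (intro add_mono mult_left_mono geometric_convolution q0 order_refl) auto
    also have "... = (5 * q + A powr u * M powr (u - 2)) * B" by (simp add: algebra_simps)
    also have "5 * q + A powr u * M powr (u - 2) = D * M powr (u - 2)"
      using M0 by (simp add: q_def D_def powr_mult algebra_simps)
    finally show ?thesis .
  qed
  have "V \<le> (1 + D) * M powr (u - 2) * B"
    using V3
  proof
    assume V: "V = B powr (u / 2)"
    have "B powr (u / 2) = sqrt B powr (u - 2) * B"
      using B0 by (simp add: powr_half_sqrt[symmetric] powr_powr powr_diff diff_divide_distrib)
    also have "... \<le> M powr (u - 2) * B" by (intro mult_right_mono powr_mono2 BM) (use u2 B0 in auto)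
    also have "... \<le> (1 + D) * (M powr (u - 2) * B)" using D0 B0 by (simp add: distrib_right)
    finally show ?thesis using V by (simp add: mult.assoc)
  next
    assume "\<exists>l\<le>L. V = np u (S l)"
    then have "V \<le> D * M powr (u - 2) * B" using bound by auto
    also have "... \<le> (1 + D) * M powr (u - 2) * B" using B0 by (intro mult_right_mono) auto
    finally show ?thesis .
  qed
  moreover have "V = M powr (u - 2) * M\<^sup>2"
    unfolding MV[symmetric] using M0 by (simp add: powr_diff powr_numeral)
  ultimately have "M powr (u - 2) * M\<^sup>2 \<le> M powr (u - 2) * ((1 + D) * B)" by (simp add: mult_ac)
  then have M2: "M\<^sup>2 \<le> (1 + D) * B" using M0 by simp
  have "np u (S L) \<le> M powr u" using V2[of L] MV by simp
  also have "... = (M\<^sup>2) powr (u / 2)" using M0 by (simp add: powr_powr flip: powr_numeral)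
  also have "... \<le> ((1 + D) * B) powr (u / 2)" by (intro powr_mono2 M2) (use u in auto)
  finally show ?thesis unfolding D_def B_def .
qed

end

section \<open>Duality: from sums of pieces to the square-function type bound\<close>

lemma kfam_reflect:
  assumes K: "kfam K A"
  shows "kfam (%l s. K l (- s)) A"
  unfolding kfam_def
proof (intro conjI allI impI)
  note k = kfamD[OF K]
  show "0 < A" by (rule k)
  fix l
  show "rapid (%s. K l (- s))" by (rule rapid_reflect[OF k(2)])
  show "(LINT s|lborel. norm (K l (- s))) \<le> A"
    using k(3)[of l] lborel_integral_reflect[of "%s. norm (K l s)"] by simp
  show "(LINT v|lborel. norm (K l (- (v + s)) - K l (- v))) \<le> A * 2 ^ l * \<bar>s\<bar>" for s
    using k(4)[of l "- s"] lborel_integral_reflect[of "%v. norm (K l (v + - s) - K l v)"] by (simp add: algebra_simps)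
  assume l: "l > 0"
  show "(LINT s|lborel. K l (- s)) = 0" using k(5)[OF l] lborel_integral_reflect[of "K l"] by simp
  fix \<alpha> :: real assume "0 < \<alpha>" "\<alpha> \<le> 1"
  then show "(LINT s|lborel. norm (K l (- s)) * \<bar>s\<bar> powr \<alpha>) \<le> A * 2 powr (- \<alpha> * real l)"
    using k(6)[OF l] lborel_integral_reflect[of "%s. norm (K l s) * \<bar>s\<bar> powr \<alpha>"] by simp
qed

lemma young_crude:
  fixes x y p u :: real
  assumes "0 \<le> x" "0 \<le> y" "1 < p" "1 < u" "1 / u + 1 / p = 1"
  shows "x * y \<le> x powr u + y powr p"
proof -
  have "x * y \<le> x powr u / u + y powr p / p" by (rule Youngs_inequality[OF assms(4,3,5,1,2)])
  also have "... \<le> x powr u + y powr p"   proof (intro add_mono)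
    show "x powr u / u \<le> x powr u" "y powr p / p \<le> y powr p"
      using assms mult_left_mono[of 1 u "x powr u"] mult_left_mono[of 1 p "y powr p"] by (auto simp: divide_le_eq)
  qed
  finally show ?thesis .
qed

lemma holder_dual_crude:
  fixes f F :: "'n::finite cfun"
  assumes f: "Lpi p f" "np p f \<le> A powr p" "A > 0" and F: "Lpi u F" "np u F \<le> B powr u" "B > 0"
    and pu: "1 < p" "1 < u" "1 / u + 1 / p = 1"
  shows "(LINT x|lborel. norm (f x * F x)) \<le> 2 * A * B"
proof -
  note [measurable] = Lpi_measurable[OF f(1)] Lpi_measurable[OF F(1)]
  note I = integral_scaled_le[OF f(2,3,1)] and J = integral_scaled_le[OF F(2,3,1)]
  have "(LINT x|lborel. norm (f x * F x)) \<le> (LINT x|lborel. A * B * ((norm (F x) / B) powr u + (norm (f x) / A) powr p))"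
  proof (rule integral_norm_dominated(2))
    show "integrable lborel (%x. A * B * ((norm (F x) / B) powr u + (norm (f x) / A) powr p))" using I(1) J(1) by auto
    fix x
    have "norm (f x * F x) = A * B * ((norm (F x) / B) * (norm (f x) / A))" using f(3) F(3) by (simp add: norm_mult)
    also have "... \<le> A * B * ((norm (F x) / B) powr u + (norm (f x) / A) powr p)"
      by (intro mult_left_mono young_crude) (use f(3) F(3) pu in auto)
    finally show "norm (f x * F x) \<le> A * B * ((norm (F x) / B) powr u + (norm (f x) / A) powr p)" .
  qed measurable
  also have "... = A * B * ((LINT x|lborel. (norm (F x) / B) powr u) + (LINT x|lborel. (norm (f x) / A) powr p))"
    using I(1) J(1) by simp
  also have "... \<le> A * B * (1 + 1)" by (intro mult_left_mono add_mono I J) (use f(3) F(3) in auto)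
  finally show ?thesis by simp
qed

lemma pg_cmult: "pg f ==> pg (%x. c * f x)"
proof (rule pg_le[of f _ "norm c" 1])
  assume "pg f"
  note [measurable] = pg_measurable[OF this]
  show "(%x. c * f x) \<in> borel_measurable borel" by measurable
qed (auto simp: norm_mult mult_left_mono)

text \<open>Testing against \<open>g\<^sub>k = c\<^sub>k \<bar>P\<^sub>k f\<bar>\<^sup>p\<^sup>-\<^sup>2 cnj (P\<^sub>k f)\<close> turns the bound for sums into its dual.\<close>

lemma dual_test:
  fixes f :: "'n::finite cfun" and i :: 'n
  assumes K: "kfam K A" and f: "Lpi p f" "np p f \<le> A0 powr p" "A0 > 0"
    and pu: "1 < p" "1 < u" "1 / u + 1 / p = 1" and c: "!!k. 0 \<le> c k"
  defines "g \<equiv> %k x. cor (c k) * gf p (axc i (K k) f x)"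
  shows "Lpi u (g k)" "np u (g k) = c k powr u * np p (axc i (K k) f)"
    and "np u (%x. \<Sum>k<L. axc i (%s. K k (- s)) (g k) x) \<le> B powr u ==> B > 0 ==>
      (\<Sum>k<L. c k * np p (axc i (K k) f)) \<le> 2 * A0 * B"
proof -
  have p1: "1 \<le> p" and u1: "1 \<le> u" using pu by auto
  note k = kfamD[OF K]
  have P: "Lpi p (axc i (K k) f)" for k by (rule Lpi_axc(1)[OF k(2) f(1) p1 k(3) k(1)])
  note [measurable] = Lpi_measurable[OF P] Lpi_measurable[OF f(1)]
  have pgg: "pg (g k)" for k unfolding g_def by (intro pg_cmult pg_gf Lpi_pg[OF P] pu)
  have ex: "(p - 1) * u = p" using pu by (simp add: field_simps)
  have ng: "norm (g k x) powr u = c k powr u * norm (axc i (K k) f x) powr p" for k x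
    using c[of k] by (simp add: g_def norm_mult norm_gf powr_mult powr_powr ex)
  show Lg: "Lpi u (g k)" for k
    unfolding Lpi_def ng using pgg Lpi_int[OF P] by auto
  show "np u (g k) = c k powr u * np p (axc i (K k) f)" for k
    unfolding np_def ng by simp
  let ?S = "%x. \<Sum>k<L. axc i (%s. K k (- s)) (g k) x"
  assume B: "np u ?S \<le> B powr u" "B > 0"
  have Lh: "Lpi u (axc i (%s. K k (- s)) (g k))" for k
    by (rule Lpi_axc(1)[OF _ Lg u1]) (use kfamD[OF kfam_reflect[OF K]] in auto)
  have LS: "Lpi u ?S" by (rule Lpi_sum) (use pu Lh in auto)
  have le: "norm (g k x) * norm (f y) \<le> norm (g k x) powr u + norm (f y) powr p" for k x y
    by (rule young_crude) (use pu in auto)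
  have le': "norm (f x) * norm (F y) \<le> norm (f x) powr p + norm (F y) powr u" for x y and F :: "'n cfun"
    using young_crude[of "norm (F y)" "norm (f x)" p u] pu by (simp add: mult.commute add.commute)
  have eq: "cor (c k * np p (axc i (K k) f)) = (LINT x|lborel. f x * axc i (%s. K k (- s)) (g k) x)" for k
  proof -
    have "(LINT x|lborel. f x * axc i (%s. K k (- s)) (g k) x) = (LINT x|lborel. g k x * axc i (K k) f x)"
      by (rule adjoint_axis[OF k(2) pgg Lpi_pg[OF f(1)] Lpi_int[OF Lg] Lpi_int[OF f(1)] le, symmetric])
    also have "(%x. g k x * axc i (K k) f x) = (%x. cor (c k * norm (axc i (K k) f x) powr p))"
      using gf_mult_self[of p] by (auto simp: g_def mult.assoc)
    also have "(LINT x|lborel. cor (c k * norm (axc i (K k) f x) powr p)) = cor (c k * np p (axc i (K k) f))"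
      unfolding np_def by (simp only: integral_complex_of_real integral_mult_right_zero)
    finally show ?thesis by simp
  qed
  have i: "integrable lborel (%x. f x * axc i (%s. K k (- s)) (g k) x)" for k
    using pairing_integrable[OF Lpi_pg[OF f(1)] Lpi_pg[OF Lh[of k]] Lpi_int[OF f(1)] Lpi_int[OF Lh[of k]],
        where c = 0] le'[of _ "axc i (%s. K k (- s)) (g k)"] by simp
  have "cor (\<Sum>k<L. c k * np p (axc i (K k) f)) = (LINT x|lborel. f x * ?S x)"
    unfolding of_real_sum eq sum_distrib_left using i by (subst Bochner_Integration.integral_sum) auto
  then have "norm (cor (\<Sum>k<L. c k * np p (axc i (K k) f))) \<le> (LINT x|lborel. norm (f x * ?S x))"
    using integral_norm_bound[of lborel "%x. f x * ?S x"] by simp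
  also have "... \<le> 2 * A0 * B" by (rule holder_dual_crude[OF f LS B pu])
  finally show "(\<Sum>k<L. c k * np p (axc i (K k) f)) \<le> 2 * A0 * B"
    unfolding norm_of_real by linarith
qed

text \<open>The dual exponent \<open>u\<close> lies on the other side of 2. Testing bounds the sum X
  by a constant times A0 X^(1/2) if p \<le> 2 and A0 X^(1/u) if p > 2. As X is a finite sum, the
  power of X can be divided out, with a constant independent of \<open>L\<close>.\<close>

theorem axis_lr_bound:
  assumes K: "kfam K A" and p: "1 < p"
  shows "\<exists>C\<ge>0. \<forall>(i::'n::finite) (f :: 'n cfun) A0 L. Lpi p f --> np p f \<le> A0 powr p --> A0 > 0 -->
    (\<Sum>k<L. np p (axc i (K k) f) powr (max 2 p / p)) \<le> C * A0 powr max 2 p"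
proof -
  define u where "u = p / (p - 1)"
  have u: "1 < u" "1 / u + 1 / p = 1" using p by (auto simp: u_def field_simps)
  note k = kfamD[OF K]
  show ?thesis
  proof (cases "p \<le> 2")
    case True
    have u2: "2 \<le> u" using True p by (simp add: u_def field_simps)
    define D where "D = 15 * 2 powr (u - 2) * u\<^sup>2 * A\<^sup>2 + A powr u"
    have D0: "D \<ge> 0" unfolding D_def by simp
    show ?thesis
    proof (intro exI[of _ "8 * (1 + D)"] conjI allI impI)
      fix i :: 'n and f :: "'n cfun" and A0 and L :: nat assume f: "Lpi p f" "np p f \<le> A0 powr p" "0 < A0"
      define a where "a k = np p (axc i (K k) f) powr (1 / p)" for k
      have a0: "a k \<ge> 0" for k by (simp add: a_def)
      have ap: "a k powr p = np p (axc i (K k) f)" for k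
        using np_nonneg[of p "axc i (K k) f"] p by (cases "np p (axc i (K k) f) = 0") (auto simp: a_def powr_powr)
      define X where "X = (\<Sum>k<L. (a k)\<^sup>2)"
      have X0: "X \<ge> 0" unfolding X_def by (intro sum_nonneg) auto
      have "X \<le> 8 * (1 + D) * A0\<^sup>2"
      proof (cases "X = 0")
        case False
        then have Xp: "X > 0" using X0 by simp
        then have L: "L > 0" by (cases L) (auto simp: X_def)
        \<comment> \<open>The locale asks for positive majorants, while some a_k may be 0. Spreading
          X evenly over the \<open>L\<close> terms makes all of them positive and merely doubles the
          sum.\<close>
        define \<delta> where "\<delta> = X / real L"
        have \<delta>: "\<delta> > 0" using Xp L by (simp add: \<delta>_def)
        define b where "b k = sqrt ((a k)\<^sup>2 + \<delta>)" for k
        have b: "b k > 0" "(b k)\<^sup>2 = (a k)\<^sup>2 + \<delta>" "a k \<le> b k" for k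
          using \<delta> by (auto simp: b_def add_nonneg_pos intro!: real_le_rsqrt)
        \<comment> \<open>With this weight the tested quantity is the square of a_k, and the test
          function has norm a_k because (2 - p) u + p = u.\<close>
        define c where "c k = a k powr (2 - p)" for k
        have c: "0 \<le> c k" for k by (simp add: c_def)
        let ?g = "%k x. cor (c k) * gf p (axc i (K k) f x)"
        have npg: "np u (?g k) \<le> b k powr u" for k
        proof -
          have "np u (?g k) = a k powr ((2 - p) * u) * a k powr p"
            using dual_test(2)[OF K f p u c, where i = i and k = k] unfolding ap[symmetric] by (simp add: c_def powr_powr)
          also have "... = a k powr u"
          proof -
            have "(2 - p) * u + p = u" using p by (simp add: u_def field_simps)
            then show ?thesis by (simp flip: powr_add)
          qed
          also have "... \<le> b k powr u" by (intro powr_mono2 b) (use u a0 in auto)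
          finally show ?thesis .
        qed
        interpret AS: axis_sums "%l s. K l (- s)" A u i ?g b "%k. axc i (%s. K k (- s)) (?g k)" "%l x. \<Sum>k<l. axc i (%s. K k (- s)) (?g k) x"
          by unfold_locales (use kfam_reflect[OF K] u b(1) npg dual_test(1)[OF K f p u c] in auto)
        have sb: "(\<Sum>l<L. (b l)\<^sup>2) = 2 * X"
          using L by (simp add: b(2) sum.distrib X_def[symmetric] \<delta>_def)
        define B where "B = sqrt ((1 + D) * (2 * X))"
        have B: "B > 0" using D0 Xp by (simp add: B_def)
        have "np u (%x. \<Sum>k<L. axc i (%s. K k (- s)) (?g k) x) \<le> ((1 + D) * (2 * X)) powr (u / 2)"
          using AS.sum_ge2[OF u2 L] unfolding sb D_def .
        also have "... = B powr u"
          using D0 Xp by (simp add: B_def powr_half_sqrt[symmetric] powr_powr)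
        finally have nS: "np u (%x. \<Sum>k<L. axc i (%s. K k (- s)) (?g k) x) \<le> B powr u" .
        have "(\<Sum>k<L. c k * np p (axc i (K k) f)) \<le> 2 * A0 * B"
          by (rule dual_test(3)[OF K f p u c nS B])
        also have "(\<Sum>k<L. c k * np p (axc i (K k) f)) = X"
          unfolding X_def
        proof (rule sum.cong[OF refl])
          fix k
          show "c k * np p (axc i (K k) f) = (a k)\<^sup>2"
            unfolding ap[symmetric] c_def using a0[of k] by (cases "a k = 0") (auto simp flip: powr_add powr_numeral)
        qed
        finally have "X\<^sup>2 \<le> (2 * A0 * B)\<^sup>2" using X0 by (intro power_mono) auto
        also have "... = 8 * (1 + D) * A0\<^sup>2 * X" using D0 Xp by (simp add: B_def power_mult_distrib)
        finally show ?thesis using Xp by (simp add: power2_eq_square)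
      qed (use D0 in simp)
      moreover have "np p (axc i (K k) f) powr (max 2 p / p) = (a k)\<^sup>2" for k
        unfolding ap[symmetric] using a0[of k] p True by (cases "a k = 0") (auto simp: powr_powr powr_numeral)
      ultimately show "(\<Sum>k<L. np p (axc i (K k) f) powr (max 2 p / p)) \<le> 8 * (1 + D) * A0 powr max 2 p"
        using True f(3) by (simp add: X_def powr_numeral)
    qed (use D0 in simp)
  next
    case False
    have u2: "u \<le> 2" using False p by (simp add: u_def field_simps)
    define C where "C = A powr u * (8 * u / (1 - 2 powr (1 - u)) + 1 + 2 * u)"
    have C0: "C > 0"
      unfolding C_def using k(1) u(1) by (intro mult_pos_pos add_nonneg_pos add_nonneg_nonneg divide_nonneg_pos) (auto simp: powr_less_one)
    show ?thesis
    proof (intro exI[of _ "(2 * (2 * C) powr (1 / u)) powr p"] conjI allI impI)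
      fix i :: 'n and f :: "'n cfun" and A0 and L :: nat assume f: "Lpi p f" "np p f \<le> A0 powr p" "0 < A0"
      define a where "a k = np p (axc i (K k) f)" for k
      have a0: "a k \<ge> 0" for k by (simp add: a_def np_nonneg)
      define X where "X = (\<Sum>k<L. a k)"
      have X0: "X \<ge> 0" unfolding X_def by (intro sum_nonneg a0)
      have "X \<le> (2 * (2 * C) powr (1 / u)) powr p * A0 powr p"
      proof (cases "X = 0")
        case False
        then have Xp: "X > 0" using X0 by simp
        then have L: "L > 0" by (cases L) (auto simp: X_def)
        define \<delta> where "\<delta> = X / real L"
        have \<delta>: "\<delta> > 0" using Xp L by (simp add: \<delta>_def)
        define b where "b k = (a k + \<delta>) powr (1 / u)" for k
        have b: "b k > 0" "b k powr u = a k + \<delta>" for k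
          using \<delta> a0[of k] u(1) by (auto simp: b_def powr_powr)
        define c :: "nat => real" where "c k = 1" for k
        have c: "0 \<le> c k" for k by (simp add: c_def)
        let ?g = "%k x. cor (c k) * gf p (axc i (K k) f x)"
        have npg: "np u (?g k) \<le> b k powr u" for k
          using dual_test(2)[OF K f p u c, where i = i and k = k] \<delta> by (simp add: c_def a_def b(2))
        interpret AS: axis_sums "%l s. K l (- s)" A u i ?g b "%k. axc i (%s. K k (- s)) (?g k)" "%l x. \<Sum>k<l. axc i (%s. K k (- s)) (?g k) x"
          by unfold_locales (use kfam_reflect[OF K] u b(1) npg dual_test(1)[OF K f p u c] in auto)
        have sb: "(\<Sum>l<L. b l powr u) = 2 * X"
          using L by (simp add: b(2) sum.distrib X_def[symmetric] \<delta>_def)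
        define B where "B = (2 * C * X) powr (1 / u)"
        have B: "B > 0" using C0 Xp by (simp add: B_def)
        have "np u (%x. \<Sum>k<L. axc i (%s. K k (- s)) (?g k) x) \<le> C * (2 * X)"
          using AS.sum_le2[OF u2, of L] unfolding sb C_def .
        also have "... = B powr u"
          using C0 Xp u(1) by (simp add: B_def powr_powr)
        finally have nS: "np u (%x. \<Sum>k<L. axc i (%s. K k (- s)) (?g k) x) \<le> B powr u" .
        have "(\<Sum>k<L. c k * np p (axc i (K k) f)) \<le> 2 * A0 * B"
          by (rule dual_test(3)[OF K f p u c nS B])
        then have "X \<le> 2 * A0 * ((2 * C) powr (1 / u) * X powr (1 / u))"
          using C0 Xp by (simp add: c_def X_def a_def B_def powr_mult)
        moreover have "X = X powr (1 / u) * X powr (1 / p)" using Xp u(2) by (simp flip: powr_add)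
        ultimately have "X powr (1 / u) * X powr (1 / p) \<le> X powr (1 / u) * (2 * (2 * C) powr (1 / u) * A0)"
          by (simp add: mult_ac)
        then have "X powr (1 / p) \<le> 2 * (2 * C) powr (1 / u) * A0" using Xp by simp
        then have "(X powr (1 / p)) powr p \<le> (2 * (2 * C) powr (1 / u) * A0) powr p" by (intro powr_mono2) (use p in auto)
        then show ?thesis using Xp p C0 f(3) by (simp add: powr_powr powr_mult)
      qed simp
      moreover have "np p (axc i (K k) f) powr (max 2 p / p) = a k" for k
        using False p a0[of k] by (simp add: a_def max_def)
      ultimately show "(\<Sum>k<L. np p (axc i (K k) f) powr (max 2 p / p)) \<le> (2 * (2 * C) powr (1 / u)) powr p * A0 powr max 2 p"
        using False by (simp add: X_def max_def)
    qed simp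
  qed
qed

section \<open>Dyadic decompositions\<close>

lemma sm1_of_real:
  assumes "smooth1 f"
  shows "sm1 (%x. cor (f x))"
proof -
  have "chain (%r x. cor ((deriv ^^ r) f x))"
    unfolding chain_def
  proof safe
    fix r x
    have "(deriv ^^ r) f differentiable at x" using assms by (auto simp: smooth1_def)
    then have "((deriv ^^ r) f has_real_derivative (deriv ^^ Suc r) f x) (at x)"
      by (simp add: DERIV_deriv_iff_real_differentiable)
    then show "((%x. cor ((deriv ^^ r) f x)) has_vector_derivative cor ((deriv ^^ Suc r) f x)) (at x)"
      by (rule has_vector_derivative_of_real)
  qed
  then show ?thesis unfolding sm1_def by (intro exI conjI) (assumption, simp)
qed

lemma test1_mono: "test1 R m ==> R \<le> R' ==> test1 R' m"
  by (auto simp: test1_def)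

lemma test1_scale:
  assumes m: "test1 R m" and a: "0 < a"
  shows "test1 (R * a) (%x. m (x / a))"
  using sm1_affine[of m "1 / a" 0] m a by (auto simp: test1_def field_simps abs_divide)

lemma test1_diff:
  assumes "test1 R f" "test1 R g"
  shows "test1 R (%x. f x - g x)"
proof -
  have "sm1 (%x. f x + (-1) * g x)" using assms by (intro sm1_add sm1_mult sm1_const) (auto simp: test1_def)
  then show ?thesis using assms by (auto simp: test1_def)
qed

lemma lborel_integral_scale:
  fixes F :: "real => real"
  assumes "0 < a"
  shows "(LINT s|lborel. a * F (a * s)) = (LINT s|lborel. F s)"
  using lborel_integral_real_affine[of a F 0] assms by simp

lemma nn_integral_lborel_scale:
  fixes F :: "real => ennreal"
  assumes [measurable]: "F \<in> borel_measurable borel" and a: "0 < a"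
  shows "(\<integral>\<^sup>+s. F (a * s) \<partial>lborel) = ennreal (1 / a) * (\<integral>\<^sup>+s. F s \<partial>lborel)"
proof -
  have "(\<integral>\<^sup>+s. F s \<partial>lborel) = ennreal \<bar>a\<bar> * (\<integral>\<^sup>+s. F (0 + a * s) \<partial>lborel)"
    by (rule nn_integral_real_affine) (use a in auto)
  then have "ennreal (1 / a) * (\<integral>\<^sup>+s. F s \<partial>lborel) = (ennreal (1 / a) * ennreal a) * (\<integral>\<^sup>+s. F (a * s) \<partial>lborel)"
    using a by (simp add: mult.assoc)
  also have "ennreal (1 / a) * ennreal a = 1" using a by (simp flip: ennreal_mult)
  finally show ?thesis by simp
qed

lemma rapid_modulus:
  assumes K: "rapid K" and K': "rapid K'" and d: "!!s. (K has_vector_derivative K' s) (at s)"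
  shows "(LINT v|lborel. norm (K (v + s) - K v)) \<le> (LINT v|lborel. norm (K' v)) * \<bar>s\<bar>"
proof -
  have i: "integrable lborel (%v. norm (K' v))" using rapid_integrable[OF K', of 0] by simp
  have j: "integrable lborel (%v. norm (K (v + s) - K v))"
    using rapid_integrable[OF rapid_diff[OF rapid_shift[OF K] K], of 0] by simp
  have "ennreal (LINT v|lborel. norm (K (v + s) - K v)) = (\<integral>\<^sup>+v. norm (K (v + s) - K v) \<partial>lborel)"
    by (rule nn_integral_eq_integral[OF j, symmetric]) auto
  also have "... \<le> ennreal \<bar>s\<bar> * (\<integral>\<^sup>+v. norm (K' v) \<partial>lborel)"
    by (rule kernel_L1_modulus[OF d]) (use K' in \<open>simp add: rapid_def\<close>)
  also have "(\<integral>\<^sup>+v. norm (K' v) \<partial>lborel) = ennreal (LINT v|lborel. norm (K' v))"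
    by (rule nn_integral_eq_integral[OF i]) auto
  finally show ?thesis
    by (simp add: mult.commute Bochner_Integration.integral_nonneg flip: ennreal_mult)
qed

lemma rapid_powr_finite:
  assumes K: "rapid K" and p: "0 < p"
  shows "(\<integral>\<^sup>+s. ennreal (norm (K s) powr p) \<partial>lborel) < \<infinity>"
proof -
  define M where "M = nat \<lceil>2 / p\<rceil>"
  have "2 / p \<le> real M" unfolding M_def by (rule real_nat_ceiling_ge)
  then have Mp: "real M * p \<ge> 2" using p by (simp add: field_simps)
  obtain D where D: "!!s. (1 + \<bar>s\<bar>) ^ M * norm (K s) \<le> D" using K unfolding rapid_def by blast
  have "norm (K s) powr p \<le> D powr p * inverse (1 + s\<^sup>2)" for s
  proof -
    have "((1 + \<bar>s\<bar>) ^ M * norm (K s)) powr p \<le> D powr p" by (intro powr_mono2 D) (use p in auto)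
    moreover have "((1 + \<bar>s\<bar>) ^ M * norm (K s)) powr p = (1 + \<bar>s\<bar>) powr (real M * p) * norm (K s) powr p"
      by (simp add: powr_mult powr_powr flip: powr_realpow)
    moreover have "(1 + s\<^sup>2) * norm (K s) powr p \<le> (1 + \<bar>s\<bar>) powr (real M * p) * norm (K s) powr p"
    proof (rule mult_right_mono)
      have "1 + s\<^sup>2 \<le> (1 + \<bar>s\<bar>)\<^sup>2" by (simp add: power2_eq_square algebra_simps)
      also have "... = (1 + \<bar>s\<bar>) powr 2" by (simp add: powr_realpow[of _ 2, simplified])
      also have "... \<le> (1 + \<bar>s\<bar>) powr (real M * p)" by (intro powr_mono Mp) auto
      finally show "1 + s\<^sup>2 \<le> (1 + \<bar>s\<bar>) powr (real M * p)" .
    qed simp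
    ultimately have "(1 + s\<^sup>2) * norm (K s) powr p \<le> D powr p" by linarith
    moreover have "1 + s\<^sup>2 > 0" by (simp add: add_pos_nonneg)
    ultimately show ?thesis by (simp add: field_simps)
  qed
  then have "(\<integral>\<^sup>+s. ennreal (norm (K s) powr p) \<partial>lborel) \<le> (\<integral>\<^sup>+s. ennreal (D powr p * inverse (1 + s\<^sup>2)) \<partial>lborel)"
    by (intro nn_integral_mono ennreal_leI)
  also have "... < \<infinity>"
    by (subst nn_integral_eq_integral[OF integrable_mult_right[OF integrable_inverse_square]])
       (auto simp: add_nonneg_nonneg)
  finally show ?thesis .
qed

definition cphi :: "(real => real) => nat => real => complex" where
  "cphi \<phi>0 k x = cor (phi \<phi>0 k x)"

text \<open>For k > 0 every \<open>cphi\<close> is a dilate of this one function, so a single kernel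
  governs all levels above 0.\<close>

definition cth :: "(real => real) => real => complex" where
  "cth \<phi>0 x = cor (\<phi>0 x) - cor (\<phi>0 (2 * x))"

lemma cphi_0: "cphi \<phi>0 0 x = cor (\<phi>0 x)"
  by (simp add: cphi_def phi_def)

lemma two_powr_nat: "2 powr (- real k) * x = x / 2 ^ k" "2 powr (1 - real k) * x = 2 * (x / 2 ^ k)"
  by (simp_all add: powr_minus powr_diff powr_realpow divide_inverse mult_ac)

lemma cphi_pos: "k > 0 ==> cphi \<phi>0 k = (%x. cth \<phi>0 (x / 2 ^ k))"
  by (simp add: cphi_def phi_def cth_def two_powr_nat fun_eq_iff)

locale phi_setup =
  fixes \<phi>0 :: "real => real"
  assumes adm: "admissible_phi0 \<phi>0"
begin

lemma test_phi0: "test1 (3/2) (%x. cor (\<phi>0 x))"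
  using adm sm1_of_real[of \<phi>0] unfolding admissible_phi0_def test1_def by simp

lemma test_th: "test1 (3/2) (cth \<phi>0)"
proof -
  have "test1 (3/2 * (1/2)) (%x. cor (\<phi>0 (x / (1/2))))"
    by (rule test1_scale[OF test_phi0]) simp
  then have a: "test1 (3/2 * (1/2)) (%x. cor (\<phi>0 (2 * x)))"
    by (simp add: mult.commute)
  have "test1 (3/2) (%x. cor (\<phi>0 (2 * x)))"
    by (rule test1_mono[OF a]) simp
  from test1_diff[OF test_phi0 this] show ?thesis by (simp add: cth_def[abs_def])
qed

lemma test_cphi: "test1 (3/2 * 2 ^ k) (cphi \<phi>0 k)"
proof (cases "k = 0")
  case True
  then show ?thesis using test_phi0 by (simp add: cphi_0[abs_def])
next
  case False
  then show ?thesis using test1_scale[OF test_th, of "2 ^ k"] by (simp add: cphi_pos)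
qed

lemma ker_cphi: "k > 0 ==> ker (cphi \<phi>0 k) s = 2 ^ k * ker (cth \<phi>0) (2 ^ k * s)"
  using ker_scale[of "2 ^ k" "cth \<phi>0" s] by (simp add: cphi_pos)

lemma cphi_at_0: "k > 0 ==> cphi \<phi>0 k 0 = 0"
  by (simp add: cphi_pos cth_def)

text \<open>For k > 0 the kernels are L_1-normalised dilates of one kernel, so their L_1 norms agree
  and their increments and moments scale by powers of 2^k. Level 0 has a kernel of its own and
  enters with its own constants.\<close>

lemma kfam_cphi: "\<exists>A. kfam (%k. ker (cphi \<phi>0 k)) A"
proof -
  let ?\<kappa> = "ker (cth \<phi>0)" and ?K0 = "ker (cphi \<phi>0 0)"
  have r: "rapid (ker (cphi \<phi>0 k))" for k by (rule rapid_ker[OF test_cphi])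
  have r\<kappa>: "rapid ?\<kappa>" by (rule rapid_ker[OF test_th])
  define D where "D m = ker (%\<eta>. (\<i> * cor \<eta>) * m \<eta>)" for m
  have dm: "rapid (D m)" "!!s. (ker m has_vector_derivative D m s) (at s)" if "test1 R m" for m R
    unfolding D_def using that by (auto intro!: rapid_ker[OF test1_mult[OF that sm1_linear]] ker_has_derivative)
  define L1 where "L1 K = (LINT s|lborel. norm (K s))" for K :: "real => complex"
  have L1: "L1 K \<ge> 0" for K unfolding L1_def by (rule Bochner_Integration.integral_nonneg) auto
  define Mo where "Mo = (LINT s|lborel. (1 + \<bar>s\<bar>) ^ 1 * norm (?\<kappa> s))"
  have Mo: "Mo \<ge> 0" unfolding Mo_def by (rule Bochner_Integration.integral_nonneg) auto
  define A where "A = 1 + L1 ?K0 + L1 (D (cphi \<phi>0 0)) + L1 ?\<kappa> + L1 (D (cth \<phi>0)) + Mo"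
  note A = A_def L1[of ?K0] L1[of "D (cphi \<phi>0 0)"] L1[of ?\<kappa>] L1[of "D (cth \<phi>0)"] Mo
  have "kfam (%k. ker (cphi \<phi>0 k)) A"
    unfolding kfam_def
  proof (intro conjI allI impI r)
    show "0 < A" using A by linarith
    fix k
    show "(LINT s|lborel. norm (ker (cphi \<phi>0 k) s)) \<le> A"
    proof (cases "k = 0")
      case True then show ?thesis using A by (simp add: L1_def)
    next
      case False
      then have "(LINT s|lborel. norm (ker (cphi \<phi>0 k) s)) = (LINT s|lborel. 2 ^ k * norm (?\<kappa> (2 ^ k * s)))"
        by (simp add: ker_cphi norm_mult norm_power)
      also have "... = L1 ?\<kappa>" unfolding L1_def by (rule lborel_integral_scale) simp
      finally show ?thesis using A by simp
    qed
    show "(LINT v|lborel. norm (ker (cphi \<phi>0 k) (v + s) - ker (cphi \<phi>0 k) v)) \<le> A * 2 ^ k * \<bar>s\<bar>" for s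
    proof (cases "k = 0")
      case True
      have "(LINT v|lborel. norm (?K0 (v + s) - ?K0 v)) \<le> L1 (D (cphi \<phi>0 0)) * \<bar>s\<bar>"
        unfolding L1_def by (rule rapid_modulus[OF r dm[OF test_cphi]])
      also have "... \<le> A * \<bar>s\<bar>" using A by (intro mult_right_mono) auto
      finally show ?thesis using True by simp
    next
      case False
      have "(LINT v|lborel. norm (ker (cphi \<phi>0 k) (v + s) - ker (cphi \<phi>0 k) v)) =
        (LINT v|lborel. 2 ^ k * norm (?\<kappa> (2 ^ k * v + 2 ^ k * s) - ?\<kappa> (2 ^ k * v)))"
        using False by (simp add: ker_cphi distrib_left norm_mult norm_power flip: right_diff_distrib)
      also have "... = (LINT v|lborel. norm (?\<kappa> (v + 2 ^ k * s) - ?\<kappa> v))"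
        by (rule lborel_integral_scale[of "2 ^ k" "%v. norm (?\<kappa> (v + 2 ^ k * s) - ?\<kappa> v)"]) simp
      also have "... \<le> L1 (D (cth \<phi>0)) * \<bar>2 ^ k * s\<bar>"
        unfolding L1_def by (rule rapid_modulus[OF r\<kappa> dm[OF test_th]])
      also have "... \<le> A * \<bar>2 ^ k * s\<bar>" using A by (intro mult_right_mono) auto
      finally show ?thesis by (simp add: abs_mult mult.assoc)
    qed
    assume k: "0 < k"
    \<comment> \<open>Inversion at frequency 0: the integral of the kernel is the value of the
      multiplier there.\<close>
    show "(LINT s|lborel. ker (cphi \<phi>0 k) s) = 0"
      using ker_inversion[OF test_cphi, of k 0] by (simp add: cphi_at_0[OF k])
    fix \<alpha> :: real assume \<alpha>: "0 < \<alpha>" "\<alpha> \<le> 1"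
    have "(LINT s|lborel. norm (ker (cphi \<phi>0 k) s) * \<bar>s\<bar> powr \<alpha>) =
       (LINT s|lborel. 2 powr (- \<alpha> * real k) * (2 ^ k * (norm (?\<kappa> (2 ^ k * s)) * \<bar>2 ^ k * s\<bar> powr \<alpha>)))"
    proof (rule Bochner_Integration.integral_cong[OF refl])
      fix s :: real
      have "2 powr (- \<alpha> * real k) * \<bar>2 ^ k * s\<bar> powr \<alpha> = \<bar>s\<bar> powr \<alpha>"
        by (simp add: abs_mult powr_mult powr_powr powr_minus field_simps flip: powr_realpow)
      then show "norm (ker (cphi \<phi>0 k) s) * \<bar>s\<bar> powr \<alpha> = 2 powr (- \<alpha> * real k) * (2 ^ k * (norm (?\<kappa> (2 ^ k * s)) * \<bar>2 ^ k * s\<bar> powr \<alpha>))"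
        using k by (simp add: ker_cphi norm_mult norm_power)
    qed
    also have "... = 2 powr (- \<alpha> * real k) * (LINT s|lborel. 2 ^ k * (norm (?\<kappa> (2 ^ k * s)) * \<bar>2 ^ k * s\<bar> powr \<alpha>))"
      by (rule integral_mult_right_zero)
    also have "(LINT s|lborel. 2 ^ k * (norm (?\<kappa> (2 ^ k * s)) * \<bar>2 ^ k * s\<bar> powr \<alpha>)) = (LINT s|lborel. norm (?\<kappa> s) * \<bar>s\<bar> powr \<alpha>)"
      by (rule lborel_integral_scale[of "2 ^ k" "%s. norm (?\<kappa> s) * \<bar>s\<bar> powr \<alpha>"]) simp
    also have "... \<le> Mo"
      unfolding Mo_def
    proof (rule Bochner_Integration.integral_mono)
      show "integrable lborel (%s. norm (?\<kappa> s) * \<bar>s\<bar> powr \<alpha>)"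
        using abs_powr_integrable[OF r\<kappa> \<alpha>, of 1] by simp
      show "integrable lborel (%s. (1 + \<bar>s\<bar>) ^ 1 * norm (?\<kappa> s))" by (rule rapid_integrable[OF r\<kappa>])
      fix s :: real
      have "\<bar>s\<bar> powr \<alpha> \<le> (1 + \<bar>s\<bar>) powr \<alpha>" by (intro powr_mono2) (use \<alpha> in auto)
      also have "... \<le> (1 + \<bar>s\<bar>) powr 1" by (intro powr_mono) (use \<alpha> in auto)
      finally show "norm (?\<kappa> s) * \<bar>s\<bar> powr \<alpha> \<le> (1 + \<bar>s\<bar>) ^ 1 * norm (?\<kappa> s)"
        using mult_right_mono[of "\<bar>s\<bar> powr \<alpha>" "1 + \<bar>s\<bar>" "norm (?\<kappa> s)"] by (simp add: mult.commute)
    qed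
    finally have le: "(LINT s|lborel. norm (ker (cphi \<phi>0 k) s) * \<bar>s\<bar> powr \<alpha>) \<le> 2 powr (- \<alpha> * real k) * Mo"
      by simp
    have "Mo \<le> A" using A by linarith
    then have "2 powr (- \<alpha> * real k) * Mo \<le> 2 powr (- \<alpha> * real k) * A" by (intro mult_left_mono) auto
    with le show "(LINT s|lborel. norm (ker (cphi \<phi>0 k) s) * \<bar>s\<bar> powr \<alpha>) \<le> A * 2 powr (- \<alpha> * real k)"
      by (simp only: mult.commute[of A])
  qed
  then show ?thesis by blast
qed

text \<open>Dilation multiplies the p-th power by 2^(k p) and the length element by 2^(-k).\<close>

lemma ker_cphi_powr:
  assumes p: "0 < p"
  shows "\<exists>c>0. \<forall>k. (\<integral>\<^sup>+s. ennreal (norm (ker (cphi \<phi>0 k) s) powr p) \<partial>lborel) \<le> ennreal (c * 2 powr (real k * (p - 1)))"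
proof -
  let ?\<kappa> = "ker (cth \<phi>0)" and ?K0 = "ker (cphi \<phi>0 0)"
  define N where "N K = enn2real (\<integral>\<^sup>+s. ennreal (norm (K s) powr p) \<partial>lborel)" for K :: "real => complex"
  have N: "(\<integral>\<^sup>+s. ennreal (norm (K s) powr p) \<partial>lborel) = ennreal (N K)" if "rapid K" for K
    using rapid_powr_finite[OF that p] by (simp add: N_def)
  have N0: "N K \<ge> 0" for K by (simp add: N_def)
  have r\<kappa>: "rapid ?\<kappa>" and r0: "rapid ?K0" by (intro rapid_ker[OF test_th] rapid_ker[OF test_cphi])+
  note [measurable] = rapid_measurable[OF r\<kappa>]
  have *: "(\<integral>\<^sup>+s. ennreal (norm (ker (cphi \<phi>0 k) s) powr p) \<partial>lborel) \<le> ennreal ((1 + N ?K0 + N ?\<kappa>) * 2 powr (real k * (p - 1)))" for k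
  proof (cases "k = 0")
    case True
    then show ?thesis using N0[of ?\<kappa>] by (simp add: N[OF r0] ennreal_leI)
  next
    case False
    have "(\<integral>\<^sup>+s. ennreal (norm (ker (cphi \<phi>0 k) s) powr p) \<partial>lborel) =
       (\<integral>\<^sup>+s. ennreal (2 powr (real k * p)) * ennreal (norm (?\<kappa> (2 ^ k * s)) powr p) \<partial>lborel)"
      using False by (simp add: ker_cphi norm_mult norm_power powr_mult powr_powr flip: ennreal_mult powr_realpow)
    also have "... = ennreal (2 powr (real k * p)) * (\<integral>\<^sup>+s. ennreal (norm (?\<kappa> (2 ^ k * s)) powr p) \<partial>lborel)"
      by (rule nn_integral_cmult) measurable
    also have "(\<integral>\<^sup>+s. ennreal (norm (?\<kappa> (2 ^ k * s)) powr p) \<partial>lborel) = ennreal (1 / 2 ^ k) * ennreal (N ?\<kappa>)"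
      using nn_integral_lborel_scale[of "%s. ennreal (norm (?\<kappa> s) powr p)" "2 ^ k"] by (simp add: N[OF r\<kappa>])
    also have "ennreal (2 powr (real k * p)) * (ennreal (1 / 2 ^ k) * ennreal (N ?\<kappa>)) = ennreal (2 powr (real k * (p - 1)) * N ?\<kappa>)"
      using N0[of ?\<kappa>] by (simp add: powr_diff powr_realpow right_diff_distrib field_simps flip: ennreal_mult)
    also have "... \<le> ennreal ((1 + N ?K0 + N ?\<kappa>) * 2 powr (real k * (p - 1)))"
      using N0[of ?K0] by (intro ennreal_leI) (simp add: mult.commute mult_left_mono)
    finally show ?thesis .
  qed
  show ?thesis using N0[of ?K0] N0[of ?\<kappa>] * by (intro exI[of _ "1 + N ?K0 + N ?\<kappa>"]) auto
qed

text \<open>The cutoff reproducing the slices in the case \<open>p < 1\<close>.\<close>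

lemma cutoff_kernel:
  "\<exists>H>0. \<forall>j. \<exists>R \<Phi>. test1 R \<Phi> \<and> (\<forall>u. \<bar>u\<bar> \<le> 8 * 2 ^ j --> \<Phi> u = 1) \<and> (\<forall>r. norm (ker \<Phi> r) \<le> H * 2 ^ j)"
proof -
  obtain C where C: "!!s. (1 + \<bar>s\<bar>) ^ 0 * norm (ker (%x. cor (\<phi>0 x)) s) \<le> C"
    using rapid_ker[OF test_phi0] unfolding rapid_def by blast
  have C0: "C \<ge> 0" using order_trans[OF norm_ge_zero] C[of 0] by simp
  show ?thesis
  proof (rule exI[of _ "8 * (C + 1)"], intro conjI allI)
    fix j :: nat
    let ?\<Phi> = "%x. cor (\<phi>0 (x / (8 * 2 ^ j)))"
    have "test1 (3/2 * (8 * 2 ^ j)) ?\<Phi>" by (rule test1_scale[OF test_phi0]) simp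
    moreover have "?\<Phi> u = 1" if "\<bar>u\<bar> \<le> 8 * 2 ^ j" for u
      using adm that by (auto simp: admissible_phi0_def abs_divide)
    moreover have "norm (ker ?\<Phi> r) \<le> 8 * (C + 1) * 2 ^ j" for r
    proof -
      have "norm (ker ?\<Phi> r) = 8 * 2 ^ j * norm (ker (%x. cor (\<phi>0 x)) (8 * 2 ^ j * r))"
        by (subst ker_scale) (auto simp: norm_mult norm_power)
      also have "... \<le> 8 * 2 ^ j * (C + 1)" using C[of "8 * 2 ^ j * r"] by (intro mult_left_mono) auto
      finally show ?thesis by (simp add: algebra_simps)
    qed
    ultimately show "\<exists>R \<Phi>. test1 R \<Phi> \<and> (\<forall>u. \<bar>u\<bar> \<le> 8 * 2 ^ j --> \<Phi> u = 1) \<and> (\<forall>r. norm (ker \<Phi> r) \<le> 8 * (C + 1) * 2 ^ j)"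
      by blast
  qed (use C0 in simp)
qed

end

lemma smooth_fun_scale:
  assumes "smooth_fun (f :: 'n::finite cfun)"
  shows "smooth_fun (%x. f (a *\<^sub>R x))"
proof (rule smooth_fun_coinduct[of _ "{%x. c * f (a *\<^sub>R x) |c f. smooth_fun f}"])
  show "(%x. f (a *\<^sub>R x)) \<in> {%x. c * f (a *\<^sub>R x) |c f. smooth_fun f}"
    using assms by (intro CollectI exI[of _ 1] exI[of _ f]) auto
  fix g :: "'n cfun" and i assume "g \<in> {%x. c * f (a *\<^sub>R x) |c f. smooth_fun f}"
  then obtain c f where g: "g = (%x. c * f (a *\<^sub>R x))" and f: "smooth_fun f" by blast
  show "continuous_on UNIV g" unfolding g
    by (intro continuous_intros continuous_on_compose2[OF smooth_fun_continuous[OF f]]) auto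
  have "has_pd g i (%x. (c * cor a) * dpart i f (a *\<^sub>R x))"
    unfolding has_pd_def
  proof
    fix x
    have "((%t. f (a *\<^sub>R x + t *\<^sub>R axis i 1)) has_vector_derivative dpart i f (a *\<^sub>R x + (a * 0 + 0) *\<^sub>R axis i 1)) (at (a * 0 + 0))"
      by (rule has_pd_at[OF smooth_fun_has_pd[OF f]])
    from has_vector_derivative_mult_right[OF has_vector_derivative_compose_affine[OF this], of c]
    show "((%t. g (x + t *\<^sub>R axis i 1)) has_vector_derivative (c * cor a) * dpart i f (a *\<^sub>R x)) (at 0)"
      unfolding g by (simp add: scaleR_add_right mult.assoc)
  qed
  then show "\<exists>h\<in>{%x. c * f (a *\<^sub>R x) |c f. smooth_fun f}. has_pd g i h"
    using smooth_fun_dpart[OF f] by (intro bexI[of _ "%x. (c * cor a) * dpart i f (a *\<^sub>R x)"]) auto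
qed

lemma fm_sum:
  assumes T: "tempered T" and n: "!!j. j \<in> J ==> bump R (n j)" and J: "finite J"
  shows "bump R (%\<xi>. \<Sum>j\<in>J. n j \<xi>) \<and> fm (%\<xi>. \<Sum>j\<in>J. n j \<xi>) T x = (\<Sum>j\<in>J. fm (n j) T x)"
  using J n
proof (induction J)
  case empty
  have b0: "bump R (%\<xi>. 0)" by (simp add: bump_def smooth_fun_const)
  have "T (FT (%\<xi>. 0 * (%_. 0) \<xi> + 0 * (%_. 0) \<xi>)) = 0"
    by (subst tempered_FT_lincomb[OF T b0 b0]) simp
  then show ?case using b0 by (simp add: fm_def)
next
  case (insert j J)
  have b1: "bump R (n j)" and b2: "bump R (%\<xi>. \<Sum>j\<in>J. n j \<xi>)" using insert by auto
  have b: "bump R (%\<xi>. 1 * n j \<xi> + 1 * (\<Sum>j\<in>J. n j \<xi>))" by (rule bump_lincomb[OF b1 b2])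
  have "T (FT (%\<xi>. 1 * (ee x \<xi> * n j \<xi>) + 1 * (ee x \<xi> * (\<Sum>j\<in>J. n j \<xi>)))) =
      1 * T (FT (%\<xi>. ee x \<xi> * n j \<xi>)) + 1 * T (FT (%\<xi>. ee x \<xi> * (\<Sum>j\<in>J. n j \<xi>)))"
    by (rule tempered_FT_lincomb[OF T bump_ee[OF b1] bump_ee[OF b2]])
  then have "fm (%\<xi>. n j \<xi> + (\<Sum>j\<in>J. n j \<xi>)) T x = fm (n j) T x + fm (%\<xi>. \<Sum>j\<in>J. n j \<xi>) T x"
    by (simp add: fm_def distrib_left)
  then show ?case using insert b by simp
qed

definition cpsi :: "(real^'n::finite => real) => nat => 'n cfun" where
  "cpsi \<psi>0 j \<xi> = cor (psi \<psi>0 j \<xi>)"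

lemma bump_mono: "bump R n ==> R \<le> R' ==> bump R' n"
proof -
  assume n: "bump R n" and R: "R \<le> R'"
  have "qbox R \<subseteq> qbox R'" unfolding qbox_def by (auto intro: order_trans[OF _ R])
  then show ?thesis using n unfolding bump_def by blast
qed

locale psi_setup =
  fixes \<psi>0 :: "real^'n::finite => real"
  assumes adm: "admissible_psi0 \<psi>0"
begin

lemma psi_sum: "(\<Sum>j\<le>J. psi \<psi>0 j \<xi>) = \<psi>0 ((1 / 2 ^ J) *\<^sub>R \<xi>)"
proof (induction J)
  case 0 then show ?case by (simp add: psi_def)
next
  case (Suc J)
  have "2 powr (- real (Suc J)) = 1 / 2 ^ Suc J" "2 powr (1 - real (Suc J)) = 1 / 2 ^ J"
    using two_powr_nat[of "Suc J" 1] by auto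
  then show ?case using Suc by (simp add: psi_def)
qed

lemma psi_zero:
  assumes "\<bar>\<xi> $ i\<bar> \<ge> 3/2 * 2 ^ j"
  shows "psi \<psi>0 j \<xi> = 0"
proof -
  have z: "\<psi>0 ((1 / 2 ^ l) *\<^sub>R \<xi>) = 0" if "l \<le> j" for l
  proof -
    have "3/2 * 2 ^ l \<le> (3/2 * 2 ^ j :: real)" by (intro mult_left_mono power_increasing that) auto
    then have "3/2 * 2 ^ l \<le> \<bar>\<xi> $ i\<bar>" using assms by (rule order_trans)
    then have "\<bar>((1 / 2 ^ l) *\<^sub>R \<xi>) $ i\<bar> \<ge> 3/2" by (simp add: abs_divide field_simps)
    then show ?thesis using adm unfolding admissible_psi0_def by blast
  qed
  show ?thesis
  proof (cases j)
    case 0 then show ?thesis using z[of 0] by (simp add: psi_def)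
  next
    case (Suc l)
    have "psi \<psi>0 j \<xi> = (\<Sum>j\<le>Suc l. psi \<psi>0 j \<xi>) - (\<Sum>j\<le>l. psi \<psi>0 j \<xi>)" using Suc by simp
    then show ?thesis unfolding psi_sum using z[of l] z[of "Suc l"] Suc by simp
  qed
qed

lemma bump_cpsi: "bump (3/2 * 2 ^ j) (cpsi \<psi>0 j)"
  unfolding bump_def
proof safe
  have s: "smooth_fun (%x. cor (\<psi>0 (a *\<^sub>R x)))" for a
    using adm smooth_fun_scale[of "%x. cor (\<psi>0 x)" a] by (auto simp: admissible_psi0_def)
  have s0: "smooth_fun (%x. cor (\<psi>0 x))" using s[of 1] by simp
  show "smooth_fun (cpsi \<psi>0 j)"
    using smooth_fun_lincomb[OF s s, of 1 "2 powr (- real j)" "-1" "2 powr (1 - real j)"] s0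
    by (cases "j = 0") (auto simp: cpsi_def[abs_def] psi_def)
  fix \<xi> :: "real^'n" assume "\<xi> \<notin> qbox (3/2 * 2 ^ j)"
  then obtain i where "\<bar>\<xi> $ i\<bar> > 3/2 * 2 ^ j" by (auto simp: qbox_def not_le)
  then show "cpsi \<psi>0 j \<xi> = 0" using psi_zero[of j \<xi> i] by (simp add: cpsi_def)
qed

end

section \<open>Arithmetic of the extended quasi-norms\<close>

lemma epowr_ennreal: "0 \<le> x ==> epowr (ennreal x) r = ennreal (x powr r)"
  by (simp add: epowr_def)

lemma epowr_top [simp]: "epowr \<top> r = \<top>" "epowr \<infinity> r = \<infinity>"
  by (simp_all add: epowr_def)

lemma epowr_zero [simp]: "epowr 0 r = 0"
  by (simp add: epowr_def)

lemma epowr_mono: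
  assumes "x \<le> y" "0 \<le> r"
  shows "epowr x r \<le> epowr y r"
proof (cases y)
  case (real b)
  then obtain a where a: "x = ennreal a" "0 \<le> a" using assms by (cases x) (auto simp: top_unique)
  then show ?thesis using real assms by (simp add: epowr_ennreal ennreal_leI powr_mono2)
qed simp

lemma epowr_cmult:
  assumes "0 < c" "0 < r"
  shows "epowr (ennreal c * x) r = ennreal (c powr r) * epowr x r"
proof (cases x)
  case (real a)
  then show ?thesis using assms by (simp add: epowr_ennreal powr_mult flip: ennreal_mult)
next
  case top
  then show ?thesis using assms by (simp add: ennreal_mult_top)
qed

lemma epowr_epowr:
  assumes "0 < r" "0 < s"
  shows "epowr (epowr x r) s = epowr x (r * s)"
  by (cases x) (auto simp: epowr_ennreal powr_powr)

lemma epowr_one [simp]: "epowr x 1 = x"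
  by (cases x) (auto simp: epowr_ennreal)

text \<open>The sum is at most the number of terms times the largest one, an argument that works for
  exponents on both sides of 1.\<close>

lemma epowr_sum_le:
  assumes J: "finite J" and r: "0 < r" and c: "real (card J) \<le> c" "0 < c"
  shows "epowr (\<Sum>j\<in>J. x j) r \<le> ennreal (c powr r) * (\<Sum>j\<in>J. epowr (x j) r)"
proof (cases "J = {}")
  case False
  define m where "m = Max (x ` J)"
  have m: "x j \<le> m" if "j \<in> J" for j unfolding m_def using J that by auto
  have "m \<in> x ` J" unfolding m_def using J False by (intro Max_in) auto
  then obtain j0 where j0: "j0 \<in> J" "x j0 = m" by auto
  have "(\<Sum>j\<in>J. x j) \<le> of_nat (card J) * m" using m by (rule sum_bounded_above)
  also have "... \<le> ennreal c * m"
    using c(1) by (intro mult_right_mono) (auto simp: ennreal_of_nat_eq_real_of_nat ennreal_leI)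
  finally have "epowr (\<Sum>j\<in>J. x j) r \<le> epowr (ennreal c * m) r" by (rule epowr_mono) (use r in simp)
  also have "... = ennreal (c powr r) * epowr (x j0) r" using j0 c r by (simp add: epowr_cmult)
  also have "... \<le> ennreal (c powr r) * (\<Sum>j\<in>J. epowr (x j) r)"
    using J j0 by (intro mult_left_mono member_le_sum) auto
  finally show ?thesis .
qed simp

lemma Lp_qnorm_real: "p \<noteq> \<infinity> ==> Lp_qnorm p g = epowr (Ip (enn2real p) g) (1 / enn2real p)"
  by (simp add: Lp_qnorm_def Ip_def)

text \<open>A continuous function that exceeds its essential supremum at one point does so on a
  nonempty open set, which is not negligible.\<close>

lemma Linf_ge:
  fixes g :: "'n::finite cfun"
  assumes g: "continuous_on UNIV g"
  shows "ennreal (norm (g x)) \<le> Lp_qnorm \<infinity> g"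
proof (rule ccontr)
  assume "\<not> ?thesis"
  then have lt: "Lp_qnorm \<infinity> g < ennreal (norm (g x))" by simp
  then obtain c where c: "Lp_qnorm \<infinity> g = ennreal c" "0 \<le> c" by (cases "Lp_qnorm \<infinity> g") auto
  define U where "U = {y. c < norm (g y)}"
  have "open U" unfolding U_def using g by (intro open_Collect_less continuous_intros)
  moreover have "x \<in> U" using lt c by (simp add: U_def ennreal_less_iff)
  ultimately have "\<not> negligible U" using open_not_negligible by blast
  moreover have "AE y in lborel. ennreal (norm (g y)) \<le> Lp_qnorm \<infinity> g"
    using esssup_AE[of "%y. ennreal (norm (g y))" lborel] by (simp add: Lp_qnorm_def)
  then have "AE y in lborel. y \<notin> U" using c by (auto simp: U_def)
  then have "U \<in> null_sets lborel"
    using \<open>open U\<close> by (subst (asm) AE_iff_null_sets[symmetric]) auto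
  then have "negligible U" by (simp add: negligible_iff_null_sets null_sets_completionI)
  ultimately show False by simp
qed

lemma Linf_le:
  fixes g :: "'n::finite cfun"
  assumes g: "g \<in> borel_measurable borel" and le: "!!x. ennreal (norm (g x)) \<le> c"
  shows "Lp_qnorm \<infinity> g \<le> c"
  unfolding Lp_qnorm_def using g le by (auto intro!: esssup_I)

text \<open>Crude for p \<ge> 1, but it covers the quasi-norms as well: the factors 3 and 3^(1/p)
  come from raising sums of at most three terms to the powers p and 1/p.\<close>

lemma Lp_qnorm_sum_le:
  fixes g :: "'j => 'n::finite cfun"
  assumes p: "0 < p" and J: "finite J" "card J \<le> 3" and g: "!!j. j \<in> J ==> continuous_on UNIV (g j)"
  shows "Lp_qnorm p (%x. \<Sum>j\<in>J. g j x) \<le> ennreal (3 * 3 powr inv_p p) * (\<Sum>j\<in>J. Lp_qnorm p (g j))"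
proof (cases "p = \<infinity>")
  case True
  have m: "(%x. \<Sum>j\<in>J. g j x) \<in> borel_measurable borel"
    using g by (intro borel_measurable_continuous_onI continuous_intros) auto
  have "Lp_qnorm p (%x. \<Sum>j\<in>J. g j x) \<le> (\<Sum>j\<in>J. Lp_qnorm p (g j))"
    unfolding True
  proof (rule Linf_le[OF m])
    fix x
    have "ennreal (norm (\<Sum>j\<in>J. g j x)) \<le> ennreal (\<Sum>j\<in>J. norm (g j x))" by (intro ennreal_leI norm_sum)
    also have "... = (\<Sum>j\<in>J. ennreal (norm (g j x)))" by (simp add: sum_ennreal)
    also have "... \<le> (\<Sum>j\<in>J. Lp_qnorm \<infinity> (g j))" by (intro sum_mono Linf_ge g)
    finally show "ennreal (norm (\<Sum>j\<in>J. g j x)) \<le> (\<Sum>j\<in>J. Lp_qnorm \<infinity> (g j))" .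
  qed
  also have "... \<le> ennreal (3 * 3 powr inv_p p) * (\<Sum>j\<in>J. Lp_qnorm p (g j))"
    using mult_right_mono[of 1 "ennreal (3 * 3 powr inv_p p)" "\<Sum>j\<in>J. Lp_qnorm p (g j)"] True
    by (simp add: inv_p_def)
  finally show ?thesis .
next
  case False
  define r where "r = enn2real p"
  have r: "r > 0" using p False by (simp add: r_def enn2real_positive_iff less_top)
  have c3: "real (card J) \<le> 3" using J by simp
  have [measurable]: "g j \<in> borel_measurable borel" if "j \<in> J" for j
    using g that by (intro borel_measurable_continuous_onI)
  have "Ip r (%x. \<Sum>j\<in>J. g j x) \<le> (\<integral>\<^sup>+x. ennreal (3 powr r) * (\<Sum>j\<in>J. ennreal (norm (g j x) powr r)) \<partial>lborel)"
    unfolding Ip_def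
  proof (rule nn_integral_mono)
    fix x
    have "ennreal (norm (\<Sum>j\<in>J. g j x) powr r) \<le> ennreal ((\<Sum>j\<in>J. norm (g j x)) powr r)"
      by (intro ennreal_leI powr_mono2 norm_sum) (use r in auto)
    also have "... = epowr (\<Sum>j\<in>J. ennreal (norm (g j x))) r" by (simp add: sum_ennreal epowr_ennreal sum_nonneg)
    also have "... \<le> ennreal (3 powr r) * (\<Sum>j\<in>J. epowr (ennreal (norm (g j x))) r)"
      by (rule epowr_sum_le[OF J(1) r c3]) simp
    finally show "ennreal (norm (\<Sum>j\<in>J. g j x) powr r) \<le> ennreal (3 powr r) * (\<Sum>j\<in>J. ennreal (norm (g j x) powr r))"
      by (simp add: epowr_ennreal)
  qed
  also have "... = ennreal (3 powr r) * (\<Sum>j\<in>J. Ip r (g j))"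
    unfolding Ip_def by (subst nn_integral_cmult) (auto simp: nn_integral_sum simp del: sum_ennreal)
  finally have "Lp_qnorm p (%x. \<Sum>j\<in>J. g j x) \<le> epowr (ennreal (3 powr r) * (\<Sum>j\<in>J. Ip r (g j))) (1 / r)"
    unfolding Lp_qnorm_real[OF False] r_def[symmetric] by (rule epowr_mono) (use r in simp)
  also have "... = ennreal 3 * epowr (\<Sum>j\<in>J. Ip r (g j)) (1 / r)"
    using r by (subst epowr_cmult) (auto simp: powr_powr)
  also have "... \<le> ennreal 3 * (ennreal (3 powr (1 / r)) * (\<Sum>j\<in>J. epowr (Ip r (g j)) (1 / r)))"
    by (intro mult_left_mono epowr_sum_le[OF J(1) _ c3]) (use r in auto)
  also have "... = ennreal (3 * 3 powr inv_p p) * (\<Sum>j\<in>J. Lp_qnorm p (g j))"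
    unfolding Lp_qnorm_real[OF False] r_def[symmetric] using False
    by (simp add: inv_p_def r_def ennreal_mult mult.assoc)
  finally show ?thesis .
qed

section \<open>Splitting a mixed block into isotropic blocks\<close>

lemma smooth_fun_coord_sm1: "sm1 m ==> smooth_fun (%\<xi>::real^'n::finite. m (\<xi> $ i))"
  unfolding sm1_def using smooth_fun_coord by blast

lemma smooth_fun_prod_coord:
  assumes "finite I" "!!i. i \<in> I ==> sm1 (m i)"
  shows "smooth_fun (%\<xi>::real^'n::finite. \<Prod>i\<in>I. m i (\<xi> $ i))"
  using assms
proof (induction I)
  case (insert i I)
  then show ?case using smooth_fun_mult[OF smooth_fun_coord_sm1[of "m i" i]] by auto
qed (simp add: smooth_fun_const)

locale decomposition = phi: phi_setup \<phi>0 + psi: psi_setup \<psi>0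
  for \<phi>0 :: "real => real" and \<psi>0 :: "real^'n::finite => real"
begin

abbreviation BN :: "real => ennreal => ennreal => ('n cfun => complex) => ennreal" where
  "BN t p q == besov_qnorm \<psi>0 (t * real CARD('n)) p q"

text \<open>The mixed cutoffs are applied to the isotropic block \<open>j\<close> on the axes in
  \<open>I\<close> only, so that the axes can be added one at a time.\<close>

definition PM :: "'n set => ('n => nat) => nat => (('n cfun) => complex) => 'n cfun" where
  "PM I k j T = fm (%\<xi>. (\<Prod>i\<in>I. cphi \<phi>0 (k i) (\<xi> $ i)) * cpsi \<psi>0 j \<xi>) T"

lemma bump_PM: "bump (3/2 * 2 ^ j) (%\<xi>. (\<Prod>i\<in>I. cphi \<phi>0 (k i) (\<xi> $ i)) * cpsi \<psi>0 j \<xi>)"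
  by (intro bump_mult psi.bump_cpsi smooth_fun_prod_coord) (use phi.test_cphi in \<open>auto simp: test1_def\<close>)

lemma PM_empty: "PM {} k j T = fmult (psi \<psi>0 j) T"
  by (simp add: PM_def fmult_eq_fm cpsi_def[abs_def])

lemma PM_insert:
  assumes "tempered T" "i \<notin> I"
  shows "PM (insert i I) k j T = axc i (ker (cphi \<phi>0 (k i))) (PM I k j T)"
  unfolding PM_def using fm_axc[OF assms(1) bump_PM[where j = j and I = I and k = k] phi.test_cphi[of "k i"], of i] assms(2)
  by (simp add: mult.assoc)

lemma PM_continuous: "tempered T ==> continuous_on UNIV (PM I k j T)"
  unfolding PM_def by (rule fm_continuous[OF _ bump_PM])

lemma PM_pg: "tempered T ==> pg (PM I k j T)"
  unfolding PM_def by (rule pg_fm[OF _ bump_PM])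

lemma PM_cong: "(!!i. i \<in> I ==> k i = k' i) ==> PM I k j T = PM I k' j T"
  unfolding PM_def by (metis (no_types, lifting) prod.cong)

text \<open>For p \<ge> 1 the kernels have uniformly bounded L_1 norms. For p < 1 the height of
  order 2^j of the reproducing kernel enters with power 1 - p, and the integral of the p-th power of
  the level-k kernel is at most of order 2^(k(p-1)); together they give 2^((j-k)(1-p)), and the p-th
  root yields the exponent.\<close>

lemma axis_bound:
  assumes p: "0 < p"
  shows "\<exists>C>0. \<forall>T j k i n. tempered T --> bump (3/2 * 2 ^ j) (n :: 'n cfun) --> k \<le> Suc j -->
    Lp_qnorm p (axc i (ker (cphi \<phi>0 k)) (fm n T)) \<le>
      ennreal (C * 2 powr ((real j - real k) * max 0 (inv_p p - 1))) * Lp_qnorm p (fm n T)"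
proof -
  obtain A where "kfam (%k. ker (cphi \<phi>0 k)) A" using phi.kfam_cphi by blast
  note K = kfamD[OF this]
  show ?thesis
  proof (cases "p = \<infinity>")
    case True
    show ?thesis
    proof (rule exI[of _ A], intro conjI allI impI)
      fix T :: "('n cfun) => complex" and j k :: nat and i :: 'n and n :: "'n cfun"
      assume T: "tempered T" and n: "bump (3/2 * 2 ^ j) n"
      let ?f = "fm n T"
      have "Lp_qnorm \<infinity> (axc i (ker (cphi \<phi>0 k)) ?f) \<le> ennreal A * Lp_qnorm \<infinity> ?f"
      proof (cases "Lp_qnorm \<infinity> ?f")
        case (real c)
        have b: "norm (?f x) \<le> c" for x
          using Linf_ge[OF fm_continuous[OF T n], of x] real by simp
        have pgf: "pg ?f" by (rule pg_fm[OF T n])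
        show ?thesis
          unfolding real(2)
        proof (rule Linf_le)
          show "axc i (ker (cphi \<phi>0 k)) ?f \<in> borel_measurable borel" by (rule pg_measurable[OF pg_axc[OF K(2) pgf]])
          show "ennreal (norm (axc i (ker (cphi \<phi>0 k)) ?f x)) \<le> ennreal A * ennreal c" for x
            using young_axis_sup[OF K(2)[of k] pgf b K(3)[of k], of i x] K(1) real(1) by (simp add: ennreal_leI flip: ennreal_mult)
        qed
      next
        case top
        then show ?thesis using K(1) by (simp add: ennreal_mult_top)
      qed
      then show "Lp_qnorm p (axc i (ker (cphi \<phi>0 k)) ?f) \<le> ennreal (A * 2 powr ((real j - real k) * max 0 (inv_p p - 1))) * Lp_qnorm p ?f"
        using True by (simp add: inv_p_def)
    qed (rule K(1))
  next
    case False
    define r where "r = enn2real p"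
    have r: "r > 0" using p False by (simp add: r_def enn2real_positive_iff less_top)
    have inv: "inv_p p = 1 / r" using False by (simp add: inv_p_def r_def)
    define s where "s = max 0 (1 - r)"
    have s\<sigma>: "s * (1 / r) = max 0 (inv_p p - 1)" using r by (auto simp: s_def inv max_def field_simps)
    have Ibound: "\<exists>C>0. \<forall>T j k i n. tempered T --> bump (3/2 * 2 ^ j) (n :: 'n cfun) --> k \<le> Suc j -->
      Ip r (axc i (ker (cphi \<phi>0 k)) (fm n T)) \<le> ennreal (C * 2 powr ((real j - real k) * s)) * Ip r (fm n T)"
    proof (cases "r < 1")
      case False
      show ?thesis
      proof (rule exI[of _ "A powr r"], intro conjI allI impI)
        fix T :: "('n cfun) => complex" and j k :: nat and i :: 'n and n :: "'n cfun"
        assume T: "tempered T" and n: "bump (3/2 * 2 ^ j) n"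
        show "Ip r (axc i (ker (cphi \<phi>0 k)) (fm n T)) \<le> ennreal (A powr r * 2 powr ((real j - real k) * s)) * Ip r (fm n T)"
          using young_axis[OF K(2) pg_fm[OF T n] _ K(3) K(1), of r i k] False by (simp add: s_def)
      qed (use K(1) in simp)
    next
      case True
      obtain c where c: "c > 0" "!!k. (\<integral>\<^sup>+s. ennreal (norm (ker (cphi \<phi>0 k) s) powr r) \<partial>lborel) \<le> ennreal (c * 2 powr (real k * (r - 1)))"
        using phi.ker_cphi_powr[OF r] by blast
      obtain H where H: "H > 0" "!!j. \<exists>R \<Phi>. test1 R \<Phi> \<and> (\<forall>u. \<bar>u\<bar> \<le> 8 * 2 ^ j --> \<Phi> u = 1) \<and> (\<forall>r. norm (ker \<Phi> r) \<le> H * 2 ^ j)"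
        using phi.cutoff_kernel by blast
      show ?thesis
      proof (rule exI[of _ "H powr (1 - r) * c"], intro conjI allI impI)
        fix T :: "('n cfun) => complex" and j k :: nat and i :: 'n and n :: "'n cfun"
        assume T: "tempered T" and n: "bump (3/2 * 2 ^ j) n" and k: "k \<le> Suc j"
        obtain R \<Phi> where \<Phi>: "test1 R \<Phi>" "!!u. \<bar>u\<bar> \<le> 8 * 2 ^ j ==> \<Phi> u = 1" "!!r. norm (ker \<Phi> r) \<le> H * 2 ^ j"
          using H(2)[of j] by blast
        \<comment> \<open>As k \<le> j + 1, the two supports add up to at most 3/2 (2^j + 2^(j+1)) =
          9/2 2^j, well within the range 8 2^j on which the cutoff is 1.\<close>
        have "(2::real) ^ k \<le> 2 ^ Suc j" by (rule power_increasing[OF k]) simp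
        then have "(2::real) ^ k \<le> 2 * 2 ^ j" "(0::real) \<le> 2 ^ j" by auto
        then have R: "3/2 * 2 ^ j + 3/2 * 2 ^ k \<le> (8 * 2 ^ j :: real)" by linarith
        have "Ip r (axc i (ker (cphi \<phi>0 k)) (fm n T)) \<le>
           ennreal ((H * 2 ^ j) powr (1 - r)) * (\<integral>\<^sup>+s. ennreal (norm (ker (cphi \<phi>0 k) s) powr r) \<partial>lborel) * Ip r (fm n T)"
          by (rule small_p_axis[OF T n phi.test_cphi \<Phi>(1) \<Phi>(2) \<Phi>(3) r]) (use R True in \<open>auto intro: order_trans\<close>)
        also have "... \<le> ennreal ((H * 2 ^ j) powr (1 - r)) * ennreal (c * 2 powr (real k * (r - 1))) * Ip r (fm n T)"
          by (intro mult_right_mono mult_left_mono c(2)) auto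
        also have "ennreal ((H * 2 ^ j) powr (1 - r)) * ennreal (c * 2 powr (real k * (r - 1))) = ennreal (H powr (1 - r) * c * 2 powr ((real j - real k) * s))"
        proof -
          have "(H * 2 ^ j) powr (1 - r) * (c * 2 powr (real k * (r - 1))) = H powr (1 - r) * c * (2 powr (real j * (1 - r)) * 2 powr (real k * (r - 1)))"
            using H(1) by (simp add: powr_mult powr_powr flip: powr_realpow)
          also have "2 powr (real j * (1 - r)) * 2 powr (real k * (r - 1)) = 2 powr ((real j - real k) * s)"
            using True by (simp add: s_def algebra_simps flip: powr_add)
          finally show ?thesis using c(1) by (simp flip: ennreal_mult)
        qed
        finally show "Ip r (axc i (ker (cphi \<phi>0 k)) (fm n T)) \<le> ennreal (H powr (1 - r) * c * 2 powr ((real j - real k) * s)) * Ip r (fm n T)" .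
      qed (use H c in simp)
    qed
    then obtain C where C: "C > 0" "!!T j k i n. tempered T ==> bump (3/2 * 2 ^ j) (n :: 'n cfun) ==> k \<le> Suc j ==>
      Ip r (axc i (ker (cphi \<phi>0 k)) (fm n T)) \<le> ennreal (C * 2 powr ((real j - real k) * s)) * Ip r (fm n T)" by metis
    show ?thesis
    proof (rule exI[of _ "C powr (1 / r)"], intro conjI allI impI)
      fix T :: "('n cfun) => complex" and j k :: nat and i :: 'n and n :: "'n cfun"
      assume T: "tempered T" and n: "bump (3/2 * 2 ^ j) n" and k: "k \<le> Suc j"
      have "epowr (Ip r (axc i (ker (cphi \<phi>0 k)) (fm n T))) (1 / r) \<le> epowr (ennreal (C * 2 powr ((real j - real k) * s)) * Ip r (fm n T)) (1 / r)"
        by (rule epowr_mono[OF C(2)[OF T n k]]) (use r in simp)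
      also have "... = ennreal ((C * 2 powr ((real j - real k) * s)) powr (1 / r)) * epowr (Ip r (fm n T)) (1 / r)"
        by (rule epowr_cmult) (use C r in auto)
      also have "(C * 2 powr ((real j - real k) * s)) powr (1 / r) = C powr (1 / r) * 2 powr ((real j - real k) * (s * (1 / r)))"
        using C(1) by (simp add: powr_mult powr_powr)
      finally show "Lp_qnorm p (axc i (ker (cphi \<phi>0 k)) (fm n T)) \<le> ennreal (C powr (1 / r) * 2 powr ((real j - real k) * max 0 (inv_p p - 1))) * Lp_qnorm p (fm n T)"
        unfolding Lp_qnorm_real[OF \<open>p \<noteq> \<infinity>\<close>] r_def[symmetric] s\<sigma> .
    qed (use C in simp)
  qed
qed

lemma block_bound:
  assumes p: "0 < p"
  shows "\<exists>C>0. \<forall>T j k. tempered T --> (\<forall>i. k i \<le> Suc j) -->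
    Lp_qnorm p (PM UNIV k j T) \<le>
      ennreal (C * 2 powr ((real j * real CARD('n) - real (sum k UNIV)) * max 0 (inv_p p - 1))) * Lp_qnorm p (fmult (psi \<psi>0 j) T)"
proof -
  let ?\<sigma> = "max 0 (inv_p p - 1)"
  obtain C where C: "C > 0" "!!T j k i n. tempered T ==> bump (3/2 * 2 ^ j) (n :: 'n cfun) ==> k \<le> Suc j ==>
    Lp_qnorm p (axc i (ker (cphi \<phi>0 k)) (fm n T)) \<le> ennreal (C * 2 powr ((real j - real k) * ?\<sigma>)) * Lp_qnorm p (fm n T)"
    using axis_bound[OF p] by metis
  have ind: "Lp_qnorm p (PM I k j T) \<le> ennreal (\<Prod>i\<in>I. C * 2 powr ((real j - real (k i)) * ?\<sigma>)) * Lp_qnorm p (fmult (psi \<psi>0 j) T)"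
    if T: "tempered T" and k: "\<forall>i. k i \<le> Suc j" and I: "finite I" for T j k I
    using I
  proof (induction I)
    case empty then show ?case by (simp add: PM_empty)
  next
    case (insert i I)
    have "Lp_qnorm p (PM (insert i I) k j T) \<le> ennreal (C * 2 powr ((real j - real (k i)) * ?\<sigma>)) * Lp_qnorm p (PM I k j T)"
      unfolding PM_insert[OF T insert.hyps(2)] unfolding PM_def by (rule C(2)[OF T bump_PM]) (use k in simp)
    also have "... \<le> ennreal (C * 2 powr ((real j - real (k i)) * ?\<sigma>)) * (ennreal (\<Prod>i\<in>I. C * 2 powr ((real j - real (k i)) * ?\<sigma>)) * Lp_qnorm p (fmult (psi \<psi>0 j) T))"
      by (intro mult_left_mono insert.IH) auto
    also have "... = ennreal (\<Prod>i\<in>insert i I. C * 2 powr ((real j - real (k i)) * ?\<sigma>)) * Lp_qnorm p (fmult (psi \<psi>0 j) T)"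
      using insert.hyps C(1) by (simp add: ennreal_mult[symmetric] prod_nonneg mult.assoc[symmetric] less_imp_le)
    finally show ?case .
  qed
  show ?thesis
  proof (rule exI[of _ "C ^ CARD('n)"], intro conjI allI impI)
    fix T :: "('n cfun) => complex" and j and k :: "'n => nat"
    assume T: "tempered T" and k: "\<forall>i. k i \<le> Suc j"
    have "(\<Prod>i\<in>UNIV. C * 2 powr ((real j - real (k i)) * ?\<sigma>)) = C ^ CARD('n) * 2 powr (\<Sum>i\<in>UNIV. (real j - real (k i)) * ?\<sigma>)"
      by (simp add: prod.distrib powr_sum)
    also have "(\<Sum>i\<in>UNIV. (real j - real (k i)) * ?\<sigma>) = (real j * real CARD('n) - real (sum k UNIV)) * ?\<sigma>"
      by (simp add: sum_distrib_right[symmetric] sum_subtractf mult.commute)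
    finally show "Lp_qnorm p (PM UNIV k j T) \<le> ennreal (C ^ CARD('n) * 2 powr ((real j * real CARD('n) - real (sum k UNIV)) * ?\<sigma>)) * Lp_qnorm p (fmult (psi \<psi>0 j) T)"
      using ind[OF T k finite[of UNIV]] by simp
  qed (use C in simp)
qed

text \<open>Let K be the largest entry of \<open>k\<close>. For K > 0 the mixed block lives where
  the largest coordinate of \<xi> lies between 2^(K-1) and 3/2 2^K, and only these isotropic blocks
  can meet it. For K = 0 truncated subtraction makes the set {0, 1}.\<close>

definition Jset :: "('n => nat) => nat set" where
  "Jset k = {Max (range k) - 1 .. Max (range k) + 1}"

lemma Jset_bound: "j \<in> Jset k ==> k i \<le> Suc j"
proof -
  assume "j \<in> Jset k"
  then have "Max (range k) - 1 \<le> j" by (simp add: Jset_def)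
  moreover have "k i \<le> Max (range k)" by (rule Max_ge) auto
  ultimately show ?thesis by linarith
qed

lemma Jset_card: "finite (Jset k)" "card (Jset k) \<le> 3"
  by (auto simp: Jset_def)

lemma phi_support:
  assumes "phi \<phi>0 k s \<noteq> 0"
  shows "\<bar>s\<bar> \<le> 3/2 * 2 ^ k" "k > 0 ==> \<bar>s\<bar> > 2 ^ (k - 1)"
proof -
  show "\<bar>s\<bar> \<le> 3/2 * 2 ^ k"
    using phi.test_cphi[of k] assms by (auto simp: test1_def cphi_def not_less[symmetric])
  assume k: "k > 0"
  show "\<bar>s\<bar> > 2 ^ (k - 1)"
  proof (rule ccontr)
    assume "\<not> ?thesis"
    then have s: "\<bar>s\<bar> \<le> 2 ^ (k - 1)" by simp
    have k2: "(2::real) ^ k = 2 * 2 ^ (k - 1)" using k by (metis Suc_diff_1 power_Suc)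
    have "\<bar>2 * (s / 2 ^ k)\<bar> \<le> 1" "\<bar>s / 2 ^ k\<bar> \<le> 1" using s by (auto simp: k2 abs_divide field_simps)
    then have "\<phi>0 (2 * (s / 2 ^ k)) = 1" "\<phi>0 (s / 2 ^ k) = 1"
      using phi.adm unfolding admissible_phi0_def by blast+
    then show False using assms k by (simp add: phi_def two_powr_nat)
  qed
qed

text \<open>On the support of the mixed block, with K the largest entry, the isotropic functions up
  to level K + 1 add up to 1, since 3/2 2^K \<le> 2^(K+1), while those below level K - 1 add up to
  0.\<close>

lemma phi_multi_decomp:
  "cor (phi_multi \<phi>0 k \<xi>) = (\<Sum>j\<in>Jset k. (\<Prod>i\<in>UNIV. cphi \<phi>0 (k i) (\<xi> $ i)) * cpsi \<psi>0 j \<xi>)"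
proof -
  have P: "(\<Prod>i\<in>UNIV. cphi \<phi>0 (k i) (\<xi> $ i)) = cor (phi_multi \<phi>0 k \<xi>)"
    by (simp add: phi_multi_def cphi_def)
  show ?thesis
  proof (cases "phi_multi \<phi>0 k \<xi> = 0")
    case False
    define \<kappa> where "\<kappa> = Max (range k)"
    have nz: "phi \<phi>0 (k i) (\<xi> $ i) \<noteq> 0" for i using False by (auto simp: phi_multi_def)
    have k\<kappa>: "k i \<le> \<kappa>" for i unfolding \<kappa>_def by (rule Max_ge) auto
    have "(\<Sum>j\<le>Suc \<kappa>. psi \<psi>0 j \<xi>) = 1"
      unfolding psi.psi_sum
    proof -
      have "\<bar>((1 / 2 ^ Suc \<kappa>) *\<^sub>R \<xi>) $ i\<bar> \<le> 1" for i
      proof -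
        have "\<bar>\<xi> $ i\<bar> \<le> 3/2 * 2 ^ k i" by (rule phi_support[OF nz])
        also have "... \<le> 3/2 * 2 ^ \<kappa>" by (intro mult_left_mono power_increasing k\<kappa>) auto
        also have "... \<le> 2 ^ Suc \<kappa>" by simp
        finally show ?thesis by (simp add: abs_divide field_simps)
      qed
      then show "\<psi>0 ((1 / 2 ^ Suc \<kappa>) *\<^sub>R \<xi>) = 1" using psi.adm unfolding admissible_psi0_def by blast
    qed
    moreover have "(\<Sum>j\<in>{..<\<kappa> - 1}. psi \<psi>0 j \<xi>) = 0"
    proof (cases "\<kappa> - 1")
      case (Suc m)
      have "\<kappa> \<in> range k" unfolding \<kappa>_def by (rule Max_in) auto
      then obtain i where i: "k i = \<kappa>" by auto
      have "\<bar>\<xi> $ i\<bar> > 2 ^ (\<kappa> - 1)" using phi_support(2)[OF nz, of i] i Suc by auto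
      \<comment> \<open>Here m is \<kappa> - 2, so the rescaled coordinate has modulus above 2,
        hence at least 3/2.\<close>
      then have "\<bar>((1 / 2 ^ m) *\<^sub>R \<xi>) $ i\<bar> \<ge> 3/2" unfolding Suc by (simp add: abs_divide field_simps)
      then have "\<psi>0 ((1 / 2 ^ m) *\<^sub>R \<xi>) = 0" using psi.adm unfolding admissible_psi0_def by blast
      then show ?thesis using psi.psi_sum[of \<xi> m] Suc by (simp add: lessThan_Suc_atMost)
    qed simp
    moreover have "{..Suc \<kappa>} = {..<\<kappa> - 1} \<union> Jset k" "{..<\<kappa> - 1} \<inter> Jset k = {}"
      by (auto simp: Jset_def \<kappa>_def)
    ultimately have "(\<Sum>j\<in>Jset k. psi \<psi>0 j \<xi>) = 1"
      using Jset_card(1)[of k] by (simp add: sum.union_disjoint)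
    then have "(\<Sum>j\<in>Jset k. cpsi \<psi>0 j \<xi>) = 1"
      unfolding cpsi_def by (simp flip: of_real_sum)
    then show ?thesis unfolding P by (simp flip: sum_distrib_left)
  qed (simp add: P)
qed

lemma block_decomp:
  assumes T: "tempered T"
  shows "fmult (phi_multi \<phi>0 k) T = (%x. \<Sum>j\<in>Jset k. PM UNIV k j T x)"
proof
  fix x
  define R where "R = 3/2 * (2::real) ^ (Max (range k) + 1)"
  have "bump R (%\<xi>. (\<Prod>i\<in>UNIV. cphi \<phi>0 (k i) (\<xi> $ i)) * cpsi \<psi>0 j \<xi>)" if "j \<in> Jset k" for j
  proof (rule bump_mono[OF bump_PM])
    have "j \<le> Max (range k) + 1" using that by (simp add: Jset_def)
    then show "3/2 * 2 ^ j \<le> R" unfolding R_def by (intro mult_left_mono power_increasing) auto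
  qed
  then show "fmult (phi_multi \<phi>0 k) T x = (\<Sum>j\<in>Jset k. PM UNIV k j T x)"
    unfolding fmult_eq_fm phi_multi_decomp PM_def
    by (intro conjunct2[OF fm_sum[OF T _ Jset_card(1)]])
qed

lemma block_qnorm:
  assumes T: "tempered T" and p: "0 < p"
  shows "Lp_qnorm p (fmult (phi_multi \<phi>0 k) T) \<le> ennreal (3 * 3 powr inv_p p) * (\<Sum>j\<in>Jset k. Lp_qnorm p (PM UNIV k j T))"
  unfolding block_decomp[OF T] by (rule Lp_qnorm_sum_le[OF p Jset_card]) (rule PM_continuous[OF T])

end

section \<open>Sufficiency\<close>

text \<open>The earlier bound takes a positive majorant A0 of the norm. If the norm is positive it
  serves as A0; if it is 0, a sufficiently small A0 would contradict a positive sum.\<close>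

lemma axis_lr_bound_np:
  assumes K: "kfam K A" and p: "1 < p"
  shows "\<exists>C\<ge>0. \<forall>(i::'n::finite) (f :: 'n cfun) L. Lpi p f -->
    (\<Sum>k<L. np p (axc i (K k) f) powr (max 2 p / p)) \<le> C * np p f powr (max 2 p / p)"
proof -
  obtain C where C: "C \<ge> 0" "!!(i::'n) (f :: 'n cfun) A0 L. Lpi p f ==> np p f \<le> A0 powr p ==> A0 > 0 ==>
    (\<Sum>k<L. np p (axc i (K k) f) powr (max 2 p / p)) \<le> C * A0 powr max 2 p"
    using axis_lr_bound[OF K p] by metis
  show ?thesis
  proof (rule exI[of _ C], intro conjI allI impI C(1))
    fix i :: 'n and f :: "'n cfun" and L :: nat assume f: "Lpi p f"
    let ?S = "\<Sum>k<L. np p (axc i (K k) f) powr (max 2 p / p)"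
    show "?S \<le> C * np p f powr (max 2 p / p)"
    proof (cases "np p f = 0")
      case True
      have "?S \<le> 0"
      proof (rule ccontr)
        assume "\<not> ?S \<le> 0"
        then have S: "?S > 0" by simp
        define A0 where "A0 = (?S / (2 * (C + 1))) powr (1 / max 2 p)"
        have A0: "A0 > 0" using S C(1) by (simp add: A0_def)
        have "?S \<le> C * A0 powr max 2 p" by (rule C(2)[OF f _ A0]) (simp add: True)
        also have "A0 powr max 2 p = ?S / (2 * (C + 1))"
        proof -
          have "max 2 p \<noteq> 0" by (simp add: max_def)
          then have "A0 powr max 2 p = (?S / (2 * (C + 1))) powr 1" unfolding A0_def powr_powr by simp
          then show ?thesis using S C(1) by simp
        qed
        also have "C * (?S / (2 * (C + 1))) < ?S"
        proof -
          have "C / (2 * (C + 1)) < 1" using C(1) by simp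
          then have "C / (2 * (C + 1)) * ?S < 1 * ?S" using S by (rule mult_strict_right_mono)
          then show ?thesis by simp
        qed
        finally show False by simp
      qed
      then show ?thesis by (simp add: True)
    next
      case False
      then have n: "np p f > 0" using np_nonneg[of p f] by simp
      have "?S \<le> C * (np p f powr (1 / p)) powr max 2 p"
        by (rule C(2)[OF f]) (use n p in \<open>auto simp: powr_powr\<close>)
      then show ?thesis using n by (simp add: powr_powr)
    qed
  qed
qed

lemma sum_powr_ge1:
  fixes x :: "'k => real"
  assumes "finite I" "!!k. k \<in> I ==> 0 \<le> x k" "1 \<le> \<alpha>"
  shows "(\<Sum>k\<in>I. x k powr \<alpha>) \<le> (\<Sum>k\<in>I. x k) powr \<alpha>"
proof -
  have X: "0 \<le> (\<Sum>k\<in>I. x k)" by (intro sum_nonneg assms)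
  have "(\<Sum>k\<in>I. x k powr \<alpha>) \<le> (\<Sum>k\<in>I. x k * (\<Sum>k\<in>I. x k) powr (\<alpha> - 1))"
  proof (rule sum_mono)
    fix k assume k: "k \<in> I"
    have "x k powr \<alpha> = x k powr (\<alpha> - 1) * x k" by (rule powr_minus_one_mult[symmetric, OF assms(2)[OF k]])
    also have "... \<le> (\<Sum>k\<in>I. x k) powr (\<alpha> - 1) * x k"
      by (intro mult_right_mono powr_mono2 member_le_sum) (use assms k in auto)
    finally show "x k powr \<alpha> \<le> x k * (\<Sum>k\<in>I. x k) powr (\<alpha> - 1)" by (simp add: mult.commute)
  qed
  also have "... = (\<Sum>k\<in>I. x k) powr \<alpha>"
    using powr_minus_one_mult[OF X, of \<alpha>] by (simp add: sum_distrib_right[symmetric] mult.commute)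
  finally show ?thesis .
qed

lemma geometric_sum_le:
  fixes x :: real
  assumes "1 < x"
  shows "(\<Sum>m\<le>M. x ^ m) \<le> x / (x - 1) * x ^ M"
proof -
  have "(\<Sum>m\<le>M. x ^ m) = (x ^ Suc M - 1) / (x - 1)"
    using geometric_sum[of x "Suc M"] assms by (simp add: lessThan_Suc_atMost)
  also have "... \<le> x ^ Suc M / (x - 1)" using assms by (intro divide_right_mono) auto
  finally show ?thesis by simp
qed

lemma nn_integral_count_space_swap:
  fixes f :: "'k::countable => 'j::countable => ennreal"
  shows "(\<integral>\<^sup>+k. \<integral>\<^sup>+j. f k j \<partial>count_space UNIV \<partial>count_space UNIV) = (\<integral>\<^sup>+j. \<integral>\<^sup>+k. f k j \<partial>count_space UNIV \<partial>count_space UNIV)"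
proof -
  interpret pair_sigma_finite "count_space (UNIV :: 'j set)" "count_space (UNIV :: 'k set)"
    by (intro pair_sigma_finite.intro sigma_finite_measure_count_space)
  show ?thesis
    by (rule Fubini') (simp add: pair_measure_countable)
qed

context decomposition
begin

text \<open>The power m / r with m = max(2, r) turns \<open>np r\<close> into the m-th power of the
  norm, and in this form the one-axis bound can be iterated: summing over the index of the new axis
  first leaves the same expression with one axis less. For q \<ge> m the sum of q-th powers is then
  controlled by that of m-th powers.\<close>

lemma lr_block:
  assumes p: "1 < p" "p \<noteq> \<infinity>" and q: "max 2 (enn2real p) \<le> q"
  shows "\<exists>C>0. \<forall>T j L. tempered T -->
    (\<Sum>k\<in>PiE UNIV (%_. {..<L}). epowr (Lp_qnorm p (PM UNIV k j T)) q) \<le> ennreal C * epowr (Lp_qnorm p (fmult (psi \<psi>0 j) T)) q"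
proof -
  define r where "r = enn2real p"
  have r: "r > 1" using p by (cases p) (auto simp: r_def ennreal_less_iff simp flip: ennreal_1)
  define m where "m = max 2 r"
  have m: "m > 0" "m \<le> q" using q by (auto simp: m_def r_def)
  have q0: "q > 0" using m by simp
  obtain A where K: "kfam (%k. ker (cphi \<phi>0 k)) A" using phi.kfam_cphi by blast
  obtain C where C: "C \<ge> 0" "!!(i::'n) (f :: 'n cfun) L. Lpi r f ==>
    (\<Sum>k<L. np r (axc i (ker (cphi \<phi>0 k)) f) powr (m / r)) \<le> C * np r f powr (m / r)"
    using axis_lr_bound_np[OF K r] unfolding m_def by metis
  have ind: "(\<forall>k. Lpi r (PM I k j T)) \<and>
      (\<Sum>k\<in>PiE I (%_. {..<L}). np r (PM I k j T) powr (m / r)) \<le> C ^ card I * np r (fmult (psi \<psi>0 j) T) powr (m / r)"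
    if T: "tempered T" and f: "Lpi r (fmult (psi \<psi>0 j) T)" and I: "finite I" for T j L I
    using I
  proof (induction I)
    case empty then show ?case using f by (simp add: PM_empty)
  next
    case (insert i I)
    let ?F = "%_::'n. {..<L}"
    have L: "Lpi r (PM (insert i I) k j T)" for k
      unfolding PM_insert[OF T insert.hyps(2)]
      by (rule Lpi_axc(1)[OF kfamD(2)[OF K] _ _ kfamD(3)[OF K] kfamD(1)[OF K]]) (use insert r in auto)
    have "(\<Sum>k\<in>PiE (insert i I) ?F. np r (PM (insert i I) k j T) powr (m / r)) =
       (\<Sum>(y, k)\<in>{..<L} \<times> PiE I ?F. np r (PM (insert i I) (k(i := y)) j T) powr (m / r))"
      unfolding PiE_insert_eq by (subst sum.reindex[OF inj_combinator[OF insert.hyps(2)]]) (auto simp: case_prod_unfold)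
    also have "... = (\<Sum>y<L. \<Sum>k\<in>PiE I ?F. np r (PM (insert i I) (k(i := y)) j T) powr (m / r))"
      by (rule sum.cartesian_product[symmetric])
    also have "... = (\<Sum>k\<in>PiE I ?F. \<Sum>y<L. np r (PM (insert i I) (k(i := y)) j T) powr (m / r))"
      by (rule sum.swap)
    also have "... = (\<Sum>k\<in>PiE I ?F. \<Sum>y<L. np r (axc i (ker (cphi \<phi>0 y)) (PM I k j T)) powr (m / r))"
    proof (intro sum.cong refl)
      fix k y
      have "PM I (k(i := y)) j T = PM I k j T" by (rule PM_cong) (use insert.hyps in auto)
      then show "np r (PM (insert i I) (k(i := y)) j T) powr (m / r) = np r (axc i (ker (cphi \<phi>0 y)) (PM I k j T)) powr (m / r)"
        by (simp add: PM_insert[OF T insert.hyps(2)])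
    qed
    also have "... \<le> (\<Sum>k\<in>PiE I ?F. C * np r (PM I k j T) powr (m / r))"
      by (intro sum_mono C(2)) (use insert in auto)
    also have "... = C * (\<Sum>k\<in>PiE I ?F. np r (PM I k j T) powr (m / r))" by (rule sum_distrib_left[symmetric])
    also have "... \<le> C * (C ^ card I * np r (fmult (psi \<psi>0 j) T) powr (m / r))"
      by (intro mult_left_mono C(1)) (use insert in auto)
    finally show ?case using L insert.hyps by (simp add: mult.assoc)
  qed
  \<comment> \<open>\<open>C\<close> may be 0, whereas the final constant has to be
    positive.\<close>
  define D where "D = (C + 1) ^ CARD('n)"
  have D: "D > 0" "C ^ CARD('n) \<le> D" using C(1) by (auto simp: D_def intro!: power_mono)
  show ?thesis
  proof (rule exI[of _ "D powr (q / m)"], intro conjI allI impI)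
    show "D powr (q / m) > 0" using D by simp
    fix T :: "('n cfun) => complex" and j L
    assume T: "tempered T"
    let ?f = "fmult (psi \<psi>0 j) T"
    have pf: "pg ?f" using PM_pg[OF T, of "{}"] by (simp add: PM_empty)
    show "(\<Sum>k\<in>PiE UNIV (%_. {..<L}). epowr (Lp_qnorm p (PM UNIV k j T)) q) \<le> ennreal (D powr (q / m)) * epowr (Lp_qnorm p ?f) q"
    proof (cases "Lpi r ?f")
      case False
      then have "Ip r ?f = \<infinity>" using Lpi_iff_Ip[OF pf, of r] by (auto simp flip: less_top)
      then have "Lp_qnorm p ?f = \<infinity>" using Lp_qnorm_real[OF p(2), of ?f] by (simp add: r_def)
      then show ?thesis using D by (simp add: ennreal_mult_top)
    next
      case True
      have Lq: "epowr (Lp_qnorm p g) q = ennreal ((np r g powr (m / r)) powr (q / m))" if "Lpi r g" for g :: "'n cfun"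
        unfolding Lp_qnorm_real[OF p(2)] r_def[symmetric] Ip_eq_np[OF that]
        using r m np_nonneg[of r g] by (simp add: epowr_ennreal powr_powr)
      note I = ind[OF T True finite[of UNIV], of L]
      have "(\<Sum>k\<in>PiE UNIV (%_. {..<L}). epowr (Lp_qnorm p (PM UNIV k j T)) q) = ennreal (\<Sum>k\<in>PiE UNIV (%_. {..<L}). (np r (PM UNIV k j T) powr (m / r)) powr (q / m))"
        using I Lq by (simp add: sum_ennreal)
      also have "... \<le> ennreal ((\<Sum>k\<in>PiE UNIV (%_. {..<L}). np r (PM UNIV k j T) powr (m / r)) powr (q / m))"
        by (intro ennreal_leI sum_powr_ge1) (use m in \<open>auto simp: finite_PiE\<close>)
      also have "... \<le> ennreal ((D * np r ?f powr (m / r)) powr (q / m))"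
      proof (intro ennreal_leI powr_mono2)
        have "C ^ CARD('n) * np r ?f powr (m / r) \<le> D * np r ?f powr (m / r)" by (intro mult_right_mono D) auto
        then show "(\<Sum>k\<in>PiE UNIV (%_. {..<L}). np r (PM UNIV k j T) powr (m / r)) \<le> D * np r ?f powr (m / r)"
          using I by linarith
      qed (use m q0 in \<open>auto intro!: sum_nonneg\<close>)
      also have "... = ennreal (D powr (q / m)) * epowr (Lp_qnorm p ?f) q"
        unfolding Lq[OF True] using D by (simp add: powr_mult flip: ennreal_mult)
      finally show ?thesis .
    qed
  qed
qed

lemma sufficiency_sup:
  assumes p: "0 < p" and t: "max 0 (inv_p p - 1) \<le> t"
  shows "\<exists>C. \<forall>T. tempered T --> mixed_qnorm \<phi>0 t p \<infinity> T \<le> ennreal C * besov_qnorm \<psi>0 (t * real CARD('n)) p \<infinity> T"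
proof -
  let ?\<sigma> = "max 0 (inv_p p - 1)" and ?d = "real CARD('n)"
  obtain C where C: "C > 0" "!!T j k. tempered T ==> (\<forall>i. k i \<le> Suc j) ==>
    Lp_qnorm p (PM UNIV k j T) \<le> ennreal (C * 2 powr ((real j * ?d - real (sum k UNIV)) * ?\<sigma>)) * Lp_qnorm p (fmult (psi \<psi>0 j) T)"
    using block_bound[OF p] by metis
  define c where "c = 3 * 3 powr inv_p p"
  have c: "c > 0" by (simp add: c_def)
  define D where "D = C * 2 powr (?d * (t - ?\<sigma>))"
  have D: "D > 0" using C(1) by (simp add: D_def)
  show ?thesis
  proof (rule exI[of _ "c * (3 * D)"], intro allI impI)
    fix T :: "('n cfun) => complex" assume T: "tempered T"
    let ?B = "besov_qnorm \<psi>0 (t * ?d) p \<infinity> T"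
    have B: "ennreal (2 powr (real j * (t * ?d))) * Lp_qnorm p (fmult (psi \<psi>0 j) T) \<le> ?B" for j
      unfolding besov_qnorm_def lq_qnorm_def by (auto intro: SUP_upper)
    have one: "ennreal (2 powr (real (sum k UNIV) * t)) * Lp_qnorm p (PM UNIV k j T) \<le> ennreal D * ?B" if j: "j \<in> Jset k" for k j
    proof -
      have kj: "\<forall>i. k i \<le> Suc j" using Jset_bound[OF j] by blast
      have "ennreal (2 powr (real (sum k UNIV) * t)) * Lp_qnorm p (PM UNIV k j T) \<le>
         ennreal (2 powr (real (sum k UNIV) * t)) * (ennreal (C * 2 powr ((real j * ?d - real (sum k UNIV)) * ?\<sigma>)) * Lp_qnorm p (fmult (psi \<psi>0 j) T))"
        by (intro mult_left_mono C(2)[OF T kj]) auto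
      also have "... = ennreal (2 powr (real (sum k UNIV) * t) * (C * 2 powr ((real j * ?d - real (sum k UNIV)) * ?\<sigma>))) * Lp_qnorm p (fmult (psi \<psi>0 j) T)"
        using C(1) by (simp add: ennreal_mult[symmetric] mult.assoc[symmetric])
      also have "... \<le> ennreal (D * 2 powr (real j * (t * ?d))) * Lp_qnorm p (fmult (psi \<psi>0 j) T)"
      proof (intro mult_right_mono ennreal_leI)
        have "sum k UNIV \<le> (\<Sum>i\<in>(UNIV::'n set). Suc j)" by (intro sum_mono) (use kj in auto)
        then have "real (sum k UNIV) \<le> real (CARD('n) * Suc j)" unfolding of_nat_le_iff by simp
        then have "real (sum k UNIV) \<le> ?d * (real j + 1)" unfolding of_nat_mult by (simp add: add.commute)
        then have "real (sum k UNIV) * (t - ?\<sigma>) \<le> ?d * (real j + 1) * (t - ?\<sigma>)" by (intro mult_right_mono) (use t in auto)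
        then have e: "real (sum k UNIV) * t + (real j * ?d - real (sum k UNIV)) * ?\<sigma> \<le> ?d * (t - ?\<sigma>) + real j * (t * ?d)"
          by (simp add: algebra_simps)
        have "2 powr (real (sum k UNIV) * t) * (C * 2 powr ((real j * ?d - real (sum k UNIV)) * ?\<sigma>)) = C * 2 powr (real (sum k UNIV) * t + (real j * ?d - real (sum k UNIV)) * ?\<sigma>)"
          by (simp add: powr_add)
        also have "... \<le> C * 2 powr (?d * (t - ?\<sigma>) + real j * (t * ?d))"
          by (intro mult_left_mono powr_mono e) (use C(1) in auto)
        also have "... = D * 2 powr (real j * (t * ?d))" by (simp add: D_def powr_add)
        finally show "2 powr (real (sum k UNIV) * t) * (C * 2 powr ((real j * ?d - real (sum k UNIV)) * ?\<sigma>)) \<le> D * 2 powr (real j * (t * ?d))" .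
      qed auto
      also have "... = ennreal D * (ennreal (2 powr (real j * (t * ?d))) * Lp_qnorm p (fmult (psi \<psi>0 j) T))"
        using D by (simp add: ennreal_mult mult.assoc)
      also have "... \<le> ennreal D * ?B" by (intro mult_left_mono B) auto
      finally show ?thesis .
    qed
    show "mixed_qnorm \<phi>0 t p \<infinity> T \<le> ennreal (c * (3 * D)) * ?B"
      unfolding mixed_qnorm_def lq_qnorm_def if_P[OF refl]
    proof (rule SUP_least)
      fix k :: "'n => nat"
      have "ennreal (2 powr (real (sum k UNIV) * t)) * Lp_qnorm p (fmult (phi_multi \<phi>0 k) T) \<le>
        ennreal (2 powr (real (sum k UNIV) * t)) * (ennreal c * (\<Sum>j\<in>Jset k. Lp_qnorm p (PM UNIV k j T)))"
        unfolding c_def by (intro mult_left_mono block_qnorm[OF T p]) auto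
      also have "... = ennreal c * (\<Sum>j\<in>Jset k. ennreal (2 powr (real (sum k UNIV) * t)) * Lp_qnorm p (PM UNIV k j T))"
        by (simp add: sum_distrib_left mult_ac)
      also have "... \<le> ennreal c * (\<Sum>j\<in>Jset k. ennreal D * ?B)"
        by (intro mult_left_mono sum_mono one) auto
      also have "(\<Sum>j\<in>Jset k. ennreal D * ?B) = of_nat (card (Jset k)) * (ennreal D * ?B)" by simp
      also have "ennreal c * (of_nat (card (Jset k)) * (ennreal D * ?B)) \<le> ennreal c * (ennreal 3 * (ennreal D * ?B))"
      proof (intro mult_left_mono mult_right_mono)
        have "ennreal (real (card (Jset k))) \<le> ennreal 3" by (rule ennreal_leI) (use Jset_card(2)[of k] in simp)
        then show "of_nat (card (Jset k)) \<le> ennreal 3" by (simp only: ennreal_of_nat_eq_real_of_nat)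
      qed auto
      also have "... = ennreal (c * (3 * D)) * ?B" using c D by (simp add: ennreal_mult mult.assoc)
      finally show "ennreal (2 powr (real (sum k UNIV) * t)) * Lp_qnorm p (fmult (phi_multi \<phi>0 k) T) \<le> ennreal (c * (3 * D)) * ?B" .
    qed
  qed
qed

text \<open>Reduces finite \<open>q\<close> to a fixed isotropic block j together with the indices k
  that see it: each k sees at most three j, and the two sums of nonnegative terms are
  exchanged.\<close>

lemma sufficiency_sum:
  assumes p: "0 < p" and q: "0 < q"
    and hyp: "\<exists>C>0. \<forall>T j. tempered T -->
      (\<integral>\<^sup>+k. indicator {k. j \<in> Jset k} k * epowr (ennreal (2 powr (real (sum k UNIV) * t)) * Lp_qnorm p (PM UNIV k j T)) q \<partial>count_space UNIV)
      \<le> ennreal C * epowr (ennreal (2 powr (real j * (t * real CARD('n)))) * Lp_qnorm p (fmult (psi \<psi>0 j) T)) q"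
  shows "\<exists>C. \<forall>T. tempered T --> mixed_qnorm \<phi>0 t p (ennreal q) T \<le> ennreal C * besov_qnorm \<psi>0 (t * real CARD('n)) p (ennreal q) T"
proof -
  from hyp obtain C where C0: "C > 0" and H: "\<forall>T j. tempered T -->
      (\<integral>\<^sup>+k. indicator {k. j \<in> Jset k} k * epowr (ennreal (2 powr (real (sum k UNIV) * t)) * Lp_qnorm p (PM UNIV k j T)) q \<partial>count_space UNIV)
      \<le> ennreal C * epowr (ennreal (2 powr (real j * (t * real CARD('n)))) * Lp_qnorm p (fmult (psi \<psi>0 j) T)) q"
    by (elim exE conjE)
  note C = C0 H[rule_format]
  define c where "c = 3 * 3 powr inv_p p"
  have c: "c > 0" by (simp add: c_def)
  define D where "D = c powr q * 3 powr q"
  have D: "D > 0" using c by (simp add: D_def)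
  show ?thesis
  proof (rule exI[of _ "(D * C) powr (1 / q)"], intro allI impI)
    fix T :: "('n cfun) => complex" assume T: "tempered T"
    let ?w = "%k::'n => nat. ennreal (2 powr (real (sum k UNIV) * t))"
    let ?x = "%k j. epowr (?w k * Lp_qnorm p (PM UNIV k j T)) q"
    let ?y = "%j. epowr (ennreal (2 powr (real j * (t * real CARD('n)))) * Lp_qnorm p (fmult (psi \<psi>0 j) T)) q"
    have pt: "epowr (?w k * Lp_qnorm p (fmult (phi_multi \<phi>0 k) T)) q \<le> ennreal D * (\<integral>\<^sup>+j. indicator {k. j \<in> Jset k} k * ?x k j \<partial>count_space UNIV)" for k
    proof -
      have "?w k * Lp_qnorm p (fmult (phi_multi \<phi>0 k) T) \<le> ?w k * (ennreal c * (\<Sum>j\<in>Jset k. Lp_qnorm p (PM UNIV k j T)))"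
        unfolding c_def by (intro mult_left_mono block_qnorm[OF T p]) auto
      also have "... = ennreal c * (\<Sum>j\<in>Jset k. ?w k * Lp_qnorm p (PM UNIV k j T))"
        by (simp add: sum_distrib_left mult_ac)
      finally have "epowr (?w k * Lp_qnorm p (fmult (phi_multi \<phi>0 k) T)) q \<le> epowr (ennreal c * (\<Sum>j\<in>Jset k. ?w k * Lp_qnorm p (PM UNIV k j T))) q"
        by (rule epowr_mono) (use q in simp)
      also have "... = ennreal (c powr q) * epowr (\<Sum>j\<in>Jset k. ?w k * Lp_qnorm p (PM UNIV k j T)) q"
        by (rule epowr_cmult[OF c q])
      also have "... \<le> ennreal (c powr q) * (ennreal (3 powr q) * (\<Sum>j\<in>Jset k. ?x k j))"
        by (intro mult_left_mono epowr_sum_le[OF Jset_card(1) q]) (use Jset_card(2)[of k] in auto)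
      also have "... = ennreal D * (\<Sum>j\<in>Jset k. ?x k j)"
        by (simp add: D_def ennreal_mult mult.assoc)
      also have "(\<Sum>j\<in>Jset k. ?x k j) = (\<Sum>j\<in>Jset k. indicator {k. j \<in> Jset k} k * ?x k j)" by (intro sum.cong) auto
      also have "... = (\<integral>\<^sup>+j. indicator {k. j \<in> Jset k} k * ?x k j \<partial>count_space UNIV)"
        by (rule nn_integral_count_space'[symmetric]) (auto simp: Jset_card)
      finally show ?thesis .
    qed
    have "(\<integral>\<^sup>+k. epowr (?w k * Lp_qnorm p (fmult (phi_multi \<phi>0 k) T)) q \<partial>count_space UNIV) \<le>
       (\<integral>\<^sup>+k. ennreal D * (\<integral>\<^sup>+j. indicator {k. j \<in> Jset k} k * ?x k j \<partial>count_space UNIV) \<partial>count_space UNIV)"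
      by (intro nn_integral_mono pt)
    also have "... = ennreal D * (\<integral>\<^sup>+k. \<integral>\<^sup>+j. indicator {k. j \<in> Jset k} k * ?x k j \<partial>count_space UNIV \<partial>count_space UNIV)"
      by (rule nn_integral_cmult) simp
    also have "(\<integral>\<^sup>+k. \<integral>\<^sup>+j. indicator {k. j \<in> Jset k} k * ?x k j \<partial>count_space UNIV \<partial>count_space UNIV) =
       (\<integral>\<^sup>+j. \<integral>\<^sup>+k. indicator {k. j \<in> Jset k} k * ?x k j \<partial>count_space UNIV \<partial>count_space UNIV)"
      by (rule nn_integral_count_space_swap)
    also have "ennreal D * ... \<le> ennreal D * (\<integral>\<^sup>+j. ennreal C * ?y j \<partial>count_space UNIV)"
      by (intro mult_left_mono nn_integral_mono C(2)[OF T]) auto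
    also have "(\<integral>\<^sup>+j. ennreal C * ?y j \<partial>count_space UNIV) = ennreal C * (\<integral>\<^sup>+j. ?y j \<partial>count_space UNIV)"
      by (rule nn_integral_cmult) simp
    also have "ennreal D * (ennreal C * (\<integral>\<^sup>+j. ?y j \<partial>count_space UNIV)) = ennreal (D * C) * (\<integral>\<^sup>+j. ?y j \<partial>count_space UNIV)"
      using D C(1) by (simp add: ennreal_mult mult.assoc)
    finally have "epowr (\<integral>\<^sup>+k. epowr (?w k * Lp_qnorm p (fmult (phi_multi \<phi>0 k) T)) q \<partial>count_space UNIV) (1 / q) \<le>
       epowr (ennreal (D * C) * (\<integral>\<^sup>+j. ?y j \<partial>count_space UNIV)) (1 / q)"
      by (rule epowr_mono) (use q in simp)
    also have "... = ennreal ((D * C) powr (1 / q)) * epowr (\<integral>\<^sup>+j. ?y j \<partial>count_space UNIV) (1 / q)"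
      by (rule epowr_cmult) (use D C q in auto)
    finally show "mixed_qnorm \<phi>0 t p (ennreal q) T \<le> ennreal ((D * C) powr (1 / q)) * besov_qnorm \<psi>0 (t * real CARD('n)) p (ennreal q) T"
      using q by (simp add: mixed_qnorm_def besov_qnorm_def lq_qnorm_def)
  qed
qed

text \<open>Over the larger cube, sums over k can be taken coordinate by coordinate or
  factored.\<close>

lemma Jset_PiE: "{k. j \<in> Jset k} \<subseteq> PiE UNIV (%_. {..<Suc (Suc j)})"
  using Jset_bound by (auto simp: PiE_UNIV_domain less_Suc_eq_le)

lemma nn_integral_Jset_le:
  assumes "!!k. j \<in> Jset k ==> F k \<le> G k"
  shows "(\<integral>\<^sup>+k. indicator {k. j \<in> Jset k} k * F k \<partial>count_space UNIV) \<le> (\<Sum>k\<in>PiE UNIV (%_. {..<Suc (Suc j)}). G k)"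
proof -
  have "(\<integral>\<^sup>+k. indicator {k. j \<in> Jset k} k * F k \<partial>count_space UNIV) \<le> (\<integral>\<^sup>+k. indicator (PiE UNIV (%_. {..<Suc (Suc j)})) k * G k \<partial>count_space UNIV)"
    using Jset_PiE[of j] assms by (intro nn_integral_mono) (auto split: split_indicator)
  also have "... = (\<Sum>k\<in>PiE UNIV (%_. {..<Suc (Suc j)}). indicator (PiE UNIV (%_. {..<Suc (Suc j)})) k * G k)"
    by (rule nn_integral_count_space') (auto simp: finite_PiE)
  finally show ?thesis by simp
qed

text \<open>Over the cube the sum of X^|k| factors into d geometric sums. As X > 1, each is
  comparable to its largest term X^(j+1), and the product of these terms with the prefactor
  reproduces the weight 2^(j d t q).\<close>

lemma hyp_subcritical:
  assumes p: "0 < p" and q: "0 < q" and t: "max 0 (inv_p p - 1) < t"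
  shows "\<exists>C>0. \<forall>T j. tempered T -->
      (\<integral>\<^sup>+k. indicator {k. j \<in> Jset k} k * epowr (ennreal (2 powr (real (sum k UNIV) * t)) * Lp_qnorm p (PM UNIV k j T)) q \<partial>count_space UNIV)
      \<le> ennreal C * epowr (ennreal (2 powr (real j * (t * real CARD('n)))) * Lp_qnorm p (fmult (psi \<psi>0 j) T)) q"
proof -
  let ?\<sigma> = "max 0 (inv_p p - 1)" and ?d = "real CARD('n)"
  obtain C where C: "C > 0" "!!T j k. tempered T ==> (\<forall>i. k i \<le> Suc j) ==>
    Lp_qnorm p (PM UNIV k j T) \<le> ennreal (C * 2 powr ((real j * ?d - real (sum k UNIV)) * ?\<sigma>)) * Lp_qnorm p (fmult (psi \<psi>0 j) T)"
    using block_bound[OF p] by metis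
  define b where "b = (t - ?\<sigma>) * q"
  have b: "b > 0" using t q by (simp add: b_def)
  define X where "X = 2 powr b"
  have X: "X > 1" using b by (simp add: X_def)
  define D where "D = C powr q * (X / (X - 1) * X) ^ CARD('n)"
  have D: "D > 0" using C(1) X by (simp add: D_def)
  show ?thesis
  proof (rule exI[of _ D], intro conjI allI impI D)
    fix T :: "('n cfun) => complex" and j assume T: "tempered T"
    let ?a = "Lp_qnorm p (fmult (psi \<psi>0 j) T)"
    let ?E = "C powr q * 2 powr (real j * ?d * ?\<sigma> * q)"
    have "(\<integral>\<^sup>+k. indicator {k. j \<in> Jset k} k * epowr (ennreal (2 powr (real (sum k UNIV) * t)) * Lp_qnorm p (PM UNIV k j T)) q \<partial>count_space UNIV)
       \<le> (\<Sum>k\<in>PiE (UNIV::'n set) (%_. {..<Suc (Suc j)}). ennreal (?E * (\<Prod>i\<in>(UNIV::'n set). X ^ k i)) * epowr ?a q)"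
    proof (rule nn_integral_Jset_le)
      fix k assume j: "j \<in> Jset k"
      have kj: "\<forall>i. k i \<le> Suc j" using Jset_bound[OF j] by blast
      have "ennreal (2 powr (real (sum k UNIV) * t)) * Lp_qnorm p (PM UNIV k j T) \<le>
         ennreal (2 powr (real (sum k UNIV) * t)) * (ennreal (C * 2 powr ((real j * ?d - real (sum k UNIV)) * ?\<sigma>)) * ?a)"
        by (intro mult_left_mono C(2)[OF T kj]) auto
      also have "... = ennreal (C * 2 powr (real j * ?d * ?\<sigma> + real (sum k UNIV) * (t - ?\<sigma>))) * ?a"
      proof -
        have "2 powr (real (sum k UNIV) * t) * (C * 2 powr ((real j * ?d - real (sum k UNIV)) * ?\<sigma>)) = C * (2 powr (real (sum k UNIV) * t) * 2 powr ((real j * ?d - real (sum k UNIV)) * ?\<sigma>))"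
          by simp
        also have "2 powr (real (sum k UNIV) * t) * 2 powr ((real j * ?d - real (sum k UNIV)) * ?\<sigma>) = 2 powr (real j * ?d * ?\<sigma> + real (sum k UNIV) * (t - ?\<sigma>))"
          unfolding powr_add[symmetric] by (simp add: algebra_simps)
        finally have e: "2 powr (real (sum k UNIV) * t) * (C * 2 powr ((real j * ?d - real (sum k UNIV)) * ?\<sigma>)) = C * 2 powr (real j * ?d * ?\<sigma> + real (sum k UNIV) * (t - ?\<sigma>))" .
        show ?thesis unfolding e[symmetric] using C(1) by (subst ennreal_mult) (auto simp: mult.assoc)
      qed
      finally have "epowr (ennreal (2 powr (real (sum k UNIV) * t)) * Lp_qnorm p (PM UNIV k j T)) q \<le> epowr (ennreal (C * 2 powr (real j * ?d * ?\<sigma> + real (sum k UNIV) * (t - ?\<sigma>))) * ?a) q"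
        by (rule epowr_mono) (use q in simp)
      also have "... = ennreal ((C * 2 powr (real j * ?d * ?\<sigma> + real (sum k UNIV) * (t - ?\<sigma>))) powr q) * epowr ?a q"
        by (rule epowr_cmult) (use C q in auto)
      also have "(C * 2 powr (real j * ?d * ?\<sigma> + real (sum k UNIV) * (t - ?\<sigma>))) powr q = ?E * (\<Prod>i\<in>UNIV. X ^ k i)"
      proof -
        have "(\<Prod>i\<in>UNIV. X ^ k i) = X ^ sum k UNIV" by (rule power_sum[symmetric])
        also have "... = 2 powr (real (sum k UNIV) * b)" by (simp add: X_def powr_powr flip: powr_realpow) (simp add: mult.commute)
        finally have P: "(\<Prod>i\<in>UNIV. X ^ k i) = 2 powr (real (sum k UNIV) * b)" .
        have "(real j * ?d * ?\<sigma> + real (sum k UNIV) * (t - ?\<sigma>)) * q = real j * ?d * ?\<sigma> * q + real (sum k UNIV) * b"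
          by (simp add: b_def algebra_simps)
        then show ?thesis unfolding P using C(1) by (simp add: powr_mult powr_powr powr_add b_def mult.assoc del: of_nat_sum)
      qed
      finally show "epowr (ennreal (2 powr (real (sum k UNIV) * t)) * Lp_qnorm p (PM UNIV k j T)) q \<le> ennreal (?E * (\<Prod>i\<in>UNIV. X ^ k i)) * epowr ?a q" .
    qed
    also have "... = ennreal (\<Sum>k\<in>PiE UNIV (%_. {..<Suc (Suc j)}). ?E * (\<Prod>i\<in>(UNIV::'n set). X ^ k i)) * epowr ?a q"
      using X by (simp add: sum_distrib_right[symmetric] sum_ennreal prod_nonneg)
    also have "(\<Sum>k\<in>PiE UNIV (%_. {..<Suc (Suc j)}). ?E * (\<Prod>i\<in>(UNIV::'n set). X ^ k i)) = ?E * (\<Prod>i\<in>(UNIV::'n set). \<Sum>m<Suc (Suc j). X ^ m)"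
      by (subst prod_sum_PiE) (auto simp: sum_distrib_left)
    also have "... = ?E * (\<Sum>m\<le>Suc j. X ^ m) ^ CARD('n)" by (simp add: lessThan_Suc_atMost)
    also have "ennreal ... * epowr ?a q \<le> ennreal (?E * (X / (X - 1) * X ^ Suc j) ^ CARD('n)) * epowr ?a q"
      by (intro mult_right_mono ennreal_leI mult_left_mono power_mono geometric_sum_le X sum_nonneg) (use X in auto)
    also have "?E * (X / (X - 1) * X ^ Suc j) ^ CARD('n) = D * (2 powr (real j * (t * ?d))) powr q"
    proof -
      have "(X / (X - 1) * X ^ Suc j) ^ CARD('n) = (X / (X - 1) * X) ^ CARD('n) * X ^ (j * CARD('n))"
        by (simp add: power_mult mult.assoc flip: power_mult_distrib)
      moreover have "X ^ (j * CARD('n)) = 2 powr (real j * ?d * b)"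
        by (simp add: X_def powr_powr flip: powr_realpow) (simp add: mult_ac)
      moreover have "2 powr (real j * ?d * ?\<sigma> * q) * 2 powr (real j * ?d * b) = (2 powr (real j * (t * ?d))) powr q"
        unfolding powr_add[symmetric] powr_powr by (simp add: b_def algebra_simps)
      ultimately show ?thesis by (simp add: D_def mult_ac)
    qed
    also have "ennreal (D * (2 powr (real j * (t * ?d))) powr q) * epowr ?a q = ennreal D * epowr (ennreal (2 powr (real j * (t * ?d))) * ?a) q"
      using D q by (simp add: epowr_cmult ennreal_mult mult.assoc)
    finally show "(\<integral>\<^sup>+k. indicator {k. j \<in> Jset k} k * epowr (ennreal (2 powr (real (sum k UNIV) * t)) * Lp_qnorm p (PM UNIV k j T)) q \<partial>count_space UNIV)
      \<le> ennreal D * epowr (ennreal (2 powr (real j * (t * ?d))) * ?a) q" .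
  qed
qed

lemma hyp_critical:
  assumes p: "1 < p" "p \<noteq> \<infinity>" and q: "max 2 (enn2real p) \<le> q"
  shows "\<exists>C>0. \<forall>T j. tempered T -->
      (\<integral>\<^sup>+k. indicator {k. j \<in> Jset k} k * epowr (ennreal (2 powr (real (sum k UNIV) * 0)) * Lp_qnorm p (PM UNIV k j T)) q \<partial>count_space UNIV)
      \<le> ennreal C * epowr (ennreal (2 powr (real j * (0 * real CARD('n)))) * Lp_qnorm p (fmult (psi \<psi>0 j) T)) q"
proof -
  obtain C where C: "C > 0" "!!T j L. tempered T ==>
    (\<Sum>k\<in>PiE UNIV (%_. {..<L}). epowr (Lp_qnorm p (PM UNIV k j T)) q) \<le> ennreal C * epowr (Lp_qnorm p (fmult (psi \<psi>0 j) T)) q"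
    using lr_block[OF assms] by metis
  show ?thesis
  proof (rule exI[of _ C], intro conjI allI impI C(1))
    fix T :: "('n cfun) => complex" and j assume T: "tempered T"
    show "(\<integral>\<^sup>+k. indicator {k. j \<in> Jset k} k * epowr (ennreal (2 powr (real (sum k UNIV) * 0)) * Lp_qnorm p (PM UNIV k j T)) q \<partial>count_space UNIV)
      \<le> ennreal C * epowr (ennreal (2 powr (real j * (0 * real CARD('n)))) * Lp_qnorm p (fmult (psi \<psi>0 j) T)) q"
    proof -
      have "(\<integral>\<^sup>+k. indicator {k. j \<in> Jset k} k * epowr (Lp_qnorm p (PM UNIV k j T)) q \<partial>count_space UNIV)
        \<le> (\<Sum>k\<in>PiE UNIV (%_. {..<Suc (Suc j)}). epowr (Lp_qnorm p (PM UNIV k j T)) q)"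
        by (rule nn_integral_Jset_le) (rule order_refl)
      also have "... \<le> ennreal C * epowr (Lp_qnorm p (fmult (psi \<psi>0 j) T)) q" by (rule C(2)[OF T])
      finally show ?thesis by simp
    qed
  qed
qed

theorem sufficiency:
  assumes p: "0 < p" and q: "0 < q"
    and cond: "t > max 0 (inv_p p - 1) \<or> (t = 0 \<and> 1 < p \<and> max 2 p \<le> q) \<or> (p \<le> 1 \<and> t = inv_p p - 1 \<and> q = \<infinity>)"
  shows "cont_embedding
            (besov \<psi>0 (t * real CARD('n)) p q) (BN t p q)
            (mixed_besov \<phi>0 t p q) (mixed_qnorm \<phi>0 t p q)"
proof -
  have "\<exists>C. \<forall>T. tempered T --> mixed_qnorm \<phi>0 t p q T \<le> ennreal C * BN t p q T"
  proof (cases "q = \<infinity>")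
    case True
    have inv1: "inv_p p \<le> 1" if "1 < p"
      using that by (cases p) (auto simp: inv_p_def ennreal_less_iff simp flip: ennreal_1)
    have inv2: "1 \<le> inv_p p" if "p \<le> 1"
      using that p by (cases p) (auto simp: inv_p_def top_unique simp flip: ennreal_1)
    \<comment> \<open>Each of the three alternatives implies this, and for q = \<infinity> it is all
      that the supremum estimate asks for.\<close>
    have "max 0 (inv_p p - 1) \<le> t" using cond inv1 inv2 by auto
    from sufficiency_sup[OF p this] show ?thesis unfolding True .
  next
    case False
    define q' where "q' = enn2real q"
    have q': "q' > 0" "q = ennreal q'" using q False by (auto simp: q'_def enn2real_positive_iff less_top)
    show ?thesis
    proof (cases "t > max 0 (inv_p p - 1)")
      case True
      from sufficiency_sum[OF p q'(1) hyp_subcritical[OF p q'(1) True]] show ?thesis unfolding q'(2) .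
    next
      case nt: False
      then have t: "t = 0" "1 < p" "max 2 p \<le> q" using cond False by auto
      \<comment> \<open>p = \<infinity> would force q = \<infinity>, which is excluded here.\<close>
      have pi: "p \<noteq> \<infinity>" using t(3) False by (auto simp: top_unique)
      then obtain p' where p': "p = ennreal p'" "p' \<ge> 0" by (cases p) auto
      have "max 2 (enn2real p) \<le> q'"
        using t(3) p' q' by (auto simp: ennreal_le_iff simp flip: ennreal_numeral)
      from sufficiency_sum[OF p q'(1) hyp_critical[OF t(2) pi this]] show ?thesis unfolding q'(2) t(1) .
    qed
  qed
  then obtain C where C: "!!T. tempered T ==> mixed_qnorm \<phi>0 t p q T \<le> ennreal C * BN t p q T"
    by blast
  show ?thesis
    unfolding cont_embedding_def
  proof (intro conjI exI[of _ C] ballI)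
    show "besov \<psi>0 (t * real CARD('n)) p q \<subseteq> mixed_besov \<phi>0 t p q"
    proof
      fix T assume T: "T \<in> besov \<psi>0 (t * real CARD('n)) p q"
      then have "mixed_qnorm \<phi>0 t p q T \<le> ennreal C * BN t p q T" using C by (auto simp: besov_def)
      also have "... < \<infinity>" using T by (auto simp: besov_def ennreal_mult_less_top)
      finally show "T \<in> mixed_besov \<phi>0 t p q" using T by (auto simp: besov_def mixed_besov_def)
    qed
  qed (use C in \<open>auto simp: besov_def\<close>)
qed

end

section \<open>Necessity\<close>

text \<open>The regular distribution of an integrable function; every counterexample below has this
  form.\<close>

definition Tf :: "('n::finite cfun) => ('n cfun) => complex" where
  "Tf F \<phi> = (LINT x|lborel. \<phi> x * F x)"

lemma schwartz_le_seminorm: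
  assumes "\<phi> \<in> schwartz"
  shows "norm (\<phi> x) \<le> schwartz_seminorm 0 [] \<phi>"
proof -
  obtain C where C: "!!x. (1 + norm x) ^ 0 * norm (iter_pd [] \<phi> x) \<le> C"
    using assms unfolding schwartz_def by blast
  have "bdd_above (range (%x. (1 + norm x) ^ 0 * norm (iter_pd [] \<phi> x)))"
    by (rule bdd_aboveI[of _ C]) (use C in auto)
  then have "(1 + norm x) ^ 0 * norm (iter_pd [] \<phi> x) \<le> schwartz_seminorm 0 [] \<phi>"
    unfolding schwartz_seminorm_def by (intro cSUP_upper) auto
  then show ?thesis by simp
qed

lemma schwartz_mult_integrable:
  assumes \<phi>: "\<phi> \<in> schwartz" and F: "integrable lborel F"
  shows "integrable lborel (%x. \<phi> x * F x)"
proof (rule Bochner_Integration.integrable_bound)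
  show "integrable lborel (%x. schwartz_seminorm 0 [] \<phi> * norm (F x))"
    using F by (intro integrable_mult_right integrable_norm)
  have "\<phi> \<in> borel_measurable borel"
    using \<phi> by (auto simp: schwartz_def intro: borel_measurable_continuous_onI smooth_fun_continuous)
  then show "(%x. \<phi> x * F x) \<in> borel_measurable lborel" using F by measurable
  show "AE x in lborel. norm (\<phi> x * F x) \<le> norm (schwartz_seminorm 0 [] \<phi> * norm (F x))"
    by (intro AE_I2) (auto simp: norm_mult abs_mult intro!: mult_right_mono order_trans[OF schwartz_le_seminorm[OF \<phi>]])
qed

lemma tempered_Tf:
  fixes F :: "'n::finite cfun"
  assumes F: "integrable lborel F"
  shows "tempered (Tf F)"
  unfolding tempered_def
proof (intro conjI ballI allI exI[of _ "LINT x|lborel. norm (F x)"] exI[of _ 0])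
  fix f g :: "'n cfun" and a b :: complex
  assume f: "f \<in> schwartz" and g: "g \<in> schwartz"
  have "(LINT x|lborel. (a * f x + b * g x) * F x) = (LINT x|lborel. a * (f x * F x) + b * (g x * F x))"
    by (simp add: algebra_simps)
  also have "... = a * (LINT x|lborel. f x * F x) + b * (LINT x|lborel. g x * F x)"
    using schwartz_mult_integrable[OF f F] schwartz_mult_integrable[OF g F] by simp
  finally show "Tf F (%x. a * f x + b * g x) = a * Tf F f + b * Tf F g" by (simp add: Tf_def)
next
  fix f :: "'n cfun" assume f: "f \<in> schwartz"
  have "norm (Tf F f) \<le> (LINT x|lborel. schwartz_seminorm 0 [] f * norm (F x))"
    unfolding Tf_def
  proof (rule Bochner_Integration.integral_norm_bound_integral)
    show "integrable lborel (%x. schwartz_seminorm 0 [] f * norm (F x))"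
      using F by (intro integrable_mult_right integrable_norm)
  qed (auto simp: norm_mult intro!: mult_right_mono schwartz_le_seminorm f schwartz_mult_integrable F)
  then show "norm (Tf F f) \<le> (LINT x|lborel. norm (F x)) * (\<Sum>m\<le>0. \<Sum>is\<in>{is. length is \<le> 0}. schwartz_seminorm m is f)"
    by (simp add: mult.commute)
qed

section \<open>Product functions and the action of multipliers on them\<close>

lemma prod_Basis_cart: "(\<Prod>b\<in>(Basis :: (real^'n::finite) set). f b) = (\<Prod>i\<in>UNIV. f (axis i 1))"
  by (simp add: Basis_vec_def UNION_singleton_eq_range prod.reindex axis_eq_axis inj_on_def)

lemma nn_integral_prod_coord:
  fixes f :: "'n::finite => real => ennreal"
  assumes [measurable]: "!!i. f i \<in> borel_measurable borel"
  shows "(\<integral>\<^sup>+x. (\<Prod>i\<in>UNIV. f i (x $ i)) \<partial>(lborel :: (real^'n) measure)) = (\<Prod>i\<in>UNIV. \<integral>\<^sup>+s. f i s \<partial>lborel)"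
proof -
  \<comment> \<open>The product theorem for Lebesgue measure is indexed by basis vectors;
    \<open>g\<close> re-indexes the factors accordingly.\<close>
  define g where "g b = f (THE i. b = axis i (1::real))" for b :: "real^'n"
  have g: "g (axis i 1) = f i" for i by (simp add: g_def axis_eq_axis)
  have "(\<integral>\<^sup>+x. (\<Prod>b\<in>Basis. g b (x \<bullet> b)) \<partial>(lborel :: (real^'n) measure)) = (\<Prod>b\<in>Basis. (\<integral>\<^sup>+x. g b x \<partial>lborel))"
    by (rule nn_integral_lborel_prod) (auto simp: g_def)
  then show ?thesis by (simp add: prod_Basis_cart g inner_axis)
qed

lemma integral_prod_coord:
  fixes f :: "'n::finite => real => complex"
  assumes f: "!!i. integrable lborel (f i)"
  shows "integrable lborel (%x::real^'n. \<Prod>i\<in>UNIV. f i (x $ i))"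
    and "(LINT x|(lborel :: (real^'n) measure). (\<Prod>i\<in>UNIV. f i (x $ i))) = (\<Prod>i\<in>UNIV. LINT s|lborel. f i s)"
proof -
  define g where "g b = f (THE i. b = axis i (1::real))" for b :: "real^'n"
  have g: "g (axis i 1) = f i" for i by (simp add: g_def axis_eq_axis)
  have gi: "integrable lborel (g b)" for b by (simp add: g_def f)
  have [measurable]: "f i \<in> borel_measurable borel" for i using f[of i] by (auto dest: borel_measurable_integrable)
  have m: "(%x::real^'n. \<Prod>i\<in>UNIV. f i (x $ i)) \<in> borel_measurable borel" by measurable
  have pr: "(\<Prod>i\<in>UNIV. f i ((\<Sum>b\<in>Basis. x b *\<^sub>R b) $ i)) = (\<Prod>b\<in>Basis. g b (x b))" for x :: "real^'n => real"
  proof -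
    have "(\<Sum>b\<in>Basis. x b *\<^sub>R b) $ i = x (axis i 1)" for i
    proof -
      have "(\<Sum>b\<in>Basis. x b *\<^sub>R b) \<bullet> axis i 1 = x (axis i 1)" by (rule inner_sum_left_Basis) simp
      then show ?thesis by (simp add: inner_axis)
    qed
    then show ?thesis by (simp add: prod_Basis_cart g)
  qed
  interpret P: product_sigma_finite "%_::real^'n. lborel :: real measure" by standard
  have T: "(%f. \<Sum>b\<in>Basis. f b *\<^sub>R b) \<in> measurable (\<Pi>\<^sub>M b\<in>(Basis :: (real^'n) set). (lborel :: real measure)) borel" by measurable
  show "integrable lborel (%x::real^'n. \<Prod>i\<in>UNIV. f i (x $ i))"
    unfolding lborel_eq[where 'a = "real^'n"]
    unfolding integrable_distr_eq[OF T m] pr by (rule P.product_integrable_prod) (auto intro: gi)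
  show "(LINT x|(lborel :: (real^'n) measure). (\<Prod>i\<in>UNIV. f i (x $ i))) = (\<Prod>i\<in>UNIV. LINT s|lborel. f i s)"
    unfolding lborel_eq[where 'a = "real^'n"]
    unfolding integral_distr[OF T m] pr by (subst P.product_integral_prod) (auto simp: gi prod_Basis_cart g)
qed

text \<open>The function whose Fourier transform is the tensor product of the \<open>h i\<close>,
  see \<open>fourier_pk\<close>.\<close>

definition pk :: "('n::finite => real => complex) => 'n cfun" where
  "pk h x = (\<Prod>i\<in>UNIV. ker (h i) (x $ i))"

lemma ee_prod: "ee x \<xi> = (\<Prod>i\<in>UNIV. cis (x $ i * \<xi> $ i))"
  by (simp add: ee_def inner_vec_def cis_conv_exp exp_sum sum_distrib_left)

lemma rapid_L1: "rapid K ==> integrable lborel K"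
  using rapid_integrable_poly[of K "%_. 1" 1 0] by simp

lemma pk_integrable:
  assumes "!!i. test1 R (h i)"
  shows "integrable lborel (pk h)"
  unfolding pk_def by (rule integral_prod_coord(1)) (rule rapid_L1[OF rapid_ker[OF assms]])

lemma pk_continuous:
  assumes "!!i. test1 R (h i)"
  shows "continuous_on UNIV (pk h)"
proof -
  have "continuous_on UNIV (ker (h i))" for i using rapid_ker[OF assms[of i]] by (simp add: rapid_def)
  then have "continuous_on UNIV (%x::real^'a. ker (h i) (x $ i))" for i
    by (rule continuous_on_compose2) (auto intro: continuous_intros)
  then show ?thesis unfolding pk_def by (intro continuous_on_prod) auto
qed

lemma fourier_pk:
  assumes h: "!!i. test1 R (h i)"
  shows "(LINT y|lborel. pk h y * ee (- y) \<xi>) = (\<Prod>i\<in>UNIV. h i (\<xi> $ i))"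
proof -
  have "integrable lborel (%s. ker (h i) s * cis (- (s * \<xi> $ i)))" for i
    using rapid_integrable_poly[of "ker (h i)" "%s. cis (- (s * \<xi> $ i))" 1 0] rapid_ker[OF h[of i]] by simp
  from integral_prod_coord(2)[OF this] show ?thesis
    by (simp add: pk_def ee_prod prod.distrib ker_inversion[OF h])
qed

text \<open>The multiplication formula of the Fourier transform; after Fubini the inner integral is
  evaluated by one-dimensional inversion on each axis.\<close>

lemma Tf_FT_pk:
  assumes h: "!!i. test1 R (h i)" and n: "bump R' n"
  shows "Tf (pk h) (FT n) = (LINT \<xi>|lborel. n \<xi> * (\<Prod>i\<in>UNIV. h i (\<xi> $ i)))"
proof -
  have intF: "integrable (lborel \<Otimes>\<^sub>M lborel) (%(y, \<xi>). pk h y * n \<xi> * ee (- y) \<xi>)"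
  proof (rule Bochner_Integration.integrable_bound[OF integrable_prod_mult[OF pk_integrable[OF h] bump_integrable[OF n]]])
    have [measurable]: "pk h \<in> borel_measurable borel" "n \<in> borel_measurable borel"
      using borel_measurable_continuous_onI[OF pk_continuous[of R h, OF h]] bump_integrable[OF n] by (auto dest: borel_measurable_integrable)
    have "continuous_on UNIV (%z::(real^'a) \<times> (real^'a). ee (- fst z) (snd z))" by (intro continuous_intros)
    then have [measurable]: "(%z::(real^'a) \<times> (real^'a). ee (- fst z) (snd z)) \<in> borel_measurable (lborel \<Otimes>\<^sub>M lborel)"
      by (simp add: borel_measurable_continuous_onI lborel_prod)
    show "(%(y, \<xi>). pk h y * n \<xi> * ee (- y) \<xi>) \<in> borel_measurable (lborel \<Otimes>\<^sub>M lborel)"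
      unfolding split_beta by measurable
  qed (auto simp: norm_mult)
  have "Tf (pk h) (FT n) = (LINT y|lborel. LINT \<xi>|lborel. pk h y * n \<xi> * ee (- y) \<xi>)"
    unfolding Tf_def
  proof (rule Bochner_Integration.integral_cong[OF refl])
    fix y
    have "FT n y * pk h y = pk h y * (LINT \<xi>|lborel. n \<xi> * ee (- y) \<xi>)" by (simp add: FT_bump[OF n])
    also have "... = (LINT \<xi>|lborel. pk h y * (n \<xi> * ee (- y) \<xi>))" by (rule integral_mult_right_zero[symmetric])
    finally show "FT n y * pk h y = (LINT \<xi>|lborel. pk h y * n \<xi> * ee (- y) \<xi>)" by (simp add: mult.assoc)
  qed
  also have "... = (LINT \<xi>|lborel. LINT y|lborel. pk h y * n \<xi> * ee (- y) \<xi>)"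
    using lborel_pair.Fubini_integral[of "%y \<xi>. pk h y * n \<xi> * ee (- y) \<xi>"] intF by simp
  also have "... = (LINT \<xi>|lborel. n \<xi> * (\<Prod>i\<in>UNIV. h i (\<xi> $ i)))"
  proof (rule Bochner_Integration.integral_cong[OF refl])
    fix \<xi>
    have "(LINT y|lborel. pk h y * n \<xi> * ee (- y) \<xi>) = (LINT y|lborel. n \<xi> * (pk h y * ee (- y) \<xi>))" by (simp add: mult_ac)
    also have "... = n \<xi> * (LINT y|lborel. pk h y * ee (- y) \<xi>)" by (rule integral_mult_right_zero)
    finally show "(LINT y|lborel. pk h y * n \<xi> * ee (- y) \<xi>) = n \<xi> * (\<Prod>i\<in>UNIV. h i (\<xi> $ i))" by (simp add: fourier_pk[OF h])
  qed
  finally show ?thesis .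
qed

text \<open>\<open>eq\<close> says that the multiplier sends one tensor product to another; this
  covers blocks that keep a packet, annihilate it, or cut it down coordinatewise.\<close>

lemma fm_Tf_pk:
  assumes h: "!!i. test1 R (h i)" and h': "!!i. test1 R (h' i)" and n: "bump R' n"
    and eq: "!!\<xi>. n \<xi> * (\<Prod>i\<in>UNIV. h i (\<xi> $ i)) = (\<Prod>i\<in>UNIV. h' i (\<xi> $ i))"
  shows "fm n (Tf (pk h)) x = pk h' x"
proof -
  have "Tf (pk h) (FT (%\<xi>. ee x \<xi> * n \<xi>)) = (LINT \<xi>|lborel. ee x \<xi> * n \<xi> * (\<Prod>i\<in>UNIV. h i (\<xi> $ i)))"
    by (rule Tf_FT_pk[OF h bump_ee[OF n]])
  also have "... = (LINT \<xi>|lborel. (\<Prod>i\<in>UNIV. h' i (\<xi> $ i) * cis (x $ i * \<xi> $ i)))"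
    by (simp add: mult.assoc eq) (simp add: prod.distrib ee_prod mult.commute)
  also have "... = (\<Prod>i\<in>UNIV. LINT \<eta>|lborel. h' i \<eta> * cis (x $ i * \<eta>))"
    by (rule integral_prod_coord(2)) (rule test1_integrable_cis[OF h'])
  finally show ?thesis
    by (simp add: fm_def pk_def ker_def prod.distrib power_one_over prod_dividef)
qed

lemma Tf_sum:
  assumes M: "finite M" and F: "!!m. m \<in> M ==> integrable lborel (F m)" and \<phi>: "\<phi> \<in> schwartz"
  shows "Tf (%x. \<Sum>m\<in>M. c m * F m x) \<phi> = (\<Sum>m\<in>M. c m * Tf (F m) \<phi>)"
proof -
  have "(LINT x|lborel. \<phi> x * (\<Sum>m\<in>M. c m * F m x)) = (LINT x|lborel. (\<Sum>m\<in>M. c m * (\<phi> x * F m x)))"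
    by (simp add: sum_distrib_left mult_ac)
  also have "... = (\<Sum>m\<in>M. LINT x|lborel. c m * (\<phi> x * F m x))"
    by (intro Bochner_Integration.integral_sum integrable_mult_right schwartz_mult_integrable \<phi> F)
  finally show ?thesis by (simp add: Tf_def)
qed

lemma fm_packets:
  assumes M: "finite M" and h: "!!m i. test1 (R m) (h m i)" and h': "!!m i. test1 (R m) (h' m i)" and n: "bump R' n"
    and eq: "!!m \<xi>. m \<in> M ==> n \<xi> * (\<Prod>i\<in>UNIV. h m i (\<xi> $ i)) = (\<Prod>i\<in>UNIV. h' m i (\<xi> $ i))"
  shows "fm n (Tf (%x. \<Sum>m\<in>M. c m * pk (h m) x)) = (%x. \<Sum>m\<in>M. c m * pk (h' m) x)"
proof
  fix x
  have "fm n (Tf (%x. \<Sum>m\<in>M. c m * pk (h m) x)) x = (\<Sum>m\<in>M. c m * fm n (Tf (pk (h m))) x)"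
    unfolding fm_def
    by (subst Tf_sum[OF M pk_integrable[OF h] FT_schwartz[OF bump_ee[OF n]]]) (simp add: sum_distrib_left mult_ac)
  also have "... = (\<Sum>m\<in>M. c m * pk (h' m) x)"
    by (intro sum.cong refl arg_cong2[where f = "(*)"] fm_Tf_pk[OF h h' n] eq)
  finally show "fm n (Tf (%x. \<Sum>m\<in>M. c m * pk (h m) x)) x = (\<Sum>m\<in>M. c m * pk (h' m) x)" .
qed

section \<open>Sequence norms, unbounded powers, and sizes of kernels\<close>

lemma lq_qnorm_ge:
  assumes q: "0 < q" and S: "finite S" "S \<noteq> {}" and c: "!!k. k \<in> S ==> ennreal c \<le> a k" and c0: "0 \<le> c"
  shows "ennreal (real (card S) powr inv_p q * c) \<le> lq_qnorm q a"
proof (cases "q = \<infinity>")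
  case True
  obtain k where k: "k \<in> S" using S by blast
  have "ennreal c \<le> (SUP k. a k)" by (rule order_trans[OF c[OF k]]) (rule SUP_upper, simp)
  then show ?thesis using S by (simp add: True lq_qnorm_def inv_p_def)
next
  case False
  define r where "r = enn2real q"
  have r: "r > 0" using q False by (simp add: r_def enn2real_positive_iff less_top)
  have "ennreal (real (card S) * c powr r) = (\<Sum>k\<in>S. ennreal (c powr r))"
    by (simp add: ennreal_mult ennreal_of_nat_eq_real_of_nat)
  also have "... \<le> (\<Sum>k\<in>S. epowr (a k) r)"
    using epowr_mono[OF c, of _ r] r c0 by (intro sum_mono) (simp add: epowr_ennreal)
  also have "... = (\<integral>\<^sup>+k. epowr (a k) r * indicator S k \<partial>count_space UNIV)"
    by (subst nn_integral_count_space'[of S]) (auto simp: S)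
  also have "... \<le> (\<integral>\<^sup>+k. epowr (a k) r \<partial>count_space UNIV)"
    by (intro nn_integral_mono) (auto split: split_indicator)
  finally have "epowr (ennreal (real (card S) * c powr r)) (1 / r) \<le> epowr (\<integral>\<^sup>+k. epowr (a k) r \<partial>count_space UNIV) (1 / r)"
    by (rule epowr_mono) (use r in simp)
  also have "epowr (ennreal (real (card S) * c powr r)) (1 / r) = ennreal (real (card S) powr inv_p q * c)"
    using r c0 False by (simp add: epowr_ennreal powr_mult powr_powr inv_p_def r_def)
  finally show ?thesis using False by (simp add: lq_qnorm_def r_def)
qed

lemma lq_qnorm_single:
  assumes q: "0 < q" and a: "!!j. j \<noteq> J ==> a j = 0"
  shows "lq_qnorm q a = a J"
proof (cases "q = \<infinity>")
  case True
  have "(SUP k. a k) = a J"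
  proof (rule antisym)
    show "(SUP k. a k) \<le> a J" by (rule SUP_least) (metis a order_refl zero_le)
    show "a J \<le> (SUP k. a k)" by (rule SUP_upper) simp
  qed
  then show ?thesis by (simp add: True lq_qnorm_def)
next
  case False
  define r where "r = enn2real q"
  have r: "r > 0" using q False by (simp add: r_def enn2real_positive_iff less_top)
  have "(\<integral>\<^sup>+k. epowr (a k) r \<partial>count_space UNIV) = epowr (a J) r"
    by (subst nn_integral_count_space'[of "{J}"]) (auto simp: a)
  then show ?thesis using r False by (simp add: lq_qnorm_def epowr_epowr flip: r_def)
qed

lemma powr_nat_unbounded:
  assumes "0 < e" and "!!N::nat. N \<ge> N0 ==> real N powr e \<le> C"
  shows False
proof -
  define N where "N = max N0 (Suc (nat \<lceil>(\<bar>C\<bar> + 1) powr (1 / e)\<rceil>))"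
  have "(\<bar>C\<bar> + 1) powr (1 / e) \<le> real N" unfolding N_def by linarith
  then have "((\<bar>C\<bar> + 1) powr (1 / e)) powr e \<le> real N powr e" by (intro powr_mono2) (use assms(1) in auto)
  also have "... \<le> C" by (rule assms(2)) (simp add: N_def)
  finally show False using assms(1) by (simp add: powr_powr)
qed

lemma two_powr_unbounded:
  assumes "0 < e" and "!!N::nat. N \<ge> N0 ==> 2 powr (real N * e) \<le> C"
  shows False
proof (rule powr_nat_unbounded[OF assms(1)])
  fix N :: nat assume N: "N \<ge> N0"
  have "real N \<le> 2 ^ N" by (metis less_imp_le of_nat_less_two_power)
  then have "real N powr e \<le> (2 ^ N) powr e" by (intro powr_mono2) (use assms(1) in auto)
  also have "... = 2 powr (real N * e)" by (simp add: powr_powr flip: powr_realpow)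
  finally show "real N powr e \<le> C" using assms(2)[OF N] by simp
qed

lemma Lp_qnorm_zero: "0 < p ==> Lp_qnorm p (%_::real^'n::finite. 0) = 0"
proof (cases "p = \<infinity>")
  case True
  then show ?thesis using Linf_le[of "%_::real^'n. 0" 0] by simp
qed (simp add: Lp_qnorm_real Ip_def)

lemma Lp_qnorm_norm_cong: "(!!x. norm (f x) = norm (g x)) ==> Lp_qnorm p f = Lp_qnorm p g"
  by (simp add: Lp_qnorm_def)

text \<open>Otherwise the kernel vanishes almost everywhere, and inversion makes the multiplier
  vanish at \<xi>.\<close>

lemma ker_powr_pos:
  assumes m: "test1 R m" "m \<xi> \<noteq> 0" and r: "0 < r"
  shows "0 < (\<integral>\<^sup>+s. ennreal (norm (ker m s) powr r) \<partial>lborel)"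
proof (rule ccontr)
  have [measurable]: "ker m \<in> borel_measurable borel" by (rule rapid_measurable[OF rapid_ker[OF m(1)]])
  assume "\<not> ?thesis"
  then have "(\<integral>\<^sup>+s. ennreal (norm (ker m s) powr r) \<partial>lborel) = 0" by simp
  then have "AE s in lborel. ennreal (norm (ker m s) powr r) = 0" by (subst (asm) nn_integral_0_iff_AE) auto
  then have "AE s in lborel. ker m s = 0" by eventually_elim (simp add: ennreal_eq_0_iff)
  then have "AE s in lborel. ker m s * cis (- (s * \<xi>)) = 0" by eventually_elim simp
  then have "(LINT s|lborel. ker m s * cis (- (s * \<xi>))) = (LINT s|(lborel :: real measure). (0::complex))"
    by (subst integral_cong_AE[where g = "%_. 0"]) auto
  then show False using ker_inversion[OF m(1)] m(2) by simp
qed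

lemma ker_nonzero:
  assumes m: "test1 R m" "m \<xi> \<noteq> 0"
  shows "\<exists>s. ker m s \<noteq> 0"
proof (rule ccontr)
  assume "\<nexists>s. ker m s \<noteq> 0"
  then show False using ker_inversion[OF m(1), of \<xi>] m(2) by simp
qed

lemma Ip_pk:
  assumes "!!i. test1 R (h i)" "0 < r"
  shows "Ip r (pk h) = (\<Prod>i\<in>UNIV. \<integral>\<^sup>+s. ennreal (norm (ker (h i) s) powr r) \<partial>lborel)"
proof -
  have [measurable]: "ker (h i) \<in> borel_measurable borel" for i by (rule rapid_measurable[OF rapid_ker[OF assms(1)]])
  show ?thesis unfolding Ip_def pk_def
    by (subst nn_integral_prod_coord[symmetric]) (auto simp: prod_norm[symmetric] prod_powr_distrib prod_ennreal)
qed

lemma pk_bounded: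
  assumes "!!i. test1 R (h i)"
  shows "\<exists>B\<ge>0. \<forall>x. norm (pk h x) \<le> B"
proof -
  have "\<exists>C. \<forall>s. norm (ker (h i) s) \<le> C" for i using ker_decay[OF assms, of 0 i] by simp
  then obtain C where C: "!!i s. norm (ker (h i) s) \<le> C i" by metis
  have "norm (pk h x) \<le> (\<Prod>i\<in>UNIV. C i)" for x unfolding pk_def prod_norm[symmetric]
    by (intro prod_mono) (auto intro: C)
  moreover from this[of 0] have "0 \<le> (\<Prod>i\<in>UNIV. C i)" using norm_ge_zero order_trans by blast
  ultimately show ?thesis by blast
qed

lemma Lp_pk_pos_finite:
  assumes h: "!!i. test1 R (h i)" and nz: "!!i. \<exists>\<xi>. h i \<xi> \<noteq> 0" and p: "0 < p"
  shows "0 < Lp_qnorm p (pk h)" and "Lp_qnorm p (pk h) < \<infinity>"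
proof -
  have "0 < Lp_qnorm p (pk h) \<and> Lp_qnorm p (pk h) < \<infinity>"
  proof (cases "p = \<infinity>")
    case True
    have "\<exists>s. ker (h i) s \<noteq> 0" for i using ker_nonzero[OF h] nz by blast
    then obtain s where s: "!!i. ker (h i) (s i) \<noteq> 0" by metis
    have "0 < ennreal (norm (pk h (\<chi> i. s i)))" using s by (auto simp: pk_def)
    also have "... \<le> Lp_qnorm \<infinity> (pk h)" by (rule Linf_ge[OF pk_continuous[OF h]])
    finally have 1: "0 < Lp_qnorm \<infinity> (pk h)" .
    obtain B where "!!x. norm (pk h x) \<le> B" using pk_bounded[of R h, OF h] by blast
    then have "Lp_qnorm \<infinity> (pk h) \<le> ennreal B"
      by (intro Linf_le borel_measurable_continuous_onI pk_continuous[OF h] ennreal_leI)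
    then have "Lp_qnorm \<infinity> (pk h) < \<infinity>" using ennreal_less_top le_less_trans by fastforce
    with 1 show ?thesis by (simp add: True)
  next
    case False
    define r where "r = enn2real p"
    have r: "r > 0" using p False by (simp add: r_def enn2real_positive_iff less_top)
    let ?I = "%i. \<integral>\<^sup>+s. ennreal (norm (ker (h i) s) powr r) \<partial>lborel"
    have pos: "0 < ?I i" for i using ker_powr_pos[OF h _ r] nz by blast
    have fin: "?I i < \<infinity>" for i by (rule rapid_powr_finite[OF rapid_ker[OF h] r])
    have "(\<Prod>i\<in>UNIV. ?I i) \<noteq> \<infinity>" using fin by (simp add: ennreal_prod_eq_top less_imp_neq)
    moreover have "(\<Prod>i\<in>UNIV. ?I i) \<noteq> 0" using pos by (simp add: less_imp_neq[symmetric])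
    ultimately obtain x where x: "Ip r (pk h) = ennreal x" "x > 0"
      unfolding Ip_pk[of R h, OF h r] by (cases "\<Prod>i\<in>UNIV. ?I i") (auto simp: less_le)
    show ?thesis unfolding Lp_qnorm_real[OF False] r_def[symmetric] x(1) using x(2) by (simp add: epowr_ennreal)
  qed
  then show "0 < Lp_qnorm p (pk h)" and "Lp_qnorm p (pk h) < \<infinity>" by auto
qed

lemma ker_translate: "ker (%\<eta>. cis (- (b * \<eta>)) * m \<eta>) s = ker m (s - b)"
proof -
  have "cis (- (b * \<eta>)) * m \<eta> * cis (s * \<eta>) = m \<eta> * cis ((s - b) * \<eta>)" for \<eta>
  proof -
    have "cis (- (b * \<eta>)) * cis (s * \<eta>) = cis ((s - b) * \<eta>)" by (simp add: cis_mult algebra_simps)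
    then show ?thesis by (metis mult.assoc mult.commute)
  qed
  then show ?thesis by (simp only: ker_def)
qed

lemma nn_integral_powr_scale:
  fixes K :: "real => complex"
  assumes [measurable]: "K \<in> borel_measurable borel" and r: "0 < r"
  shows "(\<integral>\<^sup>+s. ennreal (norm (2 ^ L * K (2 ^ L * s)) powr r) \<partial>lborel) =
     ennreal (2 powr (real L * (r - 1))) * (\<integral>\<^sup>+s. ennreal (norm (K s) powr r) \<partial>lborel)"
proof -
  have "(\<integral>\<^sup>+s. ennreal (norm (2 ^ L * K (2 ^ L * s)) powr r) \<partial>lborel) =
      (\<integral>\<^sup>+s. ennreal ((2 ^ L) powr r) * ennreal (norm (K (2 ^ L * s)) powr r) \<partial>lborel)"
    by (simp add: norm_mult powr_mult norm_power ennreal_mult)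
  also have "... = ennreal ((2 ^ L) powr r) * (ennreal (1 / 2 ^ L) * (\<integral>\<^sup>+s. ennreal (norm (K s) powr r) \<partial>lborel))"
    by (subst nn_integral_cmult) (auto simp: nn_integral_lborel_scale[of "%s. ennreal (norm (K s) powr r)"])
  also have "... = ennreal ((2 ^ L) powr r * (1 / 2 ^ L)) * (\<integral>\<^sup>+s. ennreal (norm (K s) powr r) \<partial>lborel)"
    by (subst ennreal_mult) (auto simp: mult.assoc)
  also have "(2 ^ L) powr r * (1 / 2 ^ L) = 2 powr (real L * (r - 1))"
    by (simp add: powr_powr powr_diff right_diff_distrib flip: powr_realpow)
  finally show ?thesis .
qed

section \<open>Packets as test distributions\<close>

context decomposition
begin

lemma sm1_cphi: "sm1 (cphi \<phi>0 k)" using phi.test_cphi by (auto simp: test1_def)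

lemma bump_phi: "\<exists>R. bump R (%\<xi>::real^'n. \<Prod>i\<in>UNIV. cphi \<phi>0 (k i) (\<xi> $ i))"
proof (rule exI[of _ "3/2 * 2 ^ sum k UNIV"], unfold bump_def, intro conjI allI impI)
  show "smooth_fun (%\<xi>::real^'n. \<Prod>i\<in>UNIV. cphi \<phi>0 (k i) (\<xi> $ i))"
    by (rule smooth_fun_prod_coord) (auto intro: sm1_cphi)
  fix \<xi> :: "real^'n" assume "\<xi> \<notin> qbox (3/2 * 2 ^ sum k UNIV)"
  then obtain i where i: "\<bar>\<xi> $ i\<bar> > 3/2 * 2 ^ sum k UNIV" by (auto simp: qbox_def not_le)
  have "(2::real) ^ k i \<le> 2 ^ sum k UNIV" by (rule power_increasing) (auto intro: member_le_sum)
  then have "3/2 * 2 ^ k i < \<bar>\<xi> $ i\<bar>" using i by linarith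
  then have "cphi \<phi>0 (k i) (\<xi> $ i) = 0" using phi.test_cphi[of "k i"] unfolding test1_def by blast
  then show "(\<Prod>i\<in>UNIV. cphi \<phi>0 (k i) (\<xi> $ i)) = 0" by auto
qed

text \<open>The frame of all counterexamples. By \<open>loc\<close> every packet lies where the
  isotropic function of level J is 1 and all others are 0, so the Besov quasi-norm is a single term;
  the mixed quasi-norm is bounded below through the blocks in \<open>S\<close>, each of size at
  least \<open>lo\<close>, which yields the factor |S|^(1/q).\<close>

lemma packet_test:
  assumes C: "0 < C" "!!T. tempered T ==> BN t p q T < \<infinity> ==>
      mixed_qnorm \<phi>0 t p q T \<le> ennreal C * BN t p q T"
    and p: "0 < p" and q: "0 < q"
    and M: "finite M" and h: "!!m (i::'n). test1 (R m) (h m i)"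
    and loc: "!!m j \<xi>. m \<in> M ==> (!!i. h m i (\<xi> $ i) \<noteq> 0) ==> psi \<psi>0 j \<xi> = (if j = J then 1 else 0)"
    and B: "0 \<le> B" "Lp_qnorm p (%x. \<Sum>m\<in>M. c m * pk (h m) x) \<le> ennreal B"
    and S: "finite S" "S \<noteq> {}" and lo: "0 \<le> lo"
    and low: "!!k. k \<in> S ==> ennreal lo \<le> ennreal (2 powr (real (sum k UNIV) * t)) *
        Lp_qnorm p (%x. \<Sum>m\<in>M. c m * pk (%i \<eta>. cphi \<phi>0 (k i) \<eta> * h m i \<eta>) x)"
  shows "real (card S) powr inv_p q * lo \<le> C * (2 powr (real J * (t * real CARD('n))) * B)"
proof -
  define F where "F x = (\<Sum>m\<in>M. c m * pk (h m) x)" for x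
  have F: "integrable lborel F" unfolding F_def
    by (intro Bochner_Integration.integrable_sum integrable_mult_right pk_integrable[OF h])
  note T = tempered_Tf[OF F]
  have psi_block: "fmult (psi \<psi>0 j) (Tf F) = (if j = J then F else (%_. 0))" for j
  proof -
    have "fm (cpsi \<psi>0 j) (Tf (%x. \<Sum>m\<in>M. c m * pk (h m) x)) = (%x. \<Sum>m\<in>M. c m * pk (%i. if j = J then h m i else (%_. 0)) x)"
    proof (rule fm_packets[OF M h _ psi.bump_cpsi])
      show "test1 (R m) (if j = J then h m i else (%_. 0))" for m i using h by (auto simp: test1_def sm1_const)
      fix m \<xi> assume m: "m \<in> M"
      show "cpsi \<psi>0 j \<xi> * (\<Prod>i\<in>UNIV. h m i (\<xi> $ i)) = (\<Prod>i\<in>UNIV. (if j = J then h m i else (%_. 0)) (\<xi> $ i))"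
      proof (cases "\<exists>i. h m i (\<xi> $ i) = 0")
        case True
        then show ?thesis by (cases "j = J") (auto simp: zero_power)
      next
        case False
        then show ?thesis using loc[OF m, of \<xi> j] by (auto simp: cpsi_def)
      qed
    qed
    moreover have "pk (%i::'n. %_. 0) x = 0" for x by (simp add: pk_def ker_def)
    moreover have "fmult (psi \<psi>0 j) (Tf F) = fm (cpsi \<psi>0 j) (Tf (%x. \<Sum>m\<in>M. c m * pk (h m) x))"
      by (simp add: fmult_eq_fm cpsi_def[abs_def] F_def[abs_def])
    ultimately show ?thesis by (auto simp: F_def)
  qed
  have phi_block: "fmult (phi_multi \<phi>0 k) (Tf F) = (%x. \<Sum>m\<in>M. c m * pk (%i \<eta>. cphi \<phi>0 (k i) \<eta> * h m i \<eta>) x)" for k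
  proof -
    obtain R' where R': "bump R' (%\<xi>::real^'n. \<Prod>i\<in>UNIV. cphi \<phi>0 (k i) (\<xi> $ i))" using bump_phi by blast
    have "fm (%\<xi>. \<Prod>i\<in>UNIV. cphi \<phi>0 (k i) (\<xi> $ i)) (Tf (%x. \<Sum>m\<in>M. c m * pk (h m) x)) = (%x. \<Sum>m\<in>M. c m * pk (%i \<eta>. cphi \<phi>0 (k i) \<eta> * h m i \<eta>) x)"
      by (rule fm_packets[OF M h _ R']) (auto simp: prod.distrib intro: test1_mult h sm1_cphi)
    then show ?thesis by (simp add: fmult_eq_fm phi_multi_def cphi_def F_def[abs_def])
  qed
  have "BN t p q (Tf F) = ennreal (2 powr (real J * (t * real CARD('n)))) * Lp_qnorm p F"
    unfolding besov_qnorm_def by (subst lq_qnorm_single[OF q, of J]) (auto simp: psi_block Lp_qnorm_zero[OF p])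
  also have "... \<le> ennreal (2 powr (real J * (t * real CARD('n)))) * ennreal B"
    using B(2) by (intro mult_left_mono) (auto simp: F_def[abs_def])
  also have "... = ennreal (2 powr (real J * (t * real CARD('n))) * B)" using B by (simp add: ennreal_mult)
  finally have b: "BN t p q (Tf F) \<le> ennreal (2 powr (real J * (t * real CARD('n))) * B)" .
  have "ennreal (real (card S) powr inv_p q * lo) \<le> mixed_qnorm \<phi>0 t p q (Tf F)"
    unfolding mixed_qnorm_def by (rule lq_qnorm_ge[OF q S _ lo]) (use low in \<open>simp add: phi_block\<close>)
  also have "... \<le> ennreal C * BN t p q (Tf F)"
    by (rule C(2)[OF T]) (use b ennreal_less_top le_less_trans in fastforce)
  also have "... \<le> ennreal C * ennreal (2 powr (real J * (t * real CARD('n))) * B)"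
    by (intro mult_left_mono b) auto
  also have "... = ennreal (C * (2 powr (real J * (t * real CARD('n))) * B))"
    using C(1) B(1) by (simp add: ennreal_mult)
  finally show ?thesis using C(1) B(1) by (subst (asm) ennreal_le_iff) auto
qed

text \<open>For k > 0 the interval of radius 3/32 about 7/8 2^k lies in [4/5 2^k, 2^k]. There the
  dilate of \<open>\<phi>0\<close> at level k is 1, and the one at level k - 1 is 0 because its
  argument is at least 8/5 > 3/2.\<close>

definition cen :: "nat => real" where
  "cen k = (if k = 0 then 0 else 7/8 * 2 ^ k)"

text \<open>A bump supported where \<open>\<phi>\<^sub>k = 1\<close>, hence not seen by any other \<open>\<phi>\<^sub>j\<close>; its kernel is translated by \<open>b\<close>.\<close>

definition bk :: "real => nat => real => complex" where
  "bk b k \<eta> = cis (- (b * \<eta>)) * cor (\<phi>0 (16 * (\<eta> - cen k)))"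

lemma phi0_one: "\<bar>s\<bar> \<le> 1 ==> \<phi>0 s = 1" and phi0_zero: "\<bar>s\<bar> > 3/2 ==> \<phi>0 s = 0"
  using phi.adm by (auto simp: admissible_phi0_def)

lemma bk_nonzero: "bk b k \<eta> \<noteq> 0 ==> \<bar>\<eta> - cen k\<bar> \<le> 3/32"
proof (rule ccontr)
  assume nz: "bk b k \<eta> \<noteq> 0" and "\<not> \<bar>\<eta> - cen k\<bar> \<le> 3/32"
  then have "\<bar>16 * (\<eta> - cen k)\<bar> > 3/2" unfolding abs_mult by simp
  then show False using nz by (simp add: bk_def phi0_zero)
qed

lemma bk_center: "bk b k (cen k) \<noteq> 0"
  by (simp add: bk_def phi0_one)

lemma test1_bk: "test1 (cen k + 1) (bk b k)"
  unfolding test1_def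
proof (intro conjI allI impI)
  have "sm1 (%x. cor (\<phi>0 x))" using phi.test_phi0 by (simp add: test1_def)
  from sm1_affine[OF this, of 16 "- 16 * cen k"]
  have "sm1 (%\<eta>. cor (\<phi>0 (16 * (\<eta> - cen k))))" by (simp add: algebra_simps)
  from sm1_mult[OF sm1_cis[of "- b"] this] show "sm1 (bk b k)" by (simp add: bk_def[abs_def])
  fix x :: real assume "cen k + 1 < \<bar>x\<bar>"
  moreover have "cen k \<ge> 0" by (simp add: cen_def)
  ultimately have "\<not> \<bar>x - cen k\<bar> \<le> 3/32" by (auto simp: abs_if split: if_splits)
  then show "bk b k x = 0" using bk_nonzero by blast
qed

lemma bk_range:
  assumes "bk b k \<eta> \<noteq> 0"
  shows "\<bar>\<eta>\<bar> \<le> 2 ^ k" "k > 0 ==> 4/5 * 2 ^ k \<le> \<eta>"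
proof -
  have e: "\<bar>\<eta> - cen k\<bar> \<le> 3/32" by (rule bk_nonzero[OF assms])
  then have e: "\<eta> - cen k \<le> 3/32" "cen k - \<eta> \<le> 3/32" by linarith+
  show "\<bar>\<eta>\<bar> \<le> 2 ^ k"
  proof (cases "k = 0")
    case True
    then show ?thesis using e by (simp add: cen_def)
  next
    case False
    then have "(2::real) ^ 1 \<le> 2 ^ k" by (intro power_increasing) auto
    then show ?thesis using e False unfolding cen_def by simp
  qed
  show "4/5 * 2 ^ k \<le> \<eta>" if "k > 0"
  proof -
    have "(2::real) ^ 1 \<le> 2 ^ k" using that by (intro power_increasing) auto
    then show ?thesis using e that unfolding cen_def by simp
  qed
qed

lemma phi0_bk:
  assumes "bk b k \<eta> \<noteq> 0"
  shows "\<phi>0 (\<eta> / 2 ^ j) = (if k \<le> j then 1 else 0)"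
proof (cases "k \<le> j")
  case True
  then have "(2::real) ^ k \<le> 2 ^ j" by (intro power_increasing) auto
  with bk_range(1)[OF assms] have "\<bar>\<eta>\<bar> \<le> 2 ^ j" by (rule order_trans)
  then have "\<bar>\<eta> / 2 ^ j\<bar> \<le> 1" by (simp add: abs_divide)
  then show ?thesis using True phi0_one by simp
next
  case False
  then have k: "k > 0" "Suc j \<le> k" by auto
  then have "(2::real) ^ Suc j \<le> 2 ^ k" by (intro power_increasing) auto
  then have "8/5 * 2 ^ j \<le> \<eta>" using bk_range(2)[OF assms k(1)] by simp
  then have "8/5 \<le> \<eta> / 2 ^ j" by (simp add: field_simps)
  then have "\<bar>\<eta> / 2 ^ j\<bar> > 3/2" using abs_ge_self[of "\<eta> / 2 ^ j"] by linarith
  then show ?thesis using False phi0_zero by simp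
qed

lemma phi_eq_diff: "j > 0 ==> phi \<phi>0 j \<eta> = \<phi>0 (\<eta> / 2 ^ j) - \<phi>0 (\<eta> / 2 ^ (j - 1))"
  by (cases j) (auto simp: phi_def two_powr_nat simp del: of_nat_Suc)

lemma cphi_bk: "cphi \<phi>0 j \<eta> * bk b k \<eta> = (if j = k then bk b k \<eta> else 0)"
proof (cases "bk b k \<eta> = 0")
  case False
  have "phi \<phi>0 j \<eta> = (if j = k then 1 else 0)"
  proof (cases "j = 0")
    case True
    then show ?thesis using phi0_bk[OF False, of 0] by (simp add: phi_def)
  next
    case j: False
    then show ?thesis using phi0_bk[OF False] by (auto simp: phi_eq_diff)
  qed
  then show ?thesis by (simp add: cphi_def)
qed simp

lemma psi_localized:
  fixes \<xi> :: "real^'n"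
  assumes le: "!!i. \<bar>\<xi> $ i\<bar> \<le> 2 ^ J" and ge: "4/5 * 2 ^ J \<le> \<bar>\<xi> $ a\<bar>" and J: "J > 0"
  shows "psi \<psi>0 j \<xi> = (if j = J then 1 else 0)"
proof -
  have *: "\<psi>0 ((1 / 2 ^ l) *\<^sub>R \<xi>) = (if J \<le> l then 1 else 0)" for l
  proof (cases "J \<le> l")
    case True
    then have "(2::real) ^ J \<le> 2 ^ l" by (intro power_increasing) auto
    then have "\<bar>\<xi> $ i\<bar> \<le> 2 ^ l" for i using le[of i] by (rule order_trans[rotated])
    then have "\<bar>((1 / 2 ^ l) *\<^sub>R \<xi>) $ i\<bar> \<le> 1" for i by (simp add: abs_mult)
    then show ?thesis using True psi.adm by (auto simp: admissible_psi0_def)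
  next
    case False
    then have "(2::real) ^ Suc l \<le> 2 ^ J" by (intro power_increasing) auto
    then have "8/5 * 2 ^ l \<le> \<bar>\<xi> $ a\<bar>" using ge by simp
    then have "8/5 \<le> \<bar>\<xi> $ a\<bar> / 2 ^ l" by (simp add: field_simps)
    then have "\<bar>((1 / 2 ^ l) *\<^sub>R \<xi>) $ a\<bar> \<ge> 3/2" by (simp add: abs_mult)
    then have "\<psi>0 ((1 / 2 ^ l) *\<^sub>R \<xi>) = 0" using psi.adm unfolding admissible_psi0_def by blast
    then show ?thesis using False by simp
  qed
  show ?thesis
  proof (cases "j = 0")
    case True
    then show ?thesis using *[of 0] J by (simp add: psi_def)
  next
    case False
    then have "psi \<psi>0 j \<xi> = \<psi>0 ((1 / 2 ^ j) *\<^sub>R \<xi>) - \<psi>0 ((1 / 2 ^ (j - 1)) *\<^sub>R \<xi>)"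
    proof -
      have "2 powr (- real j) = 1 / 2 ^ j" using two_powr_nat(1)[of j 1] by simp
      moreover have "2 powr (1 - real j) = 1 / 2 ^ (j - 1)" using two_powr_nat(2)[of j 1] False by (cases j) auto
      ultimately show ?thesis using False by (simp add: psi_def)
    qed
    then show ?thesis using * False J by auto
  qed
qed

lemma norm_ker_bk: "norm (ker (bk b k) s) = norm (ker (bk 0 0) (s - b))"
proof -
  let ?m = "%\<eta>. cor (\<phi>0 (16 * \<eta>))"
  have b0: "bk 0 0 = ?m" by (auto simp: bk_def cen_def)
  have [measurable]: "?m \<in> borel_measurable borel" using test1_measurable[OF test1_bk[of 0 0]] b0 by simp
  have "ker (bk b k) s = ker (%\<eta>. ?m (\<eta> - cen k)) (s - b)" unfolding bk_def[abs_def] by (rule ker_translate)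
  also have "... = cis ((s - b) * cen k) * ker ?m (s - b)" by (rule ker_modulate) fact
  finally show ?thesis by (simp only: b0 norm_mult norm_cis mult_1_left)
qed

lemma pk_cphi_bk: "pk (%i \<eta>. cphi \<phi>0 (k' i) \<eta> * bk (b i) (k i) \<eta>) x = (if k' = k then pk (%i::'n. bk (b i) (k i)) x else 0)"
proof (cases "k' = k")
  case False
  then obtain i where i: "k' i \<noteq> k i" by auto
  then have "(%\<eta>. cphi \<phi>0 (k' i) \<eta> * bk (b i) (k i) \<eta>) = (%_. 0)" by (simp add: cphi_bk)
  then have "ker (%\<eta>. cphi \<phi>0 (k' i) \<eta> * bk (b i) (k i) \<eta>) (x $ i) = 0" by (simp add: ker_def)
  then show ?thesis using False unfolding pk_def by (metis (mono_tags, lifting) finite_class.finite_UNIV iso_tuple_UNIV_I prod_zero)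
qed (simp add: cphi_bk)

lemma norm_pk_bk: "norm (pk (%i::'n. bk (b i) (k i)) x) = norm (pk (%_. bk 0 0) (x - (\<chi> i. b i)))"
  unfolding pk_def prod_norm[symmetric] by (intro prod.cong refl) (subst norm_ker_bk, simp)

lemma psi_bk:
  fixes k :: "'n => nat"
  assumes "!!i. bk (b i) (k i) (\<xi> $ i) \<noteq> 0" and k: "!!i. k i \<le> J" "k a = J" "J > 0"
  shows "psi \<psi>0 j \<xi> = (if j = J then 1 else 0)"
proof (rule psi_localized[where a = a])
  show "\<bar>\<xi> $ i\<bar> \<le> 2 ^ J" for i
    by (rule order_trans[OF bk_range(1)[OF assms(1)]]) (rule power_increasing[OF k(1)], simp)
  show "4/5 * 2 ^ J \<le> \<bar>\<xi> $ a\<bar>" using bk_range(2)[OF assms(1)[of a]] k by simp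
qed (rule k)

text \<open>A packet with index (J, 0, ..., 0) has weight 2^(J t) in the mixed scale and 2^(J t d)
  in the isotropic one. For t < 0 and d \<ge> 2 the ratio is unbounded in J.\<close>

lemma necessity_negative:
  assumes C: "0 < C" "!!T. tempered T ==> BN t p q T < \<infinity> ==>
      mixed_qnorm \<phi>0 t p q T \<le> ennreal C * BN t p q T"
    and p: "0 < p" and q: "0 < q" and d: "CARD('n) \<ge> 2" and t: "t < 0"
  shows False
proof -
  let ?w = "pk (%_::'n. bk 0 0)"
  obtain N where N: "Lp_qnorm p ?w = ennreal N" "N > 0"
    using Lp_pk_pos_finite[where h = "%_::'n. bk 0 0", OF test1_bk _ p] bk_center[of 0 0]
    by (cases "Lp_qnorm p ?w") (auto simp: ennreal_less_zero_iff)
  fix i1 :: 'n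
  have "2 powr (real J * (- t * (real CARD('n) - 1))) \<le> C" if J: "J \<ge> 1" for J
  proof -
    define k where "k = (%i. if i = i1 then J else 0)"
    have k: "k i \<le> J" "k i1 = J" for i by (auto simp: k_def)
    have sk: "sum k UNIV = J" by (simp add: k_def)
    have eqN: "Lp_qnorm p (pk (%i. bk 0 (k i))) = ennreal N"
      unfolding N(1)[symmetric] by (rule Lp_qnorm_norm_cong) (subst norm_pk_bk, simp flip: zero_vec_def)
    have "real (card {k}) powr inv_p q * (2 powr (real J * t) * N) \<le> C * (2 powr (real J * (t * real CARD('n))) * N)"
    proof (rule packet_test[OF C p q, where M = "{0::nat}" and c = "%_. 1" and h = "%_ i. bk 0 (k i)" and R = "%_. 2 ^ J + 1"])
      show "test1 (2 ^ J + 1) (bk 0 (k i))" for i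
        by (rule test1_mono[OF test1_bk]) (auto simp: k_def cen_def)
      fix j :: nat and \<xi> assume "!!i. bk 0 (k i) (\<xi> $ i) \<noteq> 0"
      then show "psi \<psi>0 j \<xi> = (if j = J then 1 else 0)" by (rule psi_bk[where b = "%_. 0" and k = k and a = i1]) (use k J in auto)
    qed (use N sk in \<open>auto simp: eqN pk_cphi_bk[where b = "%_. 0" and k = k and k' = k] ennreal_mult\<close>)
    then have "2 powr (real J * t) * N \<le> (C * 2 powr (real J * (t * real CARD('n)))) * N" by simp
    then have "2 powr (real J * t) \<le> C * 2 powr (real J * (t * real CARD('n)))" using N(2) by simp
    then have "2 powr (real J * t) / 2 powr (real J * (t * real CARD('n))) \<le> C" by (simp add: field_simps)
    then show ?thesis by (simp add: algebra_simps flip: powr_diff)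
  qed
  moreover have "- t * (real CARD('n) - 1) > 0" using t d by (simp add: mult_neg_pos)
  ultimately show False by (rule two_powr_unbounded[rotated])
qed

end

section \<open>Norms of products, sums of translates, and the choice of signs\<close>

lemma two_level_powr:
  assumes "0 < A" "0 < X" "0 < r"
  shows "(A * (2 powr (x * (r - 1)) * X) ^ D) powr (1 / r) = 2 powr (x * real D * (1 - 1 / r)) * (A * X ^ D) powr (1 / r)"
proof -
  have "(2 powr (x * (r - 1))) ^ D = 2 powr (x * (r - 1) * real D)" by (simp add: powr_powr flip: powr_realpow)
  then have "A * (2 powr (x * (r - 1)) * X) ^ D = 2 powr (x * (r - 1) * real D) * (A * X ^ D)"
    by (simp add: power_mult_distrib mult_ac)
  also have "... powr (1 / r) = 2 powr (x * (r - 1) * real D * (1 / r)) * (A * X ^ D) powr (1 / r)"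
    using assms by (subst powr_mult) (auto simp: powr_powr)
  also have "x * (r - 1) * real D * (1 / r) = x * real D * (1 - 1 / r)" using assms by (simp add: field_simps)
  finally show ?thesis .
qed

lemma Lp_pk_two_level:
  fixes h :: "'n::finite => real => complex"
  assumes h: "!!i. test1 R (h i)" and r: "0 < r"
    and u: "(\<integral>\<^sup>+s. ennreal (norm (ker (h a) s) powr r) \<partial>lborel) = ennreal A" "0 \<le> A"
    and v: "!!i. i \<noteq> a ==> (\<integral>\<^sup>+s. ennreal (norm (ker (h i) s) powr r) \<partial>lborel) = ennreal X" "0 \<le> X"
  shows "Lp_qnorm (ennreal r) (pk h) = ennreal ((A * X ^ (CARD('n) - 1)) powr (1 / r))"
proof -
  have "Ip r (pk h) = (\<integral>\<^sup>+s. ennreal (norm (ker (h a) s) powr r) \<partial>lborel) *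
      (\<Prod>i\<in>UNIV - {a}. \<integral>\<^sup>+s. ennreal (norm (ker (h i) s) powr r) \<partial>lborel)"
    unfolding Ip_pk[of R h, OF h r] by (rule prod.remove) auto
  also have "(\<Prod>i\<in>UNIV - {a}. \<integral>\<^sup>+s. ennreal (norm (ker (h i) s) powr r) \<partial>lborel) = (\<Prod>i\<in>UNIV - {a}. ennreal X)"
    by (rule prod.cong) (auto simp: v)
  also have "... = ennreal (X ^ (CARD('n) - 1))" by (simp add: card_Diff_singleton ennreal_power v)
  finally have "Ip r (pk h) = ennreal (A * X ^ (CARD('n) - 1))" using u v(2) by (simp add: ennreal_mult)
  then show ?thesis using r u v(2) by (simp add: Lp_qnorm_real epowr_ennreal)
qed

lemma Lp_qnorm_translate:
  fixes g :: "'n::finite cfun"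
  assumes g: "continuous_on UNIV g"
  shows "Lp_qnorm p (%x. g (x - a)) = Lp_qnorm p g"
proof -
  have [measurable]: "g \<in> borel_measurable borel" by (rule borel_measurable_continuous_onI[OF g])
  have ga: "continuous_on UNIV (%x. g (x - a))"
    by (rule continuous_on_compose2[OF g]) (auto intro: continuous_intros)
  show ?thesis
  proof (cases "p = \<infinity>")
    case True
    have "ennreal (norm (g x)) \<le> Lp_qnorm \<infinity> (%x. g (x - a))" for x using Linf_ge[OF ga, of "x + a"] by simp
    then have "Lp_qnorm \<infinity> g \<le> Lp_qnorm \<infinity> (%x. g (x - a))" by (intro Linf_le) auto
    moreover have "Lp_qnorm \<infinity> (%x. g (x - a)) \<le> Lp_qnorm \<infinity> g" by (intro Linf_le Linf_ge[OF g]) measurable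
    ultimately show ?thesis by (simp add: True)
  next
    case False
    have "(\<integral>\<^sup>+x. ennreal (norm (g (x + (- a))) powr enn2real p) \<partial>lborel) = (\<integral>\<^sup>+x. ennreal (norm (g x) powr enn2real p) \<partial>lborel)"
      by (rule nn_integral_translate) measurable
    then show ?thesis using False by (simp add: Lp_qnorm_def)
  qed
qed

text \<open>A comparison of sum and integral: each value is at most 2 A times an increment of arctan
  over a unit interval, the increments telescope, and arctan oscillates by at most pi.\<close>

lemma sum_translates_bounded:
  fixes K :: "real => complex"
  assumes K: "!!s. (1 + \<bar>s\<bar>)\<^sup>2 * norm (K s) \<le> A"
  shows "(\<Sum>m\<in>{1..<J}. norm (K (s - real m))) \<le> 2 * pi * A"
proof -
  have A: "0 \<le> A" by (rule order_trans[OF _ K[of 0]]) simp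
  have step: "norm (K u) \<le> 2 * A * (arctan (- u + 1) - arctan (- u))" for u
  proof -
    have "\<exists>z. - u < z \<and> z < - u + 1 \<and> arctan (- u + 1) - arctan (- u) = ((- u + 1) - (- u)) * inverse (1 + z\<^sup>2)"
      by (rule MVT2) (auto intro: DERIV_arctan)
    then obtain z where z: "- u < z" "z < - u + 1" "arctan (- u + 1) - arctan (- u) = inverse (1 + z\<^sup>2)" by auto
    have "z\<^sup>2 \<le> (1 + \<bar>u\<bar>)\<^sup>2" by (rule abs_le_square_iff[THEN iffD1]) (use z in auto)
    moreover have "1 \<le> (1 + \<bar>u\<bar>)\<^sup>2" by (rule one_le_power) auto
    ultimately have "1 + z\<^sup>2 \<le> 2 * (1 + \<bar>u\<bar>)\<^sup>2" by linarith
    then have "(1 + z\<^sup>2) * norm (K u) \<le> 2 * (1 + \<bar>u\<bar>)\<^sup>2 * norm (K u)" by (rule mult_right_mono) auto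
    also have "... \<le> 2 * A" using K[of u] by (simp add: mult.assoc)
    finally have "(1 + z\<^sup>2) * norm (K u) \<le> 2 * A" .
    moreover have "0 < 1 + z\<^sup>2" by (simp add: add_pos_nonneg)
    ultimately show ?thesis unfolding z(3) by (simp add: field_simps)
  qed
  have "(\<Sum>m\<in>{1..<J}. norm (K (s - real m))) \<le> (\<Sum>m<J. norm (K (s - real m)))"
    by (rule sum_mono2) auto
  also have "... \<le> (\<Sum>m<J. 2 * A * (arctan (real (Suc m) - s) - arctan (real m - s)))"
  proof (rule sum_mono)
    fix m show "norm (K (s - real m)) \<le> 2 * A * (arctan (real (Suc m) - s) - arctan (real m - s))"
      using step[of "s - real m"] by (simp add: algebra_simps)
  qed
  also have "... = 2 * A * (arctan (real J - s) - arctan (real 0 - s))"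
    unfolding sum_distrib_left[symmetric] by (subst sum_lessThan_telescope) simp
  also have "... \<le> 2 * A * pi"
    using arctan_bounded[of "real J - s"] arctan_bounded[of "real 0 - s"] A by (intro mult_left_mono) auto
  finally show ?thesis by (simp add: mult_ac)
qed

text \<open>The parallelogram law shows that one of the two signs of a new summand does not increase
  the weighted square integral beyond its mean value.\<close>

lemma greedy_signs:
  fixes w :: "'a => ennreal" and E :: "nat => 'a => complex"
  assumes [measurable]: "w \<in> borel_measurable L" "!!m. E m \<in> borel_measurable L" and E: "!!m x. norm (E m x) = 1"
    and M: "finite M"
  shows "\<exists>c. (\<forall>m. norm (c m :: complex) = 1) \<and>
     (\<integral>\<^sup>+x. w x * ennreal ((norm (\<Sum>m\<in>M. c m * E m x))\<^sup>2) \<partial>L) \<le> of_nat (card M) * (\<integral>\<^sup>+x. w x \<partial>L)"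
  using M
proof (induction M rule: finite_induct)
  case empty
  show ?case by (rule exI[of _ "%_. 1"]) simp
next
  case (insert a M)
  obtain c where c: "!!m. norm (c m :: complex) = 1"
    "(\<integral>\<^sup>+x. w x * ennreal ((norm (\<Sum>m\<in>M. c m * E m x))\<^sup>2) \<partial>L) \<le> of_nat (card M) * (\<integral>\<^sup>+x. w x \<partial>L)"
    using insert.IH by blast
  define D where "D x = (\<Sum>m\<in>M. c m * E m x)" for x
  have [measurable]: "D \<in> borel_measurable L" unfolding D_def by measurable
  let ?I = "%e. \<integral>\<^sup>+x. w x * ennreal ((norm (e * E a x + D x))\<^sup>2) \<partial>L"
  let ?X = "(\<integral>\<^sup>+x. w x * ennreal ((norm (D x))\<^sup>2) \<partial>L) + (\<integral>\<^sup>+x. w x \<partial>L)"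
  have "?I 1 + ?I (- 1) = (\<integral>\<^sup>+x. 2 * (w x * ennreal ((norm (D x))\<^sup>2) + w x) \<partial>L)"
  proof (subst nn_integral_add[symmetric])
    have "w x * ennreal ((norm (1 * E a x + D x))\<^sup>2) + w x * ennreal ((norm (- 1 * E a x + D x))\<^sup>2)
       = 2 * (w x * ennreal ((norm (D x))\<^sup>2) + w x)" for x
    proof -
      have "(norm (1 * E a x + D x))\<^sup>2 + (norm (- 1 * E a x + D x))\<^sup>2 = 2 * ((norm (D x))\<^sup>2 + (norm (E a x))\<^sup>2)"
        unfolding cmod_power2 by (simp add: power2_eq_square algebra_simps)
      then have "ennreal ((norm (1 * E a x + D x))\<^sup>2) + ennreal ((norm (- 1 * E a x + D x))\<^sup>2) = ennreal (2 * ((norm (D x))\<^sup>2 + 1))"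
        by (subst ennreal_plus[symmetric]) (auto simp: E)
      also have "... = 2 * (ennreal ((norm (D x))\<^sup>2) + 1)" by (simp add: ennreal_mult ennreal_plus)
      finally show ?thesis by (simp add: distrib_left[symmetric] mult_ac)
    qed
    then show "(\<integral>\<^sup>+x. w x * ennreal ((norm (1 * E a x + D x))\<^sup>2) + w x * ennreal ((norm (- 1 * E a x + D x))\<^sup>2) \<partial>L) =
      (\<integral>\<^sup>+x. 2 * (w x * ennreal ((norm (D x))\<^sup>2) + w x) \<partial>L)" by (simp only:)
  qed measurable
  also have "... = 2 * ?X" by (subst nn_integral_cmult) (auto simp: nn_integral_add)
  finally have s: "?I 1 + ?I (- 1) = 2 * ?X" .
  have "?I 1 \<le> ?X \<or> ?I (- 1) \<le> ?X"
  proof (rule ccontr)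
    assume "\<not> ?thesis"
    then have l: "?X < ?I 1" "?X < ?I (- 1)" by auto
    \<comment> \<open>Strict inequalities in \<open>ennreal\<close> survive addition only for finite
      summands; \<open>?X\<close> is finite because it lies strictly below another value.\<close>
    then have "?X \<noteq> \<infinity>" by auto
    then have "?X + ?X < ?X + ?I (- 1)" using l(2) by (simp only: ennreal_add_left_cancel_less) simp
    also have "... \<le> ?I 1 + ?I (- 1)" by (rule add_right_mono) (rule less_imp_le[OF l(1)])
    finally show False unfolding s mult_2 by simp
  qed
  then obtain e where e: "norm (e::complex) = 1" "?I e \<le> ?X"
  proof
    assume "?I 1 \<le> ?X"
    with norm_one show thesis by (rule that)
  next
    assume *: "?I (- 1) \<le> ?X"
    show thesis by (rule that[OF _ *]) simp
  qed
  show ?case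
  proof (intro exI[of _ "c(a := e)"] conjI allI)
    show "norm ((c(a := e)) m) = 1" for m using c(1) e(1) by simp
    have "(\<Sum>m\<in>insert a M. (c(a := e)) m * E m x) = e * E a x + D x" for x
    proof -
      have "(\<Sum>m\<in>M. (c(a := e)) m * E m x) = D x" unfolding D_def by (rule sum.cong) (use insert.hyps in auto)
      then show ?thesis using insert.hyps by simp
    qed
    then have "(\<integral>\<^sup>+x. w x * ennreal ((norm (\<Sum>m\<in>insert a M. (c(a := e)) m * E m x))\<^sup>2) \<partial>L) = ?I e" by (simp only:)
    also have "... \<le> ?X" by (rule e)
    also have "... \<le> of_nat (card M) * (\<integral>\<^sup>+x. w x \<partial>L) + (\<integral>\<^sup>+x. w x \<partial>L)"
      using c(2) unfolding D_def by (intro add_right_mono)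
    also have "... = of_nat (card (insert a M)) * (\<integral>\<^sup>+x. w x \<partial>L)"
      using insert.hyps by (simp add: distrib_right add.commute)
    finally show "(\<integral>\<^sup>+x. w x * ennreal ((norm (\<Sum>m\<in>insert a M. (c(a := e)) m * E m x))\<^sup>2) \<partial>L) \<le> of_nat (card (insert a M)) * (\<integral>\<^sup>+x. w x \<partial>L)" .
  qed
qed

text \<open>Takes the place of Hoelder's inequality between L_r and L_2: if a^2 has mean of size n,
  integration gives n^(r/2) times a bounded factor.\<close>

lemma powr_le_quadratic:
  fixes a n r :: real
  assumes "0 \<le> a" "0 < n" "0 < r" "r \<le> 2"
  shows "a powr r \<le> n powr (r / 2) * (1 + a\<^sup>2 / n)"
proof -
  define y where "y = a\<^sup>2 / n"
  have y: "0 \<le> y" using assms by (simp add: y_def)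
  have "a powr r = (a\<^sup>2) powr (r / 2)" using assms by (simp add: powr_powr flip: powr_numeral)
  also have "a\<^sup>2 = n * y" using assms by (simp add: y_def)
  also have "(n * y) powr (r / 2) = n powr (r / 2) * y powr (r / 2)" using assms y by (simp add: powr_mult)
  also have "y powr (r / 2) \<le> 1 + y"
  proof (cases "y \<le> 1")
    case True
    then have "y powr (r / 2) \<le> 1" using y assms by (intro powr_le1) auto
    then show ?thesis using y by simp
  next
    case False
    then have "y powr (r / 2) \<le> y powr 1" by (intro powr_mono) (use assms in auto)
    then show ?thesis using False by simp
  qed
  finally show ?thesis by (simp add: y_def mult_left_mono)
qed

lemma two_indices:
  assumes "CARD('n::finite) \<ge> 2"
  shows "\<exists>a b::'n. a \<noteq> b"
proof (rule ccontr)
  assume "\<not> ?thesis"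
  then have "(UNIV :: 'n set) = {undefined}" by auto
  then have "CARD('n) = card {undefined :: 'n}" by (simp only:)
  then show False using assms by simp
qed

lemma powr_growth_contradiction:
  assumes "e < e'" "0 < N" and le: "!!n::nat. n \<ge> 1 ==> real n powr e' * N \<le> C * real n powr e"
  shows False
proof (rule powr_nat_unbounded[where e = "e' - e" and ?N0.0 = 1 and C = "C / N"])
  fix n :: nat assume n: "n \<ge> 1"
  have "real n powr e' * N / real n powr e \<le> C" using le[OF n] n by (simp add: field_simps)
  then show "real n powr (e' - e) \<le> C / N" using assms(2) by (simp add: powr_diff field_simps)
qed (use assms in simp)

section \<open>The counterexamples for small p and for t = 0\<close>

context decomposition
begin

text \<open>The packet is a narrow bump of level J on axis i1 and a low-pass function of level J - 1
  on the D other axes, so it lies in the isotropic block J. Its mixed block with entries J and m,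
  ..., m has quasi-norm of size 2^(m D (1 - 1/p)); in the weighted comparison this becomes 2^(m D
  \<delta>) against 2^(J D \<delta>). For \<delta> < 0 the single index m = 1 suffices; for \<delta>
  = 0 all m contribute equally, and their number is incompatible with finite q.\<close>

lemma necessity_small_p:
  assumes C: "0 < C" "!!T. tempered T ==> BN t p q T < \<infinity> ==>
      mixed_qnorm \<phi>0 t p q T \<le> ennreal C * BN t p q T"
    and p: "0 < p" and q: "0 < q" and d: "CARD('n) \<ge> 2" and pi: "p \<noteq> \<infinity>"
    and t: "t < inv_p p - 1 \<or> (t = inv_p p - 1 \<and> q \<noteq> \<infinity>)"
  shows False
proof -
  define r where "r = enn2real p"
  have r: "r > 0" "p = ennreal r" using p pi by (auto simp: r_def enn2real_positive_iff less_top)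
  have ip: "inv_p p = 1 / r" using pi by (simp add: inv_p_def r_def)
  define D where "D = CARD('n) - 1"
  have D: "D \<ge> 1" "real CARD('n) = real D + 1" using d by (auto simp: D_def)
  define \<delta> where "\<delta> = t + 1 - 1 / r"
  let ?I = "%m. \<integral>\<^sup>+s. ennreal (norm (ker m s) powr r) \<partial>lborel"
  let ?f = "%\<eta>. cor (\<phi>0 \<eta>)"
  have ex: "\<exists>X>0. ?I m = ennreal X" if m: "test1 R m" "m \<xi> \<noteq> 0" for m R \<xi>
    using ker_powr_pos[OF m r(1)] rapid_powr_finite[OF rapid_ker[OF m(1)] r(1)]
    by (cases "?I m") (auto simp: ennreal_less_zero_iff)
  obtain \<alpha> where \<alpha>: "\<alpha> > 0" "?I (bk 0 0) = ennreal \<alpha>" using ex[OF test1_bk bk_center] by blast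
  obtain \<beta> where \<beta>: "\<beta> > 0" "?I ?f = ennreal \<beta>" using ex[OF phi.test_phi0, of 0] by (auto simp: phi0_one)
  obtain \<epsilon> where \<epsilon>: "\<epsilon> > 0" "?I (cth \<phi>0) = ennreal \<epsilon>"
    using ex[OF phi.test_th, of 1] by (auto simp: cth_def phi0_one phi0_zero)
  have Ibk: "?I (bk 0 k) = ennreal \<alpha>" for k
    unfolding \<alpha>(2)[symmetric] by (intro nn_integral_cong) (subst norm_ker_bk, simp)
  have If: "?I (%\<eta>. ?f (\<eta> / 2 ^ L)) = ennreal (2 powr (real L * (r - 1)) * \<beta>)" for L
  proof -
    have "ker (%\<eta>. ?f (\<eta> / 2 ^ L)) s = 2 ^ L * ker ?f (2 ^ L * s)" for s using ker_scale[of "2 ^ L" ?f s] by simp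
    then show ?thesis
      using nn_integral_powr_scale[OF rapid_measurable[OF rapid_ker[OF phi.test_phi0]] r(1), of L] \<beta> by (simp add: ennreal_mult)
  qed
  have Ic: "?I (cphi \<phi>0 m) = ennreal (2 powr (real m * (r - 1)) * \<epsilon>)" if "m > 0" for m
    using nn_integral_powr_scale[OF rapid_measurable[OF rapid_ker[OF phi.test_th]] r(1), of m] \<epsilon>
    by (simp add: phi.ker_cphi[OF that] ennreal_mult)
  define a' where "a' = (\<alpha> * \<epsilon> ^ D) powr (1 / r)"
  define b' where "b' = (\<alpha> * \<beta> ^ D) powr (1 / r)"
  have ab: "a' > 0" "b' > 0" using \<alpha> \<beta> \<epsilon> by (auto simp: a'_def b'_def)
  obtain i1 i2 :: 'n where i2: "i2 \<noteq> i1" using two_indices[OF d] by blast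
  have main: "real (card Ms) powr inv_p q * (2 powr (real J * t) * 2 powr e * a') \<le>
      C * (2 powr (real J * (t * real CARD('n))) * (2 powr (real (J - 1) * real D * (1 - 1 / r)) * b'))"
    if J: "J \<ge> 3" and Ms: "Ms \<subseteq> {1..J - 2}" "Ms \<noteq> {}" and e: "!!m. m \<in> Ms ==> e \<le> real m * real D * \<delta>" for J Ms e
  proof -
    \<comment> \<open>Level J - 1 keeps the other coordinates below 3/2 2^(J-1) \<le> 2^J, so axis
      i1 decides the isotropic block; the functions of level m \<le> J - 2 are supported where this
      low-pass function is 1.\<close>
    define h where "h i = (if i = i1 then bk 0 J else (%\<eta>. ?f (\<eta> / 2 ^ (J - 1))))" for i
    define km where "km m i = (if i = i1 then J else m)" for m :: nat and i
    have pw: "(2::real) ^ J = 2 * 2 ^ (J - 1)" using J by (cases J) auto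
    have th: "test1 (2 ^ J + 1) (h i)" for i
    proof (cases "i = i1")
      case True
      then show ?thesis by (simp add: h_def) (rule test1_mono[OF test1_bk], simp add: cen_def)
    next
      case False
      then show ?thesis using test1_scale[OF phi.test_phi0, of "2 ^ (J - 1)"] pw
        by (simp add: h_def) (erule test1_mono, simp)
    qed
    have km: "inj km" by (rule injI) (metis i2 km_def)
    have finMs: "finite Ms" using Ms finite_subset by blast
    have skm: "real (sum (km m) UNIV) = real J + real D * real m" for m
    proof -
      have "sum (km m) UNIV = km m i1 + sum (km m) (UNIV - {i1})" by (rule sum.remove) auto
      also have "sum (km m) (UNIV - {i1}) = (\<Sum>i\<in>UNIV - {i1}. m)" by (rule sum.cong) (auto simp: km_def)
      finally show ?thesis by (simp add: km_def D_def card_Diff_singleton)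
    qed
    have "real (card (km ` Ms)) powr inv_p q * (2 powr (real J * t) * 2 powr e * a') \<le>
      C * (2 powr (real J * (t * real CARD('n))) * (2 powr (real (J - 1) * real D * (1 - 1 / r)) * b'))"
    proof (rule packet_test[OF C p q, where M = "{0::nat}" and c = "%_. 1" and h = "%_. h" and R = "%_. 2 ^ J + 1"])
      show "test1 (2 ^ J + 1) (h i)" for i by (rule th)
      show "finite (km ` Ms)" "km ` Ms \<noteq> {}" using finMs Ms by auto
      show "0 \<le> 2 powr (real (J - 1) * real D * (1 - 1 / r)) * b'" "0 \<le> 2 powr (real J * t) * 2 powr e * a'" using ab by auto
      fix j :: nat and \<xi> :: "real^'n" assume nz: "!!i. h i (\<xi> $ i) \<noteq> 0"
      show "psi \<psi>0 j \<xi> = (if j = J then 1 else 0)"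
      proof (rule psi_localized[where a = i1])
        have b: "bk 0 J (\<xi> $ i1) \<noteq> 0" using nz[of i1] by (simp add: h_def)
        show "4/5 * 2 ^ J \<le> \<bar>\<xi> $ i1\<bar>" using bk_range(2)[OF b] J by simp
        show "\<bar>\<xi> $ i\<bar> \<le> 2 ^ J" for i
        proof (cases "i = i1")
          case True
          then show ?thesis using bk_range(1)[OF b] by simp
        next
          case False
          then have "\<phi>0 (\<xi> $ i / 2 ^ (J - 1)) \<noteq> 0" using nz[of i] by (simp add: h_def)
          then have "\<bar>\<xi> $ i / 2 ^ (J - 1)\<bar> \<le> 3/2" using phi0_zero by force
          then show ?thesis using pw by (simp add: abs_divide field_simps)
        qed
      qed (use J in simp)
    next
      have "Lp_qnorm p (pk h) = ennreal ((\<alpha> * (2 powr (real (J - 1) * (r - 1)) * \<beta>) ^ D) powr (1 / r))"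
        unfolding r(2) D_def by (rule Lp_pk_two_level[OF th r(1), where a = i1])
          (use \<alpha> \<beta> in \<open>auto simp: h_def Ibk If\<close>)
      also have "... = ennreal (2 powr (real (J - 1) * real D * (1 - 1 / r)) * b')"
        using \<alpha> \<beta> r by (subst two_level_powr) (auto simp: b'_def)
      finally show "Lp_qnorm p (%x. \<Sum>m\<in>{0::nat}. 1 * pk h x) \<le> ennreal (2 powr (real (J - 1) * real D * (1 - 1 / r)) * b')" by simp
    next
      fix k assume "k \<in> km ` Ms"
      then obtain m where m: "m \<in> Ms" "k = km m" by blast
      have m': "m > 0" "m \<le> J - 2" using m Ms by auto
      have eqf: "(%\<eta>. cphi \<phi>0 (k i) \<eta> * h i \<eta>) = (if i = i1 then bk 0 J else cphi \<phi>0 m)" for i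
      proof (cases "i = i1")
        case True
        then show ?thesis by (simp add: h_def m km_def cphi_bk)
      next
        case False
        have "cphi \<phi>0 m \<eta> * ?f (\<eta> / 2 ^ (J - 1)) = cphi \<phi>0 m \<eta>" for \<eta>
        proof (cases "phi \<phi>0 m \<eta> = 0")
          case nz: False
          have "\<bar>\<eta>\<bar> \<le> 3/2 * 2 ^ m" by (rule phi_support(1)[OF nz])
          also have "... \<le> 2 ^ Suc m" by simp
          also have "(2::real) ^ Suc m \<le> 2 ^ (J - 1)" by (rule power_increasing) (use m' J in auto)
          finally have "\<bar>\<eta> / 2 ^ (J - 1)\<bar> \<le> 1" by (simp add: abs_divide)
          then show ?thesis by (simp add: phi0_one)
        qed (simp add: cphi_def)
        then show ?thesis using False by (auto simp: h_def m(2) km_def fun_eq_iff)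
      qed
      have th': "test1 (2 ^ J + 1) (if i = i1 then bk 0 J else cphi \<phi>0 m)" for i
        unfolding eqf[symmetric] by (rule test1_mult[OF th sm1_cphi])
      have "Lp_qnorm p (pk (%i. if i = i1 then bk 0 J else cphi \<phi>0 m)) = ennreal ((\<alpha> * (2 powr (real m * (r - 1)) * \<epsilon>) ^ D) powr (1 / r))"
        unfolding r(2) D_def by (rule Lp_pk_two_level[OF th' r(1), where a = i1]) (use \<alpha> \<epsilon> in \<open>auto simp: Ibk Ic[OF m'(1)]\<close>)
      also have "... = ennreal (2 powr (real m * real D * (1 - 1 / r)) * a')"
        using \<alpha> \<epsilon> r by (subst two_level_powr) (auto simp: a'_def)
      finally have L: "Lp_qnorm p (pk (%i \<eta>. cphi \<phi>0 (k i) \<eta> * h i \<eta>)) = ennreal (2 powr (real m * real D * (1 - 1 / r)) * a')"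
        unfolding eqf .
      have "2 powr (real J * t) * 2 powr e * a' \<le> 2 powr (real J * t) * 2 powr (real m * real D * \<delta>) * a'"
        using ab e[OF m(1)] by (intro mult_right_mono mult_left_mono powr_mono) auto
      also have "2 powr (real J * t) * 2 powr (real m * real D * \<delta>) = 2 powr (real (sum k UNIV) * t) * 2 powr (real m * real D * (1 - 1 / r))"
        unfolding powr_add[symmetric] m(2) skm \<delta>_def by (simp add: algebra_simps)
      finally have "ennreal (2 powr (real J * t) * 2 powr e * a') \<le> ennreal (2 powr (real (sum k UNIV) * t) * (2 powr (real m * real D * (1 - 1 / r)) * a'))"
        by (intro ennreal_leI) (simp add: mult.assoc)
      then show "ennreal (2 powr (real J * t) * 2 powr e * a') \<le> ennreal (2 powr (real (sum k UNIV) * t)) * Lp_qnorm p (%x. \<Sum>m\<in>{0::nat}. 1 * pk (%i \<eta>. cphi \<phi>0 (k i) \<eta> * h i \<eta>) x)"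
        using ab by (simp add: L ennreal_mult)
    qed auto
    then show ?thesis using card_image[OF inj_on_subset[OF km subset_UNIV], of Ms] by simp
  qed
  define c' where "c' = C * b' * 2 powr (- (real D * (1 - 1 / r)))"
  have rhs: "C * (2 powr (real J * (t * real CARD('n))) * (2 powr (real (J - 1) * real D * (1 - 1 / r)) * b')) = 2 powr (real J * t) * (c' * 2 powr (real J * real D * \<delta>))"
    if "J \<ge> 3" for J
  proof -
    have "real J * (t * real CARD('n)) + real (J - 1) * real D * (1 - 1 / r) = real J * t + (- (real D * (1 - 1 / r)) + real J * real D * \<delta>)"
      using that by (simp add: D(2) \<delta>_def of_nat_diff algebra_simps)
    from arg_cong[OF this, of "%x. 2 powr x"]
    have e: "2 powr (real J * (t * real CARD('n))) * 2 powr (real (J - 1) * real D * (1 - 1 / r)) =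
      2 powr (real J * t) * (2 powr (- (real D * (1 - 1 / r))) * 2 powr (real J * real D * \<delta>))" unfolding powr_add .
    have "C * (2 powr (real J * (t * real CARD('n))) * (2 powr (real (J - 1) * real D * (1 - 1 / r)) * b')) =
      (2 powr (real J * (t * real CARD('n))) * 2 powr (real (J - 1) * real D * (1 - 1 / r))) * (C * b')" by (simp only: mult_ac)
    also have "... = 2 powr (real J * t) * (c' * 2 powr (real J * real D * \<delta>))" unfolding e c'_def by (simp only: mult_ac)
    finally show ?thesis .
  qed
  have main': "real (card Ms) powr inv_p q * (2 powr e * a') \<le> c' * 2 powr (real J * real D * \<delta>)"
    if "J \<ge> 3" "Ms \<subseteq> {1..J - 2}" "Ms \<noteq> {}" "!!m. m \<in> Ms ==> e \<le> real m * real D * \<delta>" for J Ms e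
  proof -
    have "2 powr (real J * t) * (real (card Ms) powr inv_p q * (2 powr e * a')) \<le> 2 powr (real J * t) * (c' * 2 powr (real J * real D * \<delta>))"
      using main[OF that] unfolding rhs[OF that(1)] by (simp add: mult_ac)
    then show ?thesis by simp
  qed
  show False
  proof (cases "\<delta> < 0")
    case True
    have "2 powr (real J * (real D * - \<delta>)) \<le> c' / (2 powr (real D * \<delta>) * a')" if J: "J \<ge> 3" for J
    proof -
      have "2 powr (real D * \<delta>) * a' \<le> c' * 2 powr (real J * real D * \<delta>)"
        using main'[OF J, of "{1}" "real D * \<delta>"] J by simp
      also have "2 powr (real J * real D * \<delta>) = 1 / 2 powr (real J * (real D * - \<delta>))"
        by (simp add: powr_minus divide_simps mult.assoc)
      finally show ?thesis using ab by (simp add: field_simps)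
    qed
    moreover have "real D * - \<delta> > 0" using True D by (intro mult_pos_pos) auto
    ultimately show False by (rule two_powr_unbounded[rotated])
  next
    case False
    then have \<delta>0: "\<delta> = 0" and qf: "q \<noteq> \<infinity>" using t by (auto simp: \<delta>_def ip)
    have "inv_p q > 0" using q qf by (simp add: inv_p_def enn2real_positive_iff less_top)
    then show False
    proof (rule powr_growth_contradiction[of 0 "inv_p q" a' c'])
      fix n :: nat assume n: "n \<ge> 1"
      show "real n powr inv_p q * a' \<le> c' * real n powr 0"
        using main'[of "n + 2" "{1..n}" 0] n \<delta>0 by simp
    qed (use ab in auto)
  qed
qed

text \<open>The entry at \<open>a\<close> places all packets in the same isotropic block, the entry
  at \<open>b\<close> separates their mixed blocks.\<close>

definition km :: "'n => 'n => nat => nat => 'n => nat" where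
  "km a b J m i = (if i = a then J else if i = b then m else 0)"

text \<open>Level n + 1 exceeds every m, so all packets share one isotropic block. Each survives in
  exactly one mixed block, where modulation, translation and the unimodular \<open>c\<close> leave
  its quasi-norm at \<open>N\<close>. The mixed quasi-norm is thus at least n^(1/q) N, and it
  remains to make the norm of the sum small.\<close>

lemma cross_test:
  assumes C: "0 < C" "!!T. tempered T ==> BN 0 p q T < \<infinity> ==>
      mixed_qnorm \<phi>0 0 p q T \<le> ennreal C * BN 0 p q T"
    and p: "0 < p" and q: "0 < q" and ab: "a \<noteq> b" and n: "n \<ge> 1"
    and N: "Lp_qnorm p (pk (%_::'n. bk 0 0)) = ennreal N" "N > 0"
    and c: "!!m. norm (c m) = 1"
    and B: "0 \<le> B" "Lp_qnorm p (%x. \<Sum>m\<in>{1..n}. c m * pk (%i. bk (s m i) (km a b (Suc n) m i)) x) \<le> ennreal B"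
  shows "real n powr inv_p q * N \<le> C * B"
proof -
  let ?k = "km a b (Suc n)"
  have inj: "inj ?k" by (rule injI) (metis ab km_def)
  have kle: "?k m i \<le> Suc n" if "m \<in> {1..n}" for m i using that by (simp add: km_def)
  have "real (card (?k ` {1..n})) powr inv_p q * N \<le> C * (2 powr (real (Suc n) * (0 * real CARD('n))) * B)"
  proof (rule packet_test[OF C p q _ _ _ B(1), where M = "{1..n}" and c = c and h = "%m i. bk (s m i) (?k m i)" and R = "%m. 2 ^ (Suc n + m) + 1"])
    show "test1 (2 ^ (Suc n + m) + 1) (bk (s m i) (?k m i))" for m i
    proof (rule test1_mono[OF test1_bk])
      have "cen (?k m i) \<le> 2 ^ ?k m i" by (simp add: cen_def)
      also have "(2::real) ^ ?k m i \<le> 2 ^ (Suc n + m)" by (rule power_increasing) (auto simp: km_def)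
      finally show "cen (?k m i) + 1 \<le> 2 ^ (Suc n + m) + 1" by simp
    qed
    fix m j :: nat and \<xi> :: "real^'n" assume m: "m \<in> {1..n}" and "!!i. bk (s m i) (?k m i) (\<xi> $ i) \<noteq> 0"
    then show "psi \<psi>0 j \<xi> = (if j = Suc n then 1 else 0)"
      by (intro psi_bk[where b = "s m" and k = "?k m" and a = a]) (auto simp: kle km_def)
  next
    show "Lp_qnorm p (%x. \<Sum>m\<in>{1..n}. c m * pk (%i. bk (s m i) (?k m i)) x) \<le> ennreal B" by (rule B)
  next
    fix k assume "k \<in> ?k ` {1..n}"
    then obtain l where l: "l \<in> {1..n}" "k = ?k l" by blast
    have "(\<Sum>m\<in>{1..n}. c m * pk (%i \<eta>. cphi \<phi>0 (k i) \<eta> * bk (s m i) (?k m i) \<eta>) x) = c l * pk (%i. bk (s l i) (?k l i)) x" for x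
    proof -
      have "(\<Sum>m\<in>{1..n}. c m * pk (%i \<eta>. cphi \<phi>0 (k i) \<eta> * bk (s m i) (?k m i) \<eta>) x) =
        (\<Sum>m\<in>{1..n}. if m = l then c m * pk (%i. bk (s m i) (?k m i)) x else 0)"
        by (rule sum.cong) (auto simp: pk_cphi_bk[where b = "s _" and k = "?k _"] l inj_eq[OF inj])
      then show ?thesis using l by simp
    qed
    moreover have "Lp_qnorm p (%x. c l * pk (%i. bk (s l i) (?k l i)) x) = ennreal N"
    proof -
      have "Lp_qnorm p (%x. c l * pk (%i. bk (s l i) (?k l i)) x) = Lp_qnorm p (%x. pk (%_. bk 0 0) (x - (\<chi> i. s l i)))"
        by (rule Lp_qnorm_norm_cong) (simp only: norm_mult c mult_1_left norm_pk_bk[of "s l" "?k l"])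
      also have "... = ennreal N" unfolding N(1)[symmetric] by (rule Lp_qnorm_translate) (rule pk_continuous[OF test1_bk])
      finally show ?thesis .
    qed
    ultimately show "ennreal N \<le> ennreal (2 powr (real (sum k UNIV) * 0)) * Lp_qnorm p (%x. \<Sum>m\<in>{1..n}. c m * pk (%i \<eta>. cphi \<phi>0 (k i) \<eta> * bk (s m i) (?k m i) \<eta>) x)"
      by simp
  qed (use n N in auto)
  then show ?thesis using card_image[OF inj_on_subset[OF inj subset_UNIV], of "{1..n}"] by simp
qed

text \<open>Centres at unit distance on axis b keep the sum of the moduli below a constant U
  everywhere. For finite p = r the r-th power of the sum is then at most U^(r-1) times the sum of
  the moduli, whose integral is a constant times n.\<close>

lemma translates_bound:
  assumes p: "1 < p" and ab: "a \<noteq> b"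
  shows "\<exists>K>0. \<forall>n\<ge>1. Lp_qnorm p (%x. \<Sum>m\<in>{1..n}. 1 * pk (%i::'n. bk (if i = b then real m else 0) (km a b (Suc n) m i)) x) \<le> ennreal (K * real n powr inv_p p)"
proof -
  let ?\<kappa> = "ker (bk 0 0)" and ?w = "pk (%_::'n. bk 0 0)"
  obtain A0 where A0: "!!s. (1 + \<bar>s\<bar>)\<^sup>2 * norm (?\<kappa> s) \<le> A0" using ker_decay[OF test1_bk] by blast
  define A where "A = max A0 1"
  have A: "(1 + \<bar>s\<bar>)\<^sup>2 * norm (?\<kappa> s) \<le> A" "A \<ge> 1" for s using A0[of s] by (auto simp: A_def)
  have A1: "norm (?\<kappa> s) \<le> A" for s
  proof -
    have "1 * norm (?\<kappa> s) \<le> (1 + \<bar>s\<bar>)\<^sup>2 * norm (?\<kappa> s)" by (intro mult_right_mono one_le_power) auto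
    then show ?thesis using A(1)[of s] by simp
  qed
  define U where "U = A ^ (CARD('n) - 1) * (2 * pi * A)"
  have U: "U > 0" using A(2) by (simp add: U_def)
  let ?g = "%n m. pk (%i::'n. bk (if i = b then real m else 0) (km a b (Suc n) m i))"
  have ng: "norm (?g n m x) = (\<Prod>i\<in>UNIV - {b}. norm (?\<kappa> (x $ i))) * norm (?\<kappa> (x $ b - real m))" for n m x
  proof -
    have "norm (?g n m x) = (\<Prod>i\<in>UNIV. norm (?\<kappa> (x $ i - (if i = b then real m else 0))))"
      unfolding pk_def prod_norm[symmetric] by (intro prod.cong refl) (rule norm_ker_bk)
    also have "... = norm (?\<kappa> (x $ b - (if b = b then real m else 0))) * (\<Prod>i\<in>UNIV - {b}. norm (?\<kappa> (x $ i - (if i = b then real m else 0))))"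
      by (rule prod.remove) auto
    also have "(\<Prod>i\<in>UNIV - {b}. norm (?\<kappa> (x $ i - (if i = b then real m else 0)))) = (\<Prod>i\<in>UNIV - {b}. norm (?\<kappa> (x $ i)))"
      by (rule prod.cong) auto
    finally show ?thesis by simp
  qed
  have sumU: "(\<Sum>m\<in>{1..n}. norm (?g n m x)) \<le> U" for n x
  proof -
    have "(\<Sum>m\<in>{1..n}. norm (?g n m x)) = (\<Prod>i\<in>UNIV - {b}. norm (?\<kappa> (x $ i))) * (\<Sum>m\<in>{1..n}. norm (?\<kappa> (x $ b - real m)))"
      by (simp only: ng sum_distrib_left)
    also have "... \<le> (\<Prod>i\<in>UNIV - {b}. A) * (2 * pi * A)"
    proof (rule mult_mono)
      show "(\<Prod>i\<in>UNIV - {b}. norm (?\<kappa> (x $ i))) \<le> (\<Prod>i\<in>UNIV - {b}. A)" by (intro prod_mono) (auto intro: A1)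
      have "{1..n} = {1..<Suc n}" by auto
      then show "(\<Sum>m\<in>{1..n}. norm (?\<kappa> (x $ b - real m))) \<le> 2 * pi * A" using sum_translates_bounded[OF A(1), where J = "Suc n" and s = "x $ b"] by simp
    qed (use A(2) in \<open>auto intro: prod_nonneg sum_nonneg\<close>)
    finally show ?thesis by (simp add: U_def card_Diff_singleton)
  qed
  have nF: "norm (\<Sum>m\<in>{1..n}. 1 * ?g n m x) \<le> (\<Sum>m\<in>{1..n}. norm (?g n m x))" for n x
    by (rule order_trans[OF norm_sum]) simp
  have cont: "continuous_on UNIV (?g n m)" for n m
  proof (rule pk_continuous)
    show "test1 (2 ^ (Suc n + m) + 1) (bk (if i = b then real m else 0) (km a b (Suc n) m i))" for i
    proof (rule test1_mono[OF test1_bk])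
      have "cen (km a b (Suc n) m i) \<le> 2 ^ km a b (Suc n) m i" by (simp add: cen_def)
      also have "(2::real) ^ km a b (Suc n) m i \<le> 2 ^ (Suc n + m)" by (rule power_increasing) (auto simp: km_def)
      finally show "cen (km a b (Suc n) m i) + 1 \<le> 2 ^ (Suc n + m) + 1" by simp
    qed
  qed
  have [measurable]: "?g n m \<in> borel_measurable borel" for n m by (rule borel_measurable_continuous_onI[OF cont])
  show ?thesis
  proof (cases "p = \<infinity>")
    case True
    have "Lp_qnorm \<infinity> (%x. \<Sum>m\<in>{1..n}. 1 * ?g n m x) \<le> ennreal U" for n
    proof (rule Linf_le)
      show "(%x. \<Sum>m\<in>{1..n}. 1 * ?g n m x) \<in> borel_measurable borel" by measurable
      show "ennreal (norm (\<Sum>m\<in>{1..n}. 1 * ?g n m x)) \<le> ennreal U" for x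
        by (rule ennreal_leI) (rule order_trans[OF nF sumU])
    qed
    then show ?thesis using U by (intro exI[of _ U]) (simp add: True inv_p_def)
  next
    case False
    define r where "r = enn2real p"
    have r: "r > 1" using p False by (cases p) (auto simp: r_def ennreal_less_iff simp flip: ennreal_1)
    have "Lp_qnorm (ennreal 1) ?w < \<infinity>" "0 < Lp_qnorm (ennreal 1) ?w"
      using Lp_pk_pos_finite[where h = "%_::'n. bk 0 0" and p = "ennreal 1", OF test1_bk] bk_center[of 0 0] by auto
    then obtain W where W: "Ip 1 ?w = ennreal W" "W > 0"
      by (cases "Ip 1 ?w") (auto simp: Lp_qnorm_real ennreal_less_zero_iff)
    define K where "K = (U powr (r - 1) * W) powr (1 / r)"
    have K: "K > 0" using U W by (simp add: K_def)
    show ?thesis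
    proof (rule exI[of _ K], intro conjI allI impI K)
      fix n :: nat assume n: "n \<ge> 1"
      have Ig: "(\<integral>\<^sup>+x. ennreal (norm (?g n m x)) \<partial>lborel) = ennreal W" for m
      proof -
        have "(\<integral>\<^sup>+x. ennreal (norm (?g n m x)) \<partial>lborel) = (\<integral>\<^sup>+x. ennreal (norm (?w (x + - (\<chi> i. if i = b then real m else 0)))) \<partial>lborel)"
          by (intro nn_integral_cong) (subst norm_pk_bk, simp)
        also have "... = (\<integral>\<^sup>+x. ennreal (norm (?w x)) \<partial>lborel)"
          by (rule nn_integral_translate) (use borel_measurable_continuous_onI[OF pk_continuous[where h = "%_::'n. bk 0 0", OF test1_bk]] in measurable)
        finally show ?thesis using W by (simp add: Ip_def)
      qed
      have "Ip r (%x. \<Sum>m\<in>{1..n}. 1 * ?g n m x) \<le> (\<integral>\<^sup>+x. ennreal (U powr (r - 1)) * (\<Sum>m\<in>{1..n}. ennreal (norm (?g n m x))) \<partial>lborel)"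
        unfolding Ip_def
      proof (rule nn_integral_mono)
        fix x
        let ?s = "\<Sum>m\<in>{1..n}. norm (?g n m x)"
        have s: "0 \<le> ?s" by (rule sum_nonneg) auto
        have "norm (\<Sum>m\<in>{1..n}. 1 * ?g n m x) powr r \<le> ?s powr r" by (rule powr_mono2) (use r nF in auto)
        also have "... = ?s powr (r - 1) * ?s" by (rule powr_minus_one_mult[OF s, symmetric])
        also have "... \<le> U powr (r - 1) * ?s" by (intro mult_right_mono powr_mono2 s sumU) (use r in auto)
        finally have "ennreal (norm (\<Sum>m\<in>{1..n}. 1 * ?g n m x) powr r) \<le> ennreal (U powr (r - 1) * ?s)" by (rule ennreal_leI)
        also have "... = ennreal (U powr (r - 1)) * (\<Sum>m\<in>{1..n}. ennreal (norm (?g n m x)))"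
          by (subst ennreal_mult) (use s in \<open>auto simp: sum_ennreal\<close>)
        finally show "ennreal (norm (\<Sum>m\<in>{1..n}. 1 * ?g n m x) powr r) \<le> ennreal (U powr (r - 1)) * (\<Sum>m\<in>{1..n}. ennreal (norm (?g n m x)))" .
      qed
      also have "... = ennreal (U powr (r - 1)) * (\<Sum>m\<in>{1..n}. ennreal W)"
        by (subst nn_integral_cmult) (auto simp: nn_integral_sum Ig simp del: sum_ennreal)
      also have "... = ennreal (U powr (r - 1) * W * real n)"
        using W by (simp add: ennreal_mult ennreal_of_nat_eq_real_of_nat mult_ac)
      finally have "Lp_qnorm p (%x. \<Sum>m\<in>{1..n}. 1 * ?g n m x) \<le> epowr (ennreal (U powr (r - 1) * W * real n)) (1 / r)"
        unfolding Lp_qnorm_real[OF False] r_def[symmetric] by (rule epowr_mono) (use r in simp)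
      also have "... = ennreal (K * real n powr inv_p p)"
        using W False by (simp add: epowr_ennreal powr_mult K_def inv_p_def r_def)
      finally show "Lp_qnorm p (%x. \<Sum>m\<in>{1..n}. 1 * ?g n m x) \<le> ennreal (K * real n powr inv_p p)" .
    qed
  qed
qed

lemma pk_bk_modulate: "pk (%i::'n. bk 0 (k i)) x = ee x (\<chi> i. cen (k i)) * pk (%_. bk 0 0) x"
proof -
  have b: "bk 0 k = (%\<eta>. bk 0 0 (\<eta> - cen k))" for k by (auto simp: bk_def cen_def)
  have e: "ker (bk 0 k) s = cis (s * cen k) * ker (bk 0 0) s" for k s
    by (subst b) (rule ker_modulate[OF test1_measurable[OF test1_bk]])
  show ?thesis unfolding pk_def ee_prod prod.distrib[symmetric]
    by (intro prod.cong refl) (rule trans[OF e], simp)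
qed

text \<open>Up to characters all packets are the same function w. Greedy signs keep the square
  integral of the sum of characters with weight |w|^r at most n times the mass, as random signs
  would on average; for r \<le> 2 this bounds the L_r quasi-norm by a multiple of n^(1/2).\<close>

lemma signs_bound:
  assumes p: "0 < p" "p \<le> 2" and ab: "a \<noteq> b"
  shows "\<exists>K>0. \<forall>n\<ge>1. \<exists>c. (\<forall>m. norm (c m) = 1) \<and>
    Lp_qnorm p (%x. \<Sum>m\<in>{1..n}. c m * pk (%i::'n. bk 0 (km a b (Suc n) m i)) x) \<le> ennreal (K * real n powr (1 / 2))"
proof -
  define r where "r = enn2real p"
  have pi: "p \<noteq> \<infinity>" using p by (auto simp: top_unique)
  have r: "0 < r" using p pi by (simp add: r_def enn2real_positive_iff less_top)
  have "ennreal r \<le> ennreal 2" using p(2) pi by (simp add: r_def less_top)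
  then have r: "0 < r" "r \<le> 2" using r by (simp_all add: ennreal_le_iff del: ennreal_numeral)
  let ?w = "pk (%_::'n. bk 0 0)"
  have [measurable]: "?w \<in> borel_measurable borel"
    by (rule borel_measurable_continuous_onI[OF pk_continuous[where h = "%_::'n. bk 0 0", OF test1_bk]])
  have "Lp_qnorm p ?w < \<infinity>" "0 < Lp_qnorm p ?w"
    using Lp_pk_pos_finite[where h = "%_::'n. bk 0 0", OF test1_bk _ p(1)] bk_center[of 0 0] by auto
  then obtain W where W: "Ip r ?w = ennreal W" "W > 0"
    by (cases "Ip r ?w") (auto simp: Lp_qnorm_real[OF pi] epowr_ennreal ennreal_less_zero_iff less_le simp flip: r_def)
  define K where "K = (2 * W) powr (1 / r)"
  have K: "K > 0" using W by (simp add: K_def)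
  show ?thesis
  proof (rule exI[of _ K], intro conjI allI impI K)
    fix n :: nat assume n: "n \<ge> 1"
    let ?E = "%m x::real^'n. ee x (\<chi> i. cen (km a b (Suc n) m i))"
    let ?u = "%x. ennreal (norm (?w x) powr r)"
    have [measurable]: "?E m \<in> borel_measurable borel" for m
      by (intro borel_measurable_continuous_onI continuous_intros)
    have "\<exists>c. (\<forall>m. norm (c m :: complex) = 1) \<and>
       (\<integral>\<^sup>+x. ?u x * ennreal ((norm (\<Sum>m\<in>{1..n}. c m * ?E m x))\<^sup>2) \<partial>lborel) \<le> of_nat (card {1..n}) * (\<integral>\<^sup>+x. ?u x \<partial>lborel)"
      by (rule greedy_signs) auto
    then obtain c where c: "!!m. norm (c m :: complex) = 1"
       "(\<integral>\<^sup>+x. ?u x * ennreal ((norm (\<Sum>m\<in>{1..n}. c m * ?E m x))\<^sup>2) \<partial>lborel) \<le> ennreal (real n * W)"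
      using W by (auto simp: Ip_def ennreal_mult ennreal_of_nat_eq_real_of_nat)
    let ?D = "%x. \<Sum>m\<in>{1..n}. c m * ?E m x"
    let ?F = "%x. \<Sum>m\<in>{1..n}. c m * pk (%i::'n. bk 0 (km a b (Suc n) m i)) x"
    have F: "?F x = ?D x * ?w x" for x unfolding sum_distrib_right
      by (intro sum.cong refl) (simp only: mult.assoc pk_bk_modulate[of "km a b (Suc n) m" for m])
    let ?a = "real n powr (r / 2)"
    have "Ip r ?F \<le> (\<integral>\<^sup>+x. ennreal ?a * (?u x + ennreal (1 / real n) * (?u x * ennreal ((norm (?D x))\<^sup>2))) \<partial>lborel)"
      unfolding Ip_def F
    proof (rule nn_integral_mono)
      fix x
      have "norm (?D x * ?w x) powr r = norm (?D x) powr r * norm (?w x) powr r" by (simp add: norm_mult powr_mult)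
      also have "... \<le> (?a * (1 + (norm (?D x))\<^sup>2 / real n)) * norm (?w x) powr r"
        by (intro mult_right_mono powr_le_quadratic) (use n r in auto)
      also have "... = ?a * (norm (?w x) powr r + 1 / real n * (norm (?w x) powr r * (norm (?D x))\<^sup>2))"
        by (simp add: algebra_simps)
      finally have "ennreal (norm (?D x * ?w x) powr r) \<le> ennreal (?a * (norm (?w x) powr r + 1 / real n * (norm (?w x) powr r * (norm (?D x))\<^sup>2)))"
        by (rule ennreal_leI)
      also have "... = ennreal ?a * (?u x + ennreal (1 / real n) * (?u x * ennreal ((norm (?D x))\<^sup>2)))"
        by (simp only: ennreal_mult ennreal_plus powr_ge_zero zero_le_power2 divide_nonneg_nonneg zero_le_one of_nat_0_le_iff mult_nonneg_nonneg add_nonneg_nonneg)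
      finally show "ennreal (norm (?D x * ?w x) powr r) \<le> ennreal ?a * (?u x + ennreal (1 / real n) * (?u x * ennreal ((norm (?D x))\<^sup>2)))" .
    qed
    also have "... = ennreal ?a * (ennreal W + ennreal (1 / real n) * (\<integral>\<^sup>+x. ?u x * ennreal ((norm (?D x))\<^sup>2) \<partial>lborel))"
    proof -
      define v where "v x = ennreal ((norm (?D x))\<^sup>2)" for x
      have Dm: "?D \<in> borel_measurable borel" by (intro borel_measurable_continuous_onI continuous_intros)
      have [measurable]: "v \<in> borel_measurable lborel" unfolding v_def using Dm by simp
      define u where "u x = ?u x" for x
      have [measurable]: "u \<in> borel_measurable lborel" unfolding u_def by simp
      have Wu: "(\<integral>\<^sup>+x. u x \<partial>lborel) = ennreal W" using W(1) by (simp add: Ip_def u_def)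
      have "(\<integral>\<^sup>+x. ennreal ?a * (u x + ennreal (1 / real n) * (u x * v x)) \<partial>lborel) =
        ennreal ?a * (\<integral>\<^sup>+x. u x + ennreal (1 / real n) * (u x * v x) \<partial>lborel)" by (rule nn_integral_cmult) measurable
      also have "(\<integral>\<^sup>+x. u x + ennreal (1 / real n) * (u x * v x) \<partial>lborel) = ennreal W + (\<integral>\<^sup>+x. ennreal (1 / real n) * (u x * v x) \<partial>lborel)"
        unfolding Wu[symmetric] by (rule nn_integral_add) measurable
      also have "(\<integral>\<^sup>+x. ennreal (1 / real n) * (u x * v x) \<partial>lborel) = ennreal (1 / real n) * (\<integral>\<^sup>+x. u x * v x \<partial>lborel)"
        by (rule nn_integral_cmult) measurable
      finally show ?thesis unfolding u_def v_def .
    qed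
    also have "... \<le> ennreal ?a * (ennreal W + ennreal (1 / real n) * ennreal (real n * W))"
      by (intro mult_left_mono add_left_mono c) auto
    also have "... = ennreal (2 * W * ?a)"
      using W n by (simp add: ennreal_mult[symmetric] ennreal_plus[symmetric] mult_ac del: ennreal_plus)
    finally have "Lp_qnorm p ?F \<le> epowr (ennreal (2 * W * ?a)) (1 / r)"
      unfolding Lp_qnorm_real[OF pi] r_def[symmetric] by (rule epowr_mono) (use r in simp)
    also have "... = ennreal (K * real n powr (1 / 2))"
      using W r by (simp add: epowr_ennreal powr_mult powr_powr K_def)
    finally show "\<exists>c. (\<forall>m. norm (c m) = 1) \<and> Lp_qnorm p (%x. \<Sum>m\<in>{1..n}. c m * pk (%i::'n. bk 0 (km a b (Suc n) m i)) x) \<le> ennreal (K * real n powr (1 / 2))"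
      using c(1) by blast
  qed
qed

text \<open>The lower bound n^(1/q) is played off against n^(1/p) when q < p and against n^(1/2)
  when q < 2.\<close>

lemma necessity_zero:
  assumes C: "0 < C" "!!T. tempered T ==> BN 0 p q T < \<infinity> ==>
      mixed_qnorm \<phi>0 0 p q T \<le> ennreal C * BN 0 p q T"
    and p: "1 < p" and q: "0 < q" and d: "CARD('n) \<ge> 2" and nq: "\<not> max 2 p \<le> q"
  shows False
proof -
  have p0: "0 < p" using p by (rule less_trans[rotated]) simp
  obtain N where N: "Lp_qnorm p (pk (%_::'n. bk 0 0)) = ennreal N" "N > 0"
    using Lp_pk_pos_finite[where h = "%_::'n. bk 0 0", OF test1_bk _ p0] bk_center[of 0 0]
    by (cases "Lp_qnorm p (pk (%_::'n. bk 0 0))") (auto simp: ennreal_less_zero_iff)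
  obtain a b :: 'n where ab: "a \<noteq> b" using two_indices[OF d] by blast
  have test: "real n powr inv_p q * N \<le> C * B"
    if "n \<ge> 1" "!!m. norm (c m) = 1" "0 \<le> B"
      "Lp_qnorm p (%x. \<Sum>m\<in>{1..n}. c m * pk (%i. bk (s m i) (km a b (Suc n) m i)) x) \<le> ennreal B" for n c B s
    by (rule cross_test[OF C(1) _ p0 q ab that(1) N that(2,3,4)]) (rule C(2))
  have inv: "inv_p y < inv_p x" if "0 < x" "x < y" for x y
    using that by (cases x; cases y) (auto simp: inv_p_def ennreal_less_iff frac_less2 less_top[symmetric])
  show False
  proof (cases "q < p")
    case True
    from translates_bound[OF p ab] obtain K where K0: "K > 0"
      and K1: "\<forall>n\<ge>1. Lp_qnorm p (%x. \<Sum>m\<in>{1..n}. 1 * pk (%i::'n. bk (if i = b then real m else 0) (km a b (Suc n) m i)) x) \<le> ennreal (K * real n powr inv_p p)"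
      by (elim exE conjE)
    note K = K0 K1[rule_format]
    have "real n powr inv_p q * N \<le> (C * K) * real n powr inv_p p" if n: "n \<ge> 1" for n
    proof -
      have "real n powr inv_p q * N \<le> C * (K * real n powr inv_p p)"
        by (rule test[OF n _ _ K(2)[OF n]]) (use K(1) in auto)
      then show ?thesis by (simp only: mult.assoc)
    qed
    then show False by (rule powr_growth_contradiction[OF inv[OF q True] N(2)])
  next
    case False
    \<comment> \<open>Now p \<le> q, so the condition can fail only through q < 2, and then p < 2 as
      well.\<close>
    then have q2: "q < 2" using nq by (auto simp: not_le max_def split: if_splits)
    then have p2: "p \<le> 2" using False by auto
    from signs_bound[OF p0 p2 ab] obtain K where K0: "K > 0" and K1: "\<forall>n\<ge>1. \<exists>c. (\<forall>m. norm (c m) = 1) \<and>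
      Lp_qnorm p (%x. \<Sum>m\<in>{1..n}. c m * pk (%i::'n. bk 0 (km a b (Suc n) m i)) x) \<le> ennreal (K * real n powr (1 / 2))"
      by (elim exE conjE)
    note K = K0 K1[rule_format]
    have i2: "1 / 2 < inv_p q" using inv[OF q q2] by (simp add: inv_p_def)
    have "real n powr inv_p q * N \<le> (C * K) * real n powr (1 / 2)" if n: "n \<ge> 1" for n
    proof -
      obtain c where c: "!!m. norm (c m) = 1" "Lp_qnorm p (%x. \<Sum>m\<in>{1..n}. c m * pk (%i::'n. bk 0 (km a b (Suc n) m i)) x) \<le> ennreal (K * real n powr (1 / 2))"
        using K(2)[OF n] by blast
      have "real n powr inv_p q * N \<le> C * (K * real n powr (1 / 2))"
        by (rule test[OF n c(1) _ c(2)]) (use K(1) in auto)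
      then show ?thesis by (simp only: mult.assoc)
    qed
    then show False by (rule powr_growth_contradiction[OF i2 N(2)])
  qed
qed

theorem necessity:
  assumes p: "0 < p" and q: "0 < q" and d: "CARD('n) \<ge> 2"
    and emb: "cont_embedding
            (besov \<psi>0 (t * real CARD('n)) p q) (BN t p q)
            (mixed_besov \<phi>0 t p q) (mixed_qnorm \<phi>0 t p q)"
  shows "t > max 0 (inv_p p - 1) \<or> (t = 0 \<and> 1 < p \<and> max 2 p \<le> q) \<or> (p \<le> 1 \<and> t = inv_p p - 1 \<and> q = \<infinity>)"
proof (rule ccontr)
  assume neg: "\<not> ?thesis"
  obtain C0 where C0: "!!T. T \<in> besov \<psi>0 (t * real CARD('n)) p q ==> mixed_qnorm \<phi>0 t p q T \<le> ennreal C0 * BN t p q T"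
    using emb unfolding cont_embedding_def by blast
  \<comment> \<open>Makes the embedding constant positive, as the counterexamples assume.\<close>
  define C where "C = max C0 1"
  have C: "0 < C" "mixed_qnorm \<phi>0 t p q T \<le> ennreal C * BN t p q T"
    if "tempered T" "BN t p q T < \<infinity>" for T
  proof -
    have "mixed_qnorm \<phi>0 t p q T \<le> ennreal C0 * BN t p q T" by (rule C0) (use that in \<open>simp add: besov_def\<close>)
    also have "... \<le> ennreal C * BN t p q T" by (intro mult_right_mono ennreal_leI) (auto simp: C_def)
    finally show "mixed_qnorm \<phi>0 t p q T \<le> ennreal C * BN t p q T" .
  qed (simp add: C_def)
  have C1: "0 < C" by (simp add: C_def)
  show False
  proof (cases "p \<le> 1")
    case True
    then have pi: "p \<noteq> \<infinity>" by (auto simp: top_unique)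
    have "1 \<le> inv_p p" using True p by (cases p) (auto simp: inv_p_def top_unique simp flip: ennreal_1)
    then have "t < inv_p p - 1 \<or> (t = inv_p p - 1 \<and> q \<noteq> \<infinity>)" using neg True by (auto simp: max_def)
    then show False by (rule necessity_small_p[OF C1 _ p q d pi, rotated]) (rule C(2))
  next
    case False
    then have p1: "1 < p" by simp
    have "inv_p p \<le> 1" using p1 by (cases p) (auto simp: inv_p_def ennreal_less_iff simp flip: ennreal_1)
    then have t: "t \<le> 0" using neg by auto
    show False
    proof (cases "t = 0")
      case True
      have "\<not> max 2 p \<le> q" using neg True p1 by auto
      then show False by (rule necessity_zero[OF C1 _ p1 q d, rotated]) (rule C(2)[unfolded True])
    next
      case False
      then have "t < 0" using t by simp
      then show False by (rule necessity_negative[OF C1 _ p q d, rotated]) (rule C(2))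
    qed
  qed
qed

end

theorem theorem3p6:
  fixes \<psi>0 :: "real^'n::finite \<Rightarrow> real" and \<phi>0 :: "real \<Rightarrow> real"
    and p q :: ennreal and t :: real
  assumes "CARD('n) \<ge> 2"
    and "admissible_psi0 \<psi>0" and "admissible_phi0 \<phi>0"
    and "0 < p" and "0 < q"
  shows "cont_embedding
            (besov \<psi>0 (t * real CARD('n)) p q) (besov_qnorm \<psi>0 (t * real CARD('n)) p q)
            (mixed_besov \<phi>0 t p q) (mixed_qnorm \<phi>0 t p q)
         \<longleftrightarrow>
         (t > max 0 (inv_p p - 1)
          \<or> (t = 0 \<and> 1 < p \<and> max 2 p \<le> q)
          \<or> (p \<le> 1 \<and> t = inv_p p - 1 \<and> q = \<infinity>))"
proof -
  interpret decomposition \<phi>0 \<psi>0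
    by unfold_locales (rule assms)+
  show ?thesis using sufficiency[OF assms(4,5)] necessity[OF assms(4,5,1)] by blast
qed

end
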